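(* There exist absolute constants $K>0$ and $c>0$ such that the following holds for all integers $n\ge 2$ and $1\le d\le 2^{n/2}$. Let $U$ be the $n$-qubit unitary generated by a $\zeta$-random quantum circuit with $d$ gates, i.e. $U\sim\zeta_{(n)}^{*d}$. (1) For every $\delta\ge 0$ with $\delta<\sqrt{1-2^{-1/2}}$, with probability at least $1-\exp(-c\,d/n^8)$, $$C_{\tilde\delta}(U)\;\ge\;\frac{d}{K n^{9}\log(n)\log_2(1/\delta)}\left(1-2\log_2\left(\frac{1}{1-\delta^2}\right)\right),\qquad \tilde\delta:=\frac{\left(1-\sqrt{1-\delta^2}\right)d}{40000\,n^8\,2^n}$$ (for $\delta=0$ the right-hand side of the inequality is read as $0$). (2) For every $\delta\in(0,1/\sqrt2)$, with probability at least $1-\exp(-c\sqrt d/n^4)$, $$C_{\delta}(U|+^n\rangle)\;\ge\;\frac{\sqrt d}{K n^{4}\log_2(d/\delta^2)}\left(n-\log_2\left(\frac{\sqrt d}{200 n^{4}}\right)-2\log_2\left(\frac{1}{1-2\delta^2}\right)\right).$$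
   Context: **The measure $\zeta$ on two-qubit gates.** Let $\mathcal Z_2=\langle \mathrm{CNOT}_{1,2},\mathrm{CNOT}_{2,1}\rangle$ be the group generated by the two CNOT gates on two qubits ($6$ elements). A gate is drawn from $\zeta$ as follows: with probability $1/2$ draw a uniformly random element of $\mathcal Z_2$; with probability $1/2$ draw $e^{\mathrm i\phi Z}\otimes \mathbb 1_2$ with $\phi$ uniform in $[0,2\pi]$, where $Z=\mathrm{diag}(1,-1)$. Elements of $\mathcal Z_2$ of determinant $-1$ are regarded as elements of $SU(4)$ by multiplying with a fixed global phase. **Random circuits.** $\zeta_{(n)}$ is the distribution of the $n$-qubit unitary obtained by drawing $i\in\{1,\dots,n\}$ uniformly at random and applying an independent gate drawn from $\zeta$ to the ordered pair of neighbouring qubits $(i,i+1)$ (qubit $n+1$ is identified with qubit $1$) and the identity to the others. $\zeta_{(n)}^{*d}$ is the $d$-fold convolution, i.e. the distribution of the product $U_1\cdots U_d$ of $d$ independent draws from $\zeta_{(n)}$. **States.** $|0^n\rangle=|0\rangle^{\otimes n}$ and $|+^n\rangle=|+\rangle^{\otimes n}$ with $|+\rangle=(|0\rangle+|1\rangle)/\sqrt2$. **Robust circuit complexity.** Below, a gate means an element of $SU(4)$ applied to some pair of the $n$ qubits (identity on the rest). For $0\le\delta<1$ and an $n$-qubit pure state $|\psi\rangle$, $C_\delta(|\psi\rangle)$ is the minimal number $m$ of gates $V_1,\dots,V_m$ such that $|\phi\rangle=V_m\cdots V_1|0^n\rangle$ satisfies $\frac12\||\psi\rangle\langle\psi|-|\phi\rangle\langle\phi|\|_1\le\delta$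 ($\|\cdot\|_1$ is the trace norm). For an $n$-qubit unitary $U$, $C_\delta(U)$ is the minimal number $m$ of gates such that $\|U-V_1\cdots V_m\|_\infty\le\delta$ ($\|\cdot\|_\infty$ is the operator norm). *)

theory Defs
  imports
    "HOL-Probability.Probability"
    "Jordan_Normal_Form.Spectral_Radius"
    "Jordan_Normal_Form.Schur_Decomposition"
    "HOL-Algebra.Generated_Groups"
begin

hide_const (open) Determinants.det Finite_Cartesian_Product.vec
unbundle no vec_syntax
no_notation inner (infix \<open>\<bullet>\<close> 70)

text \<open>
  Qubits are numbered from \<open>0\<close>. The computational basis vector
  \<open>|x\<^sub>0 \<dots> x\<^sub>n\<^sub>-\<^sub>1\<rangle>\<close> has index \<open>\<Sum>q<n. x\<^sub>q * 2 ^ (n - 1 - q)\<close>, which is the ordering that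
  the Kronecker product induces.
\<close>

definition qubit :: "nat \<Rightarrow> nat \<Rightarrow> nat \<Rightarrow> nat" where
  "qubit n q k = (k div 2 ^ (n - 1 - q)) mod 2"

definition kron_mat :: "complex mat \<Rightarrow> complex mat \<Rightarrow> complex mat" where
  "kron_mat A B = mat (dim_row A * dim_row B) (dim_col A * dim_col B)
     (\<lambda>(i, j). A $$ (i div dim_row B, j div dim_col B) * B $$ (i mod dim_row B, j mod dim_col B))"

definition kron_vec :: "complex vec \<Rightarrow> complex vec \<Rightarrow> complex vec" where
  "kron_vec v w = vec (dim_vec v * dim_vec w) (\<lambda>i. v $ (i div dim_vec w) * w $ (i mod dim_vec w))"

primrec kron_power :: "complex vec \<Rightarrow> nat \<Rightarrow> complex vec" where
  "kron_power v 0 = unit_vec 1 0"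
| "kron_power v (Suc n) = kron_vec v (kron_power v n)"

definition ket0 :: "complex vec" where "ket0 = unit_vec 2 0"
definition ket1 :: "complex vec" where "ket1 = unit_vec 2 1"
definition ket_plus :: "complex vec" where
  "ket_plus = (1 / complex_of_real (sqrt 2)) \<cdot>\<^sub>v (ket0 + ket1)"

definition SU :: "nat \<Rightarrow> complex mat set" where
  "SU N = {A \<in> carrier_mat N N. A * mat_adjoint A = 1\<^sub>m N \<and> det A = 1}"

text \<open>
  The \<open>4 \<times> 4\<close> matrix \<open>g\<close> acting on the ordered pair \<open>(i, j)\<close> of distinct qubits, and the
  identity acting on the remaining ones.
\<close>

definition apply_gate :: "nat \<Rightarrow> nat \<Rightarrow> nat \<Rightarrow> complex mat \<Rightarrow> complex mat" where
  "apply_gate n i j g = mat (2 ^ n) (2 ^ n) (\<lambda>(k, l).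
     if \<forall>q<n. q \<noteq> i \<and> q \<noteq> j \<longrightarrow> qubit n q k = qubit n q l
     then g $$ (2 * qubit n i k + qubit n j k, 2 * qubit n i l + qubit n j l)
     else 0)"


section \<open>The measure on two-qubit gates\<close>

text \<open>The Borel sigma-algebra of the \<open>N \<times> N\<close> complex matrices, generated by the entries.\<close>

definition borel_mat :: "nat \<Rightarrow> complex mat measure" where
  "borel_mat N = vimage_algebra (carrier_mat N N)
     (\<lambda>A. \<lambda>ij\<in>{..<N} \<times> {..<N}. A $$ ij) (Pi\<^sub>M ({..<N} \<times> {..<N}) (\<lambda>_. borel))"

text \<open>The first qubit is the control in \<open>cnot12\<close> and the target in \<open>cnot21\<close>.\<close>

definition cnot12 :: "complex mat" where
  "cnot12 = mat_of_rows_list 4 [[1,0,0,0], [0,1,0,0], [0,0,0,1], [0,0,1,0]]"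

definition cnot21 :: "complex mat" where
  "cnot21 = mat_of_rows_list 4 [[1,0,0,0], [0,0,0,1], [0,0,1,0], [0,1,0,0]]"

definition cnot_group :: "complex mat set" where
  "cnot_group = generate (units_of (ring_mat TYPE(complex) 4 ())) {cnot12, cnot21}"

text \<open>
  The elements of \<open>cnot_group\<close> have determinant \<open>1\<close> or \<open>-1\<close>; the latter are moved into
  \<open>SU 4\<close> by a phase \<open>\<omega>\<close>, which does so precisely when \<open>\<omega> ^ 4 = -1\<close>.
\<close>

definition su_lift :: "complex \<Rightarrow> complex mat \<Rightarrow> complex mat" where
  "su_lift \<omega> A = (if det A = -1 then \<omega> \<cdot>\<^sub>m A else A)"

text \<open>\<open>e\<^sup>i\<^sup>\<phi>\<^sup>Z\<close> for \<open>Z = diag (1, -1)\<close>: the exponential of a diagonal matrix is taken entrywise.\<close>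

definition exp_iZ :: "real \<Rightarrow> complex mat" where
  "exp_iZ \<phi> = mat_diag 2 (\<lambda>k. exp (\<i> * of_real \<phi> * ([1, -1] ! k)))"

definition zeta :: "complex \<Rightarrow> complex mat measure" where
  "zeta \<omega> = measure_pmf (bernoulli_pmf (1 / 2)) \<bind> (\<lambda>b.
     if b then distr (uniform_count_measure cnot_group) (borel_mat 4) (su_lift \<omega>)
     else distr (uniform_measure lborel {0..2 * pi}) (borel_mat 4) (\<lambda>\<phi>. kron_mat (exp_iZ \<phi>) (1\<^sub>m 2)))"


section \<open>Random circuits\<close>

definition zeta_layer :: "complex \<Rightarrow> nat \<Rightarrow> complex mat measure" where
  "zeta_layer \<omega> n = measure_pmf (pmf_of_set {..<n}) \<bind> (\<lambda>i.
     distr (zeta \<omega>) (borel_mat (2 ^ n)) (apply_gate n i ((i + 1) mod n)))"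

definition mat_prod_list :: "nat \<Rightarrow> complex mat list \<Rightarrow> complex mat" where
  "mat_prod_list N As = foldr (\<lambda>A B. A * B) As (1\<^sub>m N)"

text \<open>The \<open>d\<close>-fold convolution, i.e.\ the law of the product of \<open>d\<close> independent draws.\<close>

definition zeta_circuit :: "complex \<Rightarrow> nat \<Rightarrow> nat \<Rightarrow> complex mat measure" where
  "zeta_circuit \<omega> n d = distr (Pi\<^sub>M {..<d} (\<lambda>_. zeta_layer \<omega> n)) (borel_mat (2 ^ n))
     (\<lambda>U. mat_prod_list (2 ^ n) (map U [0..<d]))"


section \<open>Robust circuit complexity\<close>

definition euclidean_norm :: "complex vec \<Rightarrow> real" where
  "euclidean_norm v = sqrt (\<Sum>i<dim_vec v. (cmod (v $ i))\<^sup>2)"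

definition operator_norm :: "complex mat \<Rightarrow> real" where
  "operator_norm A = (SUP v\<in>{v \<in> carrier_vec (dim_col A). euclidean_norm v = 1}. euclidean_norm (A *\<^sub>v v))"

text \<open>
  The sum of the singular values of \<open>A\<close> with multiplicity, i.e.\ the trace of the square root of
  \<open>mat_adjoint A * A\<close>, whose eigenvalues are real and nonnegative.
\<close>

definition trace_norm :: "complex mat \<Rightarrow> real" where
  "trace_norm A = (\<Sum>x\<in>#proots (char_poly (mat_adjoint A * A)). sqrt (Re x))"

definition projector :: "complex vec \<Rightarrow> complex mat" where
  "projector v = mat (dim_vec v) (dim_vec v) (\<lambda>(i, j). v $ i * cnj (v $ j))"

definition gates :: "nat \<Rightarrow> complex mat set" where
  "gates n = {apply_gate n i j g | i j g. i < n \<and> j < n \<and> i \<noteq> j \<and> g \<in> SU 4}"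

text \<open>The minima are taken in \<^typ>\<open>enat\<close>, so they are \<open>\<infinity>\<close> if no circuit is admissible.\<close>

definition state_complexity :: "nat \<Rightarrow> real \<Rightarrow> complex vec \<Rightarrow> enat" where
  "state_complexity n \<delta> \<psi> = (INF Vs\<in>{Vs. set Vs \<subseteq> gates n \<and>
     trace_norm (projector \<psi> - projector (fold (\<lambda>V v. V *\<^sub>v v) Vs (kron_power ket0 n))) / 2 \<le> \<delta>}. enat (length Vs))"

definition unitary_complexity :: "nat \<Rightarrow> real \<Rightarrow> complex mat \<Rightarrow> enat" where
  "unitary_complexity n \<delta> U = (INF Vs\<in>{Vs. set Vs \<subseteq> gates n \<and>
     operator_norm (U - mat_prod_list (2 ^ n) Vs) \<le> \<delta>}. enat (length Vs))"

end

(* On computational basis states, a random circuit is a permutation of the cube F_2^n (from the CNOT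
   gates) together with phases: the phase gate at step j multiplies the amplitude of x by
   exp(+-i phi_j) with sign a character a_j of x, where a_j is the image of a unit vector under
   random CNOTs. A Poincare inequality on the nonzero vectors shows that this image mixes within
   O(n^4) steps, so every block of that length produces a new character with probability bounded below.

   For a fixed matrix W, all entries of U are close to those of W only if all phases are close to
   prescribed values. Trigonometric polynomials at as many points as there are distinct
   characters bound the probability of this by exp(-c d/n^4). For the states, the 2t-th moment of
   <w|U|+^n> involves tuples x, y in (F_2^n)^t: its expectation vanishes unless all characters a_j
   satisfy sum_k a_j(x_k) = sum_k a_j(y_k), and the uncertainty principle makes this unlikely when
   x is not a permutation of y; the permutations contribute t! 2^(-nt). The choice
   t ~ sqrt d/(100 n^3) makes this comparable to the number of circuits in the net.

   A union bound over a net of circuits with few gates then gives both parts. Compactness of SU(4)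
   makes the set of unitaries of small complexity closed, hence measurable; for pure states the
   trace distance is a function of the overlap. *)
theory Submission
  imports Defs
begin

section \<open>Characters of the cube\<close>

text \<open>Discrete choices and angles are separated: a circuit is a word of equally likely letters
  together with independent uniform angles, so each probability is bounded over the angles for a
  fixed word and then averaged over words. The obstacle is that the characters of one word are
  strongly dependent. Only their arrival in blocks is controlled: whatever came before, the next
  block meets a set \<open>A\<close> of nonzero vectors with probability at least
  \<open>card A / 2 ^ (n + 2)\<close>. For matrices, \<open>A\<close> consists of the vectors that
  yield unseen characters, at least half of the cube because \<open>d\<close> is at most
  \<open>2 ^ (n - 1)\<close>; for states, of the characters that separate two
  \<open>t\<close>-tuples, at least a fraction \<open>1 / (2 * t)\<close>.

  A net of fixed precision 1/10 is enough, since the events for a fixed circuit have room to spare: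
  distance 1/5 for entries, threshold 1/2 for overlaps. The dependence on \<open>\<delta>\<close> of
  both lower bounds is absorbed by crude upper estimates of these bounds. The constants
  \<open>10 ^ 7\<close> and \<open>1 / 10 ^ 4\<close> keep the logarithm of the net size well below
  the exponent of the probability estimate.\<close>

definition chr :: "nat set \<Rightarrow> nat set \<Rightarrow> real" where
  "chr a x = (-1) ^ card (a \<inter> x)"

lemma chr_commute: "chr a x = chr x a"
  by (simp add: chr_def Int_commute)

lemma abs_chr [simp]: "\<bar>chr a x\<bar> = 1"
  by (simp add: chr_def power_abs)

lemma chr_empty [simp]: "chr {} x = 1"
  by (simp add: chr_def)

lemma chr_prod:
  assumes "finite a"
  shows "chr a x = (\<Prod>i\<in>a. if i \<in> x then - 1 else 1)"
proof -
  have "(\<Prod>i\<in>a. if i \<in> x then - 1 else (1::real)) = (\<Prod>i\<in>a \<inter> x. - 1)"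
    using assms by (subst prod.inter_restrict) auto
  then show ?thesis
    by (simp add: chr_def)
qed

text \<open>Expanding over subsets turns the sum into a product over \<open>I\<close> of one plus
  the product of the two signs; an index at which \<open>x\<close> and \<open>y\<close> differ gives
  a zero factor.\<close>

lemma chr_orthogonal:
  assumes "finite I" "x \<subseteq> I" "y \<subseteq> I"
  shows "(\<Sum>a\<in>Pow I. chr a x * chr a y) = (if x = y then 2 ^ card I else 0)"
proof -
  let ?s = "\<lambda>x i. if i \<in> x then - 1 else (1::real)"
  have "(\<Sum>a\<in>Pow I. chr a x * chr a y) = (\<Sum>a\<in>Pow I. \<Prod>i\<in>a. ?s x i * ?s y i)"
    using assms(1) by (intro sum.cong refl) (auto simp: chr_prod finite_subset prod.distrib)
  also have "\<dots> = (\<Prod>i\<in>I. ?s x i * ?s y i + 1)"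
    using assms(1) by (subst prod_add) auto
  also have "\<dots> = (if x = y then 2 ^ card I else 0)"
  proof (cases "x = y")
    case True
    have "(\<Prod>i\<in>I. ?s x i * ?s y i + 1) = (\<Prod>i\<in>I. 2)"
      using True by (intro prod.cong) auto
    then show ?thesis using True by simp
  next
    case False
    then obtain i where "i \<in> I" "(i \<in> x) \<noteq> (i \<in> y)"
      using assms by blast
    then have "(\<Prod>i\<in>I. ?s x i * ?s y i + 1) = 0"
      using assms(1) by (intro prod_zero) (auto intro!: bexI[of _ i])
    then show ?thesis using False by simp
  qed
  finally show ?thesis .
qed

text \<open>Applied to the function \<open>\<lambda>z. card {j\<in>T. x j = z} - card {j\<in>T. y j = z}\<close>, which has at most \<open>2 * card T\<close>
  nonzero values.\<close>

lemma uncertainty: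
  fixes x y :: "'j \<Rightarrow> nat set"
  assumes "finite I" "finite T" "x ` T \<subseteq> Pow I" "y ` T \<subseteq> Pow I" "z \<in> Pow I"
    and ne: "card {j\<in>T. x j = z} \<noteq> card {j\<in>T. y j = z}"
  shows "2 ^ card I \<le> real (card {a\<in>Pow I. (\<Sum>j\<in>T. chr a (x j)) \<noteq> (\<Sum>j\<in>T. chr a (y j))}) * (2 * real (card T))"
proof -
  define D where "D a = (\<Sum>j\<in>T. chr a (x j)) - (\<Sum>j\<in>T. chr a (y j))" for a
  \<comment> \<open>Fourier inversion: summing against \<open>chr a z\<close> over all characters
    counts how often \<open>w\<close> takes the value \<open>z\<close>.\<close>
  have single: "(\<Sum>a\<in>Pow I. (\<Sum>j\<in>T. chr a (w j)) * chr a z) = 2 ^ card I * real (card {j\<in>T. w j = z})"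
    if "w ` T \<subseteq> Pow I" for w
  proof -
    have "(\<Sum>a\<in>Pow I. (\<Sum>j\<in>T. chr a (w j)) * chr a z) = (\<Sum>j\<in>T. \<Sum>a\<in>Pow I. chr a (w j) * chr a z)"
      by (subst sum.swap) (simp add: sum_distrib_right)
    also have "\<dots> = (\<Sum>j\<in>T. if w j = z then 2 ^ card I else 0)"
      using that assms by (intro sum.cong refl chr_orthogonal) auto
    also have "\<dots> = 2 ^ card I * real (card {j\<in>T. w j = z})"
      using assms(2) by (simp add: sum.If_cases Int_def)
    finally show ?thesis .
  qed
  have "(\<Sum>a\<in>Pow I. D a * chr a z)
      = 2 ^ card I * (real (card {j\<in>T. x j = z}) - real (card {j\<in>T. y j = z}))"
    using single[OF assms(3)] single[OF assms(4)]
    by (simp add: D_def left_diff_distrib sum_subtractf right_diff_distrib)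
  \<comment> \<open>Multiplicities are integers, so unequal ones differ by at least one.\<close>
  moreover have "1 \<le> \<bar>real (card {j\<in>T. x j = z}) - real (card {j\<in>T. y j = z})\<bar>"
    using ne by linarith
  ultimately have "2 ^ card I \<le> \<bar>\<Sum>a\<in>Pow I. D a * chr a z\<bar>"
    by (simp add: abs_mult)
  also have "\<dots> \<le> (\<Sum>a\<in>Pow I. \<bar>D a * chr a z\<bar>)"
    by (rule sum_abs)
  also have "\<dots> = (\<Sum>a\<in>{a\<in>Pow I. D a \<noteq> 0}. \<bar>D a\<bar>)"
    using assms(1) by (intro sum.mono_neutral_cong_right) (auto simp: abs_mult)
  also have "\<dots> \<le> (\<Sum>a\<in>{a\<in>Pow I. D a \<noteq> 0}. 2 * real (card T))"
  proof (rule sum_mono)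
    fix a
    have "\<bar>\<Sum>j\<in>T. chr a (w j)\<bar> \<le> real (card T)" for w :: "'j \<Rightarrow> nat set"
      using sum_abs[of "\<lambda>j. chr a (w j)" T] by simp
    from this[of x] this[of y] show "\<bar>D a\<bar> \<le> 2 * real (card T)"
      unfolding D_def by linarith
  qed
  finally show ?thesis
    by (simp add: D_def)
qed

text \<open>Row rank equals column rank: independent functions stay independent on some
  \<open>card K\<close> points, and the square matrix of values there is nonsingular from the other
  side too, which is the form of the conclusion. The induction is Gaussian elimination with pivot
  \<open>f k0 x1\<close>.\<close>

lemma independent_points:
  fixes f :: "'k \<Rightarrow> 'x \<Rightarrow> real"
  assumes "finite K"
    and "\<And>c k. (\<forall>x\<in>X. (\<Sum>k\<in>K. c k * f k x) = 0) \<Longrightarrow> k \<in> K \<Longrightarrow> c k = 0"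
  shows "\<exists>R\<subseteq>X. finite R \<and> card R = card K \<and>
     (\<forall>m. (\<forall>k\<in>K. (\<Sum>x\<in>R. m x * f k x) = 0) \<longrightarrow> (\<forall>x\<in>R. m x = 0))"
  using assms
proof (induction K arbitrary: f rule: finite_induct)
  case empty
  then show ?case by (intro exI[of _ "{}"]) auto
next
  case (insert k0 K)
  have "\<exists>x1\<in>X. f k0 x1 \<noteq> 0"
  proof (rule ccontr)
    assume "\<not> ?thesis"
    then have "\<forall>x\<in>X. (\<Sum>k\<in>insert k0 K. (if k = k0 then 1 else 0) * f k x) = 0"
      using insert.hyps by simp
    from insert.prems[OF this, of k0] show False by simp
  qed
  then obtain x1 where x1: "x1 \<in> X" "f k0 x1 \<noteq> 0" by auto
  \<comment> \<open>One elimination step: subtracting a multiple of \<open>f k0\<close> makes the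
    other functions vanish at the pivot point.\<close>
  define g where "g k x = f k x - f k x1 / f k0 x1 * f k0 x" for k x
  have g0: "g k x1 = 0" for k using x1 by (simp add: g_def)
  have indep: "c k = 0" if c: "\<forall>x\<in>X. (\<Sum>k\<in>K. c k * g k x) = 0" and k: "k \<in> K" for c k
  proof -
    \<comment> \<open>A relation among the \<open>g k\<close> is one among the \<open>f k\<close>,
      with the subtracted multiples collected at \<open>k0\<close>.\<close>
    define c' where "c' k = (if k = k0 then - (\<Sum>k\<in>K. c k * (f k x1 / f k0 x1)) else c k)" for k
    have "(\<Sum>k\<in>insert k0 K. c' k * f k x) = 0" if "x \<in> X" for x
    proof -
      have "(\<Sum>k\<in>K. c' k * f k x) = (\<Sum>k\<in>K. c k * f k x)"
        using insert.hyps by (intro sum.cong) (auto simp: c'_def)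
      then have "(\<Sum>k\<in>insert k0 K. c' k * f k x)
          = (\<Sum>k\<in>K. c k * f k x) - (\<Sum>k\<in>K. c k * (f k x1 / f k0 x1)) * f k0 x"
        using insert.hyps by (simp add: c'_def)
      also have "\<dots> = (\<Sum>k\<in>K. c k * g k x)"
        by (simp add: g_def sum_distrib_right right_diff_distrib sum_subtractf mult.assoc)
      finally show ?thesis using c that by simp
    qed
    then have "c' k = 0" using insert.prems[of c' k] k by blast
    then show ?thesis using insert.hyps k by (auto simp: c'_def split: if_splits)
  qed
  have "\<exists>R\<subseteq>X. finite R \<and> card R = card K \<and>
     (\<forall>m. (\<forall>k\<in>K. (\<Sum>x\<in>R. m x * g k x) = 0) \<longrightarrow> (\<forall>x\<in>R. m x = 0))"
    by (rule insert.IH) (rule indep)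
  then obtain R where R: "R \<subseteq> X" "finite R" "card R = card K"
      "\<And>m x. (\<forall>k\<in>K. (\<Sum>x\<in>R. m x * g k x) = 0) \<Longrightarrow> x \<in> R \<Longrightarrow> m x = 0"
    by blast
  have x1R: "x1 \<notin> R"
  proof
    assume x1R: "x1 \<in> R"
    have "\<forall>k\<in>K. (\<Sum>x\<in>R. (if x = x1 then 1 else 0) * g k x) = 0"
      using g0 by (auto intro!: sum.neutral)
    from R(4)[OF this x1R] show False by simp
  qed
  have "m x = 0" if m: "\<forall>k\<in>insert k0 K. (\<Sum>x\<in>insert x1 R. m x * f k x) = 0" and x: "x \<in> insert x1 R" for m x
  proof -
    have "(\<Sum>x\<in>R. m x * g k x) = 0" if k: "k \<in> K" for k
    proof -
      have "(\<Sum>x\<in>R. m x * g k x) = (\<Sum>x\<in>insert x1 R. m x * g k x)"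
        using R(2) x1R g0 by simp
      also have "\<dots> = (\<Sum>x\<in>insert x1 R. m x * f k x) - f k x1 / f k0 x1 * (\<Sum>x\<in>insert x1 R. m x * f k0 x)"
        by (simp only: g_def right_diff_distrib sum_subtractf sum_distrib_left mult_ac)
      finally show ?thesis using m k by simp
    qed
    then have mR: "m x = 0" if "x \<in> R" for x using R(4) that by blast
    have "(\<Sum>x\<in>insert x1 R. m x * f k0 x) = m x1 * f k0 x1"
      using R(2) x1R mR by simp
    then have "m x1 = 0" using m x1 by simp
    then show ?thesis using mR x by auto
  qed
  then have "\<forall>m. (\<forall>k\<in>insert k0 K. (\<Sum>x\<in>insert x1 R. m x * f k x) = 0) \<longrightarrow> (\<forall>x\<in>insert x1 R. m x = 0)"
    by blast
  moreover have "insert x1 R \<subseteq> X" "finite (insert x1 R)" "card (insert x1 R) = card (insert k0 K)"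
    using R(1-3) x1 x1R insert.hyps by simp_all
  ultimately show ?case by blast
qed

section \<open>The random walk on nonzero vectors\<close>

text \<open>The Dirichlet form of one pair: as \<open>w\<close> runs through the four extensions of
  a set that avoids \<open>i\<close> and \<open>j\<close>, the differences are the three between
  values with a nonzero pattern on the pair, and one zero.\<close>

definition edge_sum :: "nat set \<Rightarrow> nat \<Rightarrow> nat \<Rightarrow> (nat set \<Rightarrow> real) \<Rightarrow> real" where
  "edge_sum I i j h = (\<Sum>w\<in>Pow I. (h (insert i w) - h (insert j w))\<^sup>2)"

lemma edge_sum_nonneg: "edge_sum I i j h \<ge> 0"
  by (simp add: edge_sum_def sum_nonneg)

lemma sum_rotate:
  "(\<Sum>x\<in>A. \<Sum>y\<in>B. \<Sum>k\<in>C. f x y k) = (\<Sum>k\<in>C. \<Sum>x\<in>A. \<Sum>y\<in>B. f x y k)"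
proof -
  have "(\<Sum>x\<in>A. \<Sum>y\<in>B. \<Sum>k\<in>C. f x y k) = (\<Sum>x\<in>A. \<Sum>k\<in>C. \<Sum>y\<in>B. f x y k)"
    by (intro sum.cong refl sum.swap)
  also have "\<dots> = (\<Sum>k\<in>C. \<Sum>x\<in>A. \<Sum>y\<in>B. f x y k)"
    by (rule sum.swap)
  finally show ?thesis .
qed

text \<open>Exchanging the coordinates up to \<open>k\<close> between \<open>x\<close> and
  \<open>y\<close> is an involution on pairs, so the mixed set is as uniform as \<open>x\<close>
  itself. This gives the canonical paths below constant congestion.\<close>

lemma sum_mix:
  fixes \<Phi> :: "nat set \<Rightarrow> real"
  assumes "finite I"
  shows "(\<Sum>x\<in>Pow I. \<Sum>y\<in>Pow I. \<Phi> (y \<inter> {..k} \<union> x \<inter> {k<..})) = 2 ^ card I * (\<Sum>w\<in>Pow I. \<Phi> w)"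
proof -
  define m where "m = (\<lambda>(x, y). (y \<inter> {..k} \<union> x \<inter> {k<..}, x \<inter> {..k} \<union> y \<inter> {k<..}))"
  have mm: "m (m p) = p" for p
    by (cases p) (force simp: m_def)
  have mP: "m p \<in> Pow I \<times> Pow I" if "p \<in> Pow I \<times> Pow I" for p
    using that by (cases p) (auto simp: m_def)
  have "(\<Sum>p\<in>Pow I \<times> Pow I. \<Phi> (fst (m p))) = (\<Sum>p\<in>Pow I \<times> Pow I. \<Phi> (fst p))"
    by (rule sum.reindex_bij_witness[of _ m m]) (simp_all only: mm mP)
  also have "(\<Sum>p\<in>Pow I \<times> Pow I. \<Phi> (fst (m p)))
      = (\<Sum>x\<in>Pow I. \<Sum>y\<in>Pow I. \<Phi> (y \<inter> {..k} \<union> x \<inter> {k<..}))"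
    by (simp add: sum.cartesian_product m_def case_prod_unfold)
  also have "(\<Sum>p\<in>Pow I \<times> Pow I. \<Phi> (fst p)) = (\<Sum>x\<in>Pow I. \<Sum>y\<in>Pow I. \<Phi> x)"
    by (simp only: sum.cartesian_product case_prod_unfold)
  finally show ?thesis
    using assms by (simp add: card_Pow sum_distrib_left)
qed

text \<open>A canonical path from \<open>insert 0 x\<close> to \<open>insert (n - 1) y\<close>: the
  coordinates of \<open>x\<close> give way to those of \<open>y\<close> from left to right, under a
  marker that always lies in the set and so keeps the path away from the empty set. Each step moves
  the marker from \<open>k\<close> to \<open>Suc k\<close> over a fixed set, which is one term of
  \<open>edge_sum\<close>.\<close>

lemma poincare_path:
  fixes h :: "nat set \<Rightarrow> real"
  assumes n: "n \<ge> 1" and x: "x \<subseteq> {..<n}" and y: "y \<subseteq> {..<n}"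
  shows "h (insert 0 x) - h (insert (n - 1) y) =
    (\<Sum>k<n-1. h (insert k (y \<inter> {..k} \<union> x \<inter> {k<..})) - h (insert (Suc k) (y \<inter> {..k} \<union> x \<inter> {k<..})))"
proof -
  define z where "z k = insert k (y \<inter> {..k} \<union> x \<inter> {k<..})" for k
  have "insert (Suc k) (y \<inter> {..k} \<union> x \<inter> {k<..}) = z (Suc k)" for k
    by (auto simp: z_def atMost_Suc)
  moreover have "z 0 = insert 0 x" by (auto simp: z_def)
  moreover have "z (n - 1) = insert (n - 1) y" using x y n by (fastforce simp: z_def)
  moreover have "h (z 0) - h (z (n - 1)) = (\<Sum>k<n-1. h (z k) - h (z (Suc k)))"
    using sum_lessThan_telescope'[of "\<lambda>k. h (z k)" "n - 1"] by simp
  ultimately show ?thesis by (simp add: z_def)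
qed

text \<open>Canonical paths compare the sets with marker \<open>0\<close> with the average over
  those with marker \<open>n - 1\<close>; moving the marker over a fixed set then reaches every
  other set, since each nonempty set is \<open>insert k a\<close> for one of its elements.\<close>

lemma poincare:
  fixes h :: "nat set \<Rightarrow> real"
  assumes n: "n \<ge> 1" and h0: "h {} = 0" and mean: "(\<Sum>a\<in>Pow {..<n}. h a) = 0"
  shows "(\<Sum>a\<in>Pow {..<n}. (h a)\<^sup>2) \<le> 4 * real n ^ 2 * (\<Sum>k<n-1. edge_sum {..<n} k (Suc k) h)"
proof -
  let ?P = "Pow {..<n}"
  define S where "S = (\<Sum>k<n-1. edge_sum {..<n} k (Suc k) h)"
  have S0: "S \<ge> 0" by (simp add: S_def sum_nonneg edge_sum_nonneg)
  \<comment> \<open>The mean of \<open>h\<close> over the sets containing \<open>n - 1\<close>. Any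
    constant can serve in the end, because subtracting one from a function with sum zero only
    increases the sum of squares.\<close>
  define m where "m = (\<Sum>y\<in>?P. h (insert (n - 1) y)) / 2 ^ n"
  define b where "b k = (\<Sum>w\<in>?P. (h (insert k w) - m)\<^sup>2)" for k
  have card: "card ?P = 2 ^ n" by (simp add: card_Pow)
  have b0: "b 0 \<le> real (n - 1) * S"
  proof -
    have step: "(h (insert 0 x) - m)\<^sup>2 \<le> (\<Sum>y\<in>?P. (h (insert 0 x) - h (insert (n - 1) y))\<^sup>2) / 2 ^ n" for x
    proof -
      have "h (insert 0 x) - m = (\<Sum>y\<in>?P. h (insert 0 x) - h (insert (n - 1) y)) / 2 ^ n"
        by (simp add: sum_subtractf card_Pow m_def diff_divide_distrib)
      then have "(h (insert 0 x) - m)\<^sup>2 = (\<Sum>y\<in>?P. h (insert 0 x) - h (insert (n - 1) y))\<^sup>2 / (2 ^ n)\<^sup>2"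
        by (simp add: power_divide)
      also have "\<dots> \<le> (2 ^ n * (\<Sum>y\<in>?P. (h (insert 0 x) - h (insert (n - 1) y))\<^sup>2)) / (2 ^ n)\<^sup>2"
        using sum_squared_le_sum_of_squares[of "\<lambda>y. h (insert 0 x) - h (insert (n - 1) y)" ?P]
        by (intro divide_right_mono) (simp_all add: card mult.commute)
      finally show ?thesis by (simp add: power2_eq_square)
    qed
    have mixk: "(\<Sum>x\<in>?P. \<Sum>y\<in>?P. (h (insert k (y \<inter> {..k} \<union> x \<inter> {k<..})) - h (insert (Suc k) (y \<inter> {..k} \<union> x \<inter> {k<..})))\<^sup>2)
        = 2 ^ n * edge_sum {..<n} k (Suc k) h" for k
      using sum_mix[where I = "{..<n}" and \<Phi> = "\<lambda>w. (h (insert k w) - h (insert (Suc k) w))\<^sup>2" and k = k]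
      by (simp add: edge_sum_def)
    from step have "b 0 \<le> (\<Sum>x\<in>?P. (\<Sum>y\<in>?P. (h (insert 0 x) - h (insert (n - 1) y))\<^sup>2) / 2 ^ n)"
      unfolding b_def by (intro sum_mono)
    also have "\<dots> \<le> (\<Sum>x\<in>?P. (\<Sum>y\<in>?P. real (n - 1) * (\<Sum>k<n-1. (h (insert k (y \<inter> {..k} \<union> x \<inter> {k<..})) - h (insert (Suc k) (y \<inter> {..k} \<union> x \<inter> {k<..})))\<^sup>2)) / 2 ^ n)"
    proof (intro sum_mono divide_right_mono)
      fix x y assume "x \<in> ?P" "y \<in> ?P"
      then have eq: "h (insert 0 x) - h (insert (n - 1) y) =
    (\<Sum>k<n-1. h (insert k (y \<inter> {..k} \<union> x \<inter> {k<..})) - h (insert (Suc k) (y \<inter> {..k} \<union> x \<inter> {k<..})))"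
        by (intro poincare_path n) auto
      show "(h (insert 0 x) - h (insert (n - 1) y))\<^sup>2 \<le> real (n - 1) * (\<Sum>k<n-1. (h (insert k (y \<inter> {..k} \<union> x \<inter> {k<..})) - h (insert (Suc k) (y \<inter> {..k} \<union> x \<inter> {k<..})))\<^sup>2)"
        unfolding eq by (rule order_trans[OF sum_squared_le_sum_of_squares]) simp
    qed simp
    also have "\<dots> = real (n - 1) / 2 ^ n * (\<Sum>k<n-1. \<Sum>x\<in>?P. \<Sum>y\<in>?P. (h (insert k (y \<inter> {..k} \<union> x \<inter> {k<..})) - h (insert (Suc k) (y \<inter> {..k} \<union> x \<inter> {k<..})))\<^sup>2)"
      by (subst sum_rotate [symmetric])
        (simp add: sum_divide_distrib [symmetric] sum_distrib_left [symmetric])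
    also have "\<dots> = real (n - 1) / 2 ^ n * (\<Sum>k<n-1. 2 ^ n * edge_sum {..<n} k (Suc k) h)"
      by (intro arg_cong2[of _ _ _ _ "(*)"] sum.cong refl) (rule mixk)
    also have "\<dots> = real (n - 1) * S"
      by (simp add: S_def flip: sum_distrib_left)
    finally show ?thesis .
  qed
  \<comment> \<open>Moving the marker from \<open>0\<close> to \<open>k\<close> over the same set
    costs the first \<open>k\<close> differences, and the two contributions \<open>2 * b 0\<close>
    and \<open>2 * n * S\<close> are each at most \<open>2 * n * S\<close>.\<close>
  have bk: "b k \<le> 4 * real n * S" if k: "k < n" for k
  proof -
    have "(h (insert k w) - m)\<^sup>2 \<le> 2 * (h (insert 0 w) - m)\<^sup>2 +
        2 * (real n * (\<Sum>j<n-1. (h (insert j w) - h (insert (Suc j) w))\<^sup>2))" for w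
    proof -
      let ?u = "\<lambda>j. h (insert j w) - h (insert (Suc j) w)"
      have "h (insert k w) - m = (h (insert 0 w) - m) - (\<Sum>j<k. ?u j)"
        using sum_lessThan_telescope'[of "\<lambda>k. h (insert k w)" k] by simp
      moreover have "(p - q)\<^sup>2 \<le> 2 * p\<^sup>2 + 2 * q\<^sup>2" for p q :: real
        using zero_le_power2[of "p + q"] by (simp add: power2_eq_square algebra_simps)
      ultimately have "(h (insert k w) - m)\<^sup>2 \<le> 2 * (h (insert 0 w) - m)\<^sup>2 + 2 * (\<Sum>j<k. ?u j)\<^sup>2"
        by metis
      also have "(\<Sum>j<k. ?u j)\<^sup>2 \<le> real k * (\<Sum>j<k. (?u j)\<^sup>2)"
        using sum_squared_le_sum_of_squares[of ?u "{..<k}"] by (simp add: mult.commute)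
      also have "\<dots> \<le> real n * (\<Sum>j<n-1. (?u j)\<^sup>2)"
        using k by (intro mult_mono sum_mono2) (auto intro: sum_nonneg)
      finally show ?thesis by simp
    qed
    then have "b k \<le> (\<Sum>w\<in>?P. 2 * (h (insert 0 w) - m)\<^sup>2 +
        2 * (real n * (\<Sum>j<n-1. (h (insert j w) - h (insert (Suc j) w))\<^sup>2)))"
      unfolding b_def by (intro sum_mono)
    also have "\<dots> = 2 * b 0 + 2 * (real n * S)"
      unfolding b_def S_def edge_sum_def
      using sum.swap[of "\<lambda>w j. (h (insert j w) - h (insert (Suc j) w))\<^sup>2" "{..<n - 1}" ?P]
      by (simp add: sum.distrib sum_distrib_left [symmetric])
    also have "\<dots> \<le> 2 * (real (n - 1) * S) + 2 * (real n * S)" using b0 by simp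
    also have "\<dots> \<le> 4 * real n * S"
      using S0 mult_right_mono[of "real (n-1)" "real n" S] by (simp add: mult.commute)
    finally show ?thesis .
  qed
  have "(\<Sum>a\<in>?P. (h a)\<^sup>2) \<le> (\<Sum>a\<in>?P - {{}}. (h a - m)\<^sup>2)"
  proof -
    have "(\<Sum>a\<in>?P - {{}}. (h a - m)\<^sup>2) = (\<Sum>a\<in>?P - {{}}. (h a)\<^sup>2) - 2 * m * (\<Sum>a\<in>?P - {{}}. h a) + real (card (?P - {{}})) * m\<^sup>2"
      by (simp add: power2_diff sum.distrib sum_subtractf sum_distrib_left [symmetric] sum_distrib_right [symmetric])
    moreover have "(\<Sum>a\<in>?P - {{}}. h a) = 0" "(\<Sum>a\<in>?P - {{}}. (h a)\<^sup>2) = (\<Sum>a\<in>?P. (h a)\<^sup>2)"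
      using mean h0 by (simp_all add: sum_diff1)
    ultimately show ?thesis by simp
  qed
  \<comment> \<open>Each nonempty set is counted once for every element \<open>k\<close>, and
    \<open>a = insert k a\<close> turns the term into one of \<open>b k\<close>.\<close>
  also have "\<dots> \<le> (\<Sum>a\<in>?P - {{}}. \<Sum>k<n. if k \<in> a then (h a - m)\<^sup>2 else 0)"
  proof (rule sum_mono)
    fix a assume "a \<in> ?P - {{}}"
    then obtain k where "k \<in> a" "k < n" by blast
    then show "(h a - m)\<^sup>2 \<le> (\<Sum>k<n. if k \<in> a then (h a - m)\<^sup>2 else 0)"
      using member_le_sum[of k "{..<n}" "\<lambda>k. if k \<in> a then (h a - m)\<^sup>2 else 0"] by auto
  qed
  also have "\<dots> = (\<Sum>k<n. \<Sum>a\<in>?P - {{}}. if k \<in> a then (h a - m)\<^sup>2 else 0)"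
    by (rule sum.swap)
  also have "\<dots> \<le> (\<Sum>k<n. b k)"
  proof (rule sum_mono)
    fix k
    have "(\<Sum>a\<in>?P - {{}}. if k \<in> a then (h a - m)\<^sup>2 else 0) = (\<Sum>a\<in>{a\<in>?P. k \<in> a}. (h (insert k a) - m)\<^sup>2)"
      by (intro sum.mono_neutral_cong_right) (auto simp: insert_absorb)
    also have "\<dots> \<le> b k"
      unfolding b_def by (intro sum_mono2) auto
    finally show "(\<Sum>a\<in>?P - {{}}. if k \<in> a then (h a - m)\<^sup>2 else 0) \<le> b k" .
  qed
  also have "\<dots> \<le> (\<Sum>k<n. 4 * real n * S)"
    by (intro sum_mono bk) auto
  also have "\<dots> = 4 * real n ^ 2 * S" by (simp add: power2_eq_square)
  finally show ?thesis by (simp add: S_def)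
qed

section \<open>The averaging operators of the walk and their spectral gap\<close>

definition heat :: "nat \<Rightarrow> nat \<Rightarrow> (nat set \<Rightarrow> real) \<Rightarrow> nat set \<Rightarrow> real" where
  "heat i j h a = (if i \<notin> a \<and> j \<notin> a then h a
     else (h (insert i (a - {i, j})) + h (insert j (a - {i, j})) + h (insert i (insert j (a - {i, j})))) / 3)"

lemma heat_empty [simp]: "heat i j h {} = h {}"
  by (simp add: heat_def)

lemma sum_Pow_pair:
  fixes \<Phi> :: "nat set \<Rightarrow> real"
  assumes I: "finite I" and ij: "i \<in> I" "j \<in> I" "i \<noteq> j"
  shows "(\<Sum>a\<in>Pow I. \<Phi> a) = (\<Sum>r\<in>Pow (I - {i, j}). \<Phi> r + \<Phi> (insert i r) + \<Phi> (insert j r) + \<Phi> (insert i (insert j r)))"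
proof -
  have one: "(\<Sum>a\<in>Pow (insert k J). F a) = (\<Sum>a\<in>Pow J. F a + F (insert k a))"
    if "finite J" "k \<notin> J" for J k and F :: "nat set \<Rightarrow> real"
  proof -
    have "inj_on (insert k) (Pow J)"
      using that by (intro inj_onI) (metis PowD insert_ident subsetD)
    then show ?thesis
      using that unfolding Pow_insert
      by (subst sum.union_disjoint) (auto simp: sum.reindex sum.distrib)
  qed
  have "I = insert i (insert j (I - {i, j}))" using ij by auto
  then have "(\<Sum>a\<in>Pow I. \<Phi> a) = (\<Sum>a\<in>Pow (insert i (insert j (I - {i, j}))). \<Phi> a)" by simp
  also have "\<dots> = (\<Sum>r\<in>Pow (I - {i, j}). (\<Phi> r + \<Phi> (insert i r)) + (\<Phi> (insert j r) + \<Phi> (insert i (insert j r))))"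
    using I ij by (simp add: one)
  finally show ?thesis by (simp add: add_ac)
qed

lemma heat_pair:
  assumes "r \<subseteq> I - {i, j}" "i \<noteq> j"
  shows "heat i j h r = h r"
    and "heat i j h (insert i r) = (h (insert i r) + h (insert j r) + h (insert i (insert j r))) / 3"
    and "heat i j h (insert j r) = (h (insert i r) + h (insert j r) + h (insert i (insert j r))) / 3"
    and "heat i j h (insert i (insert j r)) = (h (insert i r) + h (insert j r) + h (insert i (insert j r))) / 3"
proof -
  have "i \<notin> r" "j \<notin> r" using assms by auto
  then have "r - {i, j} = r" "insert i r - {i, j} = r" "insert j r - {i, j} = r" "insert i (insert j r) - {i, j} = r"
    by auto
  with \<open>i \<notin> r\<close> \<open>j \<notin> r\<close> show "heat i j h r = h r"
    and "heat i j h (insert i r) = (h (insert i r) + h (insert j r) + h (insert i (insert j r))) / 3"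
    and "heat i j h (insert j r) = (h (insert i r) + h (insert j r) + h (insert i (insert j r))) / 3"
    and "heat i j h (insert i (insert j r)) = (h (insert i r) + h (insert j r) + h (insert i (insert j r))) / 3"
    by (simp_all add: heat_def)
qed

lemma sum_heat:
  assumes "finite I" "i \<in> I" "j \<in> I" "i \<noteq> j"
  shows "(\<Sum>a\<in>Pow I. heat i j h a) = (\<Sum>a\<in>Pow I. h a)"
  unfolding sum_Pow_pair[OF assms]
  using assms(4) by (intro sum.cong refl) (simp add: heat_pair[where I = I] field_simps)

text \<open>Replacing three numbers by their mean lowers the sum of squares by a third of the sum of
  the three squared differences; these are the differences collected in
  \<open>edge_sum\<close>.\<close>

lemma sum_heat_sq:
  assumes "finite I" "i \<in> I" "j \<in> I" "i \<noteq> j"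
  shows "(\<Sum>a\<in>Pow I. (heat i j h a)\<^sup>2) = (\<Sum>a\<in>Pow I. (h a)\<^sup>2) - edge_sum I i j h / 3"
  unfolding sum_Pow_pair[OF assms] edge_sum_def sum_divide_distrib sum_subtractf[symmetric]
proof (intro sum.cong refl, goal_cases)
  case (1 r)
  have id: "insert j (insert i r) = insert i (insert j r)"
      "insert j (insert i (insert j r)) = insert i (insert j r)" by auto
  from 1 have r: "r \<subseteq> I - {i, j}" by simp
  show ?case
    unfolding heat_pair[OF r assms(4)] id
    by (simp add: id field_simps power2_eq_square)
qed

text \<open>The half that keeps \<open>h\<close> stands for the phase gates, which leave every
  character in place; the other half averages over the position of a random element of the CNOT
  group.\<close>

definition walk_op :: "nat \<Rightarrow> (nat set \<Rightarrow> real) \<Rightarrow> nat set \<Rightarrow> real" where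
  "walk_op n h a = h a / 2 + (\<Sum>i<n. heat i ((i + 1) mod n) h a) / (2 * real n)"

lemma walk_op_empty [simp]: "n > 0 \<Longrightarrow> walk_op n h {} = h {}"
  by (simp add: walk_op_def field_simps)

lemma cyclic_succ:
  fixes i n :: nat
  assumes "n \<ge> 2" "i < n"
  shows "(i + 1) mod n < n" "i \<noteq> (i + 1) mod n"
proof -
  have "(i + 1) mod n = (if i + 1 = n then 0 else i + 1)"
    using assms by simp
  then show "(i + 1) mod n < n" "i \<noteq> (i + 1) mod n"
    using assms by (simp_all split: if_splits)
qed

lemma sum_walk_op:
  assumes n: "n \<ge> 2"
  shows "(\<Sum>a\<in>Pow {..<n}. walk_op n h a) = (\<Sum>a\<in>Pow {..<n}. h a)"
proof -
  have "(\<Sum>a\<in>Pow {..<n}. \<Sum>i<n. heat i ((i + 1) mod n) h a) = (\<Sum>i<n. \<Sum>a\<in>Pow {..<n}. heat i ((i + 1) mod n) h a)"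
    by (rule sum.swap)
  also have "\<dots> = (\<Sum>i<n. \<Sum>a\<in>Pow {..<n}. h a)"
    using cyclic_succ[OF n] by (intro sum.cong refl sum_heat) auto
  also have "\<dots> = real n * (\<Sum>a\<in>Pow {..<n}. h a)" by simp
  finally show ?thesis
    using n by (simp add: walk_op_def sum.distrib sum_divide_distrib[symmetric])
qed

text \<open>Convexity of the square and \<open>sum_heat_sq\<close> give a loss of one
  \<open>6 * n\<close>-th of the summed \<open>edge_sum\<close>; with the constant
  \<open>4 * n ^ 2\<close> of the Poincare inequality this is the fraction
  \<open>1 / (24 * n ^ 3)\<close>.\<close>

lemma walk_op_contraction:
  assumes n: "n \<ge> 2" and h0: "h {} = 0" and mean: "(\<Sum>a\<in>Pow {..<n}. h a) = 0"
  shows "(\<Sum>a\<in>Pow {..<n}. (walk_op n h a)\<^sup>2) \<le> (1 - 1 / (24 * real n ^ 3)) * (\<Sum>a\<in>Pow {..<n}. (h a)\<^sup>2)"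
proof -
  let ?P = "Pow {..<n}" and ?s = "\<lambda>i. (i + 1) mod n"
  define N where "N = (\<Sum>a\<in>?P. (h a)\<^sup>2)"
  have pt: "(walk_op n h a)\<^sup>2 \<le> (h a)\<^sup>2 / 2 + (\<Sum>i<n. (heat i (?s i) h a)\<^sup>2) / (2 * real n)" for a
  proof -
    define v where "v = (\<Sum>i<n. heat i (?s i) h a) / real n"
    have "v\<^sup>2 = (\<Sum>i<n. heat i (?s i) h a)\<^sup>2 / (real n)\<^sup>2"
      by (simp add: v_def power_divide)
    also have "\<dots> \<le> ((\<Sum>i<n. (heat i (?s i) h a)\<^sup>2) * real n) / (real n)\<^sup>2"
      using sum_squared_le_sum_of_squares[of "\<lambda>i. heat i (?s i) h a" "{..<n}"]
      by (intro divide_right_mono) simp_all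
    also have "\<dots> = (\<Sum>i<n. (heat i (?s i) h a)\<^sup>2) / real n"
      by (simp add: power2_eq_square)
    finally have v: "v\<^sup>2 \<le> (\<Sum>i<n. (heat i (?s i) h a)\<^sup>2) / real n" .
    have "walk_op n h a = (h a + v) / 2"
      by (simp add: walk_op_def v_def)
    then have "(walk_op n h a)\<^sup>2 = ((h a + v) / 2)\<^sup>2" by (rule arg_cong)
    also have "\<dots> = (h a)\<^sup>2 / 2 + v\<^sup>2 / 2 - (h a - v)\<^sup>2 / 4"
      by (simp add: power2_eq_square field_simps)
    also have "\<dots> \<le> (h a)\<^sup>2 / 2 + v\<^sup>2 / 2" by simp
    finally show ?thesis using v by simp
  qed
  have "(\<Sum>a\<in>?P. (walk_op n h a)\<^sup>2) \<le> (\<Sum>a\<in>?P. (h a)\<^sup>2 / 2 + (\<Sum>i<n. (heat i (?s i) h a)\<^sup>2) / (2 * real n))"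
    by (intro sum_mono pt)
  also have "\<dots> = N / 2 + (\<Sum>i<n. \<Sum>a\<in>?P. (heat i (?s i) h a)\<^sup>2) / (2 * real n)"
    by (subst sum.swap) (simp add: N_def sum.distrib sum_divide_distrib[symmetric])
  also have "(\<Sum>i<n. \<Sum>a\<in>?P. (heat i (?s i) h a)\<^sup>2) = (\<Sum>i<n. N - edge_sum {..<n} i (?s i) h / 3)"
    unfolding N_def using cyclic_succ[OF n] by (intro sum.cong refl sum_heat_sq) auto
  also have "\<dots> = real n * N - (\<Sum>i<n. edge_sum {..<n} i (?s i) h) / 3"
    by (simp add: sum_subtractf sum_divide_distrib[symmetric])
  \<comment> \<open>The Poincare inequality works along a path; its edges are among those of the
    cycle, and every edge contributes a nonnegative amount.\<close>
  also have "(\<Sum>k<n-1. edge_sum {..<n} k (Suc k) h) = (\<Sum>k<n-1. edge_sum {..<n} k (?s k) h)"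
    by (intro sum.cong) auto
  moreover have "(\<Sum>k<n-1. edge_sum {..<n} k (?s k) h) \<le> (\<Sum>i<n. edge_sum {..<n} i (?s i) h)"
    by (intro sum_mono2) (auto simp: edge_sum_nonneg)
  moreover have "N \<le> 4 * real n ^ 2 * (\<Sum>k<n-1. edge_sum {..<n} k (Suc k) h)"
    unfolding N_def using n by (intro poincare h0 mean) auto
  ultimately have S: "N / (4 * real n ^ 2) \<le> (\<Sum>i<n. edge_sum {..<n} i (?s i) h)"
      and le: "(\<Sum>a\<in>?P. (walk_op n h a)\<^sup>2) \<le> N / 2 + (real n * N - (\<Sum>i<n. edge_sum {..<n} i (?s i) h) / 3) / (2 * real n)"
    using n by (simp_all add: pos_divide_le_eq mult.commute) (meson dual_order.trans mult_right_mono zero_le_power2 mult_left_mono zero_le_numeral mult_nonneg_nonneg)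
  note le
  also have "N / 2 + (real n * N - (\<Sum>i<n. edge_sum {..<n} i (?s i) h) / 3) / (2 * real n)
      \<le> N / 2 + (real n * N - N / (4 * real n ^ 2) / 3) / (2 * real n)"
    using S n by (intro add_mono divide_right_mono diff_mono) auto
  also have "\<dots> = (1 - 1 / (24 * real n ^ 3)) * N"
    using n by (simp add: field_simps power2_eq_square power3_eq_cube)
  finally show ?thesis by (simp add: N_def)
qed

lemma heat_shift:
  assumes "a \<noteq> {}"
  shows "heat i j (\<lambda>a. h a - (if a = {} then 0 else c)) a = heat i j h a - c"
  using assms by (auto simp: heat_def field_simps)

lemma walk_op_shift:
  assumes "n > 0"
  shows "walk_op n (\<lambda>a. h a - (if a = {} then 0 else c)) = (\<lambda>a. walk_op n h a - (if a = {} then 0 else c))"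
proof
  fix a
  show "walk_op n (\<lambda>a. h a - (if a = {} then 0 else c)) a = walk_op n h a - (if a = {} then 0 else c)"
  proof (cases "a = {}")
    case True
    then show ?thesis using assms by simp
  next
    case False
    then show ?thesis
      using assms by (simp add: walk_op_def heat_shift sum_subtractf field_simps)
  qed
qed

text \<open>Minus its equilibrium value \<open>c\<close>, the indicator of \<open>A\<close> vanishes
  at the empty set and has sum zero, so its sum of squares contracts; a single value is bounded by
  the root of that sum.\<close>

lemma walk_mixing:
  assumes n: "n \<ge> 2" and A: "A \<subseteq> Pow {..<n} - {{}}" and a: "a \<in> Pow {..<n} - {{}}"
  shows "real (card A) / 2 ^ (n + 1) \<le> ((walk_op n ^^ (96 * n ^ 4)) (indicator A)) a"
proof (cases "A = {}")
  case False
  let ?P = "Pow {..<n}"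
  let ?\<Omega> = "?P - {{}}"
  define q where "q = 1 - 1 / (24 * real n ^ 3)"
  have fin: "finite ?\<Omega>" by simp
  have finA: "finite A" using A fin by (rule finite_subset)
  have card\<Omega>: "card ?\<Omega> = 2 ^ n - 1" by (simp add: card_Pow card_Diff_subset)
  have two: "(2::real) ^ n \<ge> 4"
    using power_increasing[OF n, of "2::real"] by simp
  have card\<Omega>': "real (card ?\<Omega>) = 2 ^ n - 1" unfolding card\<Omega> by (simp add: of_nat_diff)
  define c where "c = real (card A) / (2 ^ n - 1)"
  define g where "g a = indicator A a - (if a = {} then 0 else c)" for a :: "nat set"
  have cA: "real (card A) \<le> 2 ^ n - 1"
    using card_mono[OF fin A] card\<Omega>' by linarith
  have c: "0 \<le> c" "c \<le> 1" "real (card A) / 2 ^ n \<le> c"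
    using cA two by (auto simp: c_def intro!: divide_left_mono)
  have "{} \<notin> A" using A by auto
  then have g0: "g {} = 0" by (simp add: g_def)
  have iter: "(walk_op n ^^ k) g = (\<lambda>a. (walk_op n ^^ k) (indicator A) a - (if a = {} then 0 else c))" for k
  proof (induction k)
    case 0
    then show ?case by (simp add: g_def fun_eq_iff)
  next
    case (Suc k)
    then show ?case using walk_op_shift[of n "(walk_op n ^^ k) (indicator A)" c] n by simp
  qed
  have sumg: "(\<Sum>a\<in>?P. g a) = 0"
  proof -
    have "(\<Sum>a\<in>?P. g a) = (\<Sum>a\<in>?\<Omega>. g a)" using g0 by (intro sum.mono_neutral_right) auto
    also have "\<dots> = (\<Sum>a\<in>?\<Omega>. indicator A a - c)" by (intro sum.cong) (auto simp: g_def)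
    also have "\<dots> = (\<Sum>a\<in>?\<Omega>. indicator A a) - real (card ?\<Omega>) * c" by (simp add: sum_subtractf)
    also have "(\<Sum>a\<in>?\<Omega>. indicator A a) = real (card A)"
      using A by (simp add: indicator_def sum.If_cases Int_absorb1)
    finally show ?thesis using two unfolding card\<Omega>' by (simp add: c_def)
  qed
  have N0: "(\<Sum>a\<in>?P. (g a)\<^sup>2) \<le> 2 ^ n"
  proof -
    have "(g a)\<^sup>2 \<le> 1" for a
      using c by (auto simp: g_def indicator_def abs_square_le_1)
    then have "(\<Sum>a\<in>?P. (g a)\<^sup>2) \<le> (\<Sum>a\<in>?P. 1)" by (intro sum_mono)
    then show ?thesis by (simp add: card_Pow)
  qed
  have q: "0 \<le> q" "q \<le> exp (- (1 / (24 * real n ^ 3)))"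
  proof -
    have "1 \<le> real n ^ 3" using n by simp
    then have "1 / (24 * real n ^ 3) \<le> 1" by (subst pos_divide_le_eq) linarith+
    then show "0 \<le> q" by (simp add: q_def)
    show "q \<le> exp (- (1 / (24 * real n ^ 3)))"
      using exp_ge_add_one_self[of "- (1 / (24 * real n ^ 3))"] by (simp add: q_def)
  qed
  have Nk: "(walk_op n ^^ k) g {} = 0 \<and> (\<Sum>a\<in>?P. (walk_op n ^^ k) g a) = 0 \<and>
      (\<Sum>a\<in>?P. ((walk_op n ^^ k) g a)\<^sup>2) \<le> q ^ k * 2 ^ n" for k
  proof (induction k)
    case 0
    then show ?case using g0 sumg N0 by simp
  next
    case (Suc k)
    have "(\<Sum>a\<in>?P. ((walk_op n ^^ Suc k) g a)\<^sup>2) \<le> q * (\<Sum>a\<in>?P. ((walk_op n ^^ k) g a)\<^sup>2)"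
      using walk_op_contraction[OF n, of "(walk_op n ^^ k) g"] Suc by (simp add: q_def)
    also have "\<dots> \<le> q * (q ^ k * 2 ^ n)" using Suc q by (intro mult_left_mono) auto
    finally show ?case using Suc sum_walk_op[OF n] n by simp
  qed
  \<comment> \<open>This many steps give a factor \<open>exp (- 4 * n)\<close>, hence a sum of
    squares of at most \<open>2\<close> to the power \<open>- 3 * n\<close>. As \<open>n\<close> is
    at least 2, every pointwise error is at most \<open>1 / 2 ^ (n + 1)\<close>, which for nonempty
    \<open>A\<close> is at most half of the main term.\<close>
  define k where "k = 96 * n ^ 4"
  have "((walk_op n ^^ k) g a)\<^sup>2 \<le> (\<Sum>a\<in>?P. ((walk_op n ^^ k) g a)\<^sup>2)"
    using a by (intro member_le_sum) auto
  also have "\<dots> \<le> q ^ k * 2 ^ n" using Nk by blast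
  also have "q ^ k \<le> exp (- (1 / (24 * real n ^ 3))) ^ k" using q by (intro power_mono) auto
  also have "exp (- (1 / (24 * real n ^ 3))) ^ k = exp (- (4 * real n))"
    using n by (simp add: exp_of_nat_mult[symmetric] k_def power3_eq_cube power4_eq_xxxx)
  also have "exp (- (4 * real n)) = (exp (-1)) ^ (4 * n)"
    by (simp add: exp_of_nat_mult[symmetric])
  also have "\<dots> \<le> (1 / 2) ^ (4 * n)"
    using exp_ge_add_one_self[of 1] by (intro power_mono) (auto simp: exp_minus field_simps)
  also have "(1 / 2) ^ (4 * n) * 2 ^ n \<le> (1 / 2 ^ (n + 1) :: real)\<^sup>2"
  proof -
    have "(1 / 2) ^ (4 * n) * 2 ^ n = (1 / (2::real)) ^ (3 * n)"
      by (simp add: power_divide field_simps flip: power_add)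
    also have "\<dots> \<le> (1 / 2) ^ ((n + 1) * 2)"
      using n by (intro power_decreasing) auto
    also have "\<dots> = (1 / 2 ^ (n + 1))\<^sup>2"
      by (simp add: power_divide power_mult[symmetric])
    finally show ?thesis .
  qed
  finally have "((walk_op n ^^ k) g a)\<^sup>2 \<le> (1 / 2 ^ (n + 1))\<^sup>2" by simp
  then have "\<bar>(walk_op n ^^ k) g a\<bar> \<le> 1 / 2 ^ (n + 1)"
    by (simp add: power2_le_iff_abs_le)
  moreover have "(walk_op n ^^ k) g a = (walk_op n ^^ k) (indicator A) a - c"
    using a by (simp add: iter)
  ultimately have "(walk_op n ^^ k) (indicator A) a \<ge> c - 1 / 2 ^ (n + 1)" by linarith
  moreover have "1 / 2 ^ (n + 1) \<le> real (card A) / 2 ^ (n + 1)"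
    using False finA by (intro divide_right_mono) (auto simp: Suc_le_eq card_gt_0_iff)
  moreover have "real (card A) / 2 ^ n = 2 * (real (card A) / 2 ^ (n + 1))" by simp
  ultimately show ?thesis using c(3) unfolding k_def by linarith
next
  case True
  have nonneg: "(walk_op n ^^ k) (\<lambda>_. 0) b = 0" for k b
    by (induction k arbitrary: b) (simp_all add: walk_op_def heat_def)
  have "indicator A = (\<lambda>_. 0 :: real)" using True by (simp add: fun_eq_iff)
  then show ?thesis using True nonneg by simp
qed

section \<open>Circuits of controlled-not gates\<close>

text \<open>The index that \<open>apply_gate\<close> uses for the ordered pair, with
  \<open>i\<close> as the high bit.\<close>

definition pair_val :: "nat \<Rightarrow> nat \<Rightarrow> nat set \<Rightarrow> nat" where
  "pair_val i j x = 2 * of_bool (i \<in> x) + of_bool (j \<in> x)"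

definition set_pair :: "nat \<Rightarrow> nat \<Rightarrow> nat \<Rightarrow> nat set \<Rightarrow> nat set" where
  "set_pair i j v x = (x - {i, j}) \<union> (if v div 2 = 1 then {i} else {}) \<union> (if v mod 2 = 1 then {j} else {})"

lemma pair_val_less: "pair_val i j x < 4"
  by (auto simp: pair_val_def of_bool_def)

lemma less4_cases: "v < 4 \<Longrightarrow> v = 0 \<or> v = 1 \<or> v = 2 \<or> v = (3::nat)"
  by linarith

lemma pair_val_set_pair [simp]: "i \<noteq> j \<Longrightarrow> v < 4 \<Longrightarrow> pair_val i j (set_pair i j v x) = v"
  by (drule less4_cases) (auto simp: pair_val_def set_pair_def)

lemma set_pair_Diff [simp]: "set_pair i j v x - {i, j} = x - {i, j}"
  by (auto simp: set_pair_def)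

lemma set_pair_set_pair [simp]: "set_pair i j v (set_pair i j w x) = set_pair i j v x"
  unfolding set_pair_def[of i j v "set_pair i j w x"] set_pair_Diff by (simp add: set_pair_def)

lemma set_pair_pair_val [simp]: "set_pair i j (pair_val i j x) x = x"
  by (auto simp: set_pair_def pair_val_def)

lemma set_pair_eqI: "x - {i, j} = y - {i, j} \<Longrightarrow> pair_val i j x = pair_val i j y \<Longrightarrow> x = y"
  by (metis set_pair_pair_val set_pair_def)

lemma set_pair_subset: "x \<subseteq> I \<Longrightarrow> i \<in> I \<Longrightarrow> j \<in> I \<Longrightarrow> set_pair i j v x \<subseteq> I"
  by (auto simp: set_pair_def)

definition swap12 :: "nat \<Rightarrow> nat" where
  "swap12 v = (if v = 1 then 2 else if v = 2 then 1 else v)"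

lemma swap12_swap12 [simp]: "swap12 (swap12 v) = v"
  by (simp add: swap12_def)

text \<open>The pair values \<open>v\<close> and \<open>w\<close>, read as vectors over the two-element field, are orthogonal iff
  one of them is zero or \<open>w = swap12 v\<close>.\<close>

definition pair_sign :: "nat \<Rightarrow> nat \<Rightarrow> real" where
  "pair_sign v w = (if v = 0 \<or> w = 0 \<or> w = swap12 v then 1 else - 1)"

lemma chr_union:
  assumes "finite a" "finite b" "a \<inter> b = {}"
  shows "chr (a \<union> b) x = chr a x * chr b x"
proof -
  have "(a \<union> b) \<inter> x = (a \<inter> x) \<union> (b \<inter> x)" by auto
  moreover have "card ((a \<inter> x) \<union> (b \<inter> x)) = card (a \<inter> x) + card (b \<inter> x)"
    using assms by (intro card_Un_disjoint) auto
  ultimately show ?thesis by (simp add: chr_def power_add)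
qed

lemma chr_singleton: "chr {i} x = (if i \<in> x then - 1 else 1)"
  by (simp add: chr_def)

lemma chr_split:
  assumes "finite a" "i \<noteq> j"
  shows "chr a x = chr (a - {i, j}) (x - {i, j}) * pair_sign (pair_val i j a) (pair_val i j x)"
proof -
  have "a = (a - {i, j}) \<union> (a \<inter> {i, j})" by auto
  then have "chr a x = chr (a - {i, j}) x * chr (a \<inter> {i, j}) x"
    using assms chr_union[of "a - {i, j}" "a \<inter> {i, j}" x] by auto
  also have "chr (a - {i, j}) x = chr (a - {i, j}) (x - {i, j})"
  proof -
    have "(a - {i, j}) \<inter> x = (a - {i, j}) \<inter> (x - {i, j})" by auto
    then show ?thesis by (simp only: chr_def)
  qed
  also have "chr (a \<inter> {i, j}) x = pair_sign (pair_val i j a) (pair_val i j x)"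
  proof -
    have ij: "chr {i, j} x = chr {i} x * chr {j} x"
      using chr_union[of "{i}" "{j}" x] assms by (simp add: insert_commute)
    consider "i \<in> a" "j \<in> a" | "i \<in> a" "j \<notin> a" | "i \<notin> a" "j \<in> a" | "i \<notin> a" "j \<notin> a" by blast
    then show ?thesis
    proof cases
      case 1
      then have "a \<inter> {i, j} = {i, j}" by auto
      then show ?thesis
        using 1 by (auto simp: ij chr_singleton pair_sign_def pair_val_def swap12_def)
    next
      case 2
      then have "a \<inter> {i, j} = {i}" by auto
      then show ?thesis
        using 2 by (auto simp: chr_singleton pair_sign_def pair_val_def swap12_def)
    next
      case 3
      then have "a \<inter> {i, j} = {j}" by auto
      then show ?thesis
        using 3 by (auto simp: chr_singleton pair_sign_def pair_val_def swap12_def)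
    next
      case 4
      then have "a \<inter> {i, j} = {}" by auto
      then show ?thesis
        using 4 by (auto simp: pair_sign_def pair_val_def)
    qed
  qed
  finally show ?thesis .
qed

text \<open>Over the two-element field any two distinct nonzero vectors of the plane sum to the
  third, so every permutation of the three that fixes zero is linear. This is GL(2,2), the group
  generated by the two CNOT gates.\<close>

definition perms3 :: "(nat \<Rightarrow> nat) set" where
  "perms3 = {f. f permutes {1, 2, 3}}"

lemma perms3_bounds:
  assumes "f \<in> perms3"
  shows "f 0 = 0" "v < 4 \<Longrightarrow> f v < 4" "inv_into UNIV f \<in> perms3" "inv_into UNIV f (f v) = v" "f (inv_into UNIV f v) = v" "f v = 0 \<longleftrightarrow> v = 0"
proof -
  from assms have f: "f permutes {1, 2, 3}" by (simp add: perms3_def)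
  then show f0: "f 0 = 0" by (simp add: permutes_not_in)
  show "f v < 4" if "v < 4"
  proof (cases "v \<in> {1, 2, 3}")
    case True
    then have "f v \<in> {1, 2, 3}" using permutes_in_image[OF f] by blast
    then show ?thesis by auto
  next
    case False
    then show ?thesis using permutes_not_in[OF f] that by metis
  qed
  show "inv_into UNIV f \<in> perms3" using f by (simp add: perms3_def permutes_inv)
  show "inv_into UNIV f (f v) = v" "f (inv_into UNIV f v) = v" using f by (simp_all add: permutes_inverses)
  show "f v = 0 \<longleftrightarrow> v = 0" using f0 permutes_inj[OF f] by (metis injD)
qed

lemma swap12_eq_0 [simp]: "swap12 v = 0 \<longleftrightarrow> v = 0"
  by (auto simp: swap12_def)

lemma swap12_less: "v < 4 \<Longrightarrow> swap12 v < 4"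
  by (auto simp: swap12_def)

text \<open>The transpose of the linear map \<open>f\<close>. For nonzero \<open>v\<close>, the only
  nonzero vector orthogonal to \<open>v\<close> is \<open>swap12 v\<close>; the one orthogonal to
  the transposed image of \<open>v\<close> is therefore the preimage of \<open>swap12 v\<close>
  under \<open>f\<close>, and a second \<open>swap12\<close> recovers the image itself.\<close>

definition dual_perm :: "(nat \<Rightarrow> nat) \<Rightarrow> nat \<Rightarrow> nat" where
  "dual_perm f v = swap12 (inv_into UNIV f (swap12 v))"

lemma pair_sign_dual:
  assumes "f \<in> perms3"
  shows "pair_sign v (f w) = pair_sign (dual_perm f v) w"
proof -
  have "f w = swap12 v \<longleftrightarrow> w = swap12 (dual_perm f v)"
    unfolding dual_perm_def swap12_swap12 using perms3_bounds(4,5)[OF assms] by metis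
  moreover have "f w = 0 \<longleftrightarrow> w = 0" "dual_perm f v = 0 \<longleftrightarrow> v = 0"
    using perms3_bounds(3,6)[OF assms] perms3_bounds(6)[OF perms3_bounds(3)[OF assms]]
    by (auto simp: dual_perm_def)
  ultimately show ?thesis by (simp add: pair_sign_def)
qed

lemma dual_perm_less: "f \<in> perms3 \<Longrightarrow> v < 4 \<Longrightarrow> dual_perm f v < 4"
  by (simp add: dual_perm_def swap12_less perms3_bounds)

lemma dual_perm_inj: "f \<in> perms3 \<Longrightarrow> dual_perm f v = dual_perm f w \<longleftrightarrow> v = w"
  using perms3_bounds(5)[of f] unfolding dual_perm_def by (metis swap12_swap12)

lemma dual_perm_0: "f \<in> perms3 \<Longrightarrow> dual_perm f 0 = 0"
  using perms3_bounds(1)[OF perms3_bounds(3)] by (simp add: dual_perm_def swap12_def)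

lemma finite_perms3: "finite perms3"
  by (simp add: perms3_def finite_permutations)

lemma card_perms3: "card perms3 = 6"
  using card_permutations[of "{1, 2, 3 :: nat}" 3] by (simp add: perms3_def fact_numeral)

text \<open>Composition with a transposition shows that the sum is the same for all three
  \<open>v\<close>; summing over \<open>v\<close> as well gives six times the total of
  \<open>G\<close>.\<close>

lemma sum_perms3_apply:
  fixes G :: "nat \<Rightarrow> real"
  assumes v: "v \<in> {1, 2, 3}"
  shows "(\<Sum>f\<in>perms3. G (f v)) = 2 * (G 1 + G 2 + G 3)"
proof -
  have sym: "(\<Sum>f\<in>perms3. G (f v)) = (\<Sum>f\<in>perms3. G (f w))" if "w \<in> {1, 2, 3}" for w
    unfolding perms3_def
    using sum_permutations_compose_right[OF permutes_swap_id[OF v that], of "\<lambda>f. G (f v)"]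
    by (simp only: o_apply transpose_apply_first)
  have "3 * (\<Sum>f\<in>perms3. G (f v)) = (\<Sum>w\<in>{1, 2, 3::nat}. \<Sum>f\<in>perms3. G (f w))"
    using sym[of 1] sym[of 2] sym[of 3] by simp
  also have "\<dots> = (\<Sum>f\<in>perms3. \<Sum>w\<in>{1, 2, 3::nat}. G (f w))"
    by (rule sum.swap)
  also have "\<dots> = (\<Sum>f\<in>perms3. \<Sum>w\<in>{1, 2, 3::nat}. G w)"
    by (intro sum.cong refl sum.permute[symmetric, unfolded o_def]) (simp add: perms3_def)
  also have "\<dots> = 6 * (G 1 + G 2 + G 3)"
    by (simp add: card_perms3 add_ac)
  finally show ?thesis by simp
qed

text \<open>Reindexing by inverse permutations removes the inverse in \<open>dual_perm\<close>, and
  \<open>swap12\<close> only permutes the nonzero patterns, so each of the three is hit twice.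
  Uniform CNOT group elements thus act on functions of characters as \<open>heat\<close>.\<close>

lemma sum_perms3_heat:
  assumes ij: "i \<noteq> j"
  shows "(\<Sum>f\<in>perms3. h (set_pair i j (dual_perm f (pair_val i j a)) a)) = 6 * heat i j h a"
proof (cases "pair_val i j a = 0")
  case True
  have "i \<notin> a" "j \<notin> a" "set_pair i j 0 a = a"
    using True by (auto simp: pair_val_def set_pair_def split: if_splits)
  then show ?thesis using True by (simp add: card_perms3 heat_def dual_perm_0)
next
  case False
  define F where "F u = h (set_pair i j u a)" for u
  have v: "swap12 (pair_val i j a) \<in> {1, 2, 3}"
    using False pair_val_less[of i j a] by (auto simp: swap12_def)
  have "(\<Sum>f\<in>perms3. F (dual_perm f (pair_val i j a))) = (\<Sum>f\<in>perms3. F (swap12 (f (swap12 (pair_val i j a)))))"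
    unfolding dual_perm_def perms3_def
    using sum_permutations_inverse[of "\<lambda>f. F (swap12 (f (swap12 (pair_val i j a))))" "{1,2,3}"] by simp
  also have "\<dots> = 2 * (F 2 + F 1 + F 3)"
    using sum_perms3_apply[OF v, of "\<lambda>u. F (swap12 u)"] by (simp add: swap12_def)
  also have "\<dots> = 6 * heat i j h a"
  proof -
    have "set_pair i j 2 a = insert i (a - {i, j})" "set_pair i j 1 a = insert j (a - {i, j})"
        "set_pair i j 3 a = insert i (insert j (a - {i, j}))"
      by (auto simp: set_pair_def)
    moreover have "\<not> (i \<notin> a \<and> j \<notin> a)" using False by (auto simp: pair_val_def)
    ultimately show ?thesis unfolding heat_def F_def by (simp only: if_False)
  qed
  finally show ?thesis by (simp add: F_def)
qed

text \<open>A letter \<open>(i, b, f)\<close> stands for a gate on the qubits \<open>i\<close> and \<open>i + 1\<close>: if \<open>b\<close>, the permutation \<open>f\<close> of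
  the three nonzero basis vectors, and otherwise a random phase on qubit \<open>i\<close>.\<close>

type_synonym letter = "nat \<times> bool \<times> (nat \<Rightarrow> nat)"

text \<open>Phase letters carry an idle permutation as well: with a fair coin this makes all
  \<open>12 * n\<close> letters equally likely.\<close>

definition letters :: "nat \<Rightarrow> letter set" where
  "letters n = {..<n} \<times> UNIV \<times> perms3"

text \<open>The index from which the output amplitude at \<open>x\<close> is read: after the gate it
  is a phase times the amplitude at \<open>letter_map n l x\<close> before it.\<close>

definition letter_map :: "nat \<Rightarrow> letter \<Rightarrow> nat set \<Rightarrow> nat set" where
  "letter_map n = (\<lambda>(i, b, f) x. if b then set_pair i ((i + 1) mod n) (f (pair_val i ((i + 1) mod n) x)) x else x)"

definition letter_dual :: "nat \<Rightarrow> letter \<Rightarrow> nat set \<Rightarrow> nat set" where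
  "letter_dual n = (\<lambda>(i, b, f) x. if b then set_pair i ((i + 1) mod n) (dual_perm f (pair_val i ((i + 1) mod n) x)) x else x)"

lemma finite_letters [simp]: "finite (letters n)"
  by (simp add: letters_def finite_perms3)

lemma card_letters: "card (letters n) = 12 * n"
  by (simp add: letters_def card_cartesian_product card_perms3)

lemma chr_letter_dual:
  assumes "n \<ge> 2" "l \<in> letters n" "finite a"
  shows "chr a (letter_map n l x) = chr (letter_dual n l a) x"
proof -
  obtain i b f where l: "l = (i, b, f)" by (cases l)
  define j where "j = (i + 1) mod n"
  have f: "f \<in> perms3" and i: "i < n" using assms(2) by (auto simp: l letters_def)
  then have ij: "i \<noteq> j" using cyclic_succ[OF assms(1)] by (simp add: j_def)
  have fv: "f (pair_val i j x) < 4" "dual_perm f (pair_val i j a) < 4"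
    using f by (simp_all add: perms3_bounds dual_perm_less pair_val_less)
  have fin: "finite (set_pair i j v a)" for v using assms(3) by (auto simp: set_pair_def)
  show ?thesis
  proof (cases b)
    case True
    have "chr a (set_pair i j (f (pair_val i j x)) x) = chr (set_pair i j (dual_perm f (pair_val i j a)) a) x"
      unfolding chr_split[OF assms(3) ij] chr_split[OF fin ij]
      using fv ij f by (simp add: pair_sign_dual)
    then show ?thesis using True by (simp add: letter_map_def letter_dual_def l j_def)
  qed (simp add: letter_map_def letter_dual_def l)
qed

lemma letter_map_mem:
  assumes "n \<ge> 2" "l \<in> letters n" "x \<in> Pow {..<n}"
  shows "letter_map n l x \<in> Pow {..<n}"
proof -
  obtain i b f where l: "l = (i, b, f)" by (cases l)
  have i: "i < n" using assms(2) by (auto simp: l letters_def)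
  then show ?thesis
    using assms set_pair_subset[of x "{..<n}" i] cyclic_succ(1)[OF assms(1) i]
    by (simp add: letter_map_def l)
qed

lemma letter_map_inj:
  assumes "n \<ge> 2" "l \<in> letters n"
  shows "letter_map n l x = letter_map n l y \<longleftrightarrow> x = y"
proof -
  obtain i b f where l: "l = (i, b, f)" by (cases l)
  define j where "j = (i + 1) mod n"
  have f: "f \<in> perms3" and i: "i < n" using assms(2) by (auto simp: l letters_def)
  then have ij: "i \<noteq> j" using cyclic_succ[OF assms(1)] by (simp add: j_def)
  have "x = y" if eq: "set_pair i j (f (pair_val i j x)) x = set_pair i j (f (pair_val i j y)) y"
  proof (rule set_pair_eqI)
    show "x - {i, j} = y - {i, j}" using arg_cong[OF eq, of "\<lambda>z. z - {i, j}"] by simp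
    have "f (pair_val i j x) = f (pair_val i j y)"
      using arg_cong[OF eq, of "pair_val i j"] ij f by (simp add: perms3_bounds pair_val_less)
    then show "pair_val i j x = pair_val i j y" using perms3_bounds(4)[OF f] by metis
  qed
  then show ?thesis by (auto simp: letter_map_def l j_def)
qed

lemma letter_dual_inj:
  assumes "n \<ge> 2" "l \<in> letters n"
  shows "letter_dual n l x = letter_dual n l y \<longleftrightarrow> x = y"
proof -
  obtain i b f where l: "l = (i, b, f)" by (cases l)
  define j where "j = (i + 1) mod n"
  have f: "f \<in> perms3" and i: "i < n" using assms(2) by (auto simp: l letters_def)
  then have ij: "i \<noteq> j" using cyclic_succ[OF assms(1)] by (simp add: j_def)
  have "x = y" if eq: "set_pair i j (dual_perm f (pair_val i j x)) x = set_pair i j (dual_perm f (pair_val i j y)) y"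
  proof (rule set_pair_eqI)
    show "x - {i, j} = y - {i, j}" using arg_cong[OF eq, of "\<lambda>z. z - {i, j}"] by simp
    have "dual_perm f (pair_val i j x) = dual_perm f (pair_val i j y)"
      using arg_cong[OF eq, of "pair_val i j"] ij f by (simp add: dual_perm_less pair_val_less)
    then show "pair_val i j x = pair_val i j y" using dual_perm_inj[OF f] by metis
  qed
  then show ?thesis by (auto simp: letter_dual_def l j_def)
qed

lemma letter_dual_mem:
  assumes "n \<ge> 2" "l \<in> letters n" "a \<in> Pow {..<n} - {{}}"
  shows "letter_dual n l a \<in> Pow {..<n} - {{}}"
proof -
  obtain i b f where l: "l = (i, b, f)" by (cases l)
  have i: "i < n" and f: "f \<in> perms3" using assms(2) by (auto simp: l letters_def)
  have "letter_dual n l {} = {}"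
    using dual_perm_0[OF f]
    by (simp add: letter_dual_def l pair_val_def set_pair_def)
  then have "letter_dual n l a \<noteq> {}"
    using letter_dual_inj[OF assms(1,2), of a "{}"] assms(3) by auto
  moreover have "letter_dual n l a \<in> Pow {..<n}"
    using i assms set_pair_subset[of a "{..<n}" i] cyclic_succ(1)[OF assms(1) i]
    by (simp add: letter_dual_def l)
  ultimately show ?thesis by simp
qed

text \<open>The leftmost factor of a matrix product is the first to act on row indices, so the maps
  are applied in the order of the word and their transposes, in \<open>seq_dual\<close>, in the
  opposite order.\<close>

primrec seq_map :: "nat \<Rightarrow> letter list \<Rightarrow> nat set \<Rightarrow> nat set" where
  "seq_map n [] x = x"
| "seq_map n (l # ls) x = seq_map n ls (letter_map n l x)"

primrec seq_dual :: "nat \<Rightarrow> letter list \<Rightarrow> nat set \<Rightarrow> nat set" where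
  "seq_dual n [] a = a"
| "seq_dual n (l # ls) a = letter_dual n l (seq_dual n ls a)"

text \<open>The characters of the phases of a word: a phase letter on qubit \<open>q\<close>
  contributes the unit vector of \<open>q\<close>, pulled back through all letters before it. As a
  set it forgets repetitions, which bring no new character.\<close>

primrec phase_set :: "nat \<Rightarrow> letter list \<Rightarrow> nat set set" where
  "phase_set n [] = {}"
| "phase_set n (l # ls) = (if fst (snd l) then {} else {{fst l}}) \<union> letter_dual n l ` phase_set n ls"

lemma phase_set_append: "phase_set n (xs @ ys) = phase_set n xs \<union> seq_dual n xs ` phase_set n ys"
  by (induction xs) (auto simp: image_Un image_image)

lemma card_phase_set: "finite (phase_set n ls) \<and> card (phase_set n ls) \<le> length ls"
proof (induction ls)
  case (Cons l ls)
  have "card (letter_dual n l ` phase_set n ls) \<le> length ls"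
    using card_image_le[of "phase_set n ls" "letter_dual n l"] Cons by linarith
  moreover have "card (phase_set n (l # ls)) \<le> 1 + card (letter_dual n l ` phase_set n ls)"
    using card_insert_le_m1 Cons by (auto simp: card_insert_if)
  ultimately show ?case using Cons by simp
qed simp

context
  fixes n :: nat
  assumes n: "n \<ge> 2"
begin

lemma seq_map_mem: "set ls \<subseteq> letters n \<Longrightarrow> x \<in> Pow {..<n} \<Longrightarrow> seq_map n ls x \<in> Pow {..<n}"
proof (induction ls arbitrary: x)
  case (Cons l ls)
  then show ?case using letter_map_mem[OF n, of l x] by simp
qed simp

lemma seq_map_inj: "set ls \<subseteq> letters n \<Longrightarrow> seq_map n ls x = seq_map n ls y \<longleftrightarrow> x = y"
  by (induction ls arbitrary: x y) (simp_all add: letter_map_inj[OF n])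

lemma seq_dual_inj: "set ls \<subseteq> letters n \<Longrightarrow> seq_dual n ls x = seq_dual n ls y \<longleftrightarrow> x = y"
  by (induction ls) (simp_all add: letter_dual_inj[OF n])

lemma seq_dual_mem: "set ls \<subseteq> letters n \<Longrightarrow> a \<in> Pow {..<n} - {{}} \<Longrightarrow> seq_dual n ls a \<in> Pow {..<n} - {{}}"
proof (induction ls)
  case (Cons l ls)
  then have "seq_dual n ls a \<in> Pow {..<n} - {{}}" "l \<in> letters n" by auto
  then show ?case using letter_dual_mem[OF n, of l "seq_dual n ls a"] by simp
qed simp

lemma phase_set_mem: "set ls \<subseteq> letters n \<Longrightarrow> phase_set n ls \<subseteq> Pow {..<n} - {{}}"
proof (induction ls)
  case (Cons l ls)
  then have l: "l \<in> letters n" and ls: "phase_set n ls \<subseteq> Pow {..<n} - {{}}" by simp_all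
  have "letter_dual n l ` phase_set n ls \<subseteq> Pow {..<n} - {{}}"
    by (rule image_subsetI) (rule letter_dual_mem[OF n l], rule subsetD[OF ls])
  moreover have "fst l < n" using Cons.prems by (cases l) (auto simp: letters_def)
  ultimately show ?case by simp
qed simp

lemma chr_seq_dual:
  "set ls \<subseteq> letters n \<Longrightarrow> a \<in> Pow {..<n} - {{}} \<Longrightarrow> chr a (seq_map n ls x) = chr (seq_dual n ls a) x"
proof (induction ls arbitrary: x)
  case (Cons l ls)
  have "seq_dual n ls a \<in> Pow {..<n} - {{}}" using Cons.prems by (intro seq_dual_mem) auto
  then have "finite (seq_dual n ls a)" using finite_subset by blast
  then show ?case using Cons chr_letter_dual[OF n, of l "seq_dual n ls a" x] by simp
qed simp

end

section \<open>Averages over random letters\<close>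

definition letter_avg :: "nat \<Rightarrow> (letter \<Rightarrow> real) \<Rightarrow> real" where
  "letter_avg n \<Phi> = (\<Sum>l\<in>letters n. \<Phi> l) / real (card (letters n))"

primrec seq_avg :: "nat \<Rightarrow> nat \<Rightarrow> (letter list \<Rightarrow> real) \<Rightarrow> real" where
  "seq_avg n 0 \<Phi> = \<Phi> []"
| "seq_avg n (Suc d) \<Phi> = letter_avg n (\<lambda>l. seq_avg n d (\<lambda>ls. \<Phi> (l # ls)))"

lemma letter_avg_mono: "(\<And>l. l \<in> letters n \<Longrightarrow> \<Phi> l \<le> \<Psi> l) \<Longrightarrow> letter_avg n \<Phi> \<le> letter_avg n \<Psi>"
  unfolding letter_avg_def by (intro divide_right_mono sum_mono) auto

lemma letter_avg_const: "n > 0 \<Longrightarrow> letter_avg n (\<lambda>_. c) = c"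
  by (simp add: letter_avg_def card_letters)

lemma seq_avg_mono:
  "(\<And>ls. set ls \<subseteq> letters n \<Longrightarrow> length ls = d \<Longrightarrow> \<Phi> ls \<le> \<Psi> ls) \<Longrightarrow> seq_avg n d \<Phi> \<le> seq_avg n d \<Psi>"
  by (induction d arbitrary: \<Phi> \<Psi>) (auto intro!: letter_avg_mono)

lemma seq_avg_cong:
  "(\<And>ls. set ls \<subseteq> letters n \<Longrightarrow> length ls = d \<Longrightarrow> \<Phi> ls = \<Psi> ls) \<Longrightarrow> seq_avg n d \<Phi> = seq_avg n d \<Psi>"
  by (intro antisym seq_avg_mono) auto

lemma seq_avg_const: "n > 0 \<Longrightarrow> seq_avg n d (\<lambda>_. c) = c"
  by (induction d) (simp_all add: letter_avg_const)

lemma seq_avg_linear: "seq_avg n d (\<lambda>ls. \<Phi> ls * c + \<Psi> ls) = seq_avg n d \<Phi> * c + seq_avg n d \<Psi>"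
  by (induction d arbitrary: \<Phi> \<Psi>)
    (simp_all add: letter_avg_def sum.distrib sum_distrib_right add_divide_distrib)

lemma seq_avg_mult_right: "n > 0 \<Longrightarrow> seq_avg n d (\<lambda>ls. \<Phi> ls * c) = seq_avg n d \<Phi> * c"
  using seq_avg_linear[of n d \<Phi> c "\<lambda>_. 0"] by (simp add: seq_avg_const)

lemma seq_avg_sum: "n > 0 \<Longrightarrow> seq_avg n d (\<lambda>ls. \<Sum>k\<in>K. \<Phi> k ls) = (\<Sum>k\<in>K. seq_avg n d (\<Phi> k))"
proof (induction K rule: infinite_finite_induct)
  case (insert k K)
  then show ?case using seq_avg_linear[of n d "\<Phi> k" 1 "\<lambda>ls. \<Sum>k\<in>K. \<Phi> k ls"] by simp
qed (simp_all add: seq_avg_const)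

lemma seq_avg_append:
  "seq_avg n (a + b) \<Phi> = seq_avg n a (\<lambda>xs. seq_avg n b (\<lambda>ys. \<Phi> (xs @ ys)))"
  by (induction a arbitrary: \<Phi>) auto

text \<open>In \<open>seq_dual\<close> the head letter acts last. With its average moved inside, one
  step of the walk can be split off.\<close>

lemma seq_avg_letter_avg:
  "n > 0 \<Longrightarrow> letter_avg n (\<lambda>l. seq_avg n d (\<Phi> l)) = seq_avg n d (\<lambda>ls. letter_avg n (\<lambda>l. \<Phi> l ls))"
  using seq_avg_mult_right[of n d "\<lambda>ls. \<Sum>l\<in>letters n. \<Phi> l ls" "1 / real (card (letters n))"]
  by (simp add: letter_avg_def seq_avg_sum)

lemma letter_avg_eq:
  "letter_avg n \<Phi> = (\<Sum>i<n. (\<Sum>f\<in>perms3. \<Phi> (i, False, f)) + (\<Sum>f\<in>perms3. \<Phi> (i, True, f))) / (12 * real n)"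
proof -
  have "(\<Sum>l\<in>letters n. \<Phi> l) = (\<Sum>i<n. \<Sum>b\<in>UNIV. \<Sum>f\<in>perms3. \<Phi> (i, b, f))"
    unfolding letters_def by (simp only: sum.cartesian_product case_prod_unfold prod.collapse)
  then show ?thesis by (simp add: letter_avg_def card_letters UNIV_bool add_ac)
qed

context
  fixes n :: nat
  assumes n: "n \<ge> 2"
begin

lemma letter_avg_walk_op: "letter_avg n (\<lambda>l. h (letter_dual n l a)) = walk_op n h a"
proof -
  have "(\<Sum>f\<in>perms3. h (letter_dual n (i, True, f) a)) = 6 * heat i ((i + 1) mod n) h a" if "i < n" for i
    using sum_perms3_heat[OF cyclic_succ(2)[OF n that], of h a] by (simp add: letter_dual_def)
  moreover have "(\<Sum>f\<in>perms3. h (letter_dual n (i, False, f) a)) = 6 * h a" for i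
    by (simp add: letter_dual_def card_perms3)
  ultimately have "letter_avg n (\<lambda>l. h (letter_dual n l a)) = (\<Sum>i<n. 6 * h a + 6 * heat i ((i + 1) mod n) h a) / (12 * real n)"
    by (simp add: letter_avg_eq)
  also have "\<dots> = walk_op n h a"
    using n by (simp add: walk_op_def sum.distrib sum_distrib_left[symmetric] field_simps)
  finally show ?thesis .
qed

lemma seq_avg_walk_op: "seq_avg n d (\<lambda>ls. h (seq_dual n ls a)) = (walk_op n ^^ d) h a"
proof (induction d arbitrary: h)
  case (Suc d)
  have "seq_avg n (Suc d) (\<lambda>ls. h (seq_dual n ls a)) = seq_avg n d (\<lambda>ls. letter_avg n (\<lambda>l. h (letter_dual n l (seq_dual n ls a))))"
    using n by (simp add: seq_avg_letter_avg)
  also have "\<dots> = seq_avg n d (\<lambda>ls. walk_op n h (seq_dual n ls a))"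
    by (simp only: letter_avg_walk_op)
  also have "\<dots> = (walk_op n ^^ d) (walk_op n h) a" by (rule Suc)
  finally show ?case by (simp add: funpow_swap1)
qed simp

text \<open>The mixing time of the walk, plus one letter that can write the mixed vector down as a
  character.\<close>

definition block :: nat where "block = 96 * n ^ 4 + 1"

text \<open>The last letter is a phase with probability 1/2, and the letters before it carry its
  unit vector into \<open>A\<close> with probability at least
  \<open>card A / 2 ^ (n + 1)\<close>.\<close>

lemma block_hits:
  assumes A: "A \<subseteq> Pow {..<n} - {{}}"
  shows "real (card A) / 2 ^ (n + 2) \<le> seq_avg n block (\<lambda>ls. of_bool (phase_set n ls \<inter> A \<noteq> {}))"
proof -
  let ?k = "96 * n ^ 4"
  have "real (card A) / 2 ^ (n + 2) = (\<Sum>i<n. 6 * (real (card A) / 2 ^ (n + 1))) / (12 * real n)"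
    using n by simp
  also have "\<dots> \<le> (\<Sum>i<n. 6 * (walk_op n ^^ ?k) (indicator A) {i}) / (12 * real n)"
    using walk_mixing[OF n A] by (intro divide_right_mono sum_mono mult_left_mono) auto
  also have "\<dots> = (\<Sum>i<n. 6 * seq_avg n ?k (\<lambda>ls. indicator A (seq_dual n ls {i}))) / (12 * real n)"
    by (simp only: seq_avg_walk_op)
  also have "\<dots> = seq_avg n ?k (\<lambda>xs. (\<Sum>i<n. 6 * indicator A (seq_dual n xs {i})) / (12 * real n))"
    using n seq_avg_mult_right[of n ?k "\<lambda>xs. (\<Sum>i<n. indicator A (seq_dual n xs {i}))" "6 / (12 * real n)"]
    by (simp add: seq_avg_sum sum_distrib_left[symmetric])
  also have "\<dots> = seq_avg n ?k (\<lambda>xs. letter_avg n (\<lambda>l. of_bool (\<not> fst (snd l)) * indicator A (seq_dual n xs {fst l})))"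
    by (simp add: letter_avg_eq card_perms3)
  also have "\<dots> \<le> seq_avg n ?k (\<lambda>xs. letter_avg n (\<lambda>l. of_bool (phase_set n (xs @ [l]) \<inter> A \<noteq> {})))"
    by (intro seq_avg_mono letter_avg_mono) (auto simp: phase_set_append indicator_def)
  also have "\<dots> = seq_avg n block (\<lambda>ls. of_bool (phase_set n ls \<inter> A \<noteq> {}))"
    by (simp add: block_def seq_avg_append del: of_bool_eq add_Suc_right flip: One_nat_def) simp
  finally show ?thesis .
qed

lemma block_misses:
  assumes A: "A \<subseteq> Pow {..<n} - {{}}"
  shows "seq_avg n block (\<lambda>ls. of_bool (phase_set n ls \<inter> A = {})) \<le> 1 - real (card A) / 2 ^ (n + 2)"
proof -
  have "seq_avg n block (\<lambda>ls. of_bool (phase_set n ls \<inter> A \<noteq> {}) * (-1) + 1)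
      = - seq_avg n block (\<lambda>ls. of_bool (phase_set n ls \<inter> A \<noteq> {})) + 1"
    using n seq_avg_linear[of n block "\<lambda>ls. of_bool (phase_set n ls \<inter> A \<noteq> {})" "-1" "\<lambda>_. 1"]
    by (simp add: seq_avg_const)
  moreover have "(\<lambda>ls. of_bool (phase_set n ls \<inter> A = {})) = (\<lambda>ls. of_bool (phase_set n ls \<inter> A \<noteq> {}) * (-1) + (1::real))"
    by (auto simp: fun_eq_iff)
  ultimately show ?thesis using block_hits[OF A] by simp
qed

end

text \<open>In the product of the phases at all \<open>x j\<close> and the conjugate phases at all
  \<open>y j\<close>, an angle with character \<open>a\<close> has the difference of the two sums as
  its frequency. If one of these differences is nonzero, the product has mean zero.\<close>

definition balanced :: "nat set set \<Rightarrow> 'j set \<Rightarrow> ('j \<Rightarrow> nat set) \<Rightarrow> ('j \<Rightarrow> nat set) \<Rightarrow> bool" where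
  "balanced S T x y \<longleftrightarrow> (\<forall>a\<in>S. (\<Sum>j\<in>T. chr a (x j)) = (\<Sum>j\<in>T. chr a (y j)))"

section \<open>Survival of balanced tuples and the number of distinct characters\<close>

context
  fixes n :: nat
  assumes n: "n \<ge> 2"
begin

text \<open>A character pulled back through \<open>xs\<close> takes at a point the value that the
  character itself takes at the moved point, so the later letters face the same question for the
  moved tuples.\<close>

lemma balanced_append:
  assumes "set xs \<subseteq> letters n" "set ys \<subseteq> letters n"
  shows "balanced (phase_set n (xs @ ys)) T x y \<longleftrightarrow> balanced (phase_set n xs) T x y \<and>
    balanced (phase_set n ys) T (\<lambda>j. seq_map n xs (x j)) (\<lambda>j. seq_map n xs (y j))"
proof -
  have "chr (seq_dual n xs a) z = chr a (seq_map n xs z)" if "a \<in> phase_set n ys" for a z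
    using chr_seq_dual[OF n assms(1)] phase_set_mem[OF n assms(2)] that by (metis subsetD)
  then show ?thesis by (simp add: balanced_def phase_set_append ball_Un)
qed

text \<open>By the uncertainty principle at least \<open>2 ^ n / (2 * t)\<close> characters tell the
  tuples apart, and a block contains one of them with probability at least a quarter of their
  proportion in the cube.\<close>

lemma balanced_block:
  assumes T: "finite T" "card T = t" and x: "x ` T \<subseteq> Pow {..<n}" "y ` T \<subseteq> Pow {..<n}"
    and ne: "card {j\<in>T. x j = z} \<noteq> card {j\<in>T. y j = z}"
  shows "seq_avg n (block n) (\<lambda>ls. of_bool (balanced (phase_set n ls) T x y)) \<le> 1 - 1 / (8 * real t)"
proof -
  define A where "A = {a\<in>Pow {..<n}. (\<Sum>j\<in>T. chr a (x j)) \<noteq> (\<Sum>j\<in>T. chr a (y j))}"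
  have A: "A \<subseteq> Pow {..<n} - {{}}" by (auto simp: A_def)
  have t: "t > 0"
  proof (rule ccontr)
    assume "\<not> t > 0"
    then have "T = {}" using T by simp
    then show False using ne by simp
  qed
  have z: "z \<in> Pow {..<n}"
  proof (rule ccontr)
    assume "z \<notin> Pow {..<n}"
    then have "{j\<in>T. x j = z} = {}" "{j\<in>T. y j = z} = {}" using x by auto
    then show False using ne by (simp only:)
  qed
  have "2 ^ n \<le> real (card A) * (2 * real t)"
    using uncertainty[OF _ T(1) x z ne] T(2) by (simp add: A_def)
  then have "1 / (8 * real t) \<le> real (card A) / 2 ^ (n + 2)"
    using t by (simp add: field_simps)
  then have "1 - real (card A) / 2 ^ (n + 2) \<le> 1 - 1 / (8 * real t)" by simp
  moreover have "balanced (phase_set n ls) T x y \<longleftrightarrow> phase_set n ls \<inter> A = {}" if "set ls \<subseteq> letters n" for ls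
    using phase_set_mem[OF n that] by (auto simp: balanced_def A_def)
  then have "seq_avg n (block n) (\<lambda>ls. of_bool (balanced (phase_set n ls) T x y))
      = seq_avg n (block n) (\<lambda>ls. of_bool (phase_set n ls \<inter> A = {}))"
    by (intro seq_avg_cong) simp
  ultimately show ?thesis using block_misses[OF n A] by linarith
qed

text \<open>A word acts injectively on points, so the moved tuples again have different
  multiplicities at the moved \<open>z\<close>, and the estimate for one block applies anew after
  each block.\<close>

lemma balanced_survival:
  assumes T: "finite T" "card T = t" and x: "x ` T \<subseteq> Pow {..<n}" "y ` T \<subseteq> Pow {..<n}"
    and ne: "card {j\<in>T. x j = z} \<noteq> card {j\<in>T. y j = z}"
  shows "seq_avg n (block n * q + r) (\<lambda>ls. of_bool (balanced (phase_set n ls) T x y)) \<le> (1 - 1 / (8 * real t)) ^ q"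
  using x ne
proof (induction q arbitrary: x y z)
  case 0
  have "seq_avg n r (\<lambda>ls. of_bool (balanced (phase_set n ls) T x y)) \<le> seq_avg n r (\<lambda>ls. 1)"
    by (intro seq_avg_mono) auto
  then show ?case using n by (simp add: seq_avg_const)
next
  case (Suc q)
  let ?p = "1 - 1 / (8 * real t)" and ?m = "block n * q + r"
  have p: "0 \<le> ?p" by (cases "t = 0") simp_all
  have "seq_avg n (block n + ?m) (\<lambda>ls. of_bool (balanced (phase_set n ls) T x y))
    = seq_avg n (block n) (\<lambda>xs. seq_avg n ?m (\<lambda>ys. of_bool (balanced (phase_set n (xs @ ys)) T x y)))"
    by (rule seq_avg_append)
  also have "\<dots> \<le> seq_avg n (block n) (\<lambda>xs. of_bool (balanced (phase_set n xs) T x y) * ?p ^ q)"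
  proof (intro seq_avg_mono)
    fix xs assume xs: "set xs \<subseteq> letters n"
    let ?x = "\<lambda>j. seq_map n xs (x j)" and ?y = "\<lambda>j. seq_map n xs (y j)"
    have "seq_avg n ?m (\<lambda>ys. of_bool (balanced (phase_set n (xs @ ys)) T x y))
      = seq_avg n ?m (\<lambda>ys. of_bool (balanced (phase_set n ys) T ?x ?y) * of_bool (balanced (phase_set n xs) T x y))"
      using xs by (intro seq_avg_cong) (auto simp: balanced_append)
    also have "\<dots> = seq_avg n ?m (\<lambda>ys. of_bool (balanced (phase_set n ys) T ?x ?y)) * of_bool (balanced (phase_set n xs) T x y)"
      using n by (intro seq_avg_mult_right) simp
    also have "\<dots> \<le> ?p ^ q * of_bool (balanced (phase_set n xs) T x y)"
    proof (intro mult_right_mono Suc.IH)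
      show "?x ` T \<subseteq> Pow {..<n}" "?y ` T \<subseteq> Pow {..<n}"
        using seq_map_mem[OF n xs] Suc.prems by blast+
      show "card {j \<in> T. ?x j = seq_map n xs z} \<noteq> card {j \<in> T. ?y j = seq_map n xs z}"
        using Suc.prems(3) by (simp add: seq_map_inj[OF n xs])
    qed simp
    finally show "seq_avg n ?m (\<lambda>ys. of_bool (balanced (phase_set n (xs @ ys)) T x y))
        \<le> of_bool (balanced (phase_set n xs) T x y) * ?p ^ q" by (simp add: mult.commute)
  qed
  also have "\<dots> = seq_avg n (block n) (\<lambda>xs. of_bool (balanced (phase_set n xs) T x y)) * ?p ^ q"
    using n by (intro seq_avg_mult_right) simp
  also have "\<dots> \<le> ?p * ?p ^ q"
    using balanced_block[OF T Suc.prems] p by (intro mult_right_mono) auto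
  finally show ?case by (simp add: add_ac mult_ac)
qed

text \<open>After \<open>m\<close> letters at most \<open>m\<close> characters have occurred. So at
  least \<open>2 ^ (n - 1)\<close> nonzero vectors pull back to new ones, and the next block adds a
  new character with probability at least 1/8.\<close>

lemma phase_count_block:
  assumes \<rho>: "0 \<le> \<rho>" "\<rho> \<le> 1" and m: "real m \<le> 2 ^ (n - 1) - 1"
  shows "seq_avg n (m + block n) (\<lambda>ls. \<rho> ^ card (phase_set n ls))
    \<le> seq_avg n m (\<lambda>ls. \<rho> ^ card (phase_set n ls)) * (1 - (1 - \<rho>) / 8)"
proof -
  have "seq_avg n (m + block n) (\<lambda>ls. \<rho> ^ card (phase_set n ls))
      = seq_avg n m (\<lambda>xs. seq_avg n (block n) (\<lambda>ys. \<rho> ^ card (phase_set n (xs @ ys))))"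
    by (rule seq_avg_append)
  also have "\<dots> \<le> seq_avg n m (\<lambda>xs. \<rho> ^ card (phase_set n xs) * (1 - (1 - \<rho>) / 8))"
  proof (rule seq_avg_mono)
    fix xs assume xs: "set xs \<subseteq> letters n" and len: "length xs = m"
    let ?S = "phase_set n xs"
    \<comment> \<open>The vectors whose pullback through the letters so far is an unseen character.
      Its complement in the nonzero vectors injects into the characters already seen.\<close>
    define A where "A = {a\<in>Pow {..<n} - {{}}. seq_dual n xs a \<notin> ?S}"
    have A: "A \<subseteq> Pow {..<n} - {{}}" by (auto simp: A_def)
    have fS: "finite ?S" and cS: "card ?S \<le> m" using card_phase_set[of n xs] len by auto
    have "card ((Pow {..<n} - {{}}) - A) \<le> card ?S"
    proof (rule card_inj_on_le[where f = "seq_dual n xs"])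
      show "inj_on (seq_dual n xs) ((Pow {..<n} - {{}}) - A)"
        using seq_dual_inj[OF n xs] by (auto intro!: inj_onI)
      show "seq_dual n xs ` ((Pow {..<n} - {{}}) - A) \<subseteq> ?S" by (auto simp: A_def)
    qed (rule fS)
    moreover have "card ((Pow {..<n} - {{}}) - A) = card (Pow {..<n} - {{}}) - card A"
      using A by (intro card_Diff_subset) (auto intro: finite_subset)
    moreover have "card (Pow {..<n} - {{}}) = 2 ^ n - 1" by (simp add: card_Pow card_Diff_subset)
    ultimately have "2 ^ n - 1 \<le> card A + m" using cS by linarith
    then have "real (2 ^ n - 1) \<le> real (card A + m)" by (simp only: of_nat_le_iff)
    then have "2 ^ n \<le> real (card A) + real m + 1" by (simp add: of_nat_diff)
    moreover have "(2::real) ^ n = 2 * 2 ^ (n - 1)" using n by (cases n) auto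
    ultimately have "2 ^ n / 2 \<le> real (card A)" using m by linarith
    then have hit: "1 / 8 \<le> real (card A) / 2 ^ (n + 2)" by (simp add: field_simps)
    have "seq_avg n (block n) (\<lambda>ys. \<rho> ^ card (phase_set n (xs @ ys)))
      \<le> seq_avg n (block n) (\<lambda>ys. of_bool (phase_set n ys \<inter> A \<noteq> {}) * (\<rho> ^ card ?S * (\<rho> - 1)) + \<rho> ^ card ?S)"
    proof (rule seq_avg_mono)
      fix ys assume ys: "set ys \<subseteq> letters n"
      have fin: "finite (phase_set n (xs @ ys))" using card_phase_set by blast
      have sub: "?S \<subseteq> phase_set n (xs @ ys)" by (auto simp: phase_set_append)
      show "\<rho> ^ card (phase_set n (xs @ ys))
          \<le> of_bool (phase_set n ys \<inter> A \<noteq> {}) * (\<rho> ^ card ?S * (\<rho> - 1)) + \<rho> ^ card ?S"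
      proof (cases "phase_set n ys \<inter> A = {}")
        case True
        then show ?thesis using \<rho> card_mono[OF fin sub] by (simp add: power_decreasing)
      next
        case False
        then have "?S \<subset> phase_set n (xs @ ys)"
          by (auto simp: phase_set_append A_def)
        then have "Suc (card ?S) \<le> card (phase_set n (xs @ ys))"
          using psubset_card_mono[OF fin] by (simp add: Suc_le_eq)
        then have "\<rho> ^ card (phase_set n (xs @ ys)) \<le> \<rho> ^ Suc (card ?S)"
          using \<rho> by (intro power_decreasing) auto
        then show ?thesis using False by (simp add: algebra_simps)
      qed
    qed
    also have "\<dots> = seq_avg n (block n) (\<lambda>ys. of_bool (phase_set n ys \<inter> A \<noteq> {})) * (\<rho> ^ card ?S * (\<rho> - 1)) + \<rho> ^ card ?S"
      using n by (subst seq_avg_linear) (simp add: seq_avg_const)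
    also have "\<dots> \<le> 1 / 8 * (\<rho> ^ card ?S * (\<rho> - 1)) + \<rho> ^ card ?S"
      using order_trans[OF hit block_hits[OF n A]] \<rho>
      by (intro add_right_mono mult_right_mono_neg mult_nonneg_nonpos) auto
    finally show "seq_avg n (block n) (\<lambda>ys. \<rho> ^ card (phase_set n (xs @ ys)))
        \<le> \<rho> ^ card ?S * (1 - (1 - \<rho>) / 8)" by (simp add: field_simps)
  qed
  also have "\<dots> = seq_avg n m (\<lambda>xs. \<rho> ^ card (phase_set n xs)) * (1 - (1 - \<rho>) / 8)"
    using n by (intro seq_avg_mult_right) simp
  finally show ?thesis .
qed

lemma phase_count_blocks:
  assumes \<rho>: "0 \<le> \<rho>" "\<rho> \<le> 1" and d: "real (r + block n * q) \<le> 2 ^ (n - 1)"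
  shows "seq_avg n (r + block n * q) (\<lambda>ls. \<rho> ^ card (phase_set n ls)) \<le> (1 - (1 - \<rho>) / 8) ^ q"
  using d
proof (induction q)
  case 0
  have "seq_avg n r (\<lambda>ls. \<rho> ^ card (phase_set n ls)) \<le> seq_avg n r (\<lambda>ls. 1)"
    using \<rho> by (intro seq_avg_mono) (simp add: power_le_one)
  then show ?case using n by (simp add: seq_avg_const)
next
  case (Suc q)
  have b: "block n \<ge> 1" by (simp add: block_def[OF n])
  then have "real (r + block n * q) + 1 \<le> real (r + block n * Suc q)" by simp
  then have "real (r + block n * q) \<le> 2 ^ (n - 1) - 1" using Suc.prems by linarith
  then have "seq_avg n (r + block n * q + block n) (\<lambda>ls. \<rho> ^ card (phase_set n ls))
    \<le> seq_avg n (r + block n * q) (\<lambda>ls. \<rho> ^ card (phase_set n ls)) * (1 - (1 - \<rho>) / 8)"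
    using \<rho> by (intro phase_count_block) auto
  also have "\<dots> \<le> (1 - (1 - \<rho>) / 8) ^ q * (1 - (1 - \<rho>) / 8)"
    using Suc b \<rho> by (intro mult_right_mono) auto
  finally show ?case by (simp add: add_ac mult.commute)
qed

text \<open>For words shorter than a block: the first letter is already a phase with probability
  1/2.\<close>

lemma phase_count_first:
  assumes \<rho>: "0 \<le> \<rho>" "\<rho> \<le> 1" and d: "d \<ge> 1"
  shows "seq_avg n d (\<lambda>ls. \<rho> ^ card (phase_set n ls)) \<le> 1 - (1 - \<rho>) / 8"
proof -
  obtain d' where d': "d = Suc d'" using d by (cases d) auto
  have "seq_avg n d (\<lambda>ls. \<rho> ^ card (phase_set n ls)) \<le> letter_avg n (\<lambda>l. if fst (snd l) then 1 else \<rho>)"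
    unfolding d' seq_avg.simps
  proof (rule letter_avg_mono)
    fix l assume "l \<in> letters n"
    have "seq_avg n d' (\<lambda>ls. \<rho> ^ card (phase_set n (l # ls))) \<le> seq_avg n d' (\<lambda>ls. if fst (snd l) then 1 else \<rho>)"
    proof (rule seq_avg_mono)
      fix ls
      show "\<rho> ^ card (phase_set n (l # ls)) \<le> (if fst (snd l) then 1 else \<rho>)"
      proof (cases "fst (snd l)")
        case True
        then show ?thesis using \<rho> by (simp add: power_le_one)
      next
        case False
        then have "{fst l} \<in> phase_set n (l # ls)" by simp
        then have "1 \<le> card (phase_set n (l # ls))"
          using card_phase_set[of n "l # ls"] by (metis One_nat_def Suc_leI card_gt_0_iff empty_iff)
        then show ?thesis using \<rho> False power_decreasing[of 1 _ \<rho>] by simp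
      qed
    qed
    then show "seq_avg n d' (\<lambda>ls. \<rho> ^ card (phase_set n (l # ls))) \<le> (if fst (snd l) then 1 else \<rho>)"
      using n by (simp add: seq_avg_const)
  qed
  also have "\<dots> = (1 + \<rho>) / 2"
    using n by (simp add: letter_avg_eq card_perms3 field_simps)
  also have "\<dots> \<le> 1 - (1 - \<rho>) / 8" using \<rho> by (simp add: field_simps)
  finally show ?thesis .
qed

lemma phase_count:
  assumes \<rho>: "0 \<le> \<rho>" "\<rho> \<le> 1" and d: "d \<ge> 1" "real d \<le> 2 ^ (n - 1)"
  shows "seq_avg n d (\<lambda>ls. \<rho> ^ card (phase_set n ls)) \<le> exp (- ((1 - \<rho>) * real d / (16 * real (block n))))"
proof -
  \<comment> \<open>Counting at least one block gives \<open>d \<le> 2 * block n * q\<close> for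
    short words too.\<close>
  define q where "q = max 1 (d div block n)"
  define p where "p = 1 - (1 - \<rho>) / 8"
  define c where "c = (1 - \<rho>) / 8"
  have c: "0 \<le> c" "c \<le> 1" using \<rho> by (simp_all add: c_def)
  have b: "block n \<ge> 1" by (simp add: block_def[OF n])
  have "seq_avg n d (\<lambda>ls. \<rho> ^ card (phase_set n ls)) \<le> p ^ q"
  proof (cases "d div block n \<ge> 1")
    case True
    then show ?thesis
      using phase_count_blocks[OF \<rho>, of "d mod block n" "d div block n"] d by (simp add: q_def p_def)
  next
    case False
    then show ?thesis using phase_count_first[OF \<rho> d(1)] by (simp add: q_def p_def)
  qed
  also have "p ^ q \<le> exp (- c) ^ q"
    using exp_ge_add_one_self[of "- c"] c by (intro power_mono) (simp_all add: p_def c_def)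
  also have "\<dots> = exp (- (c * real q))"
    by (simp add: exp_of_nat_mult[symmetric] mult.commute)
  also have "\<dots> \<le> exp (- (c * (real d / (2 * real (block n)))))"
  proof -
    have "d \<le> 2 * block n * q"
    proof -
      have "d = block n * (d div block n) + d mod block n" by simp
      moreover have "d mod block n < block n" using b by simp
      moreover have "block n * (d div block n) \<le> block n * q" "block n * 1 \<le> block n * q"
        by (auto simp: q_def intro!: mult_le_mono2)
      ultimately show ?thesis by linarith
    qed
    then have "real d \<le> real (2 * block n * q)" by (simp only: of_nat_le_iff)
    then have "real d / (2 * real (block n)) \<le> real q" using b by (simp add: field_simps)
    then show ?thesis using c by (intro iffD2[OF exp_le_cancel_iff] le_imp_neg_le mult_left_mono) auto
  qed
  also have "- (c * (real d / (2 * real (block n)))) = - ((1 - \<rho>) * real d / (16 * real (block n)))"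
    by (simp add: c_def)
  finally show ?thesis .
qed

end

section \<open>Amplitudes indexed by sets of qubits\<close>

definition ones :: "nat \<Rightarrow> nat \<Rightarrow> nat set" where
  "ones n k = {q. q < n \<and> qubit n q k = 1}"

definition basis_index :: "nat \<Rightarrow> nat set \<Rightarrow> nat" where
  "basis_index n = the_inv_into {..<2 ^ n} (ones n)"

definition amp :: "nat \<Rightarrow> complex vec \<Rightarrow> nat set \<Rightarrow> complex" where
  "amp n u x = u $ basis_index n x"

lemma qubit_cases: "qubit n q k = 0 \<or> qubit n q k = 1"
  by (auto simp: qubit_def)

lemma qubit_less: "qubit n q k < 2"
  by (simp add: qubit_def)

lemma qubit_eq: "q < n \<Longrightarrow> qubit n q k = of_bool (q \<in> ones n k)"
  using qubit_cases[of n q k] by (auto simp: ones_def)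

lemma ones_bij: "bij_betw (ones n) {..<2 ^ n} (Pow {..<n})"
proof -
  have inj: "inj_on (ones n) {..<2 ^ n}"
  proof (rule inj_onI)
    fix k l :: nat assume k: "k \<in> {..<2 ^ n}" and l: "l \<in> {..<2 ^ n}" and eq: "ones n k = ones n l"
    show "k = l"
    proof (rule bit_eqI)
      fix m
      show "bit k m = bit l m"
      proof (cases "m < n")
        case True
        then have "qubit n (n - 1 - m) k = qubit n (n - 1 - m) l"
          by (simp add: qubit_eq eq)
        then show ?thesis
          using True by (simp add: qubit_def bit_iff_odd odd_iff_mod_2_eq_one)
      next
        case False
        have "(2::nat) ^ n \<le> 2 ^ m" using False by (intro power_increasing) auto
        then have "k < 2 ^ m" "l < 2 ^ m" using k l order_less_le_trans by blast+
        then show ?thesis by (simp add: bit_iff_odd)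
      qed
    qed
  qed
  moreover have "ones n ` {..<2 ^ n} = Pow {..<n}"
  proof (rule card_subset_eq)
    show "ones n ` {..<2 ^ n} \<subseteq> Pow {..<n}" by (auto simp: ones_def)
    show "card (ones n ` {..<2 ^ n}) = card (Pow {..<n})"
      using card_image[OF inj] by (simp add: card_Pow)
  qed simp
  ultimately show ?thesis by (simp add: bij_betw_def)
qed

lemma ones_mem: "ones n k \<in> Pow {..<n}"
  by (auto simp: ones_def)

lemma basis_index_ones [simp]: "k < 2 ^ n \<Longrightarrow> basis_index n (ones n k) = k"
  using ones_bij[of n] by (simp add: basis_index_def the_inv_into_f_f bij_betw_def)

lemma ones_basis_index [simp]: "x \<subseteq> {..<n} \<Longrightarrow> ones n (basis_index n x) = x"
  using ones_bij[of n] by (simp add: basis_index_def f_the_inv_into_f_bij_betw)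

lemma basis_index_less: "x \<subseteq> {..<n} \<Longrightarrow> basis_index n x < 2 ^ n"
  using bij_betw_the_inv_into[OF ones_bij[of n]] unfolding basis_index_def bij_betw_def by blast

lemma nth_eq_amp: "k < 2 ^ n \<Longrightarrow> u $ k = amp n u (ones n k)"
  by (simp add: amp_def)

lemma sum_basis: "(\<Sum>k<2 ^ n. F (u $ k) k) = (\<Sum>x\<in>Pow {..<n}. F (amp n u x) (basis_index n x))"
  using sum.reindex_bij_betw[OF ones_bij, of "\<lambda>x. F (amp n u x) (basis_index n x)" n]
  by (simp add: amp_def)

lemma apply_gate_carrier [simp]: "apply_gate n i j g \<in> carrier_mat (2 ^ n) (2 ^ n)"
  by (simp add: apply_gate_def)

text \<open>In row \<open>x\<close> the only columns that can be nonzero are the four that agree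
  with \<open>x\<close> off the pair.\<close>

lemma amp_apply_gate:
  assumes ij: "i < n" "j < n" "i \<noteq> j" and u: "u \<in> carrier_vec (2 ^ n)" and x: "x \<subseteq> {..<n}"
  shows "amp n (apply_gate n i j g *\<^sub>v u) x = (\<Sum>v<4. g $$ (pair_val i j x, v) * amp n u (set_pair i j v x))"
proof -
  define k where "k = basis_index n x"
  have k: "k < 2 ^ n" and kx: "ones n k = x" using x by (simp_all add: k_def basis_index_less)
  have ent: "apply_gate n i j g $$ (k, l) =
      (if ones n l - {i, j} = x - {i, j} then g $$ (pair_val i j x, pair_val i j (ones n l)) else 0)"
    if l: "l < 2 ^ n" for l
  proof -
    have "(\<forall>q<n. q \<noteq> i \<and> q \<noteq> j \<longrightarrow> qubit n q k = qubit n q l) \<longleftrightarrow> ones n l - {i, j} = x - {i, j}"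
    proof
      assume *: "\<forall>q<n. q \<noteq> i \<and> q \<noteq> j \<longrightarrow> qubit n q k = qubit n q l"
      show "ones n l - {i, j} = x - {i, j}"
        unfolding kx[symmetric] using * by (auto simp: ones_def)
    next
      assume *: "ones n l - {i, j} = x - {i, j}"
      then have "q \<in> ones n l \<longleftrightarrow> q \<in> x" if "q \<noteq> i" "q \<noteq> j" for q using that by blast
      then show "\<forall>q<n. q \<noteq> i \<and> q \<noteq> j \<longrightarrow> qubit n q k = qubit n q l"
        by (simp add: qubit_eq kx)
    qed
    then show ?thesis
      using k l ij by (simp add: apply_gate_def qubit_eq kx pair_val_def)
  qed
  have "amp n (apply_gate n i j g *\<^sub>v u) x = (\<Sum>l<2 ^ n. apply_gate n i j g $$ (k, l) * u $ l)"
    using k u unfolding amp_def k_def[symmetric]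
    by (simp add: scalar_prod_def apply_gate_def atLeast0LessThan)
  also have "\<dots> = (\<Sum>l<2 ^ n. (if ones n l - {i, j} = x - {i, j} then g $$ (pair_val i j x, pair_val i j (ones n l)) else 0) * u $ l)"
    by (intro sum.cong refl) (simp add: ent)
  also have "\<dots> = (\<Sum>y\<in>Pow {..<n}. (if ones n (basis_index n y) - {i, j} = x - {i, j}
      then g $$ (pair_val i j x, pair_val i j (ones n (basis_index n y))) else 0) * amp n u y)"
    by (rule sum_basis)
  also have "\<dots> = (\<Sum>y\<in>Pow {..<n}. (if y - {i, j} = x - {i, j} then g $$ (pair_val i j x, pair_val i j y) else 0) * amp n u y)"
    by (intro sum.cong refl) simp
  also have "\<dots> = (\<Sum>y\<in>{y\<in>Pow {..<n}. y - {i, j} = x - {i, j}}. g $$ (pair_val i j x, pair_val i j y) * amp n u y)"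
    by (intro sum.mono_neutral_cong_right) auto
  also have "\<dots> = (\<Sum>v<4. g $$ (pair_val i j x, v) * amp n u (set_pair i j v x))"
  proof (rule sum.reindex_bij_witness[of _ "\<lambda>v. set_pair i j v x" "pair_val i j"])
    fix y assume y: "y \<in> {y\<in>Pow {..<n}. y - {i, j} = x - {i, j}}"
    show "set_pair i j (pair_val i j y) x = y"
      by (rule set_pair_eqI[of _ i j]) (use y ij in \<open>simp_all add: pair_val_less\<close>)
    then show "g $$ (pair_val i j x, pair_val i j y) * amp n u (set_pair i j (pair_val i j y) x)
        = g $$ (pair_val i j x, pair_val i j y) * amp n u y" by simp
    show "pair_val i j y \<in> {..<4}" by (simp add: pair_val_less)
  next
    fix v :: nat assume "v \<in> {..<4}"
    then show "pair_val i j (set_pair i j v x) = v" using ij by simp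
    show "set_pair i j v x \<in> {y\<in>Pow {..<n}. y - {i, j} = x - {i, j}}"
      using set_pair_subset[OF x, of i j v] ij by simp
  qed
  finally show ?thesis .
qed

section \<open>The structure of random circuits\<close>

text \<open>The one in row \<open>r\<close> stands in column \<open>f r\<close>, so the matrix
  composes amplitudes with \<open>f\<close> from the right. This is the direction of
  \<open>letter_map\<close>, and it reverses the order in products.\<close>

definition perm_gate :: "(nat \<Rightarrow> nat) \<Rightarrow> complex mat" where
  "perm_gate f = mat 4 4 (\<lambda>(r, c). if c = f r then 1 else 0)"

definition letter_mat :: "complex \<Rightarrow> nat \<Rightarrow> letter \<Rightarrow> real \<Rightarrow> complex mat" where
  "letter_mat \<omega> n = (\<lambda>(i, b, f) \<phi>. apply_gate n i ((i + 1) mod n)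
     (if b then su_lift \<omega> (perm_gate f) else kron_mat (exp_iZ \<phi>) (1\<^sub>m 2)))"

definition letter_phase :: "complex \<Rightarrow> letter \<Rightarrow> real \<Rightarrow> nat set \<Rightarrow> complex" where
  "letter_phase \<omega> = (\<lambda>(i, b, f) \<phi> x. if b then (if det (perm_gate f) = -1 then \<omega> else 1)
     else exp (\<i> * of_real (\<phi> * chr {i} x)))"

definition circuit :: "complex \<Rightarrow> nat \<Rightarrow> letter list \<Rightarrow> (nat \<Rightarrow> real) \<Rightarrow> complex mat" where
  "circuit \<omega> n ls \<phi> = mat_prod_list (2 ^ n) (map (\<lambda>j. letter_mat \<omega> n (ls ! j) (\<phi> j)) [0..<length ls])"

definition seq_phase :: "complex \<Rightarrow> nat \<Rightarrow> letter list \<Rightarrow> (nat \<Rightarrow> real) \<Rightarrow> nat set \<Rightarrow> complex" where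
  "seq_phase \<omega> n ls \<phi> x = (\<Prod>j<length ls. letter_phase \<omega> (ls ! j) (\<phi> j) (seq_map n (take j ls) x))"

lemma mat_prod_list_carrier:
  "set As \<subseteq> carrier_mat N N \<Longrightarrow> mat_prod_list N As \<in> carrier_mat N N"
  by (induction As) (auto simp: mat_prod_list_def)

lemma mat_prod_list_Cons: "mat_prod_list N (A # As) = A * mat_prod_list N As"
  by (simp add: mat_prod_list_def)

lemma letter_mat_carrier [simp]: "letter_mat \<omega> n l \<phi> \<in> carrier_mat (2 ^ n) (2 ^ n)"
  by (cases l) (simp add: letter_mat_def)

lemma circuit_carrier [simp]: "circuit \<omega> n ls \<phi> \<in> carrier_mat (2 ^ n) (2 ^ n)"
  unfolding circuit_def by (intro mat_prod_list_carrier) auto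

lemma dim_circuit [simp]: "dim_row (circuit \<omega> n ls \<phi>) = 2 ^ n" "dim_col (circuit \<omega> n ls \<phi>) = 2 ^ n"
  using circuit_carrier[of \<omega> n ls \<phi>] unfolding carrier_mat_def by simp_all

lemma circuit_Nil: "circuit \<omega> n [] \<phi> = 1\<^sub>m (2 ^ n)"
  by (simp add: circuit_def mat_prod_list_def)

lemma circuit_Cons: "circuit \<omega> n (l # ls) \<phi> = letter_mat \<omega> n l (\<phi> 0) * circuit \<omega> n ls (\<lambda>j. \<phi> (Suc j))"
proof -
  have "map (\<lambda>j. letter_mat \<omega> n ((l # ls) ! j) (\<phi> j)) [0..<length (l # ls)]
      = letter_mat \<omega> n l (\<phi> 0) # map (\<lambda>j. letter_mat \<omega> n (ls ! j) (\<phi> (Suc j))) [0..<length ls]"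
    by (rule nth_equalityI) (auto simp: nth_Cons' nth_append less_Suc_eq_0_disj simp del: upt_Suc)
  then show ?thesis by (simp add: circuit_def mat_prod_list_Cons)
qed

lemma cmod_root:
  assumes "\<omega> ^ 4 = (-1 :: complex)"
  shows "cmod \<omega> = 1"
proof -
  have "cmod \<omega> ^ 4 = 1 ^ 4" using assms norm_power[of \<omega> 4] by simp
  then show ?thesis by (rule power_eq_imp_eq_base) auto
qed

lemma cmod_letter_phase: "\<omega> ^ 4 = -1 \<Longrightarrow> cmod (letter_phase \<omega> l \<phi> x) = 1"
  by (cases l) (simp add: letter_phase_def cmod_root)

lemma cmod_seq_phase: "\<omega> ^ 4 = -1 \<Longrightarrow> cmod (seq_phase \<omega> n ls \<phi> x) = 1"
  by (simp add: seq_phase_def prod_norm[symmetric] cmod_letter_phase)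

lemma sum_less_4: "(\<Sum>v<4. F v) = F 0 + F 1 + F 2 + F (3::nat)"
  by (simp add: numeral_eq_Suc add_ac)

lemma amp_letter_mat:
  assumes n: "n \<ge> 2" and l: "l \<in> letters n" and u: "u \<in> carrier_vec (2 ^ n)" and x: "x \<subseteq> {..<n}"
  shows "amp n (letter_mat \<omega> n l \<phi> *\<^sub>v u) x = letter_phase \<omega> l \<phi> x * amp n u (letter_map n l x)"
proof -
  obtain i b f where leq: "l = (i, b, f)" by (cases l)
  define j where "j = (i + 1) mod n"
  have f: "f \<in> perms3" and i: "i < n" using l by (auto simp: leq letters_def)
  then have ij: "j < n" "i \<noteq> j" using cyclic_succ[OF n] by (simp_all add: j_def)
  define p where "p = pair_val i j x"
  have p: "p < 4" by (simp add: p_def pair_val_less)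
  show ?thesis
  proof (cases b)
    case True
    define z where "z = (if det (perm_gate f) = -1 then \<omega> else 1)"
    have "su_lift \<omega> (perm_gate f) $$ (p, v) = (if v = f p then z else 0)" if "v < 4" for v
      using that p by (simp add: su_lift_def perm_gate_def z_def)
    then have "amp n (apply_gate n i j (su_lift \<omega> (perm_gate f)) *\<^sub>v u) x
        = (\<Sum>v<4. (if v = f p then z else 0) * amp n u (set_pair i j v x))"
      using i ij u x by (subst amp_apply_gate) (auto simp: p_def intro!: sum.cong)
    also have "\<dots> = (\<Sum>v<4. if v = f p then z * amp n u (set_pair i j v x) else 0)"
      by (intro sum.cong) auto
    also have "\<dots> = z * amp n u (set_pair i j (f p) x)"
      using perms3_bounds(2)[OF f p] by simp
    finally show ?thesis
      using True by (simp add: letter_mat_def letter_phase_def letter_map_def leq j_def p_def z_def)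
  next
    case False
    have kron: "kron_mat (exp_iZ \<phi>) (1\<^sub>m 2) $$ (p, v) = (if v = p then exp (\<i> * of_real (\<phi> * chr {i} x)) else 0)"
      if v: "v < 4" for v
    proof -
      have less: "p div 2 < 2" "v div 2 < 2" "v mod 2 < 2" "p mod 2 < 2"
        using p v by auto
      have bit: "p div 2 = of_bool (i \<in> x)" by (simp add: p_def pair_val_def)
      have "kron_mat (exp_iZ \<phi>) (1\<^sub>m 2) $$ (p, v) = exp_iZ \<phi> $$ (p div 2, v div 2) * 1\<^sub>m 2 $$ (p mod 2, v mod 2)"
        using p v by (simp add: kron_mat_def exp_iZ_def mat_diag_def)
      also have "1\<^sub>m 2 $$ (p mod 2, v mod 2) = (if p mod 2 = v mod 2 then 1 else (0::complex))"
        using less by (subst index_one_mat) auto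
      also have "exp_iZ \<phi> $$ (p div 2, v div 2)
          = (if p div 2 = v div 2 then exp (\<i> * of_real \<phi> * ([1, -1] ! (p div 2))) else 0)"
        using less unfolding exp_iZ_def mat_diag_def by (subst index_mat) auto
      also have "exp (\<i> * of_real \<phi> * ([1, -1] ! (p div 2))) = exp (\<i> * of_real (\<phi> * chr {i} x))"
        unfolding bit by (cases "i \<in> x") (simp_all add: chr_singleton)
      finally have eq: "kron_mat (exp_iZ \<phi>) (1\<^sub>m 2) $$ (p, v)
          = (if p div 2 = v div 2 then exp (\<i> * of_real (\<phi> * chr {i} x)) else 0) * (if p mod 2 = v mod 2 then 1 else 0)" .
      show ?thesis
      proof (cases "v = p")
        case False
        then have "p div 2 \<noteq> v div 2 \<or> p mod 2 \<noteq> v mod 2" by (metis div_mult_mod_eq)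
        then show ?thesis unfolding eq using False by auto
      next
        case True
        then show ?thesis unfolding eq by simp
      qed
    qed
    have "amp n (apply_gate n i j (kron_mat (exp_iZ \<phi>) (1\<^sub>m 2)) *\<^sub>v u) x
        = (\<Sum>v<4. (if v = p then exp (\<i> * of_real (\<phi> * chr {i} x)) else 0) * amp n u (set_pair i j v x))"
      using i ij u x kron by (subst amp_apply_gate) (auto simp: p_def intro!: sum.cong)
    also have "\<dots> = (\<Sum>v<4. if v = p then exp (\<i> * of_real (\<phi> * chr {i} x)) * amp n u (set_pair i j v x) else 0)"
      by (intro sum.cong) auto
    also have "\<dots> = exp (\<i> * of_real (\<phi> * chr {i} x)) * amp n u x"
      using p by (simp add: p_def)
    finally show ?thesis
      using False by (simp add: letter_mat_def letter_phase_def letter_map_def leq j_def)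
  qed
qed

text \<open>Each letter is a monomial matrix, so the product reads a single input amplitude for each
  output and multiplies the phases met along the orbit of \<open>x\<close>.\<close>

lemma amp_circuit:
  assumes n: "n \<ge> 2" and "set ls \<subseteq> letters n" and u: "u \<in> carrier_vec (2 ^ n)" and "x \<subseteq> {..<n}"
  shows "amp n (circuit \<omega> n ls \<phi> *\<^sub>v u) x = seq_phase \<omega> n ls \<phi> x * amp n u (seq_map n ls x)"
  using assms(2,4)
proof (induction ls arbitrary: x \<phi>)
  case Nil
  then show ?case using u by (simp add: circuit_Nil seq_phase_def)
next
  case (Cons l ls)
  let ?C = "circuit \<omega> n ls (\<lambda>j. \<phi> (Suc j))"
  have "letter_map n l x \<subseteq> {..<n}" using letter_map_mem[OF n, of l x] Cons.prems by simp
  then have IH: "amp n (?C *\<^sub>v u) (letter_map n l x)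
      = seq_phase \<omega> n ls (\<lambda>j. \<phi> (Suc j)) (letter_map n l x) * amp n u (seq_map n (l # ls) x)"
    using Cons by simp
  have "circuit \<omega> n (l # ls) \<phi> *\<^sub>v u = letter_mat \<omega> n l (\<phi> 0) *\<^sub>v (?C *\<^sub>v u)"
    unfolding circuit_Cons by (rule assoc_mult_mat_vec[OF letter_mat_carrier circuit_carrier u])
  moreover have "?C *\<^sub>v u \<in> carrier_vec (2 ^ n)"
    using circuit_carrier u by (rule mult_mat_vec_carrier)
  ultimately have "amp n (circuit \<omega> n (l # ls) \<phi> *\<^sub>v u) x
      = letter_phase \<omega> l (\<phi> 0) x * amp n (?C *\<^sub>v u) (letter_map n l x)"
    using amp_letter_mat[OF n, of l "?C *\<^sub>v u" x] Cons.prems by simp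
  also have "\<dots> = seq_phase \<omega> n (l # ls) \<phi> x * amp n u (seq_map n (l # ls) x)"
    unfolding IH by (simp add: seq_phase_def prod.lessThan_Suc_shift del: prod.lessThan_Suc)
  finally show ?case .
qed

section \<open>The group of controlled-not gates\<close>

lemma perm_gate_carrier [simp]: "perm_gate f \<in> carrier_mat 4 4"
  by (simp add: perm_gate_def)

lemma perm_gate_mult:
  assumes "\<And>v. v < 4 \<Longrightarrow> f v < 4"
  shows "perm_gate f * perm_gate g = perm_gate (g \<circ> f)"
proof (rule eq_matI)
  fix r c assume rc: "r < dim_row (perm_gate (g \<circ> f))" "c < dim_col (perm_gate (g \<circ> f))"
  then have "(perm_gate f * perm_gate g) $$ (r, c)
      = (\<Sum>k<4. (if k = f r then 1 else 0) * (if c = g k then 1 else 0))"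
    by (simp add: perm_gate_def scalar_prod_def atLeast0LessThan)
  also have "\<dots> = (\<Sum>k<4. if k = f r then (if c = g k then 1 else 0) else 0)"
    by (intro sum.cong) auto
  also have "\<dots> = perm_gate (g \<circ> f) $$ (r, c)"
    using rc assms by (simp add: perm_gate_def)
  finally show "(perm_gate f * perm_gate g) $$ (r, c) = perm_gate (g \<circ> f) $$ (r, c)" .
qed (simp_all add: perm_gate_def)

lemma perm_gate_cong: "(\<And>v. v < 4 \<Longrightarrow> f v = g v) \<Longrightarrow> perm_gate f = perm_gate g"
  by (rule eq_matI) (auto simp: perm_gate_def)

lemma perm_gate_inj: "inj_on perm_gate perms3"
proof (rule inj_onI)
  fix f g assume f: "f \<in> perms3" and g: "g \<in> perms3" and eq: "perm_gate f = perm_gate g"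
  show "f = g"
  proof
    fix v
    show "f v = g v"
    proof (cases "v < 4")
      case True
      then have "perm_gate f $$ (v, f v) = 1" using perms3_bounds(2)[OF f] by (simp add: perm_gate_def)
      then show ?thesis using True perms3_bounds(2)[OF f] unfolding eq
        by (simp add: perm_gate_def split: if_splits)
    next
      case False
      then show ?thesis using f g by (simp add: perms3_def permutes_not_in)
    qed
  qed
qed

definition swap23 :: "nat \<Rightarrow> nat" where "swap23 v = (if v = 2 then 3 else if v = 3 then 2 else v)"
definition swap13 :: "nat \<Rightarrow> nat" where "swap13 v = (if v = 1 then 3 else if v = 3 then 1 else v)"

lemma swap_perms3: "swap23 \<in> perms3" "swap13 \<in> perms3"
proof -
  have "swap23 = Transposition.transpose 2 3" "swap13 = Transposition.transpose 1 3"
    by (auto simp: swap23_def swap13_def Transposition.transpose_def)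
  moreover have "Transposition.transpose 2 3 permutes {1, 2, 3 :: nat}" "Transposition.transpose 1 3 permutes {1, 2, 3 :: nat}"
    by (auto intro!: permutes_swap_id)
  ultimately show "swap23 \<in> perms3" "swap13 \<in> perms3"
    by (simp_all only: perms3_def mem_Collect_eq)
qed

lemma comp_perms3: "f \<in> perms3 \<Longrightarrow> g \<in> perms3 \<Longrightarrow> g \<circ> f \<in> perms3"
  by (simp add: perms3_def permutes_compose)

lemma cnot_perm_gate: "cnot12 = perm_gate swap23" "cnot21 = perm_gate swap13"
proof -
  have "r = 0 \<or> r = 1 \<or> r = 2 \<or> r = 3" if "r < 4" for r :: nat using that by linarith
  then show "cnot12 = perm_gate swap23" "cnot21 = perm_gate swap13"
    by (intro eq_matI; force simp: cnot12_def cnot21_def mat_of_rows_list_def perm_gate_def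
          swap23_def swap13_def numeral_eq_Suc less_Suc_eq)+
qed

text \<open>Both CNOT gates are transpositions of two of the three nonzero basis vectors, and two
  such transpositions generate all six permutations.\<close>

lemma cnot_group_eq: "cnot_group = perm_gate ` perms3"
proof
  let ?R = "ring_mat TYPE(complex) 4 ()"
  let ?G = "units_of ?R"
  interpret R: ring ?R by (rule ring_mat)
  interpret G: group ?G by (rule R.units_group)
  have one: "\<one>\<^bsub>?G\<^esub> = perm_gate id"
    by (simp add: units_of_def ring_mat_def) (rule eq_matI; auto simp: perm_gate_def)
  have mult: "x \<otimes>\<^bsub>?G\<^esub> y = x * y" for x y
    by (simp add: units_of_def ring_mat_def)
  have id3: "id \<in> perms3" by (simp add: perms3_def permutes_id)
  have mult_pg: "perm_gate f * perm_gate g = perm_gate (g \<circ> f)" if "f \<in> perms3" for f g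
    using perms3_bounds(2)[OF that] by (rule perm_gate_mult)
  \<comment> \<open>An involution is its own inverse in the group of units, so inverses of
    generators bring in nothing new.\<close>
  have self: "perm_gate h \<in> carrier ?G \<and> inv\<^bsub>?G\<^esub> (perm_gate h) = perm_gate h"
    if h: "h \<in> perms3" "h \<circ> h = id" for h
  proof -
    have hh: "perm_gate h * perm_gate h = 1\<^sub>m 4"
      using mult_pg[OF h(1), of h] one by (simp add: h(2) units_of_def ring_mat_def)
    then have "perm_gate h \<in> Units ?R"
      by (auto simp: Units_def ring_mat_simps intro!: bexI[of _ "perm_gate h"])
    then have c: "perm_gate h \<in> carrier ?G" by (simp add: units_of_carrier)
    moreover have "perm_gate h \<otimes>\<^bsub>?G\<^esub> perm_gate h = \<one>\<^bsub>?G\<^esub>"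
      using hh by (simp add: mult) (simp add: units_of_def ring_mat_def)
    ultimately show ?thesis using G.inv_equality by blast
  qed
  have invol: "swap23 \<circ> swap23 = id" "swap13 \<circ> swap13 = id"
    by (auto simp: swap23_def swap13_def)
  note self23 = self[OF swap_perms3(1) invol(1)] and self13 = self[OF swap_perms3(2) invol(2)]
  show "cnot_group \<subseteq> perm_gate ` perms3"
  proof
    fix x assume "x \<in> cnot_group"
    then have "x \<in> generate ?G {perm_gate swap23, perm_gate swap13}"
      by (simp add: cnot_group_def cnot_perm_gate)
    then show "x \<in> perm_gate ` perms3"
    proof (induction rule: generate.induct)
      case one
      show ?case using \<open>\<one>\<^bsub>?G\<^esub> = perm_gate id\<close> id3 by auto
    next
      case (incl h)
      then show ?case using swap_perms3 by auto
    next
      case (inv h)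
      then show ?case using self23 self13 swap_perms3 by auto
    next
      case (eng h1 h2)
      then obtain f g where "h1 = perm_gate f" "h2 = perm_gate g" "f \<in> perms3" "g \<in> perms3" by auto
      then show ?case using mult_pg comp_perms3 by (auto simp: mult)
    qed
  qed
  have gen: "perm_gate id \<in> cnot_group" "perm_gate swap23 \<in> cnot_group" "perm_gate swap13 \<in> cnot_group"
    unfolding cnot_group_def cnot_perm_gate one[symmetric]
    by (auto intro: generate.one generate.incl)
  have closed: "perm_gate (g \<circ> f) \<in> cnot_group"
    if "perm_gate f \<in> cnot_group" "perm_gate g \<in> cnot_group" "f \<in> perms3" for f g
    using generate.eng[of "perm_gate f" ?G _ "perm_gate g"] that mult_pg[OF that(3), of g]
    by (auto simp: cnot_group_def mult)
  show "perm_gate ` perms3 \<subseteq> cnot_group"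
  proof (rule image_subsetI)
    fix f assume f: "f \<in> perms3"
    have inj: "f 1 \<noteq> f 2" "f 1 \<noteq> f 3" "f 2 \<noteq> f 3"
      using perms3_bounds(4)[OF f] by (metis numeral_eq_iff num.distinct one_eq_numeral_iff)+
    have val: "f v \<in> {1, 2, 3}" if "v \<in> {1, 2, 3}" for v
      using that permutes_in_image[of f "{1, 2, 3}" v] f unfolding perms3_def by simp
    have val': "f 1 = 1 \<or> f 1 = 2 \<or> f 1 = 3" "f 2 = 1 \<or> f 2 = 2 \<or> f 2 = 3" "f 3 = 1 \<or> f 3 = 2 \<or> f 3 = 3"
      using val[of 1] val[of 2] val[of 3] by simp_all
    have f0: "f 0 = 0" using f by (rule perms3_bounds)
    \<comment> \<open>Each of the six value patterns of \<open>f\<close> is matched by an explicit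
      word of length at most three in the two transpositions.\<close>
    have "\<exists>h. perm_gate h \<in> cnot_group \<and> f 1 = h 1 \<and> f 2 = h 2 \<and> f 3 = h 3 \<and> h 0 = 0"
    proof -
      have h: "perm_gate (swap23 \<circ> swap13) \<in> cnot_group" "perm_gate (swap13 \<circ> swap23) \<in> cnot_group"
          "perm_gate (swap13 \<circ> (swap23 \<circ> swap13)) \<in> cnot_group"
        using gen swap_perms3 comp_perms3 by (auto intro!: closed)
      have "f 1 = 1 \<and> f 2 = 2 \<and> f 3 = 3 \<or> f 1 = 1 \<and> f 2 = 3 \<and> f 3 = 2 \<or> f 1 = 2 \<and> f 2 = 1 \<and> f 3 = 3 \<or>
          f 1 = 2 \<and> f 2 = 3 \<and> f 3 = 1 \<or> f 1 = 3 \<and> f 2 = 1 \<and> f 3 = 2 \<or> f 1 = 3 \<and> f 2 = 2 \<and> f 3 = 1"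
        using val' by (elim disjE) (use inj in simp_all)
      then consider "f 1 = 1 \<and> f 2 = 2 \<and> f 3 = 3" | "f 1 = 1 \<and> f 2 = 3 \<and> f 3 = 2" | "f 1 = 2 \<and> f 2 = 1 \<and> f 3 = 3"
          | "f 1 = 2 \<and> f 2 = 3 \<and> f 3 = 1" | "f 1 = 3 \<and> f 2 = 1 \<and> f 3 = 2" | "f 1 = 3 \<and> f 2 = 2 \<and> f 3 = 1" by blast
      then show ?thesis
      proof cases
        case 1
        then show ?thesis using gen(1) by (intro exI[of _ id]) simp
      next
        case 2
        then show ?thesis using gen(2) by (intro exI[of _ swap23]) (simp add: swap23_def)
      next
        case 3
        then show ?thesis using h(3) by (intro exI[of _ "swap13 \<circ> (swap23 \<circ> swap13)"]) (simp add: swap23_def swap13_def)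
      next
        case 4
        then show ?thesis using h(1) by (intro exI[of _ "swap23 \<circ> swap13"]) (simp add: swap23_def swap13_def)
      next
        case 5
        then show ?thesis using h(2) by (intro exI[of _ "swap13 \<circ> swap23"]) (simp add: swap23_def swap13_def)
      next
        case 6
        then show ?thesis using gen(3) by (intro exI[of _ swap13]) (simp add: swap13_def)
      qed
    qed
    then obtain h where h: "perm_gate h \<in> cnot_group" "f 1 = h 1" "f 2 = h 2" "f 3 = h 3" "h 0 = 0" by blast
    have "perm_gate f = perm_gate h"
    proof (rule perm_gate_cong)
      fix v :: nat assume "v < 4"
      then show "f v = h v" using h f0 less4_cases[of v] by auto
    qed
    then show "perm_gate f \<in> cnot_group" using h(1) by simp
  qed
qed

section \<open>The law of the random circuit\<close>

lemma space_borel_mat [simp]: "space (borel_mat N) = carrier_mat N N"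
  by (simp add: borel_mat_def)

lemma measurable_borel_matI:
  assumes "\<And>x. x \<in> space M \<Longrightarrow> f x \<in> carrier_mat N N"
    and "\<And>i j. i < N \<Longrightarrow> j < N \<Longrightarrow> (\<lambda>x. f x $$ (i, j)) \<in> borel_measurable M"
  shows "f \<in> M \<rightarrow>\<^sub>M borel_mat N"
  unfolding borel_mat_def
  by (intro measurable_vimage_algebra2 measurable_restrict) (use assms in auto)

lemma measurable_entry [measurable (raw)]:
  assumes "f \<in> M \<rightarrow>\<^sub>M borel_mat N" "i < N" "j < N"
  shows "(\<lambda>x. f x $$ (i, j)) \<in> borel_measurable M"
proof -
  have "(\<lambda>A. (\<lambda>ij\<in>{..<N} \<times> {..<N}. A $$ ij)) \<in> borel_mat N \<rightarrow>\<^sub>M Pi\<^sub>M ({..<N} \<times> {..<N}) (\<lambda>_. borel)"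
    unfolding borel_mat_def by (rule measurable_vimage_algebra1) (auto simp: space_PiM)
  then have "(\<lambda>A. (\<lambda>ij\<in>{..<N} \<times> {..<N}. A $$ ij) (i, j)) \<in> borel_measurable (borel_mat N)"
    by (rule measurable_component_singleton') (use assms in auto)
  then have "(\<lambda>A. A $$ (i, j)) \<in> borel_measurable (borel_mat N)"
    using assms by simp
  from measurable_compose[OF assms(1) this] show ?thesis .
qed

lemma measurable_mat_prod_list:
  assumes "\<And>j. j \<in> set js \<Longrightarrow> F j \<in> M \<rightarrow>\<^sub>M borel_mat N"
  shows "(\<lambda>x. mat_prod_list N (map (\<lambda>j. F j x) js)) \<in> M \<rightarrow>\<^sub>M borel_mat N"
  using assms
proof (induction js)
  case Nil
  then show ?case
    by (intro measurable_borel_matI) (auto simp: mat_prod_list_def)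
next
  case (Cons j js)
  let ?P = "\<lambda>x. mat_prod_list N (map (\<lambda>j. F j x) js)"
  have P: "?P \<in> M \<rightarrow>\<^sub>M borel_mat N" and F: "F j \<in> M \<rightarrow>\<^sub>M borel_mat N"
    using Cons by auto
  have car: "F j x \<in> carrier_mat N N" "?P x \<in> carrier_mat N N" if "x \<in> space M" for x
    using measurable_space[OF F that] measurable_space[OF P that] by auto
  show ?case
  proof (rule measurable_borel_matI)
    show "mat_prod_list N (map (\<lambda>j. F j x) (j # js)) \<in> carrier_mat N N" if "x \<in> space M" for x
      using car[OF that] by (simp add: mat_prod_list_Cons)
    fix a b assume ab: "a < N" "b < N"
    have "(\<lambda>x. \<Sum>k<N. F j x $$ (a, k) * ?P x $$ (k, b)) \<in> borel_measurable M"
      using ab by (intro borel_measurable_sum borel_measurable_times measurable_entry[OF F] measurable_entry[OF P]) auto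
    also have "?this \<longleftrightarrow> (\<lambda>x. mat_prod_list N (map (\<lambda>j. F j x) (j # js)) $$ (a, b)) \<in> borel_measurable M"
    proof (rule measurable_cong)
      fix x assume x: "x \<in> space M"
      show "(\<Sum>k<N. F j x $$ (a, k) * ?P x $$ (k, b)) = mat_prod_list N (map (\<lambda>j. F j x) (j # js)) $$ (a, b)"
        using car[OF x] ab by (simp add: mat_prod_list_Cons scalar_prod_def atLeast0LessThan)
    qed
    finally show "(\<lambda>x. mat_prod_list N (map (\<lambda>j. F j x) (j # js)) $$ (a, b)) \<in> borel_measurable M" .
  qed
qed

lemma measurable_apply_gate: "apply_gate n i j \<in> borel_mat 4 \<rightarrow>\<^sub>M borel_mat (2 ^ n)"
proof (rule measurable_borel_matI)
  fix k l :: nat assume kl: "k < 2 ^ n" "l < 2 ^ n"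
  have "2 * qubit n i k + qubit n j k < 4" "2 * qubit n i l + qubit n j l < 4"
    using qubit_less[of n i k] qubit_less[of n j k] qubit_less[of n i l] qubit_less[of n j l] by linarith+
  then show "(\<lambda>g. apply_gate n i j g $$ (k, l)) \<in> borel_measurable (borel_mat 4)"
    using kl by (cases "\<forall>q<n. q \<noteq> i \<and> q \<noteq> j \<longrightarrow> qubit n q k = qubit n q l")
      (simp_all add: apply_gate_def measurable_entry[OF measurable_ident_sets[OF refl]])
qed simp

abbreviation unif_angle :: "real measure" where
  "unif_angle \<equiv> uniform_measure lborel {0..2 * pi}"

lemma prob_space_unif_angle: "prob_space unif_angle"
  by (intro prob_space_uniform_measure) auto

lemma measurable_phase_gate: "(\<lambda>\<phi>. kron_mat (exp_iZ \<phi>) (1\<^sub>m 2)) \<in> unif_angle \<rightarrow>\<^sub>M borel_mat 4"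
proof (rule measurable_borel_matI)
  fix i j :: nat assume ij: "i < 4" "j < 4"
  have d: "i div 2 < 2" "j div 2 < 2" using ij by auto
  have "(\<lambda>\<phi>. kron_mat (exp_iZ \<phi>) (1\<^sub>m 2) $$ (i, j)) =
      (\<lambda>\<phi>. (if i div 2 = j div 2 then exp (\<i> * of_real \<phi> * ([1, -1] ! (j div 2))) else 0) * 1\<^sub>m 2 $$ (i mod 2, j mod 2))"
    using ij d by (simp add: kron_mat_def exp_iZ_def mat_diag_def)
  also have "\<dots> \<in> borel_measurable borel"
    by (intro borel_measurable_continuous_onI, cases "i div 2 = j div 2") (auto intro!: continuous_intros)
  finally show "(\<lambda>\<phi>. kron_mat (exp_iZ \<phi>) (1\<^sub>m 2) $$ (i, j)) \<in> borel_measurable unif_angle"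
    by simp
qed (simp add: kron_mat_def exp_iZ_def mat_diag_def)

lemma measurable_letter_mat: "letter_mat \<omega> n l \<in> unif_angle \<rightarrow>\<^sub>M borel_mat (2 ^ n)"
proof -
  obtain i b f where l: "l = (i, b, f)" by (cases l)
  show ?thesis
  proof (cases b)
    case True
    then show ?thesis
      by (simp add: l letter_mat_def)
  next
    case False
    then have "letter_mat \<omega> n l = (\<lambda>\<phi>. apply_gate n i ((i + 1) mod n) (kron_mat (exp_iZ \<phi>) (1\<^sub>m 2)))"
      by (simp add: l letter_mat_def fun_eq_iff)
    then show ?thesis
      using measurable_compose[OF measurable_phase_gate measurable_apply_gate] by simp
  qed
qed

lemma su_lift_measurable:
  "su_lift \<omega> \<in> uniform_count_measure cnot_group \<rightarrow>\<^sub>M borel_mat 4"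
proof -
  have "su_lift \<omega> \<in> cnot_group \<rightarrow> carrier_mat 4 4"
    by (auto simp: su_lift_def cnot_group_eq)
  then show ?thesis
    by (simp add: measurable_def space_uniform_count_measure sets_uniform_count_measure)
qed

text \<open>Both branches of \<open>zeta\<close> as one kernel on the coin, the form in which the
  \<open>bind\<close> lemmas apply.\<close>

definition zeta_branch :: "complex \<Rightarrow> bool \<Rightarrow> complex mat measure" where
  "zeta_branch \<omega> b = (if b then distr (uniform_count_measure cnot_group) (borel_mat 4) (su_lift \<omega>)
     else distr unif_angle (borel_mat 4) (\<lambda>\<phi>. kron_mat (exp_iZ \<phi>) (1\<^sub>m 2)))"

lemma zeta_eq_bind: "zeta \<omega> = measure_pmf (bernoulli_pmf (1 / 2)) \<bind> zeta_branch \<omega>"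
  by (simp add: zeta_def zeta_branch_def[abs_def])

lemma prob_space_zeta_branch: "prob_space (zeta_branch \<omega> b)"
proof -
  have fin: "finite cnot_group" "cnot_group \<noteq> {}"
    using finite_perms3 card_perms3 by (auto simp: cnot_group_eq)
  show ?thesis
    using prob_space.prob_space_distr[OF prob_space_uniform_count_measure[OF fin] su_lift_measurable]
      prob_space.prob_space_distr[OF prob_space_unif_angle measurable_phase_gate]
    by (simp add: zeta_branch_def)
qed

lemma zeta_kernel: "zeta_branch \<omega> \<in> measure_pmf p \<rightarrow>\<^sub>M subprob_algebra (borel_mat 4)"
proof -
  have "sets (zeta_branch \<omega> b) = sets (borel_mat 4)" for b by (simp add: zeta_branch_def)
  then have "zeta_branch \<omega> b \<in> space (subprob_algebra (borel_mat 4))" for b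
    using prob_space_imp_subprob_space[OF prob_space_zeta_branch] by (simp add: space_subprob_algebra)
  then show ?thesis by simp
qed

lemma prob_space_zeta: "prob_space (zeta \<omega>)"
  unfolding zeta_eq_bind
  by (rule prob_space.prob_space_bind[OF measure_pmf.prob_space_axioms _ zeta_kernel]) (simp add: prob_space_zeta_branch)

lemma sets_zeta [measurable_cong, simp]: "sets (zeta \<omega>) = sets (borel_mat 4)"
  unfolding zeta_eq_bind by (rule sets_bind) (auto simp: zeta_branch_def)

lemma measure_zeta:
  assumes E: "E \<in> sets (borel_mat 4)"
  shows "measure (zeta \<omega>) E = ((\<Sum>f\<in>perms3. of_bool (su_lift \<omega> (perm_gate f) \<in> E)) / 6 +
     measure unif_angle {\<phi>. kron_mat (exp_iZ \<phi>) (1\<^sub>m 2) \<in> E}) / 2"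
proof -
  have fin: "finite cnot_group" "cnot_group \<noteq> {}"
    using finite_perms3 card_perms3 by (auto simp: cnot_group_eq)
  have card: "card cnot_group = 6" unfolding cnot_group_eq using perm_gate_inj by (simp add: card_image card_perms3)
  have "measure (zeta \<omega>) E = (\<integral>b. measure (zeta_branch \<omega> b) E \<partial>measure_pmf (bernoulli_pmf (1 / 2)))"
    unfolding zeta_eq_bind by (rule measure_pmf.measure_bind[OF zeta_kernel E])
  also have "\<dots> = (measure (distr (uniform_count_measure cnot_group) (borel_mat 4) (su_lift \<omega>)) E
      + measure (distr unif_angle (borel_mat 4) (\<lambda>\<phi>. kron_mat (exp_iZ \<phi>) (1\<^sub>m 2))) E) / 2"
    by (subst integral_measure_pmf_real[where A = UNIV])
      (simp_all add: UNIV_bool add_divide_distrib zeta_branch_def)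
  also have "measure (distr unif_angle (borel_mat 4) (\<lambda>\<phi>. kron_mat (exp_iZ \<phi>) (1\<^sub>m 2))) E
      = measure unif_angle {\<phi>. kron_mat (exp_iZ \<phi>) (1\<^sub>m 2) \<in> E}"
    using E by (subst measure_distr[OF measurable_phase_gate]) (simp_all add: vimage_def)
  also have "measure (distr (uniform_count_measure cnot_group) (borel_mat 4) (su_lift \<omega>)) E
      = real (card (su_lift \<omega> -` E \<inter> cnot_group)) / 6"
    using E fin by (subst measure_distr[OF su_lift_measurable])
      (simp_all add: space_uniform_count_measure measure_uniform_count_measure card)
  also have "card (su_lift \<omega> -` E \<inter> cnot_group) = card {f\<in>perms3. su_lift \<omega> (perm_gate f) \<in> E}"
  proof -
    have "su_lift \<omega> -` E \<inter> cnot_group = perm_gate ` {f\<in>perms3. su_lift \<omega> (perm_gate f) \<in> E}"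
      by (auto simp: cnot_group_eq)
    then show ?thesis using perm_gate_inj by (metis (no_types, lifting) card_image inj_on_subset mem_Collect_eq subsetI)
  qed
  also have "real (card {f\<in>perms3. su_lift \<omega> (perm_gate f) \<in> E}) = (\<Sum>f\<in>perms3. of_bool (su_lift \<omega> (perm_gate f) \<in> E))"
    using finite_perms3 by (simp add: of_bool_def sum.If_cases Int_def)
  finally show ?thesis .
qed

lemma layer_kernel:
  "(\<lambda>i. distr (zeta \<omega>) (borel_mat (2 ^ n)) (apply_gate n i ((i + 1) mod n)))
    \<in> measure_pmf p \<rightarrow>\<^sub>M subprob_algebra (borel_mat (2 ^ n))"
  and layer_kernel_prob: "prob_space (distr (zeta \<omega>) (borel_mat (2 ^ n)) (apply_gate n i ((i + 1) mod n)))"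
proof -
  have m: "apply_gate n i j \<in> zeta \<omega> \<rightarrow>\<^sub>M borel_mat (2 ^ n)" for i j
    using measurable_apply_gate measurable_cong_sets[OF sets_zeta refl] by blast
  show prob: "prob_space (distr (zeta \<omega>) (borel_mat (2 ^ n)) (apply_gate n i ((i + 1) mod n)))" for i
    by (rule prob_space.prob_space_distr[OF prob_space_zeta m])
  have "distr (zeta \<omega>) (borel_mat (2 ^ n)) (apply_gate n i ((i + 1) mod n)) \<in> space (subprob_algebra (borel_mat (2 ^ n)))" for i
    using prob_space_imp_subprob_space[OF prob[of i]] by (simp add: space_subprob_algebra)
  then show "(\<lambda>i. distr (zeta \<omega>) (borel_mat (2 ^ n)) (apply_gate n i ((i + 1) mod n)))
    \<in> measure_pmf p \<rightarrow>\<^sub>M subprob_algebra (borel_mat (2 ^ n))" by simp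
qed

lemma prob_space_layer: "prob_space (zeta_layer \<omega> n)"
  unfolding zeta_layer_def
  by (rule prob_space.prob_space_bind[OF measure_pmf.prob_space_axioms _ layer_kernel]) (intro AE_I2 layer_kernel_prob)

lemma sets_layer [measurable_cong, simp]: "sets (zeta_layer \<omega> n) = sets (borel_mat (2 ^ n))"
  unfolding zeta_layer_def by (rule sets_bind) auto

text \<open>Position, coin and group element merge into one uniform letter; a phase letter is
  averaged over its idle permutation and a CNOT letter over its idle angle.\<close>

lemma measure_layer:
  assumes n: "n > 0" and E: "E \<in> sets (borel_mat (2 ^ n))"
  shows "measure (zeta_layer \<omega> n) E = letter_avg n (\<lambda>l. measure unif_angle {\<phi>. letter_mat \<omega> n l \<phi> \<in> E})"
proof -
  let ?s = "\<lambda>i. (i + 1) mod n"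
  interpret U: prob_space unif_angle by (rule prob_space_unif_angle)
  have m: "apply_gate n i j \<in> zeta \<omega> \<rightarrow>\<^sub>M borel_mat (2 ^ n)" for i j
    using measurable_apply_gate measurable_cong_sets[OF sets_zeta refl] by blast
  have "measure (zeta_layer \<omega> n) E
      = (\<integral>i. measure (distr (zeta \<omega>) (borel_mat (2 ^ n)) (apply_gate n i (?s i))) E \<partial>measure_pmf (pmf_of_set {..<n}))"
    unfolding zeta_layer_def by (rule measure_pmf.measure_bind[OF layer_kernel E])
  also have "\<dots> = (\<Sum>i<n. measure (distr (zeta \<omega>) (borel_mat (2 ^ n)) (apply_gate n i (?s i))) E) / real n"
    using n by (subst integral_pmf_of_set) (auto simp: lessThan_empty_iff)
  also have "\<dots> = (\<Sum>i<n. (\<Sum>f\<in>perms3. measure unif_angle {\<phi>. letter_mat \<omega> n (i, False, f) \<phi> \<in> E}) +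
     (\<Sum>f\<in>perms3. measure unif_angle {\<phi>. letter_mat \<omega> n (i, True, f) \<phi> \<in> E})) / (12 * real n)"
  proof -
    have "12 * measure (distr (zeta \<omega>) (borel_mat (2 ^ n)) (apply_gate n i (?s i))) E =
       (\<Sum>f\<in>perms3. measure unif_angle {\<phi>. letter_mat \<omega> n (i, False, f) \<phi> \<in> E}) +
       (\<Sum>f\<in>perms3. measure unif_angle {\<phi>. letter_mat \<omega> n (i, True, f) \<phi> \<in> E})" for i
    proof -
      have "measure (distr (zeta \<omega>) (borel_mat (2 ^ n)) (apply_gate n i (?s i))) E
        = measure (zeta \<omega>) (apply_gate n i (?s i) -` E \<inter> carrier_mat 4 4)"
        using E sets_eq_imp_space_eq[OF sets_zeta] by (subst measure_distr[OF m]) simp_all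
      also have "\<dots> = ((\<Sum>f\<in>perms3. of_bool (su_lift \<omega> (perm_gate f) \<in> apply_gate n i (?s i) -` E \<inter> carrier_mat 4 4)) / 6 +
     measure unif_angle {\<phi>. kron_mat (exp_iZ \<phi>) (1\<^sub>m 2) \<in> apply_gate n i (?s i) -` E \<inter> carrier_mat 4 4}) / 2"
        using measurable_sets[OF measurable_apply_gate E, of i "?s i"] by (intro measure_zeta) simp
      also have "(\<Sum>f\<in>perms3. of_bool (su_lift \<omega> (perm_gate f) \<in> apply_gate n i (?s i) -` E \<inter> carrier_mat 4 4))
        = (\<Sum>f\<in>perms3. measure unif_angle {\<phi>. letter_mat \<omega> n (i, True, f) \<phi> \<in> E})"
        using U.prob_space by (intro sum.cong refl) (auto simp: letter_mat_def su_lift_def)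
      also have "{\<phi>. kron_mat (exp_iZ \<phi>) (1\<^sub>m 2) \<in> apply_gate n i (?s i) -` E \<inter> carrier_mat 4 4}
        = {\<phi>. letter_mat \<omega> n (i, False, f) \<phi> \<in> E}" for f
        using measurable_space[OF measurable_phase_gate] by (auto simp: letter_mat_def)
      finally show ?thesis
        by (simp add: card_perms3 letter_mat_def field_simps)
    qed
    then have "(\<Sum>i<n. (\<Sum>f\<in>perms3. measure unif_angle {\<phi>. letter_mat \<omega> n (i, False, f) \<phi> \<in> E}) +
     (\<Sum>f\<in>perms3. measure unif_angle {\<phi>. letter_mat \<omega> n (i, True, f) \<phi> \<in> E})) =
      12 * (\<Sum>i<n. measure (distr (zeta \<omega>) (borel_mat (2 ^ n)) (apply_gate n i (?s i))) E)"
      by (simp only: sum_distrib_left)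
    then show ?thesis by simp
  qed
  finally show ?thesis by (simp only: letter_avg_eq)
qed

section \<open>Uniform words of letters and independent angles\<close>

lemma expectation_replicate_letters:
  fixes \<Phi> :: "letter list \<Rightarrow> real"
  assumes n: "n > 0"
  shows "measure_pmf.expectation (replicate_pmf d (pmf_of_set (letters n))) \<Phi> = seq_avg n d \<Phi>"
proof (induction d arbitrary: \<Phi>)
  case (Suc d)
  have ne: "letters n \<noteq> {}" using card_letters[of n] n by auto
  have fin: "finite (set_pmf (replicate_pmf d (pmf_of_set (letters n))))"
    using finite_lists_length_eq[OF finite_letters, of n d] ne
    by (simp add: set_replicate_pmf lists_eq_set)
  have "measure_pmf.expectation (replicate_pmf (Suc d) (pmf_of_set (letters n))) \<Phi>
      = (\<Sum>l\<in>letters n. measure_pmf.expectation (map_pmf ((#) l) (replicate_pmf d (pmf_of_set (letters n)))) \<Phi> /\<^sub>R real (card (letters n)))"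
    unfolding replicate_pmf.simps map_pmf_def[symmetric]
    by (rule pmf_expectation_bind_pmf_of_set) (use ne fin in auto)
  also have "\<dots> = seq_avg n (Suc d) \<Phi>"
    by (simp add: Suc letter_avg_def divide_inverse sum_distrib_left mult.commute)
  finally show ?case .
qed simp

lemma seq_avg_prod:
  assumes n: "n > 0"
  shows "seq_avg n d (\<lambda>ls. \<Prod>j<d. e j (ls ! j)) = (\<Prod>j<d. letter_avg n (e j))"
proof (induction d arbitrary: e)
  case (Suc d)
  have "seq_avg n (Suc d) (\<lambda>ls. \<Prod>j<Suc d. e j (ls ! j))
      = letter_avg n (\<lambda>l. seq_avg n d (\<lambda>ls. (\<Prod>j<d. e (Suc j) (ls ! j)) * e 0 l))"
    by (simp add: prod.lessThan_Suc_shift mult.commute del: prod.lessThan_Suc)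
  also have "\<dots> = letter_avg n (\<lambda>l. (\<Prod>j<d. letter_avg n (e (Suc j))) * e 0 l)"
    using n by (simp add: seq_avg_mult_right Suc[of "\<lambda>j. e (Suc j)"])
  also have "\<dots> = (\<Prod>j<Suc d. letter_avg n (e j))"
    unfolding prod.lessThan_Suc_shift by (simp add: letter_avg_def sum_distrib_left[symmetric])
  finally show ?case .
qed simp

abbreviation angles :: "nat \<Rightarrow> (nat \<Rightarrow> real) measure" where
  "angles d \<equiv> Pi\<^sub>M {..<d} (\<lambda>_. unif_angle)"

lemma prob_space_angles: "prob_space (angles d)"
  by (intro prob_space_PiM prob_space_unif_angle)

definition gate_seq :: "complex \<Rightarrow> nat \<Rightarrow> nat \<Rightarrow> letter list \<Rightarrow> (nat \<Rightarrow> real) \<Rightarrow> nat \<Rightarrow> complex mat" where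
  "gate_seq \<omega> n d ls \<phi> = (\<lambda>j\<in>{..<d}. letter_mat \<omega> n (ls ! j) (\<phi> j))"

definition gate_law :: "complex \<Rightarrow> nat \<Rightarrow> nat \<Rightarrow> letter list \<Rightarrow> (nat \<Rightarrow> complex mat) measure" where
  "gate_law \<omega> n d ls = distr (angles d) (Pi\<^sub>M {..<d} (\<lambda>_. borel_mat (2 ^ n))) (gate_seq \<omega> n d ls)"

lemma measurable_gate_seq: "gate_seq \<omega> n d ls \<in> angles d \<rightarrow>\<^sub>M Pi\<^sub>M {..<d} (\<lambda>_. borel_mat (2 ^ n))"
  unfolding gate_seq_def[abs_def]
proof (rule measurable_restrict)
  fix j assume "j \<in> {..<d}"
  then have "(\<lambda>\<phi>. \<phi> j) \<in> angles d \<rightarrow>\<^sub>M unif_angle" by (rule measurable_component_singleton)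
  then show "(\<lambda>\<phi>. letter_mat \<omega> n (ls ! j) (\<phi> j)) \<in> angles d \<rightarrow>\<^sub>M borel_mat (2 ^ n)"
    using measurable_letter_mat by (rule measurable_compose)
qed

lemma prob_space_gate_law: "prob_space (gate_law \<omega> n d ls)"
  unfolding gate_law_def by (rule prob_space.prob_space_distr[OF prob_space_angles measurable_gate_seq])

lemma gate_law_kernel:
  "gate_law \<omega> n d \<in> measure_pmf p \<rightarrow>\<^sub>M subprob_algebra (Pi\<^sub>M {..<d} (\<lambda>_. borel_mat (2 ^ n)))"
proof -
  have "gate_law \<omega> n d ls \<in> space (subprob_algebra (Pi\<^sub>M {..<d} (\<lambda>_. borel_mat (2 ^ n))))" for ls
    using prob_space_imp_subprob_space[OF prob_space_gate_law] by (simp add: space_subprob_algebra gate_law_def)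
  then show ?thesis by simp
qed

text \<open>With independent letters, the mixture over words of the product laws is the product of
  the mixtures. Both sides are compared on boxes, where each is a product of letter
  averages.\<close>

lemma layer_product:
  assumes n: "n > 0"
  shows "measure_pmf (replicate_pmf d (pmf_of_set (letters n))) \<bind> gate_law \<omega> n d = Pi\<^sub>M {..<d} (\<lambda>_. zeta_layer \<omega> n)"
proof -
  interpret L: prob_space "zeta_layer \<omega> n" by (rule prob_space_layer)
  interpret P: product_prob_space "\<lambda>_::nat. zeta_layer \<omega> n" ..
  interpret U: prob_space unif_angle by (rule prob_space_unif_angle)
  interpret UP: finite_product_prob_space "\<lambda>_::nat. unif_angle" "{..<d}" by unfold_locales simp
  let ?B = "Pi\<^sub>M {..<d} (\<lambda>_. borel_mat (2 ^ n))"
  let ?R = "replicate_pmf d (pmf_of_set (letters n))"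
  have setsB: "sets ?B = sets (Pi\<^sub>M {..<d} (\<lambda>_. zeta_layer \<omega> n))"
    by (rule sets_PiM_cong) simp_all
  interpret RB: prob_space "measure_pmf ?R \<bind> gate_law \<omega> n d"
    by (rule prob_space.prob_space_bind[OF measure_pmf.prob_space_axioms _ gate_law_kernel])
      (intro AE_I2 prob_space_gate_law)
  show ?thesis
  proof (rule P.PiM_eqI)
    show "sets (measure_pmf ?R \<bind> gate_law \<omega> n d) = sets (Pi\<^sub>M {..<d} (\<lambda>_. zeta_layer \<omega> n))"
      unfolding setsB[symmetric] by (rule sets_bind) (auto simp: gate_law_def)
    fix E assume E: "\<And>j. j \<in> {..<d} \<Longrightarrow> E j \<in> sets (zeta_layer \<omega> n)"
    then have E': "E j \<in> sets (borel_mat (2 ^ n))" if "j < d" for j using that by simp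
    have box: "Pi\<^sub>E {..<d} E \<in> sets ?B" using E' by (intro sets_PiM_I_finite) auto
    have law: "measure (gate_law \<omega> n d ls) (Pi\<^sub>E {..<d} E)
        = (\<Prod>j<d. measure unif_angle {\<phi>. letter_mat \<omega> n (ls ! j) \<phi> \<in> E j})" for ls
    proof -
      have "measure (gate_law \<omega> n d ls) (Pi\<^sub>E {..<d} E)
          = measure (angles d) (gate_seq \<omega> n d ls -` Pi\<^sub>E {..<d} E \<inter> space (angles d))"
        unfolding gate_law_def by (rule measure_distr[OF measurable_gate_seq box])
      also have "gate_seq \<omega> n d ls -` Pi\<^sub>E {..<d} E \<inter> space (angles d)
          = Pi\<^sub>E {..<d} (\<lambda>j. {\<phi>. letter_mat \<omega> n (ls ! j) \<phi> \<in> E j})"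
      proof -
        have "gate_seq \<omega> n d ls \<phi> \<in> Pi\<^sub>E {..<d} E \<longleftrightarrow> (\<forall>j<d. letter_mat \<omega> n (ls ! j) (\<phi> j) \<in> E j)" for \<phi>
          by (auto simp: gate_seq_def PiE_iff)
        then show ?thesis by (simp add: set_eq_iff space_PiM PiE_iff) blast
      qed
      also have "measure (angles d) \<dots> = (\<Prod>j<d. measure unif_angle {\<phi>. letter_mat \<omega> n (ls ! j) \<phi> \<in> E j})"
      proof (rule UP.prob_times)
        fix j assume "j \<in> {..<d}"
        then have "letter_mat \<omega> n (ls ! j) -` E j \<inter> space unif_angle \<in> sets unif_angle"
          using measurable_sets[OF measurable_letter_mat E'] by blast
        then show "{\<phi>. letter_mat \<omega> n (ls ! j) \<phi> \<in> E j} \<in> sets unif_angle" by (simp add: vimage_def)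
      qed
      finally show ?thesis .
    qed
    have "measure (measure_pmf ?R \<bind> gate_law \<omega> n d) (Pi\<^sub>E {..<d} E)
        = (\<integral>ls. measure (gate_law \<omega> n d ls) (Pi\<^sub>E {..<d} E) \<partial>measure_pmf ?R)"
      by (rule measure_pmf.measure_bind[OF gate_law_kernel box])
    also have "\<dots> = seq_avg n d (\<lambda>ls. \<Prod>j<d. measure unif_angle {\<phi>. letter_mat \<omega> n (ls ! j) \<phi> \<in> E j})"
      by (simp only: law expectation_replicate_letters[OF n])
    also have "\<dots> = (\<Prod>j<d. measure (zeta_layer \<omega> n) (E j))"
      using E' seq_avg_prod[OF n, of d "\<lambda>j l. measure unif_angle {\<phi>. letter_mat \<omega> n l \<phi> \<in> E j}"]
      by (simp add: measure_layer[OF n])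
    finally show "emeasure (measure_pmf ?R \<bind> gate_law \<omega> n d) (Pi\<^sub>E {..<d} E) = (\<Prod>j\<in>{..<d}. emeasure (zeta_layer \<omega> n) (E j))"
      by (simp add: RB.emeasure_eq_measure L.emeasure_eq_measure prod_ennreal)
  qed simp
qed

lemma measurable_layer_product:
  "(\<lambda>U. mat_prod_list (2 ^ n) (map U [0..<d])) \<in> Pi\<^sub>M {..<d} (\<lambda>_. borel_mat (2 ^ n)) \<rightarrow>\<^sub>M borel_mat (2 ^ n)"
  by (rule measurable_mat_prod_list) simp

lemma prob_space_circuit: "prob_space (zeta_circuit \<omega> n d)"
  unfolding zeta_circuit_def
proof (rule prob_space.prob_space_distr)
  show "prob_space (Pi\<^sub>M {..<d} (\<lambda>_. zeta_layer \<omega> n))" by (intro prob_space_PiM prob_space_layer)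
  have "sets (Pi\<^sub>M {..<d} (\<lambda>_. zeta_layer \<omega> n)) = sets (Pi\<^sub>M {..<d} (\<lambda>_. borel_mat (2 ^ n)))"
    by (rule sets_PiM_cong) simp_all
  then show "(\<lambda>U. mat_prod_list (2 ^ n) (map U [0..<d])) \<in> Pi\<^sub>M {..<d} (\<lambda>_. zeta_layer \<omega> n) \<rightarrow>\<^sub>M borel_mat (2 ^ n)"
    using measurable_layer_product measurable_cong_sets by blast
qed

lemma sets_circuit [simp]: "sets (zeta_circuit \<omega> n d) = sets (borel_mat (2 ^ n))"
  by (simp add: zeta_circuit_def)

lemma space_circuit [simp]: "space (zeta_circuit \<omega> n d) = carrier_mat (2 ^ n) (2 ^ n)"
  by (simp add: zeta_circuit_def)

lemma circuit_gate_seq: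
  "length ls = d \<Longrightarrow> mat_prod_list (2 ^ n) (map (gate_seq \<omega> n d ls \<phi>) [0..<d]) = circuit \<omega> n ls \<phi>"
  unfolding circuit_def by (intro arg_cong[where f = "mat_prod_list (2 ^ n)"] map_cong) (simp_all add: gate_seq_def)

lemma measurable_circuit:
  assumes "length ls = d"
  shows "circuit \<omega> n ls \<in> angles d \<rightarrow>\<^sub>M borel_mat (2 ^ n)"
  using measurable_compose[OF measurable_gate_seq measurable_layer_product]
  unfolding circuit_gate_seq[OF assms, symmetric] .

text \<open>This splits the randomness: for a fixed word only independent uniform angles remain, and
  the words enter through a finite average.\<close>

lemma measure_circuit:
  assumes n: "n > 0" and E: "E \<in> sets (borel_mat (2 ^ n))"
  shows "measure (zeta_circuit \<omega> n d) E = seq_avg n d (\<lambda>ls. measure (angles d) {\<phi>\<in>space (angles d). circuit \<omega> n ls \<phi> \<in> E})"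
proof -
  let ?B = "Pi\<^sub>M {..<d} (\<lambda>_. borel_mat (2 ^ n))"
  let ?p = "\<lambda>U. mat_prod_list (2 ^ n) (map U [0..<d])"
  have setsB: "sets (Pi\<^sub>M {..<d} (\<lambda>_. zeta_layer \<omega> n)) = sets ?B"
    by (rule sets_PiM_cong) simp_all
  have spaceB: "space (Pi\<^sub>M {..<d} (\<lambda>_. zeta_layer \<omega> n)) = space ?B"
    by (rule sets_eq_imp_space_eq[OF setsB])
  have pm: "?p \<in> Pi\<^sub>M {..<d} (\<lambda>_. zeta_layer \<omega> n) \<rightarrow>\<^sub>M borel_mat (2 ^ n)"
    using measurable_layer_product measurable_cong_sets[OF setsB] by blast
  have pre: "?p -` E \<inter> space ?B \<in> sets ?B"
    using measurable_layer_product E by (rule measurable_sets)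
  have "measure (zeta_circuit \<omega> n d) E = measure (Pi\<^sub>M {..<d} (\<lambda>_. zeta_layer \<omega> n)) (?p -` E \<inter> space ?B)"
    unfolding zeta_circuit_def using measure_distr[OF pm E] by (simp only: spaceB)
  also have "\<dots> = (\<integral>ls. measure (gate_law \<omega> n d ls) (?p -` E \<inter> space ?B) \<partial>measure_pmf (replicate_pmf d (pmf_of_set (letters n))))"
    unfolding layer_product[OF n, symmetric] by (rule measure_pmf.measure_bind[OF gate_law_kernel pre])
  also have "\<dots> = seq_avg n d (\<lambda>ls. measure (gate_law \<omega> n d ls) (?p -` E \<inter> space ?B))"
    by (rule expectation_replicate_letters[OF n])
  also have "\<dots> = seq_avg n d (\<lambda>ls. measure (angles d) {\<phi>\<in>space (angles d). circuit \<omega> n ls \<phi> \<in> E})"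
  proof (rule seq_avg_cong)
    fix ls :: "letter list" assume len: "length ls = d"
    have "measure (gate_law \<omega> n d ls) (?p -` E \<inter> space ?B)
        = measure (angles d) (gate_seq \<omega> n d ls -` (?p -` E \<inter> space ?B) \<inter> space (angles d))"
      unfolding gate_law_def by (rule measure_distr[OF measurable_gate_seq pre])
    also have "gate_seq \<omega> n d ls -` (?p -` E \<inter> space ?B) \<inter> space (angles d) = {\<phi>\<in>space (angles d). circuit \<omega> n ls \<phi> \<in> E}"
    proof -
      have "gate_seq \<omega> n d ls \<phi> \<in> space ?B" if "\<phi> \<in> space (angles d)" for \<phi>
        using measurable_gate_seq that by (rule measurable_space)
      then show ?thesis using circuit_gate_seq[OF len] by auto
    qed
    finally show "measure (gate_law \<omega> n d ls) (?p -` E \<inter> space ?B) = measure (angles d) {\<phi>\<in>space (angles d). circuit \<omega> n ls \<phi> \<in> E}" .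
  qed
  finally show ?thesis .
qed

section \<open>Moments of the random phases\<close>

text \<open>For a nonzero integer frequency the antiderivative takes the same value at both ends of
  the interval, which is a whole number of periods.\<close>

lemma integral_unif_angle:
  assumes m: "m \<in> \<int>" "m \<noteq> 0"
  shows "(\<integral>t. exp (\<i> * complex_of_real (t * m)) \<partial>unif_angle) = 0"
proof -
  have m0: "complex_of_real m \<noteq> 0" using m by simp
  have "(\<integral>t. indicator {0..2 * pi} t *\<^sub>R exp (\<i> * complex_of_real (t * m)) \<partial>lborel)
     = exp (\<i> * complex_of_real (2 * pi * m)) / (\<i> * complex_of_real m) - exp (\<i> * complex_of_real (0 * m)) / (\<i> * complex_of_real m)"
  proof (rule integral_FTC_Icc)
    fix t :: real
    have "((\<lambda>z. exp (\<i> * (z * complex_of_real m)) / (\<i> * complex_of_real m)) has_field_derivative exp (\<i> * complex_of_real (t * m))) (at (of_real t))"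
      using m0 by (auto intro!: derivative_eq_intros simp: field_simps)
    from has_vector_derivative_real_field[OF this]
    have "((\<lambda>t. exp (\<i> * complex_of_real (t * m)) / (\<i> * complex_of_real m)) has_vector_derivative exp (\<i> * complex_of_real (t * m))) (at t within {0..2 * pi})"
      by (simp add: o_def has_vector_derivative_at_within)
    then show "((\<lambda>t. exp (\<i> * complex_of_real (t * m)) / (\<i> * complex_of_real m)) has_vector_derivative exp (\<i> * complex_of_real (t * m))) (at t within {0..2 * pi})" .
  qed (auto intro!: continuous_intros)
  also have "exp (\<i> * complex_of_real (2 * pi * m)) = 1"
    using exp_integer_2pi[OF m(1)] by (simp add: mult_ac)
  finally have z: "(\<integral>t. indicator {0..2 * pi} t *\<^sub>R exp (\<i> * complex_of_real (t * m)) \<partial>lborel) = 0" by simp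
  have "unif_angle = density lborel (\<lambda>t. ennreal (indicator {0..2 * pi} t / (2 * pi)))"
    unfolding uniform_measure_def
    by (intro density_cong) (auto simp: indicator_def divide_ennreal[symmetric] ennreal_1[symmetric] simp del: ennreal_1)
  then have "(\<integral>t. exp (\<i> * complex_of_real (t * m)) \<partial>unif_angle)
      = (\<integral>t. (indicator {0..2 * pi} t / (2 * pi)) *\<^sub>R exp (\<i> * complex_of_real (t * m)) \<partial>lborel)"
    by (simp add: integral_density)
  also have "\<dots> = (\<integral>t. (1 / (2 * pi)) *\<^sub>R (indicator {0..2 * pi} t *\<^sub>R exp (\<i> * complex_of_real (t * m))) \<partial>lborel)"
    by (intro Bochner_Integration.integral_cong) (auto simp: indicator_def)
  also have "\<dots> = 0" by (simp only: integral_scaleR_right z) simp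
  finally show ?thesis .
qed

text \<open>Locates a random angle that multiplies the character \<open>a\<close>; one such angle is
  enough to make an unbalanced moment vanish.\<close>

lemma phase_set_nth:
  assumes "a \<in> phase_set n ls"
  shows "\<exists>i<length ls. \<not> fst (snd (ls ! i)) \<and> a = seq_dual n (take i ls) {fst (ls ! i)}"
  using assms
proof (induction ls arbitrary: a)
  case (Cons l ls)
  show ?case
  proof (cases "\<not> fst (snd l) \<and> a = {fst l}")
    case True
    then show ?thesis by (intro exI[of _ 0]) simp
  next
    case False
    then obtain b where b: "b \<in> phase_set n ls" "a = letter_dual n l b"
      using Cons.prems by (auto split: if_splits)
    then obtain i where "i < length ls" "\<not> fst (snd (ls ! i))" "b = seq_dual n (take i ls) {fst (ls ! i)}"
      using Cons.IH by blast
    then show ?thesis using b by (intro exI[of _ "Suc i"]) simp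
  qed
qed simp

lemma measurable_letter_phase: "(\<lambda>t. letter_phase \<omega> l t x) \<in> borel_measurable unif_angle"
proof -
  obtain i b f where l: "l = (i, b, f)" by (cases l)
  have "(\<lambda>t. exp (\<i> * complex_of_real (t * chr {i} x))) \<in> borel_measurable borel"
    by (intro borel_measurable_continuous_onI continuous_intros)
  then show ?thesis by (cases b) (simp_all add: l letter_phase_def)
qed

lemma measurable_seq_phase:
  assumes "length ls = d"
  shows "(\<lambda>\<phi>. seq_phase \<omega> n ls \<phi> x) \<in> borel_measurable (angles d)"
  unfolding seq_phase_def assms
proof (rule borel_measurable_prod)
  fix j assume "j \<in> {..<d}"
  then have "(\<lambda>\<phi>. \<phi> j) \<in> angles d \<rightarrow>\<^sub>M unif_angle" by (rule measurable_component_singleton)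
  then show "(\<lambda>\<phi>. letter_phase \<omega> (ls ! j) (\<phi> j) (seq_map n (take j ls) x)) \<in> borel_measurable (angles d)"
    using measurable_letter_phase by (rule measurable_compose)
qed

lemma borel_measurable_cnj:
  assumes "f \<in> borel_measurable M"
  shows "(\<lambda>x. cnj (f x)) \<in> borel_measurable M"
  by (rule measurable_compose[OF assms borel_measurable_continuous_onI]) (intro continuous_intros)

lemma chr_in_Ints: "chr a x \<in> \<int>"
  by (simp add: chr_def)

context
  fixes \<omega> :: complex and n d :: nat and ls :: "letter list"
  assumes \<omega>: "\<omega> ^ 4 = -1" and n: "n \<ge> 2" and ls: "set ls \<subseteq> letters n" and len: "length ls = d"
begin

abbreviation monomial :: "'j set \<Rightarrow> ('j \<Rightarrow> nat set) \<Rightarrow> 'k set \<Rightarrow> ('k \<Rightarrow> nat set) \<Rightarrow> (nat \<Rightarrow> real) \<Rightarrow> complex" where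
  "monomial J x K y \<phi> \<equiv> (\<Prod>j\<in>J. seq_phase \<omega> n ls \<phi> (x j)) * (\<Prod>k\<in>K. cnj (seq_phase \<omega> n ls \<phi> (y k)))"

lemma cmod_monomial: "cmod (monomial J x K y \<phi>) = 1"
  by (simp add: norm_mult prod_norm[symmetric] cmod_seq_phase[OF \<omega>])

lemma measurable_monomial: "monomial J x K y \<in> borel_measurable (angles d)"
  by (intro borel_measurable_times borel_measurable_prod borel_measurable_cnj measurable_seq_phase len)

lemma integrable_monomial: "integrable (angles d) (monomial J x K y)"
proof -
  interpret prob_space "angles d" by (rule prob_space_angles)
  show ?thesis
    by (rule integrable_const_bound[of _ 1]) (auto simp: cmod_monomial measurable_monomial)
qed

lemma integral_monomial_le: "cmod (\<integral>\<phi>. monomial J x K y \<phi> \<partial>angles d) \<le> 1"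
proof -
  interpret prob_space "angles d" by (rule prob_space_angles)
  have "cmod (\<integral>\<phi>. monomial J x K y \<phi> \<partial>angles d) \<le> (\<integral>\<phi>. cmod (monomial J x K y \<phi>) \<partial>angles d)"
    by (rule integral_norm_bound)
  then show ?thesis by (simp add: cmod_monomial prob_space)
qed

text \<open>Independence of the angles factors the integral over positions. At a position carrying
  \<open>a\<close> the factor is an exponential with nonzero integer frequency, the difference of
  the two character sums.\<close>

lemma integral_monomial_zero:
  fixes x :: "'j \<Rightarrow> nat set" and y :: "'k \<Rightarrow> nat set"
  assumes a: "a \<in> phase_set n ls" and ne: "(\<Sum>j\<in>J. chr a (x j)) \<noteq> (\<Sum>k\<in>K. chr a (y k))"
    and fin: "finite J" "finite K"
  shows "(\<integral>\<phi>. monomial J x K y \<phi> \<partial>angles d) = 0"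
proof -
  interpret U: prob_space unif_angle by (rule prob_space_unif_angle)
  interpret product_sigma_finite "\<lambda>_::nat. unif_angle" ..
  define h where "h i t = (\<Prod>j\<in>J. letter_phase \<omega> (ls ! i) t (seq_map n (take i ls) (x j))) *
      (\<Prod>k\<in>K. cnj (letter_phase \<omega> (ls ! i) t (seq_map n (take i ls) (y k))))" for i t
  have h_meas: "h i \<in> borel_measurable unif_angle" for i
    unfolding h_def[abs_def]
    by (intro borel_measurable_times borel_measurable_prod borel_measurable_cnj measurable_letter_phase)
  have h_int: "integrable unif_angle (h i)" for i
    by (rule U.integrable_const_bound[of _ 1])
      (auto simp: h_meas h_def norm_mult prod_norm[symmetric] cmod_letter_phase[OF \<omega>])
  have "monomial J x K y \<phi> = (\<Prod>i<d. h i (\<phi> i))" for \<phi>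
  proof -
    have "(\<Prod>j\<in>J. seq_phase \<omega> n ls \<phi> (x j)) = (\<Prod>i<d. \<Prod>j\<in>J. letter_phase \<omega> (ls ! i) (\<phi> i) (seq_map n (take i ls) (x j)))"
      unfolding seq_phase_def len by (rule prod.swap)
    moreover have "(\<Prod>k\<in>K. cnj (seq_phase \<omega> n ls \<phi> (y k))) = (\<Prod>i<d. \<Prod>k\<in>K. cnj (letter_phase \<omega> (ls ! i) (\<phi> i) (seq_map n (take i ls) (y k))))"
      unfolding seq_phase_def len cnj_prod by (rule prod.swap)
    ultimately show ?thesis by (simp add: h_def prod.distrib)
  qed
  then have "(\<integral>\<phi>. monomial J x K y \<phi> \<partial>angles d) = (\<integral>\<phi>. (\<Prod>i<d. h i (\<phi> i)) \<partial>angles d)" by simp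
  also have "\<dots> = (\<Prod>i<d. integral\<^sup>L unif_angle (h i))"
    by (rule product_integral_prod) (auto simp: h_int)
  also have "\<dots> = 0"
  proof -
    obtain i where i: "i < d" "\<not> fst (snd (ls ! i))" "a = seq_dual n (take i ls) {fst (ls ! i)}"
      using phase_set_nth[OF a] len by blast
    define q where "q = fst (ls ! i)"
    have "ls ! i \<in> letters n" using ls i(1) len by (metis nth_mem subsetD)
    then have q: "q < n" by (cases "ls ! i") (simp add: q_def letters_def)
    have take: "set (take i ls) \<subseteq> letters n" by (rule order_trans[OF set_take_subset ls])
    have s: "chr {q} (seq_map n (take i ls) z) = chr a z" for z
      using chr_seq_dual[OF n take, of "{q}" z] q i(3) by (simp add: q_def)
    define m where "m = (\<Sum>j\<in>J. chr a (x j)) - (\<Sum>k\<in>K. chr a (y k))"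
    have lp: "letter_phase \<omega> (ls ! i) t (seq_map n (take i ls) z) = exp (\<i> * complex_of_real (t * chr a z))" for t z
      using i(2) s[of z] by (cases "ls ! i") (simp add: letter_phase_def q_def)
    have "h i = (\<lambda>t. exp (\<i> * complex_of_real (t * m)))"
      using fin by (simp add: fun_eq_iff h_def lp exp_sum[symmetric] exp_cnj exp_add[symmetric] m_def
          sum_distrib_left[symmetric] right_diff_distrib sum_negf)
    moreover have "m \<in> \<int>"
      unfolding m_def by (intro Ints_diff Ints_sum chr_in_Ints)
    moreover have "m \<noteq> 0" using ne by (simp add: m_def)
    ultimately have "integral\<^sup>L unif_angle (h i) = 0"
      using integral_unif_angle by simp
    then show ?thesis using i(1) by (intro prod_zero) auto
  qed
  finally show ?thesis .
qed

text \<open>For \<open>\<bar>w\<bar> \<le> 1\<close>, the trigonometric polynomial \<open>\<bar>(1 + cnj w * p) / 2\<bar>\<^sup>2\<close> is close to \<open>1\<close> when the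
  phase \<open>p\<close> is close to \<open>w\<close>, but has mean at most \<open>1/2\<close>. The independent points supply
  as many independent factors of this kind as there are distinct characters.\<close>

lemma phase_ball:
  assumes W: "\<And>x. x \<in> Pow {..<n} \<Longrightarrow> cmod (W x) \<le> 1"
  shows "measure (angles d) {\<phi>\<in>space (angles d). \<forall>x\<in>Pow {..<n}. cmod (seq_phase \<omega> n ls \<phi> x - W x) \<le> 1 / 5}
    \<le> (50 / 81) ^ card (phase_set n ls)"
proof -
  interpret prob_space "angles d" by (rule prob_space_angles)
  let ?P = "Pow {..<n}" and ?S = "phase_set n ls"
  have S: "finite ?S" "?S \<subseteq> ?P" using card_phase_set phase_set_mem[OF n ls] by auto
  \<comment> \<open>Distinct characters are orthogonal, hence linearly independent.\<close>
  have indep: "c b = 0" if c: "\<forall>x\<in>?P. (\<Sum>a\<in>?S. c a * chr a x) = 0" and b: "b \<in> ?S" for c b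
  proof -
    have "0 = (\<Sum>x\<in>?P. (\<Sum>a\<in>?S. c a * chr a x) * chr b x)" using c by simp
    also have "\<dots> = (\<Sum>a\<in>?S. c a * (\<Sum>x\<in>?P. chr x a * chr x b))"
      by (simp add: sum_distrib_right sum_distrib_left mult.assoc chr_commute[of _ a for a] sum.swap[of _ ?S ?P] chr_commute)
    also have "\<dots> = (\<Sum>a\<in>?S. c a * (if a = b then 2 ^ n else 0))"
      using S b by (intro sum.cong refl, subst chr_orthogonal) auto
    also have "\<dots> = c b * 2 ^ n" using S(1) b by (simp add: if_distrib cong: if_cong)
    finally show ?thesis by simp
  qed
  obtain R where R: "R \<subseteq> ?P" "finite R" "card R = card ?S"
      "\<And>m. (\<forall>a\<in>?S. (\<Sum>x\<in>R. m x * chr a x) = 0) \<Longrightarrow> \<forall>x\<in>R. m x = 0"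
    using independent_points[OF S(1), of ?P chr] indep by blast
  let ?r = "card ?S"
  define p where "p \<phi> x = seq_phase \<omega> n ls \<phi> x" for \<phi> x
  define G where "G \<phi> = (\<Prod>x\<in>R. 1 + cnj (W x) * p \<phi> x)" for \<phi>
  have expand: "G \<phi> * cnj (G \<phi>) = (\<Sum>A\<in>Pow R. \<Sum>B\<in>Pow R. ((\<Prod>x\<in>A. cnj (W x)) * (\<Prod>x\<in>B. W x)) * monomial A (\<lambda>x. x) B (\<lambda>x. x) \<phi>)" for \<phi>
  proof -
    have "G \<phi> = (\<Sum>A\<in>Pow R. \<Prod>x\<in>A. cnj (W x) * p \<phi> x)"
      using prod_add[OF R(2), of "\<lambda>x. cnj (W x) * p \<phi> x" "\<lambda>_. 1"] by (simp add: G_def add.commute)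
    then have G: "G \<phi> = (\<Sum>A\<in>Pow R. (\<Prod>x\<in>A. cnj (W x)) * (\<Prod>x\<in>A. p \<phi> x))"
      by (simp add: prod.distrib)
    then have "cnj (G \<phi>) = (\<Sum>B\<in>Pow R. (\<Prod>x\<in>B. W x) * (\<Prod>x\<in>B. cnj (p \<phi> x)))"
      by (simp add: cnj_sum cnj_prod)
    then have "G \<phi> * cnj (G \<phi>) = (\<Sum>A\<in>Pow R. \<Sum>B\<in>Pow R. ((\<Prod>x\<in>A. cnj (W x)) * (\<Prod>x\<in>A. p \<phi> x)) *
        ((\<Prod>x\<in>B. W x) * (\<Prod>x\<in>B. cnj (p \<phi> x))))"
      unfolding G by (simp only: sum_product)
    then show ?thesis
      by (simp only: p_def mult_ac)
  qed
  \<comment> \<open>For distinct subsets of \<open>R\<close> the difference of the indicators is a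
    nonzero vector on \<open>R\<close>. By the choice of \<open>R\<close> some character of the word
    is not orthogonal to it, so that the two character sums differ.\<close>
  have off: "(\<integral>\<phi>. monomial A (\<lambda>x. x) B (\<lambda>x. x) \<phi> \<partial>angles d) = 0"
    if AB: "A \<in> Pow R" "B \<in> Pow R" "A \<noteq> B" for A B
  proof -
    have fin: "finite A" "finite B" using AB R(2) finite_subset by auto
    have "\<exists>a\<in>?S. (\<Sum>x\<in>A. chr a x) \<noteq> (\<Sum>x\<in>B. chr a x)"
    proof (rule ccontr)
      assume "\<not> ?thesis"
      then have eq: "(\<Sum>x\<in>A. chr a x) = (\<Sum>x\<in>B. chr a x)" if "a \<in> ?S" for a using that by blast
      define m where "m x = (if x \<in> A then 1 else 0) - (if x \<in> B then 1 else (0::real))" for x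
      have "(\<Sum>x\<in>R. m x * chr a x) = (\<Sum>x\<in>A. chr a x) - (\<Sum>x\<in>B. chr a x)" for a
      proof -
        have "(\<Sum>x\<in>R. (if x \<in> C then 1 else 0) * chr a x) = (\<Sum>x\<in>C. chr a x)" if "C \<subseteq> R" for C
          using that R(2) by (intro sum.mono_neutral_cong_right) auto
        then show ?thesis using AB by (simp add: m_def left_diff_distrib sum_subtractf)
      qed
      then have "\<forall>x\<in>R. m x = 0" using eq by (intro R(4)) simp
      moreover obtain x where "x \<in> A \<union> B" "(x \<in> A) \<noteq> (x \<in> B)" using AB(3) by blast
      ultimately show False using AB by (auto simp: m_def split: if_splits)
    qed
    then obtain a where "a \<in> ?S" "(\<Sum>x\<in>A. chr a x) \<noteq> (\<Sum>x\<in>B. chr a x)" by blast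
    then show ?thesis using fin by (rule integral_monomial_zero)
  qed
  \<comment> \<open>Only pairs of equal subsets remain, \<open>2 ^ card R\<close> terms of modulus
    at most one.\<close>
  have int: "(\<integral>\<phi>. G \<phi> * cnj (G \<phi>) \<partial>angles d)
      = (\<Sum>A\<in>Pow R. ((\<Prod>x\<in>A. cnj (W x)) * (\<Prod>x\<in>A. W x)) * (\<integral>\<phi>. monomial A (\<lambda>x. x) A (\<lambda>x. x) \<phi> \<partial>angles d))"
  proof -
    have "(\<integral>\<phi>. G \<phi> * cnj (G \<phi>) \<partial>angles d) = (\<Sum>A\<in>Pow R. \<Sum>B\<in>Pow R. ((\<Prod>x\<in>A. cnj (W x)) * (\<Prod>x\<in>B. W x)) *
        (\<integral>\<phi>. monomial A (\<lambda>x. x) B (\<lambda>x. x) \<phi> \<partial>angles d))"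
      unfolding expand
      by (simp add: integrable_monomial)
    also have "\<dots> = (\<Sum>A\<in>Pow R. \<Sum>B\<in>Pow R. if B = A then ((\<Prod>x\<in>A. cnj (W x)) * (\<Prod>x\<in>A. W x)) *
        (\<integral>\<phi>. monomial A (\<lambda>x. x) A (\<lambda>x. x) \<phi> \<partial>angles d) else 0)"
      using off by (intro sum.cong refl) auto
    finally show ?thesis using R(2) by simp
  qed
  have G2: "G \<phi> * cnj (G \<phi>) = complex_of_real ((cmod (G \<phi>))\<^sup>2)" for \<phi>
    by (simp only: complex_norm_square)
  have G_int: "integrable (angles d) (\<lambda>\<phi>. G \<phi> * cnj (G \<phi>))"
    unfolding expand by (intro Bochner_Integration.integrable_sum integrable_mult_right integrable_monomial)
  have G_int': "integrable (angles d) (\<lambda>\<phi>. (cmod (G \<phi>))\<^sup>2)"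
    using integrable_Re[OF G_int] unfolding G2 by simp
  have "(\<integral>\<phi>. (cmod (G \<phi>))\<^sup>2 \<partial>angles d) = cmod (\<integral>\<phi>. G \<phi> * cnj (G \<phi>) \<partial>angles d)"
    unfolding G2 integral_complex_of_real norm_of_real by (simp add: integral_nonneg_AE)
  also have "\<dots> \<le> (\<Sum>A\<in>Pow R. 1)"
    unfolding int
  proof (rule sum_norm_le)
    fix A assume A: "A \<in> Pow R"
    have "cmod (\<Prod>x\<in>A. W x) \<le> 1" "cmod (\<Prod>x\<in>A. cnj (W x)) \<le> 1"
      using A R(1) W by (auto simp: prod_norm[symmetric] intro!: prod_le_1)
    then show "cmod (((\<Prod>x\<in>A. cnj (W x)) * (\<Prod>x\<in>A. W x)) * (\<integral>\<phi>. monomial A (\<lambda>x. x) A (\<lambda>x. x) \<phi> \<partial>angles d)) \<le> 1"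
      using integral_monomial_le unfolding norm_mult by (intro mult_le_one norm_ge_zero mult_nonneg_nonneg)
  qed
  also have "\<dots> = 2 ^ ?r" using R(2,3) by (simp add: card_Pow)
  finally have moment: "(\<integral>\<phi>. (cmod (G \<phi>))\<^sup>2 \<partial>angles d) \<le> 2 ^ ?r" .
  \<comment> \<open>Within distance 1/5 every factor of \<open>G\<close> has modulus at least
    \<open>2 - 1 / 5\<close>. Markov's inequality compares \<open>2 ^ r\<close> with the
    \<open>r\<close>-th power of \<open>(9 / 5) ^ 2\<close>, which gives the ratio 50/81.\<close>
  have "prob {\<phi>\<in>space (angles d). \<forall>x\<in>?P. cmod (seq_phase \<omega> n ls \<phi> x - W x) \<le> 1 / 5}
      \<le> prob {\<phi>\<in>space (angles d). (cmod (G \<phi>))\<^sup>2 \<ge> (81 / 25) ^ ?r}"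
  proof (rule finite_measure_mono)
    show "{\<phi>\<in>space (angles d). \<forall>x\<in>?P. cmod (seq_phase \<omega> n ls \<phi> x - W x) \<le> 1 / 5}
        \<subseteq> {\<phi>\<in>space (angles d). (cmod (G \<phi>))\<^sup>2 \<ge> (81 / 25) ^ ?r}"
    proof safe
      fix \<phi> assume close: "\<forall>x\<in>?P. cmod (seq_phase \<omega> n ls \<phi> x - W x) \<le> 1 / 5"
      have "9 / 5 \<le> cmod (1 + cnj (W x) * p \<phi> x)" if "x \<in> R" for x
      proof -
        have px: "cmod (p \<phi> x) = 1" by (simp add: p_def cmod_seq_phase[OF \<omega>])
        have "p \<phi> x * cnj (p \<phi> x) = 1" using px complex_norm_square[of "p \<phi> x"] by simp
        then have "2 - (1 + cnj (W x) * p \<phi> x) = p \<phi> x * cnj (p \<phi> x - W x)"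
          by (simp add: algebra_simps)
        then have "cmod (2 - (1 + cnj (W x) * p \<phi> x)) = cmod (p \<phi> x - W x)"
          using px by (simp add: norm_mult del: complex_cnj_diff)
        moreover have "cmod (p \<phi> x - W x) \<le> 1 / 5" using close that R(1) by (auto simp: p_def)
        moreover have "cmod 2 \<le> cmod (2 - (1 + cnj (W x) * p \<phi> x)) + cmod (1 + cnj (W x) * p \<phi> x)"
          using norm_triangle_ineq[of "2 - (1 + cnj (W x) * p \<phi> x)" "1 + cnj (W x) * p \<phi> x"] by simp
        ultimately show ?thesis by simp
      qed
      then have "(\<Prod>x\<in>R. 9 / 5) \<le> (\<Prod>x\<in>R. cmod (1 + cnj (W x) * p \<phi> x))"
        by (intro prod_mono) auto
      then have "(9 / 5) ^ ?r \<le> cmod (G \<phi>)" by (simp add: G_def prod_norm R(3))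
      then have "((9 / 5) ^ ?r)\<^sup>2 \<le> (cmod (G \<phi>))\<^sup>2" by (intro power_mono) auto
      also have "((9 / 5) ^ ?r)\<^sup>2 = (81 / 25 :: real) ^ ?r"
        by (simp add: power_mult[symmetric] mult.commute[of _ 2]) (simp add: power_mult power2_eq_square)
      finally show "(81 / 25) ^ ?r \<le> (cmod (G \<phi>))\<^sup>2" .
    qed
    show "{\<phi>\<in>space (angles d). (cmod (G \<phi>))\<^sup>2 \<ge> (81 / 25) ^ ?r} \<in> sets (angles d)"
      using G_int' by (intro borel_measurable_le) auto
  qed
  also have "\<dots> \<le> (\<integral>\<phi>. (cmod (G \<phi>))\<^sup>2 \<partial>angles d) / (81 / 25) ^ ?r"
    by (rule integral_Markov_inequality_measure[OF G_int', of "space (angles d)"]) auto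
  also have "\<dots> \<le> 2 ^ ?r / (81 / 25) ^ ?r"
    using moment by (intro divide_right_mono) auto
  also have "\<dots> = (50 / 81) ^ ?r" by (simp add: power_divide[symmetric])
  finally show ?thesis .
qed

end

section \<open>Even moments of the overlap\<close>

lemma same_multiset_permutes:
  assumes T: "finite T" and eq: "\<And>z. card {j\<in>T. f j = z} = card {j\<in>T. g j = z}"
  shows "\<exists>\<sigma>. \<sigma> permutes T \<and> (\<forall>j\<in>T. g j = f (\<sigma> j))"
proof -
  have cnt: "count (image_mset h (mset_set T)) z = card {j\<in>T. h j = z}" for h :: "'a \<Rightarrow> 'b" and z
  proof -
    have "{j\<in>T. h j = z} = h -` {z} \<inter> set_mset (mset_set T)" using T by auto
    then show ?thesis using T by (simp add: count_image_mset)
  qed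
  have "image_mset g (mset_set T) = image_mset f (mset_set T)"
    by (rule multiset_eqI) (simp only: cnt eq)
  from image_mset_eq_implies_permutes[OF T this] show ?thesis by metis
qed

text \<open>At most \<open>fact t\<close> tuples \<open>g\<close> are rearrangements of a given
  \<open>f\<close>, and each has the same weight as \<open>f\<close>; the remaining sum of squared
  weights factors over the coordinates.\<close>

lemma sum_same_multiset:
  fixes c :: "'a \<Rightarrow> real"
  assumes X: "finite X" and c: "\<And>x. x \<in> X \<Longrightarrow> c x \<ge> 0"
  shows "(\<Sum>f\<in>Pi\<^sub>E {..<t} (\<lambda>_. X). \<Sum>g\<in>Pi\<^sub>E {..<t} (\<lambda>_. X).
      (\<Prod>j<t. c (f j)) * (\<Prod>j<t. c (g j)) * of_bool (\<forall>z. card {j\<in>{..<t}. f j = z} = card {j\<in>{..<t}. g j = z}))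
    \<le> fact t * (\<Sum>x\<in>X. (c x)\<^sup>2) ^ t"
proof -
  let ?F = "Pi\<^sub>E {..<t} (\<lambda>_. X)"
  let ?S = "{\<sigma>. \<sigma> permutes {..<t}}"
  let ?Q = "\<lambda>f g. \<forall>z. card {j\<in>{..<t}. f j = z} = card {j\<in>{..<t}. g j = z}"
  have finF: "finite ?F" using X by (intro finite_PiE) auto
  have finS: "finite ?S" by (simp add: finite_permutations)
  have "(\<Sum>g\<in>?F. (\<Prod>j<t. c (f j)) * (\<Prod>j<t. c (g j)) * of_bool (?Q f g)) \<le> fact t * (\<Prod>j<t. (c (f j))\<^sup>2)"
    if f: "f \<in> ?F" for f
  proof -
    have sq: "(\<Prod>j<t. c (f j)) * (\<Prod>j<t. c (g j)) = (\<Prod>j<t. (c (f j))\<^sup>2)"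
      if "\<sigma> permutes {..<t}" "\<forall>j\<in>{..<t}. g j = f (\<sigma> j)" for g \<sigma>
    proof -
      have "(\<Prod>j<t. c (g j)) = (\<Prod>j<t. c (f (\<sigma> j)))" using that by (intro prod.cong) auto
      also have "\<dots> = (\<Prod>j<t. c (f j))"
        using prod.permute[OF that(1), of "\<lambda>j. c (f j)"] by (simp add: o_def)
      finally show ?thesis by (simp add: power2_eq_square prod.distrib)
    qed
    have "{g\<in>?F. ?Q f g} \<subseteq> (\<lambda>\<sigma>. \<lambda>j\<in>{..<t}. f (\<sigma> j)) ` ?S"
    proof
      fix g assume g: "g \<in> {g\<in>?F. ?Q f g}"
      then obtain \<sigma> where \<sigma>: "\<sigma> permutes {..<t}" "\<forall>j\<in>{..<t}. g j = f (\<sigma> j)"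
        using same_multiset_permutes[of "{..<t}" f g] by auto
      have "g = (\<lambda>j\<in>{..<t}. f (\<sigma> j))"
        using g \<sigma>(2) by (auto simp: PiE_iff extensional_def restrict_def fun_eq_iff)
      then show "g \<in> (\<lambda>\<sigma>. \<lambda>j\<in>{..<t}. f (\<sigma> j)) ` ?S" using \<sigma>(1) by blast
    qed
    then have "card {g\<in>?F. ?Q f g} \<le> card ?S"
      using finS surj_card_le by blast
    also have "card ?S = fact t" using card_permutations[of "{..<t}" t] by simp
    finally have "card {g\<in>?F. ?Q f g} \<le> fact t" .
    then have "real (card {g\<in>?F. ?Q f g}) \<le> real (fact t)" by (rule of_nat_mono)
    then have card: "real (card {g\<in>?F. ?Q f g}) \<le> fact t" by simp
    have "(\<Sum>g\<in>?F. (\<Prod>j<t. c (f j)) * (\<Prod>j<t. c (g j)) * of_bool (?Q f g))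
        = (\<Sum>g\<in>{g\<in>?F. ?Q f g}. (\<Prod>j<t. (c (f j))\<^sup>2))"
    proof (rule sum.mono_neutral_cong_right)
      fix g assume "g \<in> {g\<in>?F. ?Q f g}"
      then have Q: "?Q f g" by simp
      then obtain \<sigma> where "\<sigma> permutes {..<t}" "\<forall>j\<in>{..<t}. g j = f (\<sigma> j)"
        using same_multiset_permutes[of "{..<t}" f g] by auto
      then show "(\<Prod>j<t. c (f j)) * (\<Prod>j<t. c (g j)) * of_bool (?Q f g) = (\<Prod>j<t. (c (f j))\<^sup>2)"
        using sq Q by simp
    qed (use finF in auto)
    also have "\<dots> = real (card {g\<in>?F. ?Q f g}) * (\<Prod>j<t. (c (f j))\<^sup>2)" by simp
    also have "\<dots> \<le> fact t * (\<Prod>j<t. (c (f j))\<^sup>2)"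
      by (intro mult_right_mono card prod_nonneg) auto
    finally show ?thesis .
  qed
  then have "(\<Sum>f\<in>?F. \<Sum>g\<in>?F. (\<Prod>j<t. c (f j)) * (\<Prod>j<t. c (g j)) * of_bool (?Q f g))
      \<le> (\<Sum>f\<in>?F. fact t * (\<Prod>j<t. (c (f j))\<^sup>2))"
    by (rule sum_mono)
  also have "\<dots> = fact t * (\<Sum>f\<in>?F. \<Prod>j<t. (c (f j))\<^sup>2)" by (simp add: sum_distrib_left)
  also have "(\<Sum>f\<in>?F. \<Prod>j<t. (c (f j))\<^sup>2) = (\<Sum>x\<in>X. (c x)\<^sup>2) ^ t"
    using prod_sum_PiE[of "{..<t}" "\<lambda>_. X" "\<lambda>_ x. (c x)\<^sup>2"] X by simp
  finally show ?thesis .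
qed

text \<open>Markov's inequality for the \<open>2 * t\<close>-th moment: the threshold 1/2 accounts
  for \<open>4 ^ t\<close>, and in the expanded moment only balanced pairs of tuples have nonzero
  mean.\<close>

lemma phase_moment_bound:
  fixes c :: "nat set \<Rightarrow> complex" and t :: nat
  assumes \<omega>: "\<omega> ^ 4 = -1" and n: "n \<ge> 2" and ls: "set ls \<subseteq> letters n" and len: "length ls = d"
  defines "F \<equiv> Pi\<^sub>E {..<t} (\<lambda>_. Pow {..<n})"
  shows "measure (angles d) {\<phi>\<in>space (angles d). cmod (\<Sum>x\<in>Pow {..<n}. c x * seq_phase \<omega> n ls \<phi> x) \<ge> 1 / 2}
    \<le> 4 ^ t * (\<Sum>f\<in>F. \<Sum>g\<in>F. (\<Prod>j<t. cmod (c (f j))) * (\<Prod>j<t. cmod (c (g j))) *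
        of_bool (balanced (phase_set n ls) {..<t} f g))"
proof -
  interpret prob_space "angles d" by (rule prob_space_angles)
  let ?P = "Pow {..<n}"
  define Z where "Z \<phi> = (\<Sum>x\<in>?P. c x * seq_phase \<omega> n ls \<phi> x)" for \<phi>
  define mon where "mon f g \<phi> = (\<Prod>j\<in>{..<t}. seq_phase \<omega> n ls \<phi> (f j)) * (\<Prod>j\<in>{..<t}. cnj (seq_phase \<omega> n ls \<phi> (g j)))" for f g :: "nat \<Rightarrow> nat set" and \<phi>
  have mon_int: "integrable (angles d) (mon f g)" for f g
    unfolding mon_def[abs_def] by (rule integrable_monomial[OF \<omega> n ls len])
  have expand: "Z \<phi> ^ t * cnj (Z \<phi> ^ t) = (\<Sum>f\<in>F. \<Sum>g\<in>F. ((\<Prod>j<t. c (f j)) * (\<Prod>j<t. cnj (c (g j)))) * mon f g \<phi>)" for \<phi>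
  proof -
    have Zt: "Z \<phi> ^ t = (\<Sum>f\<in>F. (\<Prod>j<t. c (f j)) * (\<Prod>j<t. seq_phase \<omega> n ls \<phi> (f j)))"
      using prod_sum_PiE[of "{..<t}" "\<lambda>_. ?P" "\<lambda>_ x. c x * seq_phase \<omega> n ls \<phi> x"]
      by (simp add: Z_def F_def prod.distrib)
    then have "cnj (Z \<phi> ^ t) = (\<Sum>g\<in>F. (\<Prod>j<t. cnj (c (g j))) * (\<Prod>j<t. cnj (seq_phase \<omega> n ls \<phi> (g j))))"
      by (simp add: cnj_sum cnj_prod)
    then have "Z \<phi> ^ t * cnj (Z \<phi> ^ t) = (\<Sum>f\<in>F. \<Sum>g\<in>F. ((\<Prod>j<t. c (f j)) * (\<Prod>j<t. seq_phase \<omega> n ls \<phi> (f j))) *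
        ((\<Prod>j<t. cnj (c (g j))) * (\<Prod>j<t. cnj (seq_phase \<omega> n ls \<phi> (g j)))))"
      unfolding Zt by (simp only: sum_product)
    then show ?thesis by (simp only: mon_def mult_ac)
  qed
  have Z2: "Z \<phi> ^ t * cnj (Z \<phi> ^ t) = complex_of_real ((cmod (Z \<phi>))\<^sup>2 ^ t)" for \<phi>
    by (simp only: complex_norm_square[symmetric] norm_power power_mult[symmetric] mult.commute)
  have int: "integrable (angles d) (\<lambda>\<phi>. Z \<phi> ^ t * cnj (Z \<phi> ^ t))"
    unfolding expand by (intro Bochner_Integration.integrable_sum integrable_mult_right mon_int)
  have int': "integrable (angles d) (\<lambda>\<phi>. (cmod (Z \<phi>))\<^sup>2 ^ t)"
    using integrable_Re[OF int] unfolding Z2 by simp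
  have "(\<integral>\<phi>. (cmod (Z \<phi>))\<^sup>2 ^ t \<partial>angles d) = cmod (\<integral>\<phi>. Z \<phi> ^ t * cnj (Z \<phi> ^ t) \<partial>angles d)"
    unfolding Z2 integral_complex_of_real norm_of_real by (simp add: integral_nonneg_AE)
  also have "(\<integral>\<phi>. Z \<phi> ^ t * cnj (Z \<phi> ^ t) \<partial>angles d)
      = (\<Sum>f\<in>F. \<Sum>g\<in>F. ((\<Prod>j<t. c (f j)) * (\<Prod>j<t. cnj (c (g j)))) * (\<integral>\<phi>. mon f g \<phi> \<partial>angles d))"
    unfolding expand by (simp add: mon_int)
  also have "cmod \<dots> \<le> (\<Sum>f\<in>F. \<Sum>g\<in>F. (\<Prod>j<t. cmod (c (f j))) * (\<Prod>j<t. cmod (c (g j))) *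
        of_bool (balanced (phase_set n ls) {..<t} f g))"
  proof (intro sum_norm_le)
    fix f g
    have "cmod (\<integral>\<phi>. mon f g \<phi> \<partial>angles d) \<le> of_bool (balanced (phase_set n ls) {..<t} f g)"
    proof (cases "balanced (phase_set n ls) {..<t} f g")
      case True
      then show ?thesis using integral_monomial_le[OF \<omega> n ls len, where J = "{..<t}" and x = f and K = "{..<t}" and y = g] by (simp add: mon_def)
    next
      case False
      then obtain a where "a \<in> phase_set n ls" "(\<Sum>j\<in>{..<t}. chr a (f j)) \<noteq> (\<Sum>j\<in>{..<t}. chr a (g j))"
        by (auto simp: balanced_def)
      from integral_monomial_zero[OF \<omega> n ls len this] show ?thesis by (simp add: mon_def)
    qed
    then show "cmod (((\<Prod>j<t. c (f j)) * (\<Prod>j<t. cnj (c (g j)))) * (\<integral>\<phi>. mon f g \<phi> \<partial>angles d))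
        \<le> (\<Prod>j<t. cmod (c (f j))) * (\<Prod>j<t. cmod (c (g j))) * of_bool (balanced (phase_set n ls) {..<t} f g)"
      unfolding norm_mult prod_norm[symmetric] complex_mod_cnj
      by (intro mult_left_mono) (auto intro!: mult_nonneg_nonneg prod_nonneg)
  qed
  finally have moment: "(\<integral>\<phi>. (cmod (Z \<phi>))\<^sup>2 ^ t \<partial>angles d) \<le> (\<Sum>f\<in>F. \<Sum>g\<in>F. (\<Prod>j<t. cmod (c (f j))) * (\<Prod>j<t. cmod (c (g j))) *
        of_bool (balanced (phase_set n ls) {..<t} f g))" .
  have "prob {\<phi>\<in>space (angles d). cmod (Z \<phi>) \<ge> 1 / 2} \<le> prob {\<phi>\<in>space (angles d). (cmod (Z \<phi>))\<^sup>2 ^ t \<ge> (1 / 4) ^ t}"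
  proof (rule finite_measure_mono)
    show "{\<phi>\<in>space (angles d). cmod (Z \<phi>) \<ge> 1 / 2} \<subseteq> {\<phi>\<in>space (angles d). (cmod (Z \<phi>))\<^sup>2 ^ t \<ge> (1 / 4) ^ t}"
    proof safe
      fix \<phi> assume "1 / 2 \<le> cmod (Z \<phi>)"
      then have "(1 / 2)\<^sup>2 \<le> (cmod (Z \<phi>))\<^sup>2" by (intro power_mono) auto
      then show "(1 / 4) ^ t \<le> (cmod (Z \<phi>))\<^sup>2 ^ t"
        by (intro power_mono) (simp_all add: power2_eq_square)
    qed
    show "{\<phi>\<in>space (angles d). (cmod (Z \<phi>))\<^sup>2 ^ t \<ge> (1 / 4) ^ t} \<in> sets (angles d)"
      using int' by (intro borel_measurable_le) auto
  qed
  also have "\<dots> \<le> (\<integral>\<phi>. (cmod (Z \<phi>))\<^sup>2 ^ t \<partial>angles d) / (1 / 4) ^ t"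
    by (rule integral_Markov_inequality_measure[OF int', of "space (angles d)"]) auto
  also have "\<dots> = 4 ^ t * (\<integral>\<phi>. (cmod (Z \<phi>))\<^sup>2 ^ t \<partial>angles d)"
    by (simp add: power_divide)
  also have "\<dots> \<le> 4 ^ t * (\<Sum>f\<in>F. \<Sum>g\<in>F. (\<Prod>j<t. cmod (c (f j))) * (\<Prod>j<t. cmod (c (g j))) *
        of_bool (balanced (phase_set n ls) {..<t} f g))"
    using moment by (intro mult_left_mono) auto
  finally show ?thesis by (simp add: Z_def)
qed

text \<open>Averaged over words, rearranged pairs of tuples contribute at most
  \<open>fact t * s ^ t\<close>. Every other pair survives only with small probability, and the
  total weight of all pairs is at most one by the first norm bound.\<close>

lemma phase_overlap:
  fixes c :: "nat set \<Rightarrow> complex"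
  assumes \<omega>: "\<omega> ^ 4 = -1" and n: "n \<ge> 2"
    and c1: "(\<Sum>x\<in>Pow {..<n}. cmod (c x)) \<le> 1" and c2: "(\<Sum>x\<in>Pow {..<n}. (cmod (c x))\<^sup>2) \<le> s"
  shows "seq_avg n d (\<lambda>ls. measure (angles d) {\<phi>\<in>space (angles d). cmod (\<Sum>x\<in>Pow {..<n}. c x * seq_phase \<omega> n ls \<phi> x) \<ge> 1 / 2})
    \<le> 4 ^ t * (fact t * s ^ t + (1 - 1 / (8 * real t)) ^ (d div block n))"
proof -
  let ?P = "Pow {..<n}"
  let ?F = "Pi\<^sub>E {..<t} (\<lambda>_. ?P)"
  let ?w = "\<lambda>f. \<Prod>j<t. cmod (c (f j))"
  let ?Q = "\<lambda>f g. \<forall>z. card {j\<in>{..<t}. f j = z} = card {j\<in>{..<t}. g j = z}"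
  define q where "q = (1 - 1 / (8 * real t)) ^ (d div block n)"
  have q: "0 \<le> q" unfolding q_def by (intro zero_le_power) (cases "t = 0", simp_all)
  have w: "?w f \<ge> 0" for f :: "nat \<Rightarrow> nat set" by (intro prod_nonneg) auto
  have surv: "seq_avg n d (\<lambda>ls. of_bool (balanced (phase_set n ls) {..<t} f g)) \<le> of_bool (?Q f g) + q"
    if fg: "f \<in> ?F" "g \<in> ?F" for f g
  proof (cases "?Q f g")
    case True
    have "seq_avg n d (\<lambda>ls. of_bool (balanced (phase_set n ls) {..<t} f g)) \<le> seq_avg n d (\<lambda>ls. 1)"
      by (intro seq_avg_mono) auto
    moreover have "of_bool (?Q f g) = (1::real)" using True by simp
    ultimately show ?thesis using q n by (simp only: seq_avg_const)
  next
    case False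
    then obtain z where z: "card {j\<in>{..<t}. f j = z} \<noteq> card {j\<in>{..<t}. g j = z}" by blast
    have img: "f ` {..<t} \<subseteq> ?P" "g ` {..<t} \<subseteq> ?P" using fg by blast+
    have "seq_avg n (block n * (d div block n) + d mod block n) (\<lambda>ls. of_bool (balanced (phase_set n ls) {..<t} f g)) \<le> q"
      unfolding q_def by (rule balanced_survival[OF n _ _ img z]) simp_all
    moreover have "(0::real) \<le> of_bool (?Q f g)" by simp
    ultimately show ?thesis unfolding mult_div_mod_eq by linarith
  qed
  have "seq_avg n d (\<lambda>ls. measure (angles d) {\<phi>\<in>space (angles d). cmod (\<Sum>x\<in>?P. c x * seq_phase \<omega> n ls \<phi> x) \<ge> 1 / 2})
    \<le> seq_avg n d (\<lambda>ls. \<Sum>f\<in>?F. \<Sum>g\<in>?F. of_bool (balanced (phase_set n ls) {..<t} f g) * (4 ^ t * (?w f * ?w g)))"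
  proof (rule seq_avg_mono)
    fix ls assume ls: "set ls \<subseteq> letters n" "length ls = d"
    show "measure (angles d) {\<phi>\<in>space (angles d). cmod (\<Sum>x\<in>?P. c x * seq_phase \<omega> n ls \<phi> x) \<ge> 1 / 2}
      \<le> (\<Sum>f\<in>?F. \<Sum>g\<in>?F. of_bool (balanced (phase_set n ls) {..<t} f g) * (4 ^ t * (?w f * ?w g)))"
      using phase_moment_bound[OF \<omega> n ls, of c t] by (simp add: sum_distrib_left mult_ac)
  qed
  also have "\<dots> = (\<Sum>f\<in>?F. \<Sum>g\<in>?F. seq_avg n d (\<lambda>ls. of_bool (balanced (phase_set n ls) {..<t} f g)) * (4 ^ t * (?w f * ?w g)))"
    using n by (simp add: seq_avg_sum seq_avg_mult_right)
  also have "\<dots> \<le> (\<Sum>f\<in>?F. \<Sum>g\<in>?F. (of_bool (?Q f g) + q) * (4 ^ t * (?w f * ?w g)))"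
    using w by (intro sum_mono mult_right_mono surv mult_nonneg_nonneg) auto
  also have "\<dots> = 4 ^ t * ((\<Sum>f\<in>?F. \<Sum>g\<in>?F. ?w f * ?w g * of_bool (?Q f g)) + q * (\<Sum>f\<in>?F. \<Sum>g\<in>?F. ?w f * ?w g))"
    by (simp only: sum_distrib_left distrib_right distrib_left sum.distrib mult_ac)
  also have "\<dots> \<le> 4 ^ t * (fact t * s ^ t + q * 1)"
  proof (intro mult_left_mono add_mono)
    have "(\<Sum>f\<in>?F. \<Sum>g\<in>?F. ?w f * ?w g * of_bool (?Q f g)) \<le> fact t * (\<Sum>x\<in>?P. (cmod (c x))\<^sup>2) ^ t"
      by (rule sum_same_multiset) auto
    also have "\<dots> \<le> fact t * s ^ t"
      using c2 by (intro mult_left_mono power_mono sum_nonneg) auto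
    finally show "(\<Sum>f\<in>?F. \<Sum>g\<in>?F. ?w f * ?w g * of_bool (?Q f g)) \<le> fact t * s ^ t" .
    have "(\<Sum>f\<in>?F. ?w f) = (\<Sum>x\<in>?P. cmod (c x)) ^ t"
      using prod_sum_PiE[of "{..<t}" "\<lambda>_. ?P" "\<lambda>_ x. cmod (c x)"] by simp
    also have "\<dots> \<le> 1" using c1 by (intro power_le_one sum_nonneg) auto
    finally have "(\<Sum>f\<in>?F. ?w f) \<le> 1" .
    then have "(\<Sum>f\<in>?F. ?w f) * (\<Sum>g\<in>?F. ?w g) \<le> 1"
      using w by (intro mult_le_one sum_nonneg) auto
    then show "(\<Sum>f\<in>?F. \<Sum>g\<in>?F. ?w f * ?w g) \<le> 1" by (simp only: sum_product)
  qed (use q in auto)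
  finally show ?thesis by (simp add: q_def)
qed

section \<open>Probability of being close to a fixed matrix\<close>

lemma borel_measurable_cmod:
  "f \<in> borel_measurable M \<Longrightarrow> (\<lambda>x. cmod (f x)) \<in> borel_measurable M"
  by (rule measurable_compose[OF _ borel_measurable_norm])

lemma sets_entries_close:
  "{U \<in> carrier_mat N N. \<forall>k<N. \<forall>c<N. cmod (U $$ (k, c) - V $$ (k, c)) \<le> e} \<in> sets (borel_mat N)"
proof -
  have "{U \<in> space (borel_mat N). \<forall>k\<in>{..<N}. \<forall>c\<in>{..<N}. cmod (U $$ (k, c) - V $$ (k, c)) \<le> e} \<in> sets (borel_mat N)"
  proof (intro sets.sets_Collect_finite_All finite_lessThan)
    fix k c assume "k \<in> {..<N}" "c \<in> {..<N}"
    then have "(\<lambda>U. cmod (U $$ (k, c) - V $$ (k, c))) \<in> borel_measurable (borel_mat N)"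
      by (intro borel_measurable_cmod borel_measurable_diff borel_measurable_const
          measurable_entry[OF measurable_ident_sets[OF refl]]) auto
    then show "{U \<in> space (borel_mat N). cmod (U $$ (k, c) - V $$ (k, c)) \<le> e} \<in> sets (borel_mat N)"
      by (intro borel_measurable_le) auto
  qed
  then show ?thesis by (simp only: space_borel_mat lessThan_iff Ball_def)
qed

lemma circuit_entry:
  assumes n: "n \<ge> 2" and ls: "set ls \<subseteq> letters n" and x: "x \<in> Pow {..<n}"
  shows "circuit \<omega> n ls \<phi> $$ (basis_index n x, basis_index n (seq_map n ls x)) = seq_phase \<omega> n ls \<phi> x"
proof -
  define c where "c = basis_index n (seq_map n ls x)"
  have y: "seq_map n ls x \<in> Pow {..<n}" using seq_map_mem[OF n ls x] .
  have c: "c < 2 ^ n" and k: "basis_index n x < 2 ^ n" using x y by (simp_all add: c_def basis_index_less)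
  have "circuit \<omega> n ls \<phi> $$ (basis_index n x, c) = amp n (circuit \<omega> n ls \<phi> *\<^sub>v unit_vec (2 ^ n) c) x"
    using c k unfolding amp_def
    by (subst index_mult_mat_vec) (auto simp: scalar_prod_right_unit)
  also have "\<dots> = seq_phase \<omega> n ls \<phi> x * amp n (unit_vec (2 ^ n) c) (seq_map n ls x)"
    using x by (intro amp_circuit n ls) auto
  also have "amp n (unit_vec (2 ^ n) c) (seq_map n ls x) = 1"
    using c by (simp add: amp_def c_def[symmetric])
  finally show ?thesis by (simp add: c_def)
qed

text \<open>This puts \<open>d\<close> in the range in which half of the cube is still
  unseen.\<close>

lemma powr_half_le:
  assumes "n \<ge> 2"
  shows "2 powr (real n / 2) \<le> 2 ^ (n - 1)"
proof -
  have "2 powr (real n / 2) \<le> 2 powr real (n - 1)"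
    using assms by (intro powr_mono) (simp_all add: of_nat_diff field_simps)
  then show ?thesis by (simp add: powr_realpow)
qed

text \<open>For a fixed word the nonzero entries of the circuit stand at known places, one in each
  row, so closeness to \<open>V\<close> prescribes all phases approximately. The bound by the number
  of distinct characters is then averaged over words.\<close>

lemma circuit_ball:
  assumes \<omega>: "\<omega> ^ 4 = -1" and n: "n \<ge> 2" and d: "d \<ge> 1" "real d \<le> 2 powr (real n / 2)"
    and V: "\<And>k c. k < 2 ^ n \<Longrightarrow> c < 2 ^ n \<Longrightarrow> cmod (V $$ (k, c)) \<le> 1"
  shows "measure (zeta_circuit \<omega> n d)
      {U \<in> carrier_mat (2 ^ n) (2 ^ n). \<forall>k<2 ^ n. \<forall>c<2 ^ n. cmod (U $$ (k, c) - V $$ (k, c)) \<le> 1 / 5}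
    \<le> exp (- (31 / 1296 * real d / real (block n)))"
proof -
  let ?E = "{U \<in> carrier_mat (2 ^ n) (2 ^ n). \<forall>k<2 ^ n. \<forall>c<2 ^ n. cmod (U $$ (k, c) - V $$ (k, c)) \<le> 1 / 5}"
  have "measure (zeta_circuit \<omega> n d) ?E = seq_avg n d (\<lambda>ls. measure (angles d) {\<phi>\<in>space (angles d). circuit \<omega> n ls \<phi> \<in> ?E})"
    using n by (intro measure_circuit sets_entries_close) simp
  also have "\<dots> \<le> seq_avg n d (\<lambda>ls. (50 / 81) ^ card (phase_set n ls))"
  proof (rule seq_avg_mono)
    fix ls assume ls: "set ls \<subseteq> letters n" and len: "length ls = d"
    interpret prob_space "angles d" by (rule prob_space_angles)
    define W where "W x = V $$ (basis_index n x, basis_index n (seq_map n ls x))" for x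
    have idx: "basis_index n x < 2 ^ n" "basis_index n (seq_map n ls x) < 2 ^ n" if "x \<in> Pow {..<n}" for x
      using seq_map_mem[OF n ls that] that by (simp_all add: basis_index_less)
    have "measure (angles d) {\<phi>\<in>space (angles d). circuit \<omega> n ls \<phi> \<in> ?E}
        \<le> measure (angles d) {\<phi>\<in>space (angles d). \<forall>x\<in>Pow {..<n}. cmod (seq_phase \<omega> n ls \<phi> x - W x) \<le> 1 / 5}"
    proof (rule finite_measure_mono)
      show "{\<phi>\<in>space (angles d). circuit \<omega> n ls \<phi> \<in> ?E}
          \<subseteq> {\<phi>\<in>space (angles d). \<forall>x\<in>Pow {..<n}. cmod (seq_phase \<omega> n ls \<phi> x - W x) \<le> 1 / 5}"
      proof safe
        fix \<phi> x assume "\<forall>k<2 ^ n. \<forall>c<2 ^ n. cmod (circuit \<omega> n ls \<phi> $$ (k, c) - V $$ (k, c)) \<le> 1 / 5"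
          and "x \<subseteq> {..<n}"
        then show "cmod (seq_phase \<omega> n ls \<phi> x - W x) \<le> 1 / 5"
          using idx[of x] circuit_entry[OF n ls, of x \<omega> \<phi>] by (metis W_def PowI)
      qed
      show "{\<phi>\<in>space (angles d). \<forall>x\<in>Pow {..<n}. cmod (seq_phase \<omega> n ls \<phi> x - W x) \<le> 1 / 5} \<in> sets (angles d)"
        by (intro sets.sets_Collect_finite_All borel_measurable_le borel_measurable_cmod borel_measurable_diff
            borel_measurable_const measurable_seq_phase len finite_Pow_iff[THEN iffD2]) simp
    qed
    also have "\<dots> \<le> (50 / 81) ^ card (phase_set n ls)"
      by (rule phase_ball[OF \<omega> n ls len]) (use V idx in \<open>simp add: W_def\<close>)
    finally show "measure (angles d) {\<phi>\<in>space (angles d). circuit \<omega> n ls \<phi> \<in> ?E} \<le> (50 / 81) ^ card (phase_set n ls)" .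
  qed
  \<comment> \<open>The factor \<open>(1 - 50 / 81) / 16\<close> is 31/1296.\<close>
  also have "\<dots> \<le> exp (- ((1 - 50 / 81) * real d / (16 * real (block n))))"
    using phase_count[OF n _ _ d(1) order_trans[OF d(2) powr_half_le[OF n]], of "50 / 81"] by simp
  finally show ?thesis by simp
qed

section \<open>Product states\<close>

lemma dim_kron_power: "dim_vec v = 2 \<Longrightarrow> dim_vec (kron_power v n) = 2 ^ n"
  by (induction n) (simp_all add: kron_vec_def)

lemma kron_power_plus:
  "k < 2 ^ n \<Longrightarrow> kron_power ket_plus n $ k = (1 / complex_of_real (sqrt 2)) ^ n"
proof (induction n arbitrary: k)
  case (Suc n)
  have dim: "dim_vec ket_plus = 2" by (simp add: ket_plus_def ket0_def ket1_def)
  have "ket_plus $ i = 1 / complex_of_real (sqrt 2)" if "i < 2" for i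
    using that by (auto simp: ket_plus_def ket0_def ket1_def less_2_cases_iff)
  moreover have "k div 2 ^ n < 2" using Suc.prems by (simp add: less_mult_imp_div_less)
  ultimately show ?case
    using Suc dim by (simp add: kron_vec_def dim_kron_power)
qed simp

lemma kron_power_0: "kron_power ket0 n = unit_vec (2 ^ n) 0"
proof (induction n)
  case (Suc n)
  have eq: "kron_power ket0 (Suc n) = kron_vec (unit_vec 2 0) (unit_vec (2 ^ n) 0)"
    by (simp add: Suc) (simp add: ket0_def)
  show ?case
    unfolding eq
  proof (rule eq_vecI)
    fix i assume "i < dim_vec (unit_vec (2 ^ Suc n) 0 :: complex vec)"
    then have i: "i < 2 * 2 ^ n" by simp
    have d: "i div 2 ^ n < 2" using i by (simp add: less_mult_imp_div_less)
    have "i = 0 \<longleftrightarrow> i div 2 ^ n = 0 \<and> i mod 2 ^ n = 0"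
      by (metis div_mult_mod_eq add_0 mult_0 div_0 mod_0)
    then show "kron_vec (unit_vec 2 0) (unit_vec (2 ^ n) 0) $ i = unit_vec (2 ^ Suc n) 0 $ i"
      using i d by (simp add: kron_vec_def unit_vec_def)
  qed (simp add: kron_vec_def)
qed simp

lemma kron_power_plus_carrier: "kron_power ket_plus n \<in> carrier_vec (2 ^ n)"
  by (intro carrier_vecI dim_kron_power) (simp add: ket_plus_def ket0_def ket1_def)

definition inner_vec :: "complex vec \<Rightarrow> complex vec \<Rightarrow> complex" where
  "inner_vec w v = (\<Sum>k<dim_vec v. cnj (w $ k) * v $ k)"

lemma euclidean_norm_sq: "(euclidean_norm v)\<^sup>2 = (\<Sum>k<dim_vec v. (cmod (v $ k))\<^sup>2)"
  unfolding euclidean_norm_def by (rule real_sqrt_pow2) (simp add: sum_nonneg)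

lemma measurable_mult_vec:
  assumes "k < N" "v \<in> carrier_vec N"
  shows "(\<lambda>U. (U *\<^sub>v v) $ k) \<in> borel_measurable (borel_mat N)"
proof -
  have "(\<lambda>U. \<Sum>c<N. U $$ (k, c) * v $ c) \<in> borel_measurable (borel_mat N)"
    using assms by (intro borel_measurable_sum borel_measurable_times borel_measurable_const
        measurable_entry[OF measurable_ident_sets[OF refl]]) auto
  also have "?this \<longleftrightarrow> ?thesis"
    using assms by (intro measurable_cong) (auto simp: scalar_prod_def atLeast0LessThan)
  finally show ?thesis .
qed

lemma sets_overlap:
  assumes "v \<in> carrier_vec N"
  shows "{U \<in> carrier_mat N N. cmod (inner_vec w (U *\<^sub>v v)) \<ge> e} \<in> sets (borel_mat N)"
proof -
  have "(\<lambda>U. cmod (\<Sum>k<N. cnj (w $ k) * (U *\<^sub>v v) $ k)) \<in> borel_measurable (borel_mat N)"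
    using assms by (intro borel_measurable_cmod borel_measurable_sum borel_measurable_times borel_measurable_const
        measurable_mult_vec) auto
  then have "{U \<in> space (borel_mat N). cmod (\<Sum>k<N. cnj (w $ k) * (U *\<^sub>v v) $ k) \<ge> e} \<in> sets (borel_mat N)"
    by (intro borel_measurable_le) auto
  also have "{U \<in> space (borel_mat N). cmod (\<Sum>k<N. cnj (w $ k) * (U *\<^sub>v v) $ k) \<ge> e}
      = {U \<in> carrier_mat N N. cmod (inner_vec w (U *\<^sub>v v)) \<ge> e}"
    by (auto simp: inner_vec_def)
  finally show ?thesis .
qed

lemma amp_circuit_plus:
  assumes n: "n \<ge> 2" and ls: "set ls \<subseteq> letters n" and x: "x \<in> Pow {..<n}"
  shows "amp n (circuit \<omega> n ls \<phi> *\<^sub>v kron_power ket_plus n) x = seq_phase \<omega> n ls \<phi> x * (1 / complex_of_real (sqrt 2)) ^ n"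
proof -
  have "amp n (kron_power ket_plus n) (seq_map n ls x) = (1 / complex_of_real (sqrt 2)) ^ n"
    unfolding amp_def using seq_map_mem[OF n ls x] by (intro kron_power_plus basis_index_less) auto
  then show ?thesis using amp_circuit[OF n ls kron_power_plus_carrier] x by simp
qed

lemma cmod_sqrt2_power: "cmod ((1 / complex_of_real (sqrt 2)) ^ n) = 1 / sqrt (2 ^ n)"
  by (simp add: norm_power norm_divide power_divide real_sqrt_power)

text \<open>All amplitudes of the plus state equal \<open>2\<close> to the power
  \<open>- n / 2\<close>, so the coefficients of the phases are those of \<open>w\<close> scaled
  down: their squares sum to at most \<open>1 / 2 ^ n\<close>, and by Cauchy-Schwarz their moduli
  sum to at most one.\<close>

lemma circuit_overlap:
  assumes \<omega>: "\<omega> ^ 4 = -1" and n: "n \<ge> 2" and w: "w \<in> carrier_vec (2 ^ n)" "euclidean_norm w \<le> 1"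
  shows "measure (zeta_circuit \<omega> n d)
      {U \<in> carrier_mat (2 ^ n) (2 ^ n). cmod (inner_vec w (U *\<^sub>v kron_power ket_plus n)) \<ge> 1 / 2}
    \<le> 4 ^ t * (fact t * (1 / 2 ^ n) ^ t + (1 - 1 / (8 * real t)) ^ (d div block n))"
proof -
  let ?E = "{U \<in> carrier_mat (2 ^ n) (2 ^ n). cmod (inner_vec w (U *\<^sub>v kron_power ket_plus n)) \<ge> 1 / 2}"
  let ?P = "Pow {..<n}"
  let ?z = "(1 / complex_of_real (sqrt 2)) ^ n"
  define c where "c x = cnj (amp n w x) * ?z" for x
  have w2: "(\<Sum>x\<in>?P. (cmod (amp n w x))\<^sup>2) \<le> 1"
  proof -
    have "(\<Sum>x\<in>?P. (cmod (amp n w x))\<^sup>2) = (euclidean_norm w)\<^sup>2"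
      using sum_basis[of "\<lambda>a _. (cmod a)\<^sup>2" w n] w by (simp add: euclidean_norm_sq)
    also have "\<dots> \<le> 1"
      using w(2) by (intro power_le_one) (auto simp: euclidean_norm_def intro!: sum_nonneg)
    finally show ?thesis .
  qed
  have c2: "(\<Sum>x\<in>?P. (cmod (c x))\<^sup>2) \<le> 1 / 2 ^ n"
  proof -
    have "(\<Sum>x\<in>?P. (cmod (c x))\<^sup>2) = (\<Sum>x\<in>?P. (cmod (amp n w x))\<^sup>2) / 2 ^ n"
      unfolding c_def norm_mult cmod_sqrt2_power complex_mod_cnj sum_divide_distrib
      by (intro sum.cong refl) (simp add: power_mult_distrib power_divide)
    then show ?thesis using w2 by (simp add: divide_right_mono)
  qed
  have c1: "(\<Sum>x\<in>?P. cmod (c x)) \<le> 1"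
  proof -
    have "(\<Sum>x\<in>?P. cmod (c x))\<^sup>2 \<le> (\<Sum>x\<in>?P. (cmod (c x))\<^sup>2) * real (card ?P)"
      by (rule sum_squared_le_sum_of_squares)
    also have "\<dots> \<le> 1 / 2 ^ n * 2 ^ n"
      using c2 by (intro mult_mono) (auto simp: card_Pow)
    finally have "(\<Sum>x\<in>?P. cmod (c x))\<^sup>2 \<le> 1" by simp
    then show ?thesis by (simp add: abs_square_le_1 abs_le_iff)
  qed
  have "measure (zeta_circuit \<omega> n d) ?E = seq_avg n d (\<lambda>ls. measure (angles d) {\<phi>\<in>space (angles d). circuit \<omega> n ls \<phi> \<in> ?E})"
    using n by (intro measure_circuit sets_overlap kron_power_plus_carrier) simp
  also have "\<dots> = seq_avg n d (\<lambda>ls. measure (angles d) {\<phi>\<in>space (angles d). cmod (\<Sum>x\<in>?P. c x * seq_phase \<omega> n ls \<phi> x) \<ge> 1 / 2})"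
  proof (rule seq_avg_cong)
    fix ls assume ls: "set ls \<subseteq> letters n"
    have "inner_vec w (circuit \<omega> n ls \<phi> *\<^sub>v kron_power ket_plus n) = (\<Sum>x\<in>?P. c x * seq_phase \<omega> n ls \<phi> x)" for \<phi>
    proof -
      let ?v = "circuit \<omega> n ls \<phi> *\<^sub>v kron_power ket_plus n"
      have "dim_vec ?v = 2 ^ n" by simp
      then have "inner_vec w ?v = (\<Sum>k<2 ^ n. cnj (w $ k) * ?v $ k)" by (simp only: inner_vec_def)
      also have "\<dots> = (\<Sum>x\<in>?P. cnj (w $ basis_index n x) * amp n ?v x)"
        by (rule sum_basis)
      also have "\<dots> = (\<Sum>x\<in>?P. c x * seq_phase \<omega> n ls \<phi> x)"
        by (intro sum.cong refl) (simp add: amp_circuit_plus[OF n ls] c_def amp_def[of n w] mult_ac)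
      finally show ?thesis .
    qed
    then show "measure (angles d) {\<phi>\<in>space (angles d). circuit \<omega> n ls \<phi> \<in> ?E}
        = measure (angles d) {\<phi>\<in>space (angles d). cmod (\<Sum>x\<in>?P. c x * seq_phase \<omega> n ls \<phi> x) \<ge> 1 / 2}" by simp
  qed
  also have "\<dots> \<le> 4 ^ t * (fact t * (1 / 2 ^ n) ^ t + (1 - 1 / (8 * real t)) ^ (d div block n))"
    by (rule phase_overlap[OF \<omega> n c1 c2])
  finally show ?thesis .
qed

section \<open>Norms and nets of circuits\<close>

lemma euclidean_norm_L2: "euclidean_norm v = L2_set (\<lambda>i. cmod (v $ i)) {..<dim_vec v}"
  by (simp add: euclidean_norm_def L2_set_def)

lemma euclidean_norm_nonneg [simp]: "euclidean_norm v \<ge> 0"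
  by (simp add: euclidean_norm_L2)

lemma euclidean_norm_triangle:
  assumes "u \<in> carrier_vec N" "v \<in> carrier_vec N" "w \<in> carrier_vec N"
  shows "euclidean_norm (u - w) \<le> euclidean_norm (u - v) + euclidean_norm (v - w)"
proof -
  have "euclidean_norm (u - w) = L2_set (\<lambda>i. cmod (u $ i - w $ i)) {..<N}"
    using assms unfolding euclidean_norm_L2 by (intro L2_set_cong) auto
  also have "\<dots> \<le> L2_set (\<lambda>i. cmod (u $ i - v $ i) + cmod (v $ i - w $ i)) {..<N}"
  proof (rule L2_set_mono)
    show "cmod (u $ i - w $ i) \<le> cmod (u $ i - v $ i) + cmod (v $ i - w $ i)" for i
      using norm_triangle_ineq[of "u $ i - v $ i" "v $ i - w $ i"] by simp
  qed simp
  also have "\<dots> \<le> L2_set (\<lambda>i. cmod (u $ i - v $ i)) {..<N} + L2_set (\<lambda>i. cmod (v $ i - w $ i)) {..<N}"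
    by (rule L2_set_triangle_ineq)
  also have "L2_set (\<lambda>i. cmod (u $ i - v $ i)) {..<N} = euclidean_norm (u - v)"
    using assms unfolding euclidean_norm_L2 by (intro L2_set_cong) auto
  also have "L2_set (\<lambda>i. cmod (v $ i - w $ i)) {..<N} = euclidean_norm (v - w)"
    using assms unfolding euclidean_norm_L2 by (intro L2_set_cong) auto
  finally show ?thesis .
qed

lemma entry_le_euclidean_norm: "k < dim_vec v \<Longrightarrow> cmod (v $ k) \<le> euclidean_norm v"
  unfolding euclidean_norm_L2 by (rule member_le_L2_set) auto

lemma euclidean_norm_unit_vec: "c < N \<Longrightarrow> euclidean_norm (unit_vec N c) = 1"
  by (simp add: euclidean_norm_def unit_vec_def if_distrib[of cmod] if_distrib[of "\<lambda>x. x\<^sup>2"] cong: if_cong)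

lemma euclidean_norm_amp:
  "u \<in> carrier_vec (2 ^ n) \<Longrightarrow> (euclidean_norm u)\<^sup>2 = (\<Sum>x\<in>Pow {..<n}. (cmod (amp n u x))\<^sup>2)"
  using sum_basis[of "\<lambda>a _. (cmod a)\<^sup>2" u n] by (simp add: euclidean_norm_sq)

lemma sum_Pow_set_pair:
  fixes \<Phi> :: "nat set \<Rightarrow> real"
  assumes I: "finite I" and ij: "i \<in> I" "j \<in> I" "i \<noteq> j"
  shows "(\<Sum>x\<in>Pow I. \<Phi> x) = (\<Sum>r\<in>Pow (I - {i, j}). \<Sum>v<4. \<Phi> (set_pair i j v r))"
  unfolding sum_Pow_pair[OF assms]
proof (intro sum.cong refl)
  fix r assume "r \<in> Pow (I - {i, j})"
  then have "r - {i, j} = r" by auto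
  then have "set_pair i j 0 r = r" "set_pair i j 1 r = insert j r" "set_pair i j 2 r = insert i r"
      "set_pair i j 3 r = insert i (insert j r)"
    by (auto simp: set_pair_def)
  then show "\<Phi> r + \<Phi> (insert i r) + \<Phi> (insert j r) + \<Phi> (insert i (insert j r)) = (\<Sum>v<4. \<Phi> (set_pair i j v r))"
    by (simp add: sum_less_4)
qed

lemma mat_adjoint_entry:
  "A \<in> carrier_mat N N \<Longrightarrow> i < N \<Longrightarrow> j < N \<Longrightarrow> mat_adjoint A $$ (i, j) = cnj (A $$ (j, i))"
  by (simp add: mat_adjoint_def mat_of_rows_index)

lemma mat_adjoint_carrier: "A \<in> carrier_mat N N \<Longrightarrow> mat_adjoint A \<in> carrier_mat N N"
  by (rule carrier_matI) (simp_all add: mat_adjoint_def)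

lemma unitary_isometry:
  assumes A: "A \<in> carrier_mat N N" "A * mat_adjoint A = 1\<^sub>m N"
  shows "(\<Sum>r<N. (cmod (\<Sum>w<N. A $$ (r, w) * y w))\<^sup>2) = (\<Sum>w<N. (cmod (y w))\<^sup>2)"
proof -
  \<comment> \<open>Unitarity is given by a right inverse, whereas preserving norms needs the left
    one; for square matrices they agree.\<close>
  have inv: "mat_adjoint A * A = 1\<^sub>m N"
    using mat_mult_left_right_inverse[OF A(1) mat_adjoint_carrier[OF A(1)] A(2)] .
  have orth: "(\<Sum>r<N. cnj (A $$ (r, a)) * A $$ (r, b)) = (if a = b then 1 else 0)" if "a < N" "b < N" for a b
  proof -
    have "(mat_adjoint A * A) $$ (a, b) = (\<Sum>r<N. mat_adjoint A $$ (a, r) * A $$ (r, b))"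
      using that A(1) mat_adjoint_carrier[OF A(1)] by (simp add: scalar_prod_def atLeast0LessThan)
    also have "\<dots> = (\<Sum>r<N. cnj (A $$ (r, a)) * A $$ (r, b))"
      using that A(1) by (intro sum.cong) (auto simp: mat_adjoint_entry)
    finally show ?thesis using that by (simp add: inv)
  qed
  have "complex_of_real (\<Sum>r<N. (cmod (\<Sum>w<N. A $$ (r, w) * y w))\<^sup>2)
      = (\<Sum>r<N. (\<Sum>b<N. A $$ (r, b) * y b) * cnj (\<Sum>a<N. A $$ (r, a) * y a))"
    by (simp only: of_real_sum complex_norm_square)
  also have "\<dots> = (\<Sum>r<N. \<Sum>b<N. \<Sum>a<N. (cnj (A $$ (r, a)) * A $$ (r, b)) * (y b * cnj (y a)))"
    by (simp only: cnj_sum complex_cnj_mult sum_product mult_ac)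
  also have "\<dots> = (\<Sum>b<N. \<Sum>a<N. \<Sum>r<N. (cnj (A $$ (r, a)) * A $$ (r, b)) * (y b * cnj (y a)))"
    using sum_rotate[of "\<lambda>b a r. (cnj (A $$ (r, a)) * A $$ (r, b)) * (y b * cnj (y a))" "{..<N}" "{..<N}" "{..<N}"] by simp
  also have "\<dots> = (\<Sum>b<N. \<Sum>a<N. (if a = b then 1 else 0) * (y b * cnj (y a)))"
    by (intro sum.cong refl) (simp add: sum_distrib_right[symmetric] orth)
  also have "\<dots> = (\<Sum>b<N. y b * cnj (y b))"
    by (intro sum.cong refl) (simp add: if_distrib[of "\<lambda>z. z * _"] cong: if_cong)
  also have "\<dots> = complex_of_real (\<Sum>w<N. (cmod (y w))\<^sup>2)"
    by (simp only: of_real_sum complex_norm_square)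
  finally show ?thesis by (simp only: of_real_eq_iff)
qed

lemma SU_entry_le:
  assumes "g \<in> SU N" "r < N" "c < N"
  shows "cmod (g $$ (r, c)) \<le> 1"
proof -
  have "(\<Sum>r<N. (cmod (\<Sum>w<N. g $$ (r, w) * (if w = c then 1 else 0)))\<^sup>2) = (\<Sum>w<N. (cmod (if w = c then 1 else 0))\<^sup>2)"
    by (rule unitary_isometry) (use assms in \<open>auto simp: SU_def\<close>)
  also have "\<dots> = 1"
    using assms(3) by (simp add: if_distrib[of cmod] if_distrib[of "\<lambda>x. x\<^sup>2"] cong: if_cong)
  finally have "(\<Sum>r<N. (cmod (g $$ (r, c)))\<^sup>2) = 1"
    using assms(3) by (simp add: if_distrib[of "\<lambda>z. _ * z"] cong: if_cong)
  then have "(cmod (g $$ (r, c)))\<^sup>2 \<le> 1"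
    using assms(2) member_le_sum[of r "{..<N}" "\<lambda>r. (cmod (g $$ (r, c)))\<^sup>2"] by simp
  then show ?thesis by (simp add: abs_square_le_1 abs_le_iff)
qed

section \<open>Gates acting on blocks of four amplitudes\<close>

context
  fixes n i j :: nat
  assumes ij: "i < n" "j < n" "i \<noteq> j"
begin

text \<open>Amplitudes that agree off the pair form blocks of four, and the gate acts on every block
  as the matrix \<open>g\<close>.\<close>

lemma norm_apply_gate:
  assumes u: "u \<in> carrier_vec (2 ^ n)"
  shows "(euclidean_norm (apply_gate n i j g *\<^sub>v u))\<^sup>2
    = (\<Sum>r\<in>Pow ({..<n} - {i, j}). \<Sum>v<4. (cmod (\<Sum>w<4. g $$ (v, w) * amp n u (set_pair i j w r)))\<^sup>2)"
proof -
  have "apply_gate n i j g *\<^sub>v u \<in> carrier_vec (2 ^ n)"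
    using apply_gate_carrier u by (rule mult_mat_vec_carrier)
  then have "(euclidean_norm (apply_gate n i j g *\<^sub>v u))\<^sup>2
      = (\<Sum>x\<in>Pow {..<n}. (cmod (\<Sum>w<4. g $$ (pair_val i j x, w) * amp n u (set_pair i j w x)))\<^sup>2)"
    using ij u by (simp add: euclidean_norm_amp amp_apply_gate)
  also have "\<dots> = (\<Sum>r\<in>Pow ({..<n} - {i, j}). \<Sum>v<4. (cmod (\<Sum>w<4. g $$ (v, w) * amp n u (set_pair i j w r)))\<^sup>2)"
    using ij by (subst sum_Pow_set_pair[of "{..<n}" i j]) auto
  finally show ?thesis .
qed

lemma norm_SU_gate:
  assumes u: "u \<in> carrier_vec (2 ^ n)" and g: "g \<in> SU 4"
  shows "euclidean_norm (apply_gate n i j g *\<^sub>v u) = euclidean_norm u"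
proof -
  have "(euclidean_norm (apply_gate n i j g *\<^sub>v u))\<^sup>2 = (\<Sum>r\<in>Pow ({..<n} - {i, j}). \<Sum>w<4. (cmod (amp n u (set_pair i j w r)))\<^sup>2)"
    unfolding norm_apply_gate[OF u]
    by (rule sum.cong[OF refl], rule unitary_isometry) (use g in \<open>auto simp: SU_def\<close>)
  also have "\<dots> = (\<Sum>x\<in>Pow {..<n}. (cmod (amp n u x))\<^sup>2)"
    using ij by (subst sum_Pow_set_pair[of "{..<n}" i j]) auto
  also have "\<dots> = (euclidean_norm u)\<^sup>2" using u by (simp add: euclidean_norm_amp)
  finally show ?thesis by simp
qed

text \<open>On each block Cauchy-Schwarz bounds a squared entry of the image by
  \<open>4 * e ^ 2\<close> times the squared norm of the block, and there are four entries.\<close>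

lemma norm_gate_diff:
  assumes u: "u \<in> carrier_vec (2 ^ n)" and g: "g \<in> carrier_mat 4 4" "h \<in> carrier_mat 4 4"
    and e: "\<And>r c. r < 4 \<Longrightarrow> c < 4 \<Longrightarrow> cmod (g $$ (r, c) - h $$ (r, c)) \<le> e"
  shows "euclidean_norm (apply_gate n i j g *\<^sub>v u - apply_gate n i j h *\<^sub>v u) \<le> 4 * e * euclidean_norm u"
proof -
  have "cmod (g $$ (0, 0) - h $$ (0, 0)) \<le> e" by (rule e) auto
  then have e0: "0 \<le> e" using norm_ge_zero[of "g $$ (0, 0) - h $$ (0, 0)"] by linarith
  have gh: "apply_gate n i j g *\<^sub>v u - apply_gate n i j h *\<^sub>v u = apply_gate n i j (g - h) *\<^sub>v u"
  proof -
    have less: "2 * qubit n i k + qubit n j k < 4" for k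
      using qubit_less[of n i k] qubit_less[of n j k] by linarith
    have "apply_gate n i j (g - h) = apply_gate n i j g - apply_gate n i j h"
      using g less by (intro eq_matI) (auto simp: apply_gate_def)
    then show ?thesis using u by (simp add: minus_mult_distrib_mat_vec[OF apply_gate_carrier apply_gate_carrier u])
  qed
  have pt: "(cmod (\<Sum>w<4. (g - h) $$ (v, w) * amp n u (set_pair i j w r)))\<^sup>2 \<le> (4 * e\<^sup>2) * (\<Sum>w<4. (cmod (amp n u (set_pair i j w r)))\<^sup>2)"
    if v: "v \<in> {..<4}" for r v
  proof -
    let ?y = "\<lambda>w. cmod (amp n u (set_pair i j w r))"
    have "cmod (\<Sum>w<4. (g - h) $$ (v, w) * amp n u (set_pair i j w r)) \<le> (\<Sum>w<4. e * ?y w)"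
      using v e g by (intro sum_norm_le) (auto simp: norm_mult intro!: mult_right_mono)
    then have "(cmod (\<Sum>w<4. (g - h) $$ (v, w) * amp n u (set_pair i j w r)))\<^sup>2 \<le> (\<Sum>w<4. e * ?y w)\<^sup>2"
      by (intro power_mono) auto
    also have "\<dots> \<le> (\<Sum>w<4. (e * ?y w)\<^sup>2) * real (card {..<4::nat})"
      by (rule sum_squared_le_sum_of_squares)
    also have "\<dots> = (4 * e\<^sup>2) * (\<Sum>w<4. (?y w)\<^sup>2)"
      by (simp add: power_mult_distrib sum_distrib_left[symmetric])
    finally show ?thesis .
  qed
  have "(euclidean_norm (apply_gate n i j (g - h) *\<^sub>v u))\<^sup>2
      \<le> (\<Sum>r\<in>Pow ({..<n} - {i, j}). \<Sum>v<(4::nat). (4 * e\<^sup>2) * (\<Sum>w<4. (cmod (amp n u (set_pair i j w r)))\<^sup>2))"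
    unfolding norm_apply_gate[OF u, of "g - h"]
  proof (rule sum_mono, rule sum_mono)
    fix r and v :: nat assume "v \<in> {..<4}"
    then show "(cmod (\<Sum>w<4. (g - h) $$ (v, w) * amp n u (set_pair i j w r)))\<^sup>2
        \<le> (4 * e\<^sup>2) * (\<Sum>w<4. (cmod (amp n u (set_pair i j w r)))\<^sup>2)"
      by (rule pt)
  qed
  also have "\<dots> = 16 * e\<^sup>2 * (\<Sum>r\<in>Pow ({..<n} - {i, j}). \<Sum>w<4. (cmod (amp n u (set_pair i j w r)))\<^sup>2)"
    by (simp add: sum_distrib_left[symmetric])
  also have "\<dots> = (4 * e * euclidean_norm u)\<^sup>2"
    using ij u sum_Pow_set_pair[of "{..<n}" i j "\<lambda>x. (cmod (amp n u x))\<^sup>2"]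
    by (simp add: power_mult_distrib euclidean_norm_amp)
  finally show ?thesis
    unfolding gh by (rule power2_le_imp_le) (use e0 in simp)
qed

end

lemma gates_carrier: "gates n \<subseteq> carrier_mat (2 ^ n) (2 ^ n)"
  by (auto simp: gates_def)

lemma norm_gates:
  assumes "V \<in> gates n" "u \<in> carrier_vec (2 ^ n)"
  shows "euclidean_norm (V *\<^sub>v u) = euclidean_norm u"
  using assms norm_SU_gate by (auto simp: gates_def)

lemma norm_gate_product:
  assumes "set Vs \<subseteq> gates n" "u \<in> carrier_vec (2 ^ n)"
  shows "euclidean_norm (mat_prod_list (2 ^ n) Vs *\<^sub>v u) = euclidean_norm u"
  using assms
proof (induction Vs)
  case (Cons V Vs)
  have V: "V \<in> carrier_mat (2 ^ n) (2 ^ n)" and Vs: "mat_prod_list (2 ^ n) Vs \<in> carrier_mat (2 ^ n) (2 ^ n)"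
    using Cons.prems gates_carrier by (auto intro!: mat_prod_list_carrier)
  have "mat_prod_list (2 ^ n) (V # Vs) *\<^sub>v u = V *\<^sub>v (mat_prod_list (2 ^ n) Vs *\<^sub>v u)"
    unfolding mat_prod_list_Cons by (rule assoc_mult_mat_vec[OF V Vs Cons.prems(2)])
  then show ?case using Cons norm_gates[of V n] mult_mat_vec_carrier[OF Vs Cons.prems(2)] by simp
qed (simp add: mat_prod_list_def)

lemma mult_unit_vec_entry:
  fixes A :: "complex mat"
  assumes "A \<in> carrier_mat N N" "k < N" "c < N"
  shows "(A *\<^sub>v unit_vec N c) $ k = A $$ (k, c)"
  using assms by simp

lemma gate_product_entry_le:
  assumes "set Vs \<subseteq> gates n" "k < 2 ^ n" "c < 2 ^ n"
  shows "cmod (mat_prod_list (2 ^ n) Vs $$ (k, c)) \<le> 1"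
proof -
  have V: "mat_prod_list (2 ^ n) Vs \<in> carrier_mat (2 ^ n) (2 ^ n)"
    using assms gates_carrier by (intro mat_prod_list_carrier) auto
  have "cmod (mat_prod_list (2 ^ n) Vs $$ (k, c)) \<le> euclidean_norm (mat_prod_list (2 ^ n) Vs *\<^sub>v unit_vec (2 ^ n) c)"
    using V assms entry_le_euclidean_norm[of k "mat_prod_list (2 ^ n) Vs *\<^sub>v unit_vec (2 ^ n) c"]
    by (simp add: mult_unit_vec_entry del: index_mult_mat_vec)
  also have "\<dots> = 1" using assms by (simp add: norm_gate_product euclidean_norm_unit_vec)
  finally show ?thesis .
qed

lemma fold_gates:
  assumes "set Vs \<subseteq> carrier_mat N N" "u \<in> carrier_vec N"
  shows "fold (\<lambda>V v. V *\<^sub>v v) Vs u = mat_prod_list N (rev Vs) *\<^sub>v u"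
  using assms
proof (induction Vs rule: rev_induct)
  case (snoc V Vs)
  have "mat_prod_list N (rev Vs) \<in> carrier_mat N N" using snoc.prems by (intro mat_prod_list_carrier) auto
  then have "V *\<^sub>v (mat_prod_list N (rev Vs) *\<^sub>v u) = mat_prod_list N (V # rev Vs) *\<^sub>v u"
    using snoc.prems unfolding mat_prod_list_Cons by (intro assoc_mult_mat_vec[symmetric]) auto
  then show ?case using snoc by simp
qed (simp add: mat_prod_list_def)

text \<open>A rounded matrix is in general not unitary. The net therefore consists of one true gate
  from every occupied cell of the grid.\<close>

lemma representatives:
  assumes "finite T" "key ` A \<subseteq> T"
  shows "\<exists>R\<subseteq>A. finite R \<and> card R \<le> card T \<and> (\<forall>a\<in>A. \<exists>r\<in>R. key r = key a)"
proof -
  define R where "R = inv_into A key ` (key ` A)"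
  have fin: "finite (key ` A)" using assms by (rule finite_subset[rotated])
  have "R \<subseteq> A" by (auto simp: R_def inv_into_into)
  moreover have "card R \<le> card T"
    using card_image_le[OF fin, of "inv_into A key"] card_mono[OF assms] by (simp add: R_def)
  moreover have "\<exists>r\<in>R. key r = key a" if "a \<in> A" for a
    using that by (intro bexI[of _ "inv_into A key (key a)"]) (auto simp: R_def f_inv_into_f)
  moreover have "finite R" using fin by (simp add: R_def)
  ultimately show ?thesis by blast
qed

lemma floor_eq_imp_close:
  fixes x y s :: real
  assumes "s > 0" "\<lfloor>s * x\<rfloor> = \<lfloor>s * y\<rfloor>"
  shows "\<bar>x - y\<bar> \<le> 1 / s"
proof -
  have "\<bar>s * x - s * y\<bar> < 1" using assms(2) by linarith
  then have "s * \<bar>x - y\<bar> \<le> 1" using assms(1) by (simp add: right_diff_distrib[symmetric] abs_mult)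
  then show ?thesis using assms(1) by (simp add: field_simps)
qed

text \<open>The 32 real coordinates of an element of \<open>SU 4\<close> lie between -1 and 1, and
  each is rounded to one of \<open>2 * s + 1\<close> values. Equal keys give entries within
  \<open>2 / s\<close>, hence gates within \<open>8 / s\<close>; the square of \<open>n\<close>
  counts the pairs of qubits.\<close>

lemma gate_net:
  assumes s: "s \<ge> 1"
  shows "\<exists>R\<subseteq>gates n. finite R \<and> card R \<le> n ^ 2 * (2 * s + 1) ^ 32 \<and>
    (\<forall>V\<in>gates n. \<exists>W\<in>R. \<forall>u\<in>carrier_vec (2 ^ n). euclidean_norm (V *\<^sub>v u - W *\<^sub>v u) \<le> 8 / real s * euclidean_norm u)"
proof -
  define A where "A = {(i, j, g). i < n \<and> j < n \<and> i \<noteq> j \<and> g \<in> SU 4}"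
  let ?D = "{..<4::nat} \<times> {..<4::nat}"
  let ?Z = "{- int s..int s}"
  define key where "key = (\<lambda>(i::nat, j::nat, g :: complex mat). (i, j, \<lambda>rc\<in>?D. (\<lfloor>real s * Re (g $$ rc)\<rfloor>, \<lfloor>real s * Im (g $$ rc)\<rfloor>)))"
  define T where "T = {..<n} \<times> {..<n} \<times> (Pi\<^sub>E ?D (\<lambda>_. ?Z \<times> ?Z))"
  have range: "\<lfloor>real s * x\<rfloor> \<in> ?Z" if "\<bar>x\<bar> \<le> 1" for x
  proof -
    have "real s * \<bar>x\<bar> \<le> real s * 1" using that by (intro mult_left_mono) auto
    then have "\<bar>real s * x\<bar> \<le> real s" by (simp add: abs_mult)
    then show ?thesis by (simp add: le_floor_iff floor_le_iff abs_le_iff)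
  qed
  have finT: "finite T" unfolding T_def by (intro finite_cartesian_product finite_PiE) auto
  have keyT: "key ` A \<subseteq> T"
  proof (rule image_subsetI)
    fix p assume "p \<in> A"
    then obtain i j g where p: "p = (i, j, g)" and g: "g \<in> SU 4" and ij: "i < n" "j < n"
      by (auto simp: A_def)
    have "\<bar>Re (g $$ rc)\<bar> \<le> 1 \<and> \<bar>Im (g $$ rc)\<bar> \<le> 1" if "rc \<in> ?D" for rc
      using SU_entry_le[OF g] abs_Re_le_cmod[of "g $$ rc"] abs_Im_le_cmod[of "g $$ rc"] that
      by (cases rc) (auto intro: order_trans)
    then show "key p \<in> T"
      using range ij unfolding p by (simp add: key_def T_def)
  qed
  have cardT: "card T = n ^ 2 * (2 * s + 1) ^ 32"
  proof -
    have "card ?Z = 2 * s + 1" by simp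
    then have "card (?Z \<times> ?Z) = (2 * s + 1) ^ 2" by (simp only: card_cartesian_product power2_eq_square)
    then have "card (Pi\<^sub>E ?D (\<lambda>_. ?Z \<times> ?Z)) = ((2 * s + 1) ^ 2) ^ 16"
      by (simp add: card_PiE card_cartesian_product)
    also have "\<dots> = (2 * s + 1) ^ 32" by (simp only: power_mult[symmetric]) simp
    finally show ?thesis by (simp add: T_def card_cartesian_product power2_eq_square)
  qed
  obtain R where R: "R \<subseteq> A" "finite R" "card R \<le> card T" "\<forall>a\<in>A. \<exists>r\<in>R. key r = key a"
    using representatives[OF finT keyT] by blast
  let ?G = "\<lambda>(i, j, g). apply_gate n i j g"
  have "\<exists>W\<in>?G ` R. \<forall>u\<in>carrier_vec (2 ^ n). euclidean_norm (V *\<^sub>v u - W *\<^sub>v u) \<le> 8 / real s * euclidean_norm u"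
    if "V \<in> gates n" for V
  proof -
    from that obtain i j g where V: "V = apply_gate n i j g" and a: "(i, j, g) \<in> A" by (auto simp: gates_def A_def)
    then obtain h where h: "(i, j, h) \<in> R" "key (i, j, h) = key (i, j, g)"
      using R(4) by (fastforce simp: key_def)
    have hA: "(i, j, h) \<in> A" using h R(1) by auto
    have close: "cmod (g $$ (r, c) - h $$ (r, c)) \<le> 2 / real s" if "r < 4" "c < 4" for r c
    proof -
      have "(\<lambda>rc\<in>?D. (\<lfloor>real s * Re (h $$ rc)\<rfloor>, \<lfloor>real s * Im (h $$ rc)\<rfloor>)) (r, c)
          = (\<lambda>rc\<in>?D. (\<lfloor>real s * Re (g $$ rc)\<rfloor>, \<lfloor>real s * Im (g $$ rc)\<rfloor>)) (r, c)"
        using h(2) by (simp add: key_def)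
      then have "\<lfloor>real s * Re (h $$ (r, c))\<rfloor> = \<lfloor>real s * Re (g $$ (r, c))\<rfloor>" "\<lfloor>real s * Im (h $$ (r, c))\<rfloor> = \<lfloor>real s * Im (g $$ (r, c))\<rfloor>"
        using that by auto
      then have "\<bar>Re (h $$ (r, c)) - Re (g $$ (r, c))\<bar> \<le> 1 / real s" "\<bar>Im (h $$ (r, c)) - Im (g $$ (r, c))\<bar> \<le> 1 / real s"
        using s by (auto intro!: floor_eq_imp_close)
      then show ?thesis using cmod_le[of "g $$ (r, c) - h $$ (r, c)"] by (simp add: abs_minus_commute)
    qed
    have "euclidean_norm (V *\<^sub>v u - apply_gate n i j h *\<^sub>v u) \<le> 4 * (2 / real s) * euclidean_norm u"
      if "u \<in> carrier_vec (2 ^ n)" for u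
      unfolding V using a hA that close by (intro norm_gate_diff) (auto simp: A_def SU_def)
    moreover have "apply_gate n i j h \<in> ?G ` R" using h(1) by force
    ultimately show ?thesis by (intro bexI[of _ "apply_gate n i j h"]) auto
  qed
  moreover have "?G ` R \<subseteq> gates n"
  proof (rule image_subsetI)
    fix p assume "p \<in> R"
    then obtain i j g where "p = (i, j, g)" "i < n" "j < n" "i \<noteq> j" "g \<in> SU 4"
      using R(1) by (auto simp: A_def)
    then show "?G p \<in> gates n" by (auto simp: gates_def)
  qed
  moreover have "finite (?G ` R)" using R(2) by simp
  moreover have "card (?G ` R) \<le> n ^ 2 * (2 * s + 1) ^ 32"
    using card_image_le[OF R(2), of ?G] R(3) cardT by simp
  ultimately show ?thesis by blast
qed

text \<open>Errors of the gates merely add: replacing them one by one, the gates on either side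
  preserve the Euclidean norm.\<close>

lemma circuit_net:
  assumes s: "s \<ge> 1"
  shows "\<exists>Q. finite Q \<and> card Q \<le> (n ^ 2 * (2 * s + 1) ^ 32) ^ m \<and> (\<forall>Ws\<in>Q. set Ws \<subseteq> gates n) \<and>
    (\<forall>Vs. set Vs \<subseteq> gates n \<and> length Vs = m \<longrightarrow> (\<exists>Ws\<in>Q. \<forall>u\<in>carrier_vec (2 ^ n).
      euclidean_norm (mat_prod_list (2 ^ n) Vs *\<^sub>v u - mat_prod_list (2 ^ n) Ws *\<^sub>v u) \<le> real m * (8 / real s) * euclidean_norm u))"
proof -
  obtain R where R: "R \<subseteq> gates n" "finite R" "card R \<le> n ^ 2 * (2 * s + 1) ^ 32"
    "\<And>V. V \<in> gates n \<Longrightarrow> \<exists>W\<in>R. \<forall>u\<in>carrier_vec (2 ^ n). euclidean_norm (V *\<^sub>v u - W *\<^sub>v u) \<le> 8 / real s * euclidean_norm u"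
    using gate_net[OF s, of n] by blast
  define Q where "Q = {Ws. set Ws \<subseteq> R \<and> length Ws = m}"
  have "\<exists>Ws. set Ws \<subseteq> R \<and> length Ws = length Vs \<and> (\<forall>u\<in>carrier_vec (2 ^ n).
      euclidean_norm (mat_prod_list (2 ^ n) Vs *\<^sub>v u - mat_prod_list (2 ^ n) Ws *\<^sub>v u) \<le> real (length Vs) * (8 / real s) * euclidean_norm u)"
    if "set Vs \<subseteq> gates n" for Vs
    using that
  proof (induction Vs)
    case Nil
    have "euclidean_norm (1\<^sub>m (2 ^ n) *\<^sub>v u - 1\<^sub>m (2 ^ n) *\<^sub>v u) \<le> 0" if "u \<in> carrier_vec (2 ^ n)" for u
      using that by (simp add: euclidean_norm_def)
    then show ?case by (intro exI[of _ "[]"]) (simp add: mat_prod_list_def)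
  next
    case (Cons V Vs)
    let ?A = "mat_prod_list (2 ^ n) Vs"
    obtain Ws where Ws: "set Ws \<subseteq> R" "length Ws = length Vs" and
      IH: "\<And>u. u \<in> carrier_vec (2 ^ n) \<Longrightarrow> euclidean_norm (?A *\<^sub>v u - mat_prod_list (2 ^ n) Ws *\<^sub>v u) \<le> real (length Vs) * (8 / real s) * euclidean_norm u"
      using Cons by auto
    obtain W where W: "W \<in> R" and close: "\<And>u. u \<in> carrier_vec (2 ^ n) \<Longrightarrow> euclidean_norm (V *\<^sub>v u - W *\<^sub>v u) \<le> 8 / real s * euclidean_norm u"
      using R(4)[of V] Cons.prems by auto
    let ?B = "mat_prod_list (2 ^ n) Ws"
    have car: "V \<in> carrier_mat (2 ^ n) (2 ^ n)" "W \<in> carrier_mat (2 ^ n) (2 ^ n)" "?A \<in> carrier_mat (2 ^ n) (2 ^ n)" "?B \<in> carrier_mat (2 ^ n) (2 ^ n)"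
      using Cons.prems W Ws R(1) gates_carrier[of n] by (auto intro!: mat_prod_list_carrier)
    have "euclidean_norm (mat_prod_list (2 ^ n) (V # Vs) *\<^sub>v u - mat_prod_list (2 ^ n) (W # Ws) *\<^sub>v u)
        \<le> real (length (V # Vs)) * (8 / real s) * euclidean_norm u" if u: "u \<in> carrier_vec (2 ^ n)" for u
    proof -
      have a: "?A *\<^sub>v u \<in> carrier_vec (2 ^ n)" and b: "?B *\<^sub>v u \<in> carrier_vec (2 ^ n)"
        using car u by (auto intro!: mult_mat_vec_carrier)
      have "euclidean_norm ((V * ?A) *\<^sub>v u - (W * ?B) *\<^sub>v u) = euclidean_norm (V *\<^sub>v (?A *\<^sub>v u) - W *\<^sub>v (?B *\<^sub>v u))"
        by (simp only: assoc_mult_mat_vec[OF car(1,3) u] assoc_mult_mat_vec[OF car(2,4) u])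
      also have "\<dots> \<le> euclidean_norm (V *\<^sub>v (?A *\<^sub>v u) - W *\<^sub>v (?A *\<^sub>v u)) + euclidean_norm (W *\<^sub>v (?A *\<^sub>v u) - W *\<^sub>v (?B *\<^sub>v u))"
        using mult_mat_vec_carrier[OF car(1) a] mult_mat_vec_carrier[OF car(2) a] mult_mat_vec_carrier[OF car(2) b]
        by (rule euclidean_norm_triangle)
      also have "W *\<^sub>v (?A *\<^sub>v u) - W *\<^sub>v (?B *\<^sub>v u) = W *\<^sub>v (?A *\<^sub>v u - ?B *\<^sub>v u)"
        by (rule mult_minus_distrib_mat_vec[symmetric, OF car(2) a b])
      also have "euclidean_norm \<dots> = euclidean_norm (?A *\<^sub>v u - ?B *\<^sub>v u)"
        using W R(1) a b by (intro norm_gates) auto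
      also have "\<dots> \<le> real (length Vs) * (8 / real s) * euclidean_norm u" by (rule IH[OF u])
      also have "euclidean_norm (V *\<^sub>v (?A *\<^sub>v u) - W *\<^sub>v (?A *\<^sub>v u)) \<le> 8 / real s * euclidean_norm u"
        using close[OF a] Cons.prems u by (simp add: norm_gate_product)
      finally show ?thesis by (simp add: mat_prod_list_Cons algebra_simps add_divide_distrib)
    qed
    then show ?case using W Ws by (intro exI[of _ "W # Ws"]) auto
  qed
  then have "\<exists>Ws\<in>Q. \<forall>u\<in>carrier_vec (2 ^ n). euclidean_norm (mat_prod_list (2 ^ n) Vs *\<^sub>v u - mat_prod_list (2 ^ n) Ws *\<^sub>v u) \<le> real m * (8 / real s) * euclidean_norm u"
    if "set Vs \<subseteq> gates n \<and> length Vs = m" for Vs using that unfolding Q_def by blast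
  moreover have "finite Q" unfolding Q_def by (rule finite_lists_length_eq[OF R(2)])
  moreover have "card Q \<le> (n ^ 2 * (2 * s + 1) ^ 32) ^ m"
    unfolding Q_def card_lists_length_eq[OF R(2)] using R(3) by (rule power_mono) simp
  moreover have "\<forall>Ws\<in>Q. set Ws \<subseteq> gates n" using R(1) by (auto simp: Q_def)
  ultimately show ?thesis by blast
qed

section \<open>The trace norm of a difference of rank one projectors\<close>

lemma inner_self: "inner_vec v v = complex_of_real ((euclidean_norm v)\<^sup>2)"
  unfolding euclidean_norm_sq inner_vec_def of_real_sum
  by (intro sum.cong refl) (simp only: complex_norm_square mult.commute)

lemma inner_swap: "dim_vec v = dim_vec w \<Longrightarrow> inner_vec v w = cnj (inner_vec w v)"
  by (simp add: inner_vec_def cnj_sum mult.commute)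

lemma cauchy_schwarz_vec:
  assumes "dim_vec v = dim_vec w"
  shows "(cmod (inner_vec v w))\<^sup>2 \<le> (euclidean_norm v)\<^sup>2 * (euclidean_norm w)\<^sup>2"
proof -
  have "cmod (inner_vec v w) \<le> (\<Sum>k<dim_vec w. cmod (v $ k) * cmod (w $ k))"
    unfolding inner_vec_def by (rule sum_norm_le) (simp add: norm_mult)
  then have "(cmod (inner_vec v w))\<^sup>2 \<le> (\<Sum>k<dim_vec w. cmod (v $ k) * cmod (w $ k))\<^sup>2"
    by (intro power_mono) auto
  also have "\<dots> \<le> (euclidean_norm v)\<^sup>2 * (euclidean_norm w)\<^sup>2"
    unfolding euclidean_norm_sq assms by (rule Cauchy_Schwarz_ineq_sum)
  finally show ?thesis .
qed

lemma trace_mult_commute: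
  fixes X Y :: "complex mat"
  assumes "X \<in> carrier_mat N N" "Y \<in> carrier_mat N N"
  shows "(\<Sum>i<N. (X * Y) $$ (i, i)) = (\<Sum>i<N. (Y * X) $$ (i, i))"
proof -
  have "(\<Sum>i<N. (X * Y) $$ (i, i)) = (\<Sum>i<N. \<Sum>k<N. X $$ (i, k) * Y $$ (k, i))"
    using assms by (simp add: scalar_prod_def atLeast0LessThan)
  also have "\<dots> = (\<Sum>k<N. \<Sum>i<N. Y $$ (k, i) * X $$ (i, k))"
    by (subst sum.swap) (simp add: mult.commute)
  also have "\<dots> = (\<Sum>i<N. (Y * X) $$ (i, i))"
    using assms by (simp add: scalar_prod_def atLeast0LessThan)
  finally show ?thesis .
qed

text \<open>For a Hermitian matrix, Schur's theorem turns the trace norm into the sum of the absolute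
  eigenvalues.\<close>

lemma trace_norm_eigenvalues:
  assumes A: "A \<in> carrier_mat N N" and herm: "mat_adjoint A = A"
  shows "\<exists>e. trace_norm A = (\<Sum>i<N. sqrt (Re ((e i)\<^sup>2))) \<and> (\<forall>i<N. eigenvalue A (e i)) \<and>
    (\<Sum>i<N. A $$ (i, i)) = (\<Sum>i<N. e i) \<and> (\<Sum>i<N. (A * A) $$ (i, i)) = (\<Sum>i<N. (e i)\<^sup>2)"
proof -
  obtain es where es: "char_poly A = (\<Prod>a\<leftarrow>es. [:- a, 1:])" using char_poly_factorized[OF A] by auto
  obtain B P Q where schur: "schur_decomposition A es = (B, P, Q)" by (cases "schur_decomposition A es") auto
  from schur_decomposition[OF A es schur]
  have sim: "similar_mat_wit A B P Q" and ut: "upper_triangular B" and diag: "diag_mat B = es" by auto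
  from similar_mat_witD2[OF A sim]
  have PQ: "P * Q = 1\<^sub>m N" "Q * P = 1\<^sub>m N" "A = P * B * Q" and car: "B \<in> carrier_mat N N" "P \<in> carrier_mat N N" "Q \<in> carrier_mat N N"
    by auto
  define e where "e i = B $$ (i, i)" for i
  have low: "B $$ (i, k) = 0" if "k < i" "i < N" for i k using ut car that by (auto simp: upper_triangular_def)
  have BB: "(B * B) $$ (i, k) = (\<Sum>l<N. B $$ (i, l) * B $$ (l, k))" if "i < N" "k < N" for i k
    using that car by (simp add: scalar_prod_def atLeast0LessThan)
  have diagBB: "(B * B) $$ (i, i) = (e i)\<^sup>2" if i: "i < N" for i
  proof -
    have "(B * B) $$ (i, i) = (\<Sum>l<N. if l = i then (e i)\<^sup>2 else 0)"
      unfolding BB[OF i i] using low i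
      by (intro sum.cong refl) (auto simp: e_def power2_eq_square neq_iff)
    then show ?thesis using i by simp
  qed
  have utBB: "upper_triangular (B * B)"
    unfolding upper_triangular_def
  proof (intro allI impI)
    fix i k assume "i < dim_row (B * B)" "k < i"
    then have i: "i < N" "k < i" using car by auto
    have "B $$ (i, l) * B $$ (l, k) = 0" if "l < N" for l
      using low[of l i] low[of k l] i that by (cases "l < i") auto
    then have "(\<Sum>l<N. B $$ (i, l) * B $$ (l, k)) = 0" by (intro sum.neutral) auto
    then show "(B * B) $$ (i, k) = 0" using i by (simp add: BB)
  qed
  have AA: "A * A = P * (B * B) * Q"
  proof -
    have "A * A = (P * B * Q) * (P * B * Q)" using PQ(3) by simp
    also have "\<dots> = P * B * (Q * P) * B * Q" using car by (simp add: assoc_mult_mat[of _ N N _ N _ N])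
    also have "\<dots> = P * (B * B) * Q" using car PQ(2) by (simp add: assoc_mult_mat[of _ N N _ N _ N])
    finally show ?thesis .
  qed
  \<comment> \<open>Being similar to the upper triangular \<open>B * B\<close>, the matrix
    \<open>A * A\<close> has the squares of the \<open>e i\<close> as eigenvalues, with the right
    multiplicities.\<close>
  have "similar_mat (A * A) (B * B)"
    unfolding similar_mat_def similar_mat_wit_def Let_def
    by (rule exI[of _ P], rule exI[of _ Q]) (use A car PQ(1,2) AA in auto)
  then have "char_poly (A * A) = char_poly (B * B)" by (rule char_poly_similar)
  also have "\<dots> = (\<Prod>a\<leftarrow>diag_mat (B * B). [:- a, 1:])"
    using car by (intro char_poly_upper_triangular[OF _ utBB]) auto
  also have "diag_mat (B * B) = map (\<lambda>i. (e i)\<^sup>2) [0..<N]"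
    using car diagBB by (simp add: diag_mat_def)
  finally have cp: "char_poly (mat_adjoint A * A) = (\<Prod>a\<leftarrow>map (\<lambda>i. (e i)\<^sup>2) [0..<N]. [:- a, 1:])"
    by (simp only: herm)
  have pr: "proots (\<Prod>a\<leftarrow>as. [:- a, 1:]) = mset as" for as :: "complex list"
  proof (induction as)
    case (Cons a as)
    have "(\<Prod>a\<leftarrow>as. [:- a, 1:]) \<noteq> 0" by (auto simp: prod_list_zero_iff)
    then show ?case using Cons by (simp add: proots_mult del: mult_pCons_left)
  qed simp
  have "trace_norm A = (\<Sum>x\<in>#mset (map (\<lambda>i. (e i)\<^sup>2) [0..<N]). sqrt (Re x))"
    unfolding trace_norm_def cp pr by (rule refl)
  also have "\<dots> = (\<Sum>i\<leftarrow>[0..<N]. sqrt (Re ((e i)\<^sup>2)))"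
    by (simp only: mset_map[symmetric] sum_mset_sum_list list.map_comp o_def)
  also have "\<dots> = (\<Sum>i<N. sqrt (Re ((e i)\<^sup>2)))"
    by (simp add: interv_sum_list_conv_sum_set_nat atLeast0LessThan)
  finally have tn: "trace_norm A = (\<Sum>i<N. sqrt (Re ((e i)\<^sup>2)))" .
  have eig: "eigenvalue A (e i)" if "i < N" for i
  proof -
    have "e i \<in> set es" unfolding diag[symmetric] using that car by (auto simp: diag_mat_def e_def)
    then have "poly (char_poly A) (e i) = 0"
      unfolding es by (auto simp: poly_prod_list prod_list_zero_iff)
    then show ?thesis using eigenvalue_root_char_poly[OF A] by simp
  qed
  have tr1: "(\<Sum>i<N. A $$ (i, i)) = (\<Sum>i<N. e i)"
  proof -
    have "(\<Sum>i<N. (P * (B * Q)) $$ (i, i)) = (\<Sum>i<N. ((B * Q) * P) $$ (i, i))"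
      using car by (intro trace_mult_commute) auto
    moreover have "P * (B * Q) = A" "(B * Q) * P = B"
      using car PQ by (simp_all add: assoc_mult_mat[of _ N N _ N _ N])
    ultimately show ?thesis by (simp add: e_def)
  qed
  have tr2: "(\<Sum>i<N. (A * A) $$ (i, i)) = (\<Sum>i<N. (e i)\<^sup>2)"
  proof -
    have "(\<Sum>i<N. (P * ((B * B) * Q)) $$ (i, i)) = (\<Sum>i<N. (((B * B) * Q) * P) $$ (i, i))"
      using car by (intro trace_mult_commute) auto
    moreover have "P * ((B * B) * Q) = A * A" "((B * B) * Q) * P = B * B"
      using car PQ AA by (simp_all add: assoc_mult_mat[of _ N N _ N _ N])
    ultimately show ?thesis using diagBB by simp
  qed
  show ?thesis using tn eig tr1 tr2 by blast
qed

text \<open>For nonzero \<open>e\<close> the eigenvector lies in the span of both vectors. Its inner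
  products with them solve a homogeneous system of two linear equations, whose determinant is the
  displayed quadratic.\<close>

lemma projector_diff_eigenvalue:
  assumes dim: "\<psi> \<in> carrier_vec N" "\<phi> \<in> carrier_vec N"
    and ev: "eigenvalue (projector \<psi> - projector \<phi>) e"
  defines "a \<equiv> (euclidean_norm \<psi>)\<^sup>2" and "b \<equiv> (euclidean_norm \<phi>)\<^sup>2" and "s \<equiv> inner_vec \<psi> \<phi>"
  shows "e = 0 \<or> (e - of_real a) * (e + of_real b) + of_real ((cmod s)\<^sup>2) = 0"
proof (rule disjCI)
  assume ne: "\<not> (e - of_real a) * (e + of_real b) + of_real ((cmod s)\<^sup>2) = 0"
  obtain v where v: "v \<in> carrier_vec N" "v \<noteq> 0\<^sub>v N" "(projector \<psi> - projector \<phi>) *\<^sub>v v = e \<cdot>\<^sub>v v"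
    using ev dim by (auto simp: eigenvalue_def eigenvector_def projector_def)
  define \<alpha> where "\<alpha> = inner_vec \<psi> v"
  define \<beta> where "\<beta> = inner_vec \<phi> v"
  have ent: "e * v $ k = \<alpha> * \<psi> $ k - \<beta> * \<phi> $ k" if k: "k < N" for k
  proof -
    have "e * v $ k = ((projector \<psi> - projector \<phi>) *\<^sub>v v) $ k" unfolding v(3) using v(1) k by simp
    also have "\<dots> = (\<Sum>l<N. (\<psi> $ k * cnj (\<psi> $ l) - \<phi> $ k * cnj (\<phi> $ l)) * v $ l)"
      using k dim v(1) by (simp add: projector_def scalar_prod_def atLeast0LessThan)
    also have "\<dots> = \<alpha> * \<psi> $ k - \<beta> * \<phi> $ k"
      using v(1) by (simp add: \<alpha>_def \<beta>_def inner_vec_def left_diff_distrib right_diff_distrib sum_subtractf sum_distrib_right sum_distrib_left mult_ac)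
    finally show ?thesis .
  qed
  have in\<psi>: "e * inner_vec w v = \<alpha> * inner_vec w \<psi> - \<beta> * inner_vec w \<phi>" for w
  proof -
    have "e * inner_vec w v = (\<Sum>k<N. cnj (w $ k) * (e * v $ k))"
      using v(1) by (simp add: inner_vec_def sum_distrib_left mult_ac)
    also have "\<dots> = (\<Sum>k<N. cnj (w $ k) * (\<alpha> * \<psi> $ k - \<beta> * \<phi> $ k))"
      by (intro sum.cong refl) (simp add: ent)
    also have "\<dots> = \<alpha> * inner_vec w \<psi> - \<beta> * inner_vec w \<phi>"
      using dim by (simp add: inner_vec_def right_diff_distrib sum_subtractf sum_distrib_left mult_ac)
    finally show ?thesis .
  qed
  have s': "inner_vec \<phi> \<psi> = cnj s" using dim by (simp add: s_def inner_swap[of \<phi> \<psi>])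
  have eq1: "(e - of_real a) * \<alpha> = - \<beta> * s"
    using in\<psi>[of \<psi>] by (simp add: \<alpha>_def[symmetric] inner_self a_def s_def algebra_simps)
  have eq2: "(e + of_real b) * \<beta> = \<alpha> * cnj s"
    using in\<psi>[of \<phi>] by (simp add: \<beta>_def[symmetric] inner_self b_def s' algebra_simps)
  have ss: "s * cnj s = of_real ((cmod s)\<^sup>2)" by (simp only: complex_norm_square)
  have "((e - of_real a) * (e + of_real b) + s * cnj s) * \<alpha> = (e + of_real b) * ((e - of_real a) * \<alpha>) + s * (\<alpha> * cnj s)"
    by (simp add: algebra_simps)
  also have "\<dots> = - s * ((e + of_real b) * \<beta>) + s * (\<alpha> * cnj s)" unfolding eq1 by (simp add: algebra_simps)
  also have "\<dots> = 0" unfolding eq2 by simp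
  finally have "\<alpha> = 0" using ne by (simp add: ss)
  have "((e - of_real a) * (e + of_real b) + s * cnj s) * \<beta> = (e - of_real a) * ((e + of_real b) * \<beta>) + cnj s * (\<beta> * s)"
    by (simp add: algebra_simps)
  also have "\<dots> = cnj s * ((e - of_real a) * \<alpha>) + cnj s * (\<beta> * s)" unfolding eq2 by (simp add: algebra_simps)
  also have "\<dots> = 0" unfolding eq1 by simp
  finally have "\<beta> = 0" using ne by (simp add: ss)
  show "e = 0"
  proof (rule ccontr)
    assume "e \<noteq> 0"
    then have "v $ k = 0" if "k < N" for k using ent[OF that] \<open>\<alpha> = 0\<close> \<open>\<beta> = 0\<close> by simp
    then have "v = 0\<^sub>v N" using v(1) by (intro eq_vecI) auto
    then show False using v(2) by simp
  qed
qed

text \<open>The eigenvalues are zero or the two roots of a quadratic; the traces of \<open>A\<close>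
  and \<open>A * A\<close> replace a count of multiplicities. The vectors are not normalised, since
  the complexity event ranges over all matrices in the space of the measure.\<close>

theorem trace_norm_projectors:
  assumes dim: "\<psi> \<in> carrier_vec N" "\<phi> \<in> carrier_vec N"
  shows "trace_norm (projector \<psi> - projector \<phi>)
    = sqrt (((euclidean_norm \<psi>)\<^sup>2 + (euclidean_norm \<phi>)\<^sup>2)\<^sup>2 - 4 * (cmod (inner_vec \<psi> \<phi>))\<^sup>2)"
proof -
  define A where "A = projector \<psi> - projector \<phi>"
  define a where "a = (euclidean_norm \<psi>)\<^sup>2"
  define b where "b = (euclidean_norm \<phi>)\<^sup>2"
  define s2 where "s2 = (cmod (inner_vec \<psi> \<phi>))\<^sup>2"
  define p where "p = a - b"
  define r where "r = sqrt ((a + b)\<^sup>2 - 4 * s2)"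
  have ab: "0 \<le> a" "0 \<le> b" "0 \<le> s2" "s2 \<le> a * b"
    using cauchy_schwarz_vec[of \<psi> \<phi>] dim by (simp_all add: a_def b_def s2_def)
  have D: "(a + b)\<^sup>2 - 4 * s2 = p\<^sup>2 + 4 * (a * b - s2)" by (simp add: p_def power2_eq_square algebra_simps)
  have r0: "0 \<le> r" "r\<^sup>2 = (a + b)\<^sup>2 - 4 * s2" "\<bar>p\<bar> \<le> r"
    using ab unfolding r_def D by (auto intro: real_le_rsqrt)
  have A: "A \<in> carrier_mat N N" using dim by (intro carrier_matI) (simp_all add: A_def projector_def)
  have entA: "A $$ (i, j) = \<psi> $ i * cnj (\<psi> $ j) - \<phi> $ i * cnj (\<phi> $ j)" if "i < N" "j < N" for i j
    using that dim by (simp add: A_def projector_def)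
  have herm: "mat_adjoint A = A"
  proof (rule eq_matI)
    fix i j assume "i < dim_row A" "j < dim_col A"
    then have "i < N" "j < N" using A by auto
    then show "mat_adjoint A $$ (i, j) = A $$ (i, j)"
      using A by (simp add: mat_adjoint_entry[OF A] entA mult.commute)
  qed (use mat_adjoint_carrier[OF A] A in auto)
  obtain e where tn: "trace_norm A = (\<Sum>i<N. sqrt (Re ((e i)\<^sup>2)))" and ev: "\<And>i. i < N \<Longrightarrow> eigenvalue A (e i)"
    and tr: "(\<Sum>i<N. A $$ (i, i)) = (\<Sum>i<N. e i)" "(\<Sum>i<N. (A * A) $$ (i, i)) = (\<Sum>i<N. (e i)\<^sup>2)"
    using trace_norm_eigenvalues[OF A herm] by blast
  have roots: "Im (e i) = 0 \<and> (Re (e i) = 0 \<or> Re (e i) = (p + r) / 2 \<or> Re (e i) = (p - r) / 2)" if i: "i < N" for i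
  proof -
    have "e i = 0 \<or> (e i - of_real a) * (e i + of_real b) + of_real s2 = 0"
      using projector_diff_eigenvalue[OF dim, of "e i"] ev[OF i] by (simp add: A_def a_def b_def s2_def)
    \<comment> \<open>Vieta: the roots have sum \<open>a - b\<close> and product
      \<open>s2 - a * b\<close>.\<close>
    moreover have "(e i - of_real a) * (e i + of_real b) + of_real s2 = (e i - of_real ((p + r) / 2)) * (e i - of_real ((p - r) / 2))"
    proof -
      define x where "x = complex_of_real ((p + r) / 2)"
      define y where "y = complex_of_real ((p - r) / 2)"
      have "r * r = p * p + 4 * (a * b - s2)" using r0(2) D by (simp add: power2_eq_square)
      then have "((p + r) / 2) * ((p - r) / 2) = s2 - a * b" by (simp add: field_simps)
      then have xy: "x * y = of_real s2 - of_real a * of_real b"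
        unfolding x_def y_def by (simp only: of_real_mult[symmetric] of_real_diff[symmetric])
      have "(p + r) / 2 + (p - r) / 2 = a - b" by (simp add: p_def field_simps)
      then have sum: "x + y = of_real a - of_real b"
        unfolding x_def y_def by (simp only: of_real_add[symmetric] of_real_diff[symmetric])
      have "(e i - x) * (e i - y) = e i * e i - (x + y) * e i + x * y" by (simp add: algebra_simps)
      also have "\<dots> = (e i - of_real a) * (e i + of_real b) + of_real s2"
        unfolding xy sum by (simp add: algebra_simps)
      finally show ?thesis by (simp only: x_def y_def)
    qed
    ultimately have "e i = of_real 0 \<or> e i = of_real ((p + r) / 2) \<or> e i = of_real ((p - r) / 2)" by auto
    then show ?thesis by (metis Im_complex_of_real Re_complex_of_real)
  qed
  have abs: "sqrt (Re ((e i)\<^sup>2)) = \<bar>Re (e i)\<bar>" if "i < N" for i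
    using roots[OF that] by (simp add: power2_eq_square)
  \<comment> \<open>The three possible values of \<open>e i\<close> all satisfy this identity, the
    roots having opposite weak signs because \<open>\<bar>p\<bar> \<le> r\<close>. Summed over
    \<open>i\<close>, it expresses the trace norm by the two traces.\<close>
  have lin: "r * \<bar>Re (e i)\<bar> = 2 * Re ((e i)\<^sup>2) - p * Re (e i)" if i: "i < N" for i
  proof -
    have sq: "Re ((e i)\<^sup>2) = (Re (e i))\<^sup>2" using roots[OF i] by (simp add: power2_eq_square)
    consider "Re (e i) = 0" | "Re (e i) = (p + r) / 2" | "Re (e i) = (p - r) / 2" using roots[OF i] by blast
    then show ?thesis
    proof cases
      case 2
      then have "\<bar>Re (e i)\<bar> = (p + r) / 2" using r0 by simp
      then show ?thesis unfolding sq 2 by (simp add: power2_eq_square field_simps)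
    next
      case 3
      then have "\<bar>Re (e i)\<bar> = (r - p) / 2" using r0 by simp
      then show ?thesis unfolding sq 3 by (simp add: power2_eq_square field_simps)
    qed (simp add: sq)
  qed
  have tr1: "(\<Sum>i<N. Re (e i)) = p"
  proof -
    have "(\<Sum>i<N. A $$ (i, i)) = complex_of_real a - complex_of_real b"
      using dim inner_self[of \<psi>] inner_self[of \<phi>]
      by (simp add: entA sum_subtractf a_def b_def inner_vec_def mult.commute)
    then show ?thesis using tr(1) by (simp add: p_def flip: Re_sum)
  qed
  have tr2: "(\<Sum>i<N. Re ((e i)\<^sup>2)) = a\<^sup>2 + b\<^sup>2 - 2 * s2"
  proof -
    have prod: "(\<Sum>i<N. \<Sum>j<N. (f i * g j) * (h j * k i)) = (\<Sum>i<N. f i * k i) * (\<Sum>j<N. g j * h j)" for f g h k :: "nat \<Rightarrow> complex"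
      by (simp add: sum_product mult_ac)
    have "(\<Sum>i<N. (A * A) $$ (i, i)) = (\<Sum>i<N. \<Sum>j<N. A $$ (i, j) * A $$ (j, i))"
      using A by (simp add: scalar_prod_def atLeast0LessThan)
    also have "\<dots> = (\<Sum>i<N. \<Sum>j<N. (\<psi> $ i * cnj (\<psi> $ j)) * (\<psi> $ j * cnj (\<psi> $ i)))
        - (\<Sum>i<N. \<Sum>j<N. (\<psi> $ i * cnj (\<psi> $ j)) * (\<phi> $ j * cnj (\<phi> $ i)))
        - (\<Sum>i<N. \<Sum>j<N. (\<phi> $ i * cnj (\<phi> $ j)) * (\<psi> $ j * cnj (\<psi> $ i)))
        + (\<Sum>i<N. \<Sum>j<N. (\<phi> $ i * cnj (\<phi> $ j)) * (\<phi> $ j * cnj (\<phi> $ i)))"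
      by (simp add: entA left_diff_distrib right_diff_distrib sum_subtractf sum.distrib algebra_simps)
    also have "\<dots> = inner_vec \<psi> \<psi> * inner_vec \<psi> \<psi> - inner_vec \<phi> \<psi> * inner_vec \<psi> \<phi>
        - inner_vec \<psi> \<phi> * inner_vec \<phi> \<psi> + inner_vec \<phi> \<phi> * inner_vec \<phi> \<phi>"
      unfolding prod using dim by (simp add: inner_vec_def mult.commute)
    also have "\<dots> = complex_of_real (a\<^sup>2 + b\<^sup>2 - 2 * s2)"
    proof -
      have "inner_vec \<psi> \<phi> * inner_vec \<phi> \<psi> = of_real s2"
        using dim by (simp add: inner_swap[of \<phi> \<psi>] s2_def complex_norm_square del: of_real_power)
      then show ?thesis unfolding inner_self a_def[symmetric] b_def[symmetric]
        by (simp add: power2_eq_square mult.commute)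
    qed
    finally show ?thesis using tr(2) by (simp flip: Re_sum)
  qed
  have rt: "r * trace_norm A = r\<^sup>2"
  proof -
    have "r * trace_norm A = (\<Sum>i<N. 2 * Re ((e i)\<^sup>2) - p * Re (e i))"
      unfolding tn sum_distrib_left by (intro sum.cong refl) (simp add: abs lin)
    also have "\<dots> = 2 * (a\<^sup>2 + b\<^sup>2 - 2 * s2) - p * p"
      by (simp only: sum_subtractf sum_distrib_left[symmetric] tr1 tr2)
    also have "\<dots> = r\<^sup>2" unfolding r0(2) by (simp add: p_def power2_eq_square algebra_simps)
    finally show ?thesis .
  qed
  \<comment> \<open>Cancelling \<open>r\<close> needs \<open>r\<close> nonzero; for
    \<open>r = 0\<close> both roots are zero and so is every eigenvalue.\<close>
  have "trace_norm A = r"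
  proof (cases "r = 0")
    case True
    then have "p = 0" using r0 by simp
    then have "Re (e i) = 0" if "i < N" for i using roots[OF that] True by auto
    then show ?thesis unfolding tn using abs True by simp
  next
    case False
    then show ?thesis using rt by (simp add: power2_eq_square)
  qed
  then show ?thesis by (simp add: A_def r_def a_def b_def s2_def)
qed

section \<open>Measurability of the complexity\<close>

text \<open>Matrices have no topology of their own, so the compactness argument is carried out for their
  entries in the product space \<open>nat \<times> nat \<Rightarrow> complex\<close>.\<close>

definition entries :: "nat \<Rightarrow> complex mat \<Rightarrow> nat \<times> nat \<Rightarrow> complex" where
  "entries N A = (\<lambda>(i, j). if i < N \<and> j < N then A $$ (i, j) else 0)"

text \<open>By the tube lemma, a point whose fibre over the compact \<open>K\<close> misses
  \<open>C\<close> has a neighbourhood all of whose fibres do.\<close>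

lemma closed_projection:
  assumes K: "compact K" and C: "closed C"
  shows "closed {u. \<exists>v\<in>K. (u, v) \<in> C}"
  unfolding closed_def
proof (subst open_subopen, intro ballI)
  fix u assume "u \<in> - {u. \<exists>v\<in>K. (u, v) \<in> C}"
  then have "{u} \<times> K \<subseteq> - C" by auto
  then obtain X where X: "u \<in> X" "open X" "X \<times> K \<subseteq> - C"
    using Elementary_Topology.tube_lemma[OF K] C by (metis open_Compl)
  then show "\<exists>T. open T \<and> u \<in> T \<and> T \<subseteq> - {u. \<exists>v\<in>K. (u, v) \<in> C}"
    by (intro exI[of _ X]) auto
qed

lemma continuous_on_if_const:
  "continuous_on S f \<Longrightarrow> continuous_on S g \<Longrightarrow> continuous_on S (\<lambda>x. if P then f x else g x)"
  by (cases P) simp_all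

lemma continuous_on_coord [continuous_intros]:
  "continuous_on S f \<Longrightarrow> continuous_on S (\<lambda>x. (f x :: 'a \<Rightarrow> 'b :: topological_space) i)"
  by (rule continuous_on_product_coordinates[THEN continuous_on_compose2]) auto

lemma compact_unit_box: "compact {f :: 'a \<Rightarrow> complex. \<forall>i. f i \<in> cball 0 1}"
proof -
  have "compactin (product_topology (\<lambda>_. euclidean) UNIV) (Pi\<^sub>E UNIV (\<lambda>_::'a. cball (0::complex) 1))"
    by (subst compactin_PiE) simp
  moreover have "Pi\<^sub>E UNIV (\<lambda>_::'a. cball (0::complex) 1) = {f. \<forall>i. f i \<in> cball 0 1}"
    by (auto simp: PiE_iff)
  ultimately show ?thesis by (simp only: euclidean_product_topology compactin_euclidean_iff)
qed

lemma mat_entries: "A \<in> carrier_mat N N \<Longrightarrow> mat N N (entries N A) = A"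
  by (rule eq_matI) (auto simp: entries_def)

text \<open>Orthonormality of the rows and the Leibniz formula for the determinant are closed
  conditions on entries, and the set lies in a product of unit discs, which is compact by
  Tychonoff.\<close>

lemma compact_SU: "compact (entries 4 ` SU 4)"
proof -
  let ?M = "\<lambda>f :: nat \<times> nat \<Rightarrow> complex. mat 4 4 f"
  define S where "S = {f :: nat \<times> nat \<Rightarrow> complex. (\<forall>i j. \<not> (i < 4 \<and> j < 4) \<longrightarrow> f (i, j) = 0) \<and>
    (\<forall>i j. i < 4 \<longrightarrow> j < 4 \<longrightarrow> (\<Sum>k<4. f (i, k) * cnj (f (j, k))) = (if i = j then 1 else 0)) \<and> det (?M f) = 1}"
  have SU: "?M f \<in> SU 4 \<longleftrightarrow> (\<forall>i j. i < 4 \<longrightarrow> j < 4 \<longrightarrow> (\<Sum>k<4. f (i, k) * cnj (f (j, k))) = (if i = j then 1 else 0)) \<and> det (?M f) = 1" for f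
  proof -
    have ent: "(?M f * mat_adjoint (?M f)) $$ (i, j) = (\<Sum>k<4. f (i, k) * cnj (f (j, k)))" if "i < 4" "j < 4" for i j
    proof -
      have "(?M f * mat_adjoint (?M f)) $$ (i, j) = (\<Sum>k<4. ?M f $$ (i, k) * mat_adjoint (?M f) $$ (k, j))"
        using that mat_adjoint_carrier[of "?M f" 4] by (simp add: scalar_prod_def atLeast0LessThan)
      then show ?thesis using that by (simp add: mat_adjoint_entry[of "?M f" 4])
    qed
    have "?M f * mat_adjoint (?M f) = 1\<^sub>m 4 \<longleftrightarrow> (\<forall>i j. i < 4 \<longrightarrow> j < 4 \<longrightarrow> (\<Sum>k<4. f (i, k) * cnj (f (j, k))) = (if i = j then 1 else 0))"
    proof
      assume eq: "?M f * mat_adjoint (?M f) = 1\<^sub>m 4"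
      show "\<forall>i j. i < 4 \<longrightarrow> j < 4 \<longrightarrow> (\<Sum>k<4. f (i, k) * cnj (f (j, k))) = (if i = j then 1 else 0)"
        using ent unfolding eq by (auto simp flip: ent)
    next
      assume "\<forall>i j. i < 4 \<longrightarrow> j < 4 \<longrightarrow> (\<Sum>k<4. f (i, k) * cnj (f (j, k))) = (if i = j then 1 else 0)"
      then show "?M f * mat_adjoint (?M f) = 1\<^sub>m 4"
        using mat_adjoint_carrier[of "?M f" 4] by (intro eq_matI) (auto simp: ent simp del: index_mult_mat(1))
    qed
    then show ?thesis by (simp add: SU_def)
  qed
  have "entries 4 ` SU 4 = S"
  proof (intro subset_antisym subsetI)
    fix f assume "f \<in> entries 4 ` SU 4"
    then obtain g where g: "g \<in> SU 4" "f = entries 4 g" by auto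
    then have "?M f = g" by (simp add: mat_entries SU_def)
    then have "?M f \<in> SU 4" using g by simp
    then show "f \<in> S" unfolding SU S_def using g(2) by (auto simp: entries_def)
  next
    fix f assume f: "f \<in> S"
    then have "?M f \<in> SU 4" unfolding SU by (simp add: S_def)
    moreover have "entries 4 (?M f) = f" using f by (auto simp: entries_def S_def fun_eq_iff)
    ultimately show "f \<in> entries 4 ` SU 4" by force
  qed
  moreover have "closed S"
  proof -
    have det: "det (?M f) = (\<Sum>p\<in>{p. p permutes {0..<4}}. signof p * (\<Prod>i = 0..<4. f (i, p i)))" for f
    proof -
      have "p i < 4" if "p permutes {0..<4}" "i < 4" for p and i :: nat
        using permutes_in_image[OF that(1), of i] that(2) by simp
      then show ?thesis unfolding det_def by (auto intro!: sum.cong prod.cong)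
    qed
    show ?thesis
      unfolding S_def det
      by (intro closed_Collect_conj closed_Collect_all closed_Collect_imp open_Collect_const closed_Collect_eq continuous_intros)
  qed
  moreover have "S \<subseteq> {f. \<forall>i. f i \<in> cball 0 1}"
  proof
    fix f assume f: "f \<in> S"
    then have M: "?M f \<in> SU 4" unfolding SU by (simp add: S_def)
    have "cmod (f (i, j)) \<le> 1" for i j
      using SU_entry_le[OF M, of i j] f by (cases "i < 4 \<and> j < 4") (auto simp: S_def)
    then show "f \<in> {f. \<forall>i. f i \<in> cball 0 1}" by auto
  qed
  ultimately show ?thesis
    using compact_Int_closed[OF compact_unit_box] by (metis inf.absorb2)
qed

lemma compact_gates: "compact (entries (2 ^ n) ` gates n)"
proof -
  let ?I = "{(i, j). i < n \<and> j < n \<and> i \<noteq> j}"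
  define F where "F i j f = entries (2 ^ n) (apply_gate n i j (mat 4 4 f))" for i j and f :: "nat \<times> nat \<Rightarrow> complex"
  have "continuous_on UNIV (F i j)" for i j
  proof (rule continuous_on_coordinatewise_then_product)
    fix kl :: "nat \<times> nat"
    obtain k l where kl: "kl = (k, l)" by (cases kl)
    have "2 * qubit n i k + qubit n j k < 4" "2 * qubit n i l + qubit n j l < 4"
      using qubit_less[of n i k] qubit_less[of n j k] qubit_less[of n i l] qubit_less[of n j l] by linarith+
    then have eq: "(\<lambda>f. F i j f kl) = (\<lambda>f. if (k < 2 ^ n \<and> l < 2 ^ n) \<and> (\<forall>q<n. q \<noteq> i \<and> q \<noteq> j \<longrightarrow> qubit n q k = qubit n q l)
        then f (2 * qubit n i k + qubit n j k, 2 * qubit n i l + qubit n j l) else 0)"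
      by (auto simp: F_def entries_def apply_gate_def kl fun_eq_iff)
    show "continuous_on UNIV (\<lambda>f. F i j f kl)"
      unfolding eq
      by (intro continuous_on_if_const continuous_on_const continuous_on_product_coordinates)
  qed
  then have "compact (F i j ` (entries 4 ` SU 4))" for i j
    by (intro compact_continuous_image[OF continuous_on_subset compact_SU]) auto
  moreover have "finite ?I" by (rule finite_subset[of _ "{..<n} \<times> {..<n}"]) auto
  ultimately have "compact (\<Union>(i, j)\<in>?I. F i j ` (entries 4 ` SU 4))"
    by (intro compact_UN) auto
  moreover have "(\<Union>(i, j)\<in>?I. F i j ` (entries 4 ` SU 4)) = entries (2 ^ n) ` gates n"
  proof -
    have "F i j (entries 4 g) = entries (2 ^ n) (apply_gate n i j g)" if "g \<in> SU 4" for i j g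
      using that by (simp add: F_def mat_entries SU_def)
    then have "(\<Union>(i, j)\<in>?I. F i j ` (entries 4 ` SU 4)) = (\<Union>(i, j)\<in>?I. (\<lambda>g. entries (2 ^ n) (apply_gate n i j g)) ` SU 4)"
      by (auto simp: image_image cong: image_cong)
    also have "\<dots> = entries (2 ^ n) ` gates n" unfolding gates_def by blast
    finally show ?thesis .
  qed
  ultimately show ?thesis by simp
qed

definition products :: "nat \<Rightarrow> nat \<Rightarrow> complex mat set" where
  "products n m = {mat_prod_list (2 ^ n) Vs | Vs. set Vs \<subseteq> gates n \<and> length Vs = m}"

lemma products_carrier: "V \<in> products n m \<Longrightarrow> V \<in> carrier_mat (2 ^ n) (2 ^ n)"
  using gates_carrier[of n] by (auto simp: products_def intro!: mat_prod_list_carrier)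

lemma compact_products: "compact (entries (2 ^ n) ` products n m)"
proof (induction m)
  case 0
  have "products n 0 = {1\<^sub>m (2 ^ n)}" by (auto simp: products_def mat_prod_list_def)
  then show ?case by simp
next
  case (Suc m)
  let ?N = "2 ^ n :: nat"
  define F where "F = (\<lambda>(f, g) (i, j). if i < ?N \<and> j < ?N then \<Sum>k<?N. f (i, k) * g (k, j) else (0::complex))"
  have coords: "continuous_on UNIV (\<lambda>p :: (nat \<times> nat \<Rightarrow> complex) \<times> (nat \<times> nat \<Rightarrow> complex). fst p ij)"
      "continuous_on UNIV (\<lambda>p :: (nat \<times> nat \<Rightarrow> complex) \<times> (nat \<times> nat \<Rightarrow> complex). snd p ij)" for ij
    by (rule continuous_on_coord, intro continuous_on_fst continuous_on_snd continuous_on_id)+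
  have cont: "continuous_on UNIV F"
  proof (rule continuous_on_coordinatewise_then_product)
    fix ij :: "nat \<times> nat"
    obtain i j where ij: "ij = (i, j)" by (cases ij)
    show "continuous_on UNIV (\<lambda>p. F p ij)"
      unfolding F_def ij case_prod_unfold fst_conv snd_conv
      by (intro continuous_on_if_const continuous_on_sum continuous_on_mult coords continuous_on_const)
  qed
  have mult: "entries ?N (V * W) = F (entries ?N V, entries ?N W)"
    if "V \<in> carrier_mat ?N ?N" "W \<in> carrier_mat ?N ?N" for V W
  proof
    fix ij :: "nat \<times> nat"
    obtain i j where ij: "ij = (i, j)" by (cases ij)
    show "entries ?N (V * W) ij = F (entries ?N V, entries ?N W) ij"
    proof (cases "i < ?N \<and> j < ?N")
      case True
      then have "(V * W) $$ (i, j) = (\<Sum>k<?N. V $$ (i, k) * W $$ (k, j))"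
        using that by (simp add: scalar_prod_def atLeast0LessThan)
      then show ?thesis using True by (simp add: F_def entries_def ij)
    next
      case False
      then show ?thesis by (auto simp: F_def entries_def ij)
    qed
  qed
  have "products n (Suc m) = (\<lambda>(V, W). V * W) ` (gates n \<times> products n m)"
  proof (intro subset_antisym subsetI)
    fix U assume "U \<in> products n (Suc m)"
    then obtain V Vs where "U = V * mat_prod_list ?N Vs" "V \<in> gates n" "set Vs \<subseteq> gates n" "length Vs = m"
      by (auto simp: products_def length_Suc_conv mat_prod_list_Cons)
    then show "U \<in> (\<lambda>(V, W). V * W) ` (gates n \<times> products n m)" by (force simp: products_def)
  next
    fix U assume "U \<in> (\<lambda>(V, W). V * W) ` (gates n \<times> products n m)"
    then obtain V Vs where "U = V * mat_prod_list ?N Vs" "V \<in> gates n" "set Vs \<subseteq> gates n" "length Vs = m"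
      by (auto simp: products_def)
    then show "U \<in> products n (Suc m)"
      unfolding products_def by (intro CollectI exI[of _ "V # Vs"]) (simp add: mat_prod_list_Cons)
  qed
  then have "entries ?N ` products n (Suc m) = (\<lambda>(V, W). entries ?N (V * W)) ` (gates n \<times> products n m)"
    by (simp add: image_image case_prod_unfold)
  also have "\<dots> = (\<lambda>(V, W). F (entries ?N V, entries ?N W)) ` (gates n \<times> products n m)"
  proof (rule image_cong[OF refl])
    fix p assume "p \<in> gates n \<times> products n m"
    then obtain V W where p: "p = (V, W)" "V \<in> gates n" "W \<in> products n m" by (elim SigmaE)
    have "entries ?N (V * W) = F (entries ?N V, entries ?N W)"
      using p(2) gates_carrier products_carrier[OF p(3)] by (intro mult) blast+
    then show "(case p of (V, W) \<Rightarrow> entries ?N (V * W)) = (case p of (V, W) \<Rightarrow> F (entries ?N V, entries ?N W))"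
      by (simp add: p(1))
  qed
  also have "\<dots> = F ` ((entries ?N ` gates n) \<times> (entries ?N ` products n m))"
    by (simp add: map_prod_surj_on[symmetric, OF refl refl] image_image case_prod_unfold map_prod_def)
  finally have "entries ?N ` products n (Suc m) = F ` ((entries ?N ` gates n) \<times> (entries ?N ` products n m))" .
  then show ?case
    using compact_continuous_image[OF continuous_on_subset[OF cont subset_UNIV] compact_Times[OF compact_gates Suc]] by simp
qed

lemma measurable_entries: "entries N \<in> borel_measurable (borel_mat N)"
proof (rule measurable_coordinatewise_then_product)
  fix ij :: "nat \<times> nat"
  obtain i j where ij: "ij = (i, j)" by (cases ij)
  show "(\<lambda>A. entries N A ij) \<in> borel_measurable (borel_mat N)"
    using measurable_entry[OF measurable_ident_sets[OF refl], of i N j]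
    by (cases "i < N \<and> j < N") (auto simp: entries_def ij)
qed

text \<open>For every length the products form a compact set, so the matrices related to one of them
  form a closed set; only countably many lengths occur.\<close>

lemma sets_closed_relation:
  assumes C: "closed C" and R: "\<And>U V. U \<in> carrier_mat (2 ^ n) (2 ^ n) \<Longrightarrow> V \<in> carrier_mat (2 ^ n) (2 ^ n) \<Longrightarrow>
    R U V \<longleftrightarrow> (entries (2 ^ n) U, entries (2 ^ n) V) \<in> C"
  shows "{U \<in> carrier_mat (2 ^ n) (2 ^ n). \<exists>Vs. set Vs \<subseteq> gates n \<and> real (length Vs) < r \<and> R U (mat_prod_list (2 ^ n) Vs)}
    \<in> sets (borel_mat (2 ^ n))"
proof -
  let ?N = "2 ^ n :: nat"
  have "{U \<in> carrier_mat ?N ?N. \<exists>Vs. set Vs \<subseteq> gates n \<and> real (length Vs) < r \<and> R U (mat_prod_list ?N Vs)}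
    = (\<Union>m\<in>{m. real m < r}. entries ?N -` {u. \<exists>v\<in>entries ?N ` products n m. (u, v) \<in> C} \<inter> space (borel_mat ?N))"
  proof -
    have "(\<exists>Vs. set Vs \<subseteq> gates n \<and> real (length Vs) < r \<and> R U (mat_prod_list ?N Vs)) \<longleftrightarrow>
        (\<exists>m. real m < r \<and> (\<exists>V\<in>products n m. (entries ?N U, entries ?N V) \<in> C))" if U: "U \<in> carrier_mat ?N ?N" for U
    proof -
      have "(\<exists>Vs. set Vs \<subseteq> gates n \<and> real (length Vs) < r \<and> R U (mat_prod_list ?N Vs)) \<longleftrightarrow>
        (\<exists>m. real m < r \<and> (\<exists>V\<in>products n m. R U V))" by (auto simp: products_def)
      then show ?thesis using R[OF U products_carrier] by blast
    qed
    then have "{U \<in> carrier_mat ?N ?N. \<exists>Vs. set Vs \<subseteq> gates n \<and> real (length Vs) < r \<and> R U (mat_prod_list ?N Vs)}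
      = {U \<in> carrier_mat ?N ?N. \<exists>m. real m < r \<and> (\<exists>V\<in>products n m. (entries ?N U, entries ?N V) \<in> C)}"
      by (intro Collect_cong conj_cong refl)
    also have "\<dots> = (\<Union>m\<in>{m. real m < r}. entries ?N -` {u. \<exists>v\<in>entries ?N ` products n m. (u, v) \<in> C} \<inter> space (borel_mat ?N))"
      by auto
    finally show ?thesis .
  qed
  also have "\<dots> \<in> sets (borel_mat ?N)"
    by (intro sets.countable_UN' countable_Collect countableI_type measurable_sets[OF measurable_entries] borel_closed closed_projection compact_products C)
      (use measurable_sets[OF measurable_entries borel_closed[OF closed_projection[OF compact_products C]]] in auto)
  finally show ?thesis .
qed

text \<open>An infimum of a nonempty set of extended naturals is attained; for the empty set it is
  infinity, which lies below no real.\<close>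

lemma complexity_less:
  "ereal_of_enat (INF Vs\<in>S. enat (length Vs)) < ereal r \<longleftrightarrow> (\<exists>Vs\<in>S. real (length Vs) < r)"
proof
  assume *: "ereal_of_enat (INF Vs\<in>S. enat (length Vs)) < ereal r"
  have "S \<noteq> {}" using * by (auto simp: top_enat_def)
  then have "(INF Vs\<in>S. enat (length Vs)) \<in> (\<lambda>Vs. enat (length Vs)) ` S"
    by (metis (mono_tags) ex_in_conv imageI wellorder_InfI)
  then obtain Vs where "Vs \<in> S" "(INF Vs\<in>S. enat (length Vs)) = enat (length Vs)" by auto
  then show "\<exists>Vs\<in>S. real (length Vs) < r" using * by auto
next
  assume "\<exists>Vs\<in>S. real (length Vs) < r"
  then obtain Vs where Vs: "Vs \<in> S" "real (length Vs) < r" by auto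
  have "ereal_of_enat (INF Vs\<in>S. enat (length Vs)) \<le> ereal_of_enat (enat (length Vs))"
    unfolding ereal_of_enat_le_iff using Vs(1) by (rule INF_lower)
  also have "\<dots> < ereal r" using Vs(2) by simp
  finally show "ereal_of_enat (INF Vs\<in>S. enat (length Vs)) < ereal r" .
qed

text \<open>The operator norm is a real supremum and can be compared pointwise only once it is known
  to be bounded; the sum of the moduli of all entries is bound enough.\<close>

lemma operator_norm_bdd:
  assumes A: "A \<in> carrier_mat N N"
  shows "bdd_above ((\<lambda>v. euclidean_norm (A *\<^sub>v v)) ` {v \<in> carrier_vec (dim_col A). euclidean_norm v = 1})"
proof (rule bdd_aboveI2)
  fix v assume v: "v \<in> {v \<in> carrier_vec (dim_col A). euclidean_norm v = 1}"
  then have vN: "v \<in> carrier_vec N" "euclidean_norm v = 1" using A by auto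
  have "euclidean_norm (A *\<^sub>v v) \<le> (\<Sum>k<N. cmod ((A *\<^sub>v v) $ k))"
    unfolding euclidean_norm_L2 using A by (intro order_trans[OF L2_set_le_sum]) auto
  also have "\<dots> \<le> (\<Sum>k<N. \<Sum>l<N. cmod (A $$ (k, l)))"
  proof (rule sum_mono)
    fix k assume "k \<in> {..<N}"
    then have "cmod ((A *\<^sub>v v) $ k) = cmod (\<Sum>l<N. A $$ (k, l) * v $ l)"
      using A vN by (simp add: scalar_prod_def atLeast0LessThan)
    also have "\<dots> \<le> (\<Sum>l<N. cmod (A $$ (k, l)))"
    proof (rule sum_norm_le)
      fix l assume "l \<in> {..<N}"
      then have "cmod (v $ l) \<le> 1" using entry_le_euclidean_norm[of l v] vN by simp
      then show "cmod (A $$ (k, l) * v $ l) \<le> cmod (A $$ (k, l))"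
        by (simp add: norm_mult mult_left_le)
    qed
    finally show "cmod ((A *\<^sub>v v) $ k) \<le> (\<Sum>l<N. cmod (A $$ (k, l)))" .
  qed
  finally show "euclidean_norm (A *\<^sub>v v) \<le> (\<Sum>k<N. \<Sum>l<N. cmod (A $$ (k, l)))" .
qed

lemma operator_norm_le_iff:
  assumes A: "A \<in> carrier_mat N N" and N: "N > 0"
  shows "operator_norm A \<le> e \<longleftrightarrow> (\<forall>v. v \<in> carrier_vec N \<and> euclidean_norm v = 1 \<longrightarrow> euclidean_norm (A *\<^sub>v v) \<le> e)"
proof -
  have "unit_vec N 0 \<in> {v \<in> carrier_vec (dim_col A). euclidean_norm v = 1}"
    using A N by (simp add: euclidean_norm_unit_vec)
  then have ne: "{v \<in> carrier_vec (dim_col A). euclidean_norm v = 1} \<noteq> {}" by blast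
  show ?thesis
    unfolding operator_norm_def cSUP_le_iff[OF ne operator_norm_bdd[OF A]] using A by auto
qed

text \<open>An operator norm of at most \<open>e\<close> is an intersection over unit vectors of
  conditions that are closed in the entries.\<close>

lemma unitary_complexity_event:
  fixes e r :: real and n d :: nat
  defines "B \<equiv> {U \<in> carrier_mat (2 ^ n) (2 ^ n). \<exists>Vs. set Vs \<subseteq> gates n \<and> real (length Vs) < r \<and> operator_norm (U - mat_prod_list (2 ^ n) Vs) \<le> e}"
  shows "B \<in> sets (borel_mat (2 ^ n))"
    and "{U \<in> space (zeta_circuit \<omega> n d). ereal_of_enat (unitary_complexity n e U) \<ge> ereal r} = carrier_mat (2 ^ n) (2 ^ n) - B"
proof -
  let ?N = "2 ^ n :: nat"
  define C :: "((nat \<times> nat \<Rightarrow> complex) \<times> (nat \<times> nat \<Rightarrow> complex)) set" where "C = {(u, v). \<forall>x. x \<in> carrier_vec ?N \<and> euclidean_norm x = 1 \<longrightarrow>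
     sqrt (\<Sum>k<?N. (cmod (\<Sum>l<?N. (u (k, l) - v (k, l)) * x $ l))\<^sup>2) \<le> e}"
  have "closed C"
    unfolding C_def case_prod_unfold
    by (intro closed_Collect_all closed_Collect_imp open_Collect_const closed_Collect_le continuous_intros)
  then show "B \<in> sets (borel_mat (2 ^ n))"
    unfolding B_def
  proof (rule sets_closed_relation)
    fix U V :: "complex mat" assume UV: "U \<in> carrier_mat ?N ?N" "V \<in> carrier_mat ?N ?N"
    have eq: "euclidean_norm ((U - V) *\<^sub>v x) = sqrt (\<Sum>k<?N. (cmod (\<Sum>l<?N. (entries ?N U (k, l) - entries ?N V (k, l)) * x $ l))\<^sup>2)"
      if "x \<in> carrier_vec ?N" for x
      using UV that by (simp add: euclidean_norm_def scalar_prod_def atLeast0LessThan entries_def)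
    then show "operator_norm (U - V) \<le> e \<longleftrightarrow> (entries ?N U, entries ?N V) \<in> C"
    proof -
      have "U - V \<in> carrier_mat ?N ?N" using UV(2) by (rule minus_carrier_mat)
      then have "operator_norm (U - V) \<le> e \<longleftrightarrow>
          (\<forall>x. x \<in> carrier_vec ?N \<and> euclidean_norm x = 1 \<longrightarrow> euclidean_norm ((U - V) *\<^sub>v x) \<le> e)"
        by (rule operator_norm_le_iff) simp
      also have "\<dots> \<longleftrightarrow> (entries ?N U, entries ?N V) \<in> C"
        unfolding C_def mem_Collect_eq case_prod_conv by (intro all_cong1 imp_cong refl) (simp only: eq)
      finally show ?thesis .
    qed
  qed
  have "ereal_of_enat (unitary_complexity n e U) < ereal r \<longleftrightarrow> U \<in> B" if "U \<in> carrier_mat ?N ?N" for U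
    unfolding unitary_complexity_def complexity_less using that by (auto simp: B_def)
  then have "ereal r \<le> ereal_of_enat (unitary_complexity n e U) \<longleftrightarrow> U \<notin> B" if "U \<in> carrier_mat ?N ?N" for U
    using that by (metis not_less)
  then show "{U \<in> space (zeta_circuit \<omega> n d). ereal_of_enat (unitary_complexity n e U) \<ge> ereal r} = carrier_mat (2 ^ n) (2 ^ n) - B"
    by auto
qed

text \<open>With the formula for the trace norm the trace distance is a continuous function of the
  entries of both matrices, so its sublevel sets are closed.\<close>

lemma state_complexity_event:
  fixes \<delta> r :: real and n d :: nat
  defines "\<psi> \<equiv> \<lambda>U. U *\<^sub>v kron_power ket_plus n" and "\<phi> \<equiv> \<lambda>Vs. mat_prod_list (2 ^ n) Vs *\<^sub>v unit_vec (2 ^ n) 0"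
  defines "D \<equiv> \<lambda>x y. sqrt (((euclidean_norm x)\<^sup>2 + (euclidean_norm y)\<^sup>2)\<^sup>2 - 4 * (cmod (inner_vec x y))\<^sup>2)"
  defines "B \<equiv> {U \<in> carrier_mat (2 ^ n) (2 ^ n). \<exists>Vs. set Vs \<subseteq> gates n \<and> real (length Vs) < r \<and> D (\<psi> U) (\<phi> Vs) / 2 \<le> \<delta>}"
  shows "B \<in> sets (borel_mat (2 ^ n))"
    and "{U \<in> space (zeta_circuit \<omega> n d). ereal_of_enat (state_complexity n \<delta> (U *\<^sub>v kron_power ket_plus n)) \<ge> ereal r} = carrier_mat (2 ^ n) (2 ^ n) - B"
proof -
  let ?N = "2 ^ n :: nat"
  let ?p = "\<lambda>l. kron_power ket_plus n $ l"
  define C :: "((nat \<times> nat \<Rightarrow> complex) \<times> (nat \<times> nat \<Rightarrow> complex)) set" where "C = {(u, v).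
    sqrt (((\<Sum>k<?N. (cmod (\<Sum>l<?N. u (k, l) * ?p l))\<^sup>2) + (\<Sum>k<?N. (cmod (v (k, 0)))\<^sup>2))\<^sup>2
      - 4 * (cmod (\<Sum>k<?N. cnj (\<Sum>l<?N. u (k, l) * ?p l) * v (k, 0)))\<^sup>2) / 2 \<le> \<delta>}"
  have "closed C"
    unfolding C_def case_prod_unfold
    by (intro closed_Collect_le continuous_intros) auto
  then show "B \<in> sets (borel_mat (2 ^ n))"
    unfolding B_def \<phi>_def
  proof (rule sets_closed_relation)
    fix U V :: "complex mat" assume UV: "U \<in> carrier_mat ?N ?N" "V \<in> carrier_mat ?N ?N"
    have U: "\<psi> U $ k = (\<Sum>l<?N. entries ?N U (k, l) * ?p l)" if "k < ?N" for k
      using UV that kron_power_plus_carrier[of n] by (simp add: \<psi>_def scalar_prod_def atLeast0LessThan entries_def)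
    have V: "(V *\<^sub>v unit_vec ?N 0) $ k = entries ?N V (k, 0)" if "k < ?N" for k
      using UV that by (simp add: entries_def)
    have dim: "dim_vec (\<psi> U) = ?N" "dim_vec (V *\<^sub>v unit_vec ?N 0) = ?N" using UV by (simp_all add: \<psi>_def)
    show "D (\<psi> U) (V *\<^sub>v unit_vec ?N 0) / 2 \<le> \<delta> \<longleftrightarrow> (entries ?N U, entries ?N V) \<in> C"
      unfolding D_def C_def euclidean_norm_sq inner_vec_def dim
      by (simp add: U V del: index_mult_mat_vec)
  qed
  have tn: "trace_norm (projector (\<psi> U) - projector (fold (\<lambda>V v. V *\<^sub>v v) Vs (kron_power ket0 n))) = D (\<psi> U) (\<phi> (rev Vs))"
    if "U \<in> carrier_mat ?N ?N" "set Vs \<subseteq> gates n" for U Vs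
  proof -
    have "set Vs \<subseteq> carrier_mat ?N ?N" using that gates_carrier by blast
    then have f: "fold (\<lambda>V v. V *\<^sub>v v) Vs (kron_power ket0 n) = \<phi> (rev Vs)"
      by (simp add: \<phi>_def kron_power_0 fold_gates)
    have c1: "\<psi> U \<in> carrier_vec ?N"
      unfolding \<psi>_def using that(1) kron_power_plus_carrier by (rule mult_mat_vec_carrier)
    have "mat_prod_list ?N (rev Vs) \<in> carrier_mat ?N ?N"
      using \<open>set Vs \<subseteq> carrier_mat ?N ?N\<close> by (intro mat_prod_list_carrier) simp
    then have c2: "\<phi> (rev Vs) \<in> carrier_vec ?N"
      unfolding \<phi>_def by (rule mult_mat_vec_carrier) simp
    show ?thesis unfolding f D_def by (rule trace_norm_projectors[OF c1 c2])
  qed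
  have "ereal_of_enat (state_complexity n \<delta> (\<psi> U)) < ereal r \<longleftrightarrow> U \<in> B" if U: "U \<in> carrier_mat ?N ?N" for U
  proof -
    have "(\<exists>Vs\<in>{Vs. set Vs \<subseteq> gates n \<and> trace_norm (projector (\<psi> U) - projector (fold (\<lambda>V v. V *\<^sub>v v) Vs (kron_power ket0 n))) / 2 \<le> \<delta>}. real (length Vs) < r)
        \<longleftrightarrow> (\<exists>Vs. set Vs \<subseteq> gates n \<and> real (length Vs) < r \<and> D (\<psi> U) (\<phi> (rev Vs)) / 2 \<le> \<delta>)"
      using tn[OF U] by auto
    \<comment> \<open>The state is built with the first gate applied first, in the product that gate
      stands rightmost; reversal preserves length and gate set.\<close>
    also have "\<dots> \<longleftrightarrow> (\<exists>Vs. set Vs \<subseteq> gates n \<and> real (length Vs) < r \<and> D (\<psi> U) (\<phi> Vs) / 2 \<le> \<delta>)"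
      by (metis length_rev rev_rev_ident set_rev)
    finally show ?thesis
      unfolding state_complexity_def complexity_less using U by (simp add: B_def)
  qed
  then have "ereal r \<le> ereal_of_enat (state_complexity n \<delta> (\<psi> U)) \<longleftrightarrow> U \<notin> B" if "U \<in> carrier_mat ?N ?N" for U
    using that by (metis not_less)
  then show "{U \<in> space (zeta_circuit \<omega> n d). ereal_of_enat (state_complexity n \<delta> (U *\<^sub>v kron_power ket_plus n)) \<ge> ereal r} = carrier_mat (2 ^ n) (2 ^ n) - B"
    by (auto simp: \<psi>_def)
qed

section \<open>Union bounds\<close>

text \<open>The law is an average over circuits of words, so the inclusion is asked for these alone.
  \<open>A\<close> may contain matrices that are not unitary and lie outside
  \<open>B\<close>.\<close>

lemma circuit_measure_mono:
  assumes n: "n > 0" and sets: "A \<in> sets (borel_mat (2 ^ n))" "B \<in> sets (borel_mat (2 ^ n))"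
    and sub: "\<And>ls \<phi>. set ls \<subseteq> letters n \<Longrightarrow> circuit \<omega> n ls \<phi> \<in> A \<Longrightarrow> circuit \<omega> n ls \<phi> \<in> B"
  shows "measure (zeta_circuit \<omega> n d) A \<le> measure (zeta_circuit \<omega> n d) B"
  unfolding measure_circuit[OF n sets(1)] measure_circuit[OF n sets(2)]
proof (rule seq_avg_mono)
  fix ls assume ls: "set ls \<subseteq> letters n" and len: "length ls = d"
  interpret prob_space "angles d" by (rule prob_space_angles)
  have "circuit \<omega> n ls -` B \<inter> space (angles d) \<in> sets (angles d)"
    using measurable_circuit[OF len] sets(2) by (rule measurable_sets)
  also have "circuit \<omega> n ls -` B \<inter> space (angles d) = {\<phi>\<in>space (angles d). circuit \<omega> n ls \<phi> \<in> B}" by auto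
  finally show "prob {\<phi>\<in>space (angles d). circuit \<omega> n ls \<phi> \<in> A} \<le> prob {\<phi>\<in>space (angles d). circuit \<omega> n ls \<phi> \<in> B}"
    using sub[OF ls] by (intro finite_measure_mono) auto
qed

text \<open>A circuit in \<open>A\<close> is close to a gate product of length at most
  \<open>L\<close>, hence falls into the event of a net product of the same length. There are
  \<open>L + 1\<close> lengths, each with at most as many net points as the largest.\<close>

lemma net_union_bound:
  assumes n: "n \<ge> 2" and A: "A \<in> sets (borel_mat (2 ^ n))"
    and E: "\<And>Ws. set Ws \<subseteq> gates n \<Longrightarrow> E Ws \<in> sets (borel_mat (2 ^ n)) \<and> measure (zeta_circuit \<omega> n d) (E Ws) \<le> p"
    and cover: "\<And>ls \<phi>. set ls \<subseteq> letters n \<Longrightarrow> circuit \<omega> n ls \<phi> \<in> A \<Longrightarrow>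
      \<exists>Vs. set Vs \<subseteq> gates n \<and> length Vs \<le> L \<and> (\<forall>Ws. set Ws \<subseteq> gates n \<longrightarrow>
        (\<forall>u\<in>carrier_vec (2 ^ n). euclidean_norm (mat_prod_list (2 ^ n) Vs *\<^sub>v u - mat_prod_list (2 ^ n) Ws *\<^sub>v u) \<le> 1 / 10 * euclidean_norm u)
        \<longrightarrow> circuit \<omega> n ls \<phi> \<in> E Ws)"
  shows "measure (zeta_circuit \<omega> n d) A \<le> real (L + 1) * real (n ^ 2 * (160 * (L + 1) + 1) ^ 32) ^ L * p"
proof -
  interpret prob_space "zeta_circuit \<omega> n d" by (rule prob_space_circuit)
  \<comment> \<open>With this grid a product of at most \<open>L\<close> gates is approximated up to
    \<open>8 * L / s\<close>, which is below 1/10.\<close>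
  define s where "s = 80 * (L + 1)"
  define y where "y = n ^ 2 * (2 * s + 1) ^ 32"
  have s: "s \<ge> 1" by (simp add: s_def)
  have y1: "1 \<le> y" using n by (simp add: y_def)
  have p0: "0 \<le> p" using order_trans[OF measure_nonneg, of "zeta_circuit \<omega> n d" "E []" p] E[of "[]"] by simp
  obtain Q where Q: "\<And>m. finite (Q m)" "\<And>m. card (Q m) \<le> y ^ m" "\<And>m Ws. Ws \<in> Q m \<Longrightarrow> set Ws \<subseteq> gates n"
    "\<And>m Vs. set Vs \<subseteq> gates n \<Longrightarrow> length Vs = m \<Longrightarrow> \<exists>Ws\<in>Q m. \<forall>u\<in>carrier_vec (2 ^ n).
      euclidean_norm (mat_prod_list (2 ^ n) Vs *\<^sub>v u - mat_prod_list (2 ^ n) Ws *\<^sub>v u) \<le> real m * (8 / real s) * euclidean_norm u"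
    using circuit_net[OF s, of n] unfolding y_def[symmetric] by metis
  define X where "X = (\<Union>m\<in>{..L}. \<Union>Ws\<in>Q m. E Ws)"
  have XE: "(\<Union>Ws\<in>Q m. E Ws) \<in> sets (borel_mat (2 ^ n))" for m
    using E Q(1,3) by (intro sets.finite_UN) blast+
  then have X: "X \<in> sets (borel_mat (2 ^ n))" unfolding X_def by (rule sets.finite_UN[OF finite_atMost])
  have "prob A \<le> prob X"
  proof (rule circuit_measure_mono[OF _ A X])
    fix ls \<phi> assume "set ls \<subseteq> letters n" "circuit \<omega> n ls \<phi> \<in> A"
    from cover[OF this] obtain Vs where Vs: "set Vs \<subseteq> gates n" "length Vs \<le> L"
      "\<And>Ws. set Ws \<subseteq> gates n \<Longrightarrow> (\<forall>u\<in>carrier_vec (2 ^ n). euclidean_norm (mat_prod_list (2 ^ n) Vs *\<^sub>v u - mat_prod_list (2 ^ n) Ws *\<^sub>v u) \<le> 1 / 10 * euclidean_norm u)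
        \<Longrightarrow> circuit \<omega> n ls \<phi> \<in> E Ws" by blast
    obtain Ws where Ws: "Ws \<in> Q (length Vs)" "\<And>u. u\<in>carrier_vec (2 ^ n) \<Longrightarrow>
      euclidean_norm (mat_prod_list (2 ^ n) Vs *\<^sub>v u - mat_prod_list (2 ^ n) Ws *\<^sub>v u) \<le> real (length Vs) * (8 / real s) * euclidean_norm u"
      using Q(4)[OF Vs(1) refl] by blast
    have "real (length Vs) * (8 / real s) \<le> 1 / 10"
      using Vs(2) by (simp add: s_def field_simps)
    then have "real (length Vs) * (8 / real s) * euclidean_norm u \<le> 1 / 10 * euclidean_norm u" for u
      by (rule mult_right_mono) simp
    then have "circuit \<omega> n ls \<phi> \<in> E Ws" using Vs(3)[OF Q(3)[OF Ws(1)]] Ws(2) order_trans by blast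
    then show "circuit \<omega> n ls \<phi> \<in> X" unfolding X_def using Ws(1) Vs(2) by blast
  qed (use n in simp)
  also have "prob X \<le> (\<Sum>m\<le>L. prob (\<Union>Ws\<in>Q m. E Ws))"
    unfolding X_def using XE by (intro finite_measure_subadditive_finite) auto
  also have "\<dots> \<le> (\<Sum>m\<le>L. real y ^ L * p)"
  proof (rule sum_mono)
    fix m assume m: "m \<in> {..L}"
    have "prob (\<Union>Ws\<in>Q m. E Ws) \<le> (\<Sum>Ws\<in>Q m. prob (E Ws))"
      using E Q(1,3) by (intro finite_measure_subadditive_finite) auto
    also have "\<dots> \<le> (\<Sum>Ws\<in>Q m. p)" using E Q(3) by (intro sum_mono) blast
    also have "\<dots> = real (card (Q m)) * p" by simp
    also have "\<dots> \<le> real (y ^ L) * p"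
    proof (rule mult_right_mono[OF _ p0])
      have "m \<le> L" using m by simp
      then have "card (Q m) \<le> y ^ L" using order_trans[OF Q(2) power_increasing[OF _ y1]] by blast
      then show "real (card (Q m)) \<le> real (y ^ L)" by (rule of_nat_mono)
    qed
    finally show "prob (\<Union>Ws\<in>Q m. E Ws) \<le> real y ^ L * p" by simp
  qed
  also have "\<dots> = real (L + 1) * real y ^ L * p" by (simp add: add.commute)
  also have "y = n ^ 2 * (160 * (L + 1) + 1) ^ 32" by (simp add: y_def s_def)
  finally show ?thesis .
qed

text \<open>The logarithm of the number of net points, with \<open>L + 1 \<le> 2 ^ L\<close>
  absorbed into the power. For \<open>L = 0\<close> both sides are one.\<close>

lemma count_bound:
  assumes n: "n \<ge> 2"
  shows "real (L + 1) * real (n ^ 2 * (160 * (L + 1) + 1) ^ 32) ^ L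
    \<le> exp (real L * (203 + 2 * ln (real n) + 32 * ln (real L)))"
proof (cases "L = 0")
  case False
  have L: "real L \<ge> 1" using False by simp
  have "L + 1 \<le> 2 ^ L" by (metis Suc_eq_plus1 Suc_leI less_exp)
  then have "real (L + 1) \<le> 2 ^ L" by (metis of_nat_le_iff of_nat_numeral of_nat_power)
  then have "real (L + 1) * real (n ^ 2 * (160 * (L + 1) + 1) ^ 32) ^ L \<le> 2 ^ L * real (n ^ 2 * (160 * (L + 1) + 1) ^ 32) ^ L"
    by (intro mult_right_mono) auto
  also have "\<dots> = (2 * (real n ^ 2 * (160 * (real L + 1) + 1) ^ 32)) ^ L"
    by (simp add: power_mult_distrib algebra_simps)
  \<comment> \<open>Since 512 is \<open>2 ^ 9\<close>, the numerical constants contribute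
    \<open>(1 + 32 * 9) * ln 2\<close>, which is below 203.\<close>
  also have "\<dots> \<le> (2 * (real n ^ 2 * (512 * real L) ^ 32)) ^ L"
    using L by (intro power_mono mult_left_mono) auto
  also have "2 * (real n ^ 2 * (512 * real L) ^ 32) = exp (ln 2 + (2 * ln (real n) + 32 * (9 * ln 2 + ln (real L))))"
  proof -
    have "(512::real) = exp (9 * ln 2)" using exp_of_nat_mult[of 9 "ln (2::real)"] by simp
    then have "512 * real L = exp (9 * ln 2 + ln (real L))" using L by (simp add: exp_add)
    then have "(512 * real L) ^ 32 = exp (32 * (9 * ln 2 + ln (real L)))"
      using exp_of_nat_mult[of 32 "9 * ln 2 + ln (real L)"] by simp
    moreover have "real n ^ 2 = exp (2 * ln (real n))" using n exp_of_nat_mult[of 2 "ln (real n)"] by simp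
    moreover have "2 = exp (ln (2::real))" by simp
    ultimately show ?thesis by (simp only: exp_add)
  qed
  also have "exp (ln 2 + (2 * ln (real n) + 32 * (9 * ln 2 + ln (real L)))) ^ L
      = exp (real L * (ln 2 + (2 * ln (real n) + 32 * (9 * ln 2 + ln (real L)))))"
    by (simp add: exp_of_nat_mult)
  also have "\<dots> \<le> exp (real L * (203 + 2 * ln (real n) + 32 * ln (real L)))"
    using ln2_le_25_over_36 by (intro iffD2[OF exp_le_cancel_iff] mult_left_mono) auto
  finally show ?thesis .
qed simp

text \<open>A matrix of small complexity is within \<open>e\<close> of a short product in operator
  norm, and that product within 1/10 of a net product; together all entries are within 1/5, the
  event of \<open>circuit_ball\<close>.\<close>

lemma unitary_complexity_bound:
  assumes \<omega>: "\<omega> ^ 4 = -1" and n: "n \<ge> 2" and d: "d \<ge> 1" "real d \<le> 2 powr (real n / 2)"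
    and e: "e \<le> 1 / 10" and L: "\<And>m. real m < r \<Longrightarrow> m \<le> L"
  shows "measure (zeta_circuit \<omega> n d) {U \<in> space (zeta_circuit \<omega> n d). ereal_of_enat (unitary_complexity n e U) \<ge> ereal r}
    \<ge> 1 - exp (real L * (203 + 2 * ln (real n) + 32 * ln (real L)) - 31 / 1296 * real d / real (block n))"
proof -
  interpret prob_space "zeta_circuit \<omega> n d" by (rule prob_space_circuit)
  let ?N = "2 ^ n :: nat"
  define B where "B = {U \<in> carrier_mat ?N ?N. \<exists>Vs. set Vs \<subseteq> gates n \<and> real (length Vs) < r \<and> operator_norm (U - mat_prod_list ?N Vs) \<le> e}"
  have B: "B \<in> sets (borel_mat ?N)" and ev: "{U \<in> space (zeta_circuit \<omega> n d). ereal_of_enat (unitary_complexity n e U) \<ge> ereal r} = carrier_mat ?N ?N - B"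
    unfolding B_def by (rule unitary_complexity_event)+
  define E where "E Ws = {U \<in> carrier_mat ?N ?N. \<forall>k<?N. \<forall>c<?N. cmod (U $$ (k, c) - mat_prod_list ?N Ws $$ (k, c)) \<le> 1 / 5}" for Ws
  have "prob B \<le> real (L + 1) * real (n ^ 2 * (160 * (L + 1) + 1) ^ 32) ^ L * exp (- (31 / 1296 * real d / real (block n)))"
  proof (rule net_union_bound[OF n B])
    fix Ws assume "set Ws \<subseteq> gates n"
    then show "E Ws \<in> sets (borel_mat ?N) \<and> prob (E Ws) \<le> exp (- (31 / 1296 * real d / real (block n)))"
      unfolding E_def using circuit_ball[OF \<omega> n d] sets_entries_close gate_product_entry_le by blast
  next
    fix ls \<phi> assume "circuit \<omega> n ls \<phi> \<in> B"
    then obtain Vs where Vs: "set Vs \<subseteq> gates n" "real (length Vs) < r" "operator_norm (circuit \<omega> n ls \<phi> - mat_prod_list ?N Vs) \<le> e"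
      by (auto simp: B_def)
    let ?U = "circuit \<omega> n ls \<phi>" and ?V = "mat_prod_list ?N Vs"
    have V: "?V \<in> carrier_mat ?N ?N" using Vs(1) gates_carrier by (intro mat_prod_list_carrier) blast
    have "?U \<in> E Ws" if Ws: "set Ws \<subseteq> gates n" and close: "\<forall>u\<in>carrier_vec ?N. euclidean_norm (?V *\<^sub>v u - mat_prod_list ?N Ws *\<^sub>v u) \<le> 1 / 10 * euclidean_norm u" for Ws
    proof -
      let ?W = "mat_prod_list ?N Ws"
      have W: "?W \<in> carrier_mat ?N ?N" using Ws gates_carrier by (intro mat_prod_list_carrier) blast
      have "cmod (?U $$ (k, c) - ?W $$ (k, c)) \<le> 1 / 5" if k: "k < ?N" and c: "c < ?N" for k c
      proof -
        let ?u = "unit_vec ?N c"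
        have D: "?U - ?V \<in> carrier_mat ?N ?N" using V by (rule minus_carrier_mat)
        have "euclidean_norm ((?U - ?V) *\<^sub>v ?u) \<le> e"
          using operator_norm_le_iff[OF D] Vs(3) c by (simp add: euclidean_norm_unit_vec)
        moreover have "cmod (((?U - ?V) *\<^sub>v ?u) $ k) \<le> euclidean_norm ((?U - ?V) *\<^sub>v ?u)"
          using carrier_matD(1)[OF V] k by (intro entry_le_euclidean_norm) simp
        moreover have "((?U - ?V) *\<^sub>v ?u) $ k = ?U $$ (k, c) - ?V $$ (k, c)"
          unfolding mult_unit_vec_entry[OF D k c] using carrier_matD[OF V] k c by simp
        ultimately have 1: "cmod (?U $$ (k, c) - ?V $$ (k, c)) \<le> 1 / 10" using e by simp
        have "euclidean_norm (?V *\<^sub>v ?u - ?W *\<^sub>v ?u) \<le> 1 / 10"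
          using close c by (auto simp: euclidean_norm_unit_vec dest!: bspec[of _ _ ?u])
        moreover have "cmod ((?V *\<^sub>v ?u - ?W *\<^sub>v ?u) $ k) \<le> euclidean_norm (?V *\<^sub>v ?u - ?W *\<^sub>v ?u)"
          using W k by (intro entry_le_euclidean_norm) simp
        moreover have "(?V *\<^sub>v ?u - ?W *\<^sub>v ?u) $ k = ?V $$ (k, c) - ?W $$ (k, c)"
          using V W k c by (simp add: mult_unit_vec_entry[of _ ?N] del: index_mult_mat_vec)
        ultimately have 2: "cmod (?V $$ (k, c) - ?W $$ (k, c)) \<le> 1 / 10" by simp
        show ?thesis
          using norm_triangle_ineq[of "?U $$ (k, c) - ?V $$ (k, c)" "?V $$ (k, c) - ?W $$ (k, c)"] 1 2 by simp
      qed
      then show ?thesis by (simp add: E_def)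
    qed
    then show "\<exists>Vs. set Vs \<subseteq> gates n \<and> length Vs \<le> L \<and> (\<forall>Ws. set Ws \<subseteq> gates n \<longrightarrow>
        (\<forall>u\<in>carrier_vec ?N. euclidean_norm (mat_prod_list ?N Vs *\<^sub>v u - mat_prod_list ?N Ws *\<^sub>v u) \<le> 1 / 10 * euclidean_norm u)
        \<longrightarrow> ?U \<in> E Ws)"
      using Vs(1) L[OF Vs(2)] by blast
  qed
  also have "\<dots> \<le> exp (real L * (203 + 2 * ln (real n) + 32 * ln (real L))) * exp (- (31 / 1296 * real d / real (block n)))"
    by (intro mult_right_mono count_bound n) simp
  also have "\<dots> = exp (real L * (203 + 2 * ln (real n) + 32 * ln (real L)) - 31 / 1296 * real d / real (block n))"
    by (simp only: exp_add[symmetric] diff_conv_add_uminus)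
  finally have "prob B \<le> exp (real L * (203 + 2 * ln (real n) + 32 * ln (real L)) - 31 / 1296 * real d / real (block n))" .
  then show ?thesis unfolding ev using prob_compl[of B] B by simp
qed

lemma norm_circuit_plus:
  assumes \<omega>: "\<omega> ^ 4 = -1" and n: "n \<ge> 2" and ls: "set ls \<subseteq> letters n"
  shows "euclidean_norm (circuit \<omega> n ls \<phi> *\<^sub>v kron_power ket_plus n) = 1"
proof -
  have "circuit \<omega> n ls \<phi> *\<^sub>v kron_power ket_plus n \<in> carrier_vec (2 ^ n)"
    using circuit_carrier kron_power_plus_carrier by (rule mult_mat_vec_carrier)
  then have "(euclidean_norm (circuit \<omega> n ls \<phi> *\<^sub>v kron_power ket_plus n))\<^sup>2 = (\<Sum>x\<in>Pow {..<n}. (1 / sqrt (2 ^ n))\<^sup>2)"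
    by (simp only: euclidean_norm_amp) (rule sum.cong[OF refl], simp only: amp_circuit_plus[OF n ls] norm_mult cmod_seq_phase[OF \<omega>] cmod_sqrt2_power mult_1)
  also have "\<dots> = 1" by (simp add: card_Pow power_divide)
  finally show ?thesis using euclidean_norm_nonneg by (metis abs_1 abs_of_nonneg power2_eq_1_iff real_sqrt_abs real_sqrt_one)
qed

text \<open>All output amplitudes of a circuit on the plus state have the same modulus. This rules
  out the empty circuit as an approximation.\<close>

lemma inner_circuit_plus_0:
  assumes \<omega>: "\<omega> ^ 4 = -1" and n: "n \<ge> 2" and ls: "set ls \<subseteq> letters n"
  shows "cmod (inner_vec (circuit \<omega> n ls \<phi> *\<^sub>v kron_power ket_plus n) (unit_vec (2 ^ n) 0)) = 1 / sqrt (2 ^ n)"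
proof -
  define v where "v = circuit \<omega> n ls \<phi> *\<^sub>v kron_power ket_plus n"
  have "inner_vec v (unit_vec (2 ^ n) 0) = (\<Sum>k<2 ^ n. if k = (0::nat) then cnj (v $ 0) else 0)"
    unfolding inner_vec_def by (intro sum.cong) (auto simp: unit_vec_def)
  then have "inner_vec v (unit_vec (2 ^ n) 0) = cnj (amp n v (ones n 0))"
    by (simp add: nth_eq_amp)
  then show ?thesis
    using amp_circuit_plus[OF n ls ones_mem, of \<omega> \<phi> 0]
    by (simp only: v_def complex_mod_cnj norm_mult cmod_seq_phase[OF \<omega>] cmod_sqrt2_power mult_1)
qed

lemma inner_diff_le:
  assumes "v \<in> carrier_vec N" "w \<in> carrier_vec N" "u \<in> carrier_vec N"
  shows "cmod (inner_vec v u) \<le> cmod (inner_vec w u) + euclidean_norm (v - w) * euclidean_norm u"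
proof -
  have "inner_vec v u = inner_vec w u + inner_vec (v - w) u"
    using assms by (simp add: inner_vec_def sum.distrib[symmetric] algebra_simps)
  moreover have "cmod (inner_vec (v - w) u) \<le> euclidean_norm (v - w) * euclidean_norm u"
    using cauchy_schwarz_vec[of "v - w" u] assms
    by (intro power2_le_imp_le[of "cmod (inner_vec (v - w) u)"]) (simp_all add: power_mult_distrib)
  ultimately show ?thesis using norm_triangle_ineq[of "inner_vec w u" "inner_vec (v - w) u"] by simp
qed

text \<open>For unit vectors the trace distance is the square root of one minus the squared overlap,
  so a distance below \<open>1 / sqrt 2\<close> means a squared overlap above 1/2. The second claim
  covers \<open>d\<close> so small that the moment estimate says nothing.\<close>

lemma state_complexity_bound:
  assumes \<omega>: "\<omega> ^ 4 = -1" and n: "n \<ge> 2" and \<delta>: "0 < \<delta>" "\<delta> < 1 / sqrt 2" and L: "\<And>m. real m < r \<Longrightarrow> m \<le> L"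
  shows "measure (zeta_circuit \<omega> n d) {U \<in> space (zeta_circuit \<omega> n d). ereal_of_enat (state_complexity n \<delta> (U *\<^sub>v kron_power ket_plus n)) \<ge> ereal r}
    \<ge> 1 - exp (real L * (203 + 2 * ln (real n) + 32 * ln (real L))) * (4 ^ t * (fact t * (1 / 2 ^ n) ^ t + (1 - 1 / (8 * real t)) ^ (d div block n)))"
    (is "_ \<ge> 1 - _ * ?p")
    and "L = 0 \<Longrightarrow> measure (zeta_circuit \<omega> n d) {U \<in> space (zeta_circuit \<omega> n d). ereal_of_enat (state_complexity n \<delta> (U *\<^sub>v kron_power ket_plus n)) \<ge> ereal r} = 1"
proof -
  interpret prob_space "zeta_circuit \<omega> n d" by (rule prob_space_circuit)
  let ?N = "2 ^ n :: nat"
  define \<psi> where "\<psi> U = U *\<^sub>v kron_power ket_plus n" for U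
  define \<phi> where "\<phi> Vs = mat_prod_list ?N Vs *\<^sub>v unit_vec ?N 0" for Vs
  define B where "B = {U \<in> carrier_mat ?N ?N. \<exists>Vs. set Vs \<subseteq> gates n \<and> real (length Vs) < r \<and>
    sqrt (((euclidean_norm (\<psi> U))\<^sup>2 + (euclidean_norm (\<phi> Vs))\<^sup>2)\<^sup>2 - 4 * (cmod (inner_vec (\<psi> U) (\<phi> Vs)))\<^sup>2) / 2 \<le> \<delta>}"
  have B: "B \<in> sets (borel_mat ?N)" and ev: "{U \<in> space (zeta_circuit \<omega> n d). ereal_of_enat (state_complexity n \<delta> (U *\<^sub>v kron_power ket_plus n)) \<ge> ereal r} = carrier_mat ?N ?N - B"
    unfolding B_def \<psi>_def \<phi>_def by (rule state_complexity_event)+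
  have compl: "prob (carrier_mat ?N ?N - B) = 1 - prob B" using prob_compl[of B] B by simp
  have carV: "mat_prod_list ?N Vs \<in> carrier_mat ?N ?N" "\<phi> Vs \<in> carrier_vec ?N" "euclidean_norm (\<phi> Vs) = 1" if "set Vs \<subseteq> gates n" for Vs
  proof -
    show c: "mat_prod_list ?N Vs \<in> carrier_mat ?N ?N" using that gates_carrier by (intro mat_prod_list_carrier) blast
    show "\<phi> Vs \<in> carrier_vec ?N" unfolding \<phi>_def using c by (rule mult_mat_vec_carrier) simp
    show "euclidean_norm (\<phi> Vs) = 1" using that by (simp add: \<phi>_def norm_gate_product euclidean_norm_unit_vec)
  qed
  have car\<psi>: "\<psi> (circuit \<omega> n ls \<theta>) \<in> carrier_vec ?N" for ls \<theta>
    unfolding \<psi>_def using circuit_carrier kron_power_plus_carrier by (rule mult_mat_vec_carrier)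
  have BE: "\<exists>Vs. set Vs \<subseteq> gates n \<and> length Vs \<le> L \<and> 1 / 2 < (cmod (inner_vec (\<phi> Vs) (\<psi> (circuit \<omega> n ls \<theta>))))\<^sup>2"
    if ls: "set ls \<subseteq> letters n" and U: "circuit \<omega> n ls \<theta> \<in> B" for ls \<theta>
  proof -
    let ?u = "\<psi> (circuit \<omega> n ls \<theta>)"
    obtain Vs where Vs: "set Vs \<subseteq> gates n" "real (length Vs) < r"
      "sqrt (((euclidean_norm ?u)\<^sup>2 + (euclidean_norm (\<phi> Vs))\<^sup>2)\<^sup>2 - 4 * (cmod (inner_vec ?u (\<phi> Vs)))\<^sup>2) / 2 \<le> \<delta>"
      using U by (auto simp: B_def)
    have "(euclidean_norm ?u) = 1" unfolding \<psi>_def by (rule norm_circuit_plus[OF \<omega> n ls])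
    then have "sqrt (4 * (1 - (cmod (inner_vec ?u (\<phi> Vs)))\<^sup>2)) / 2 \<le> \<delta>"
      using Vs(3) carV(3)[OF Vs(1)] by simp
    then have "sqrt (1 - (cmod (inner_vec ?u (\<phi> Vs)))\<^sup>2) \<le> \<delta>" by (simp only: real_sqrt_mult real_sqrt_four)
    also note \<delta>(2)
    finally have "sqrt (1 - (cmod (inner_vec ?u (\<phi> Vs)))\<^sup>2) < sqrt (1 / 2)" by (simp add: real_sqrt_divide)
    then have "1 / 2 < (cmod (inner_vec ?u (\<phi> Vs)))\<^sup>2" by simp
    moreover have "cmod (inner_vec ?u (\<phi> Vs)) = cmod (inner_vec (\<phi> Vs) ?u)"
      using car\<psi>[of ls \<theta>] carV(2)[OF Vs(1)] inner_swap[of ?u "\<phi> Vs"] by simp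
    ultimately show ?thesis using Vs L[OF Vs(2)] by auto
  qed
  show "prob {U \<in> space (zeta_circuit \<omega> n d). ereal_of_enat (state_complexity n \<delta> (U *\<^sub>v kron_power ket_plus n)) \<ge> ereal r} = 1"
    if L0: "L = 0"
  proof -
    \<comment> \<open>With \<open>L = 0\<close> only the empty product remains; its squared overlap
      with the state is \<open>1 / 2 ^ n\<close>, which is below 1/2.\<close>
    have "circuit \<omega> n ls \<theta> \<notin> B" if ls: "set ls \<subseteq> letters n" for ls \<theta>
    proof
      assume "circuit \<omega> n ls \<theta> \<in> B"
      from BE[OF ls this] L0 have "1 / 2 < (cmod (inner_vec (\<phi> []) (\<psi> (circuit \<omega> n ls \<theta>))))\<^sup>2" by auto
      moreover have "\<phi> [] = unit_vec ?N 0" by (simp add: \<phi>_def mat_prod_list_def)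
      moreover have "inner_vec (unit_vec ?N 0) (\<psi> (circuit \<omega> n ls \<theta>)) = cnj (inner_vec (\<psi> (circuit \<omega> n ls \<theta>)) (unit_vec ?N 0))"
        using car\<psi>[of ls \<theta>] by (intro inner_swap) simp
      ultimately have "1 / 2 < (1 / sqrt (2 ^ n))\<^sup>2"
        using inner_circuit_plus_0[OF \<omega> n ls, of \<theta>] by (simp only: \<psi>_def complex_mod_cnj)
      also have "\<dots> = (1 / 2) ^ n" by (simp add: power_divide)
      also have "\<dots> \<le> (1 / 2) ^ 1" using n by (intro power_decreasing) auto
      finally show False by simp
    qed
    then have "prob B \<le> prob {}" using n by (intro circuit_measure_mono B) auto
    then have "prob B = 0" using measure_nonneg[of _ B] by (simp add: antisym)
    then show ?thesis unfolding ev compl by simp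
  qed
  define E where "E Ws = {U \<in> carrier_mat ?N ?N. cmod (inner_vec (\<phi> Ws) (U *\<^sub>v kron_power ket_plus n)) \<ge> 1 / 2}" for Ws
  have "prob B \<le> real (L + 1) * real (n ^ 2 * (160 * (L + 1) + 1) ^ 32) ^ L * ?p"
  proof (rule net_union_bound[OF n B])
    fix Ws assume Ws: "set Ws \<subseteq> gates n"
    show "E Ws \<in> sets (borel_mat ?N) \<and> prob (E Ws) \<le> ?p"
      unfolding E_def
      by (intro conjI sets_overlap[OF kron_power_plus_carrier] circuit_overlap[OF \<omega> n carV(2)[OF Ws]]) (simp add: carV(3)[OF Ws])
  next
    fix ls \<theta> assume ls: "set ls \<subseteq> letters n" and U: "circuit \<omega> n ls \<theta> \<in> B"
    let ?U = "circuit \<omega> n ls \<theta>"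
    obtain Vs where Vs: "set Vs \<subseteq> gates n" "length Vs \<le> L" and big: "1 / 2 < (cmod (inner_vec (\<phi> Vs) (\<psi> ?U)))\<^sup>2"
      using BE[OF ls U] by blast
    have "?U \<in> E Ws" if Ws: "set Ws \<subseteq> gates n" and close: "\<forall>u\<in>carrier_vec ?N. euclidean_norm (mat_prod_list ?N Vs *\<^sub>v u - mat_prod_list ?N Ws *\<^sub>v u) \<le> 1 / 10 * euclidean_norm u" for Ws
    proof -
      \<comment> \<open>An overlap with square above 1/2 exceeds 3/5, and passing to the net product
        costs at most 1/10, so at least 1/2 is left.\<close>
      have "(3 / 5)\<^sup>2 \<le> (cmod (inner_vec (\<phi> Vs) (\<psi> ?U)))\<^sup>2" using big by (simp add: power2_eq_square)
      then have "3 / 5 \<le> cmod (inner_vec (\<phi> Vs) (\<psi> ?U))" by (rule power2_le_imp_le) simp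
      also have "\<dots> \<le> cmod (inner_vec (\<phi> Ws) (\<psi> ?U)) + euclidean_norm (\<phi> Vs - \<phi> Ws) * euclidean_norm (\<psi> ?U)"
        by (rule inner_diff_le[OF carV(2)[OF Vs(1)] carV(2)[OF Ws] car\<psi>])
      also have "euclidean_norm (\<psi> ?U) = 1" unfolding \<psi>_def by (rule norm_circuit_plus[OF \<omega> n ls])
      also have "euclidean_norm (\<phi> Vs - \<phi> Ws) \<le> 1 / 10"
        using bspec[OF close, of "unit_vec ?N 0"] by (simp add: \<phi>_def euclidean_norm_unit_vec)
      finally show ?thesis by (simp add: E_def \<psi>_def)
    qed
    then show "\<exists>Vs. set Vs \<subseteq> gates n \<and> length Vs \<le> L \<and> (\<forall>Ws. set Ws \<subseteq> gates n \<longrightarrow>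
        (\<forall>u\<in>carrier_vec ?N. euclidean_norm (mat_prod_list ?N Vs *\<^sub>v u - mat_prod_list ?N Ws *\<^sub>v u) \<le> 1 / 10 * euclidean_norm u)
        \<longrightarrow> ?U \<in> E Ws)"
      using Vs by blast
  qed
  also have "\<dots> \<le> exp (real L * (203 + 2 * ln (real n) + 32 * ln (real L))) * ?p"
  proof (intro mult_right_mono count_bound n)
    have "0 \<le> 1 - 1 / (8 * real t)" by (cases "t = 0") simp_all
    then show "0 \<le> ?p" by simp
  qed
  finally show "prob {U \<in> space (zeta_circuit \<omega> n d). ereal_of_enat (state_complexity n \<delta> (U *\<^sub>v kron_power ket_plus n)) \<ge> ereal r}
    \<ge> 1 - exp (real L * (203 + 2 * ln (real n) + 32 * ln (real L))) * ?p"
    unfolding ev compl by simp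
qed

section \<open>Choice of constants\<close>

text \<open>The threshold \<open>r\<close> may be negative or an integer: \<open>L\<close> is the
  largest natural number strictly below it, or zero if there is none.\<close>

lemma largest_nat_below:
  obtains L :: nat where "\<And>m. real m < r \<Longrightarrow> m \<le> L" "L = 0 \<or> real L < r"
proof
  show "m \<le> nat (\<lceil>r\<rceil> - 1)" if "real m < r" for m
    using that less_ceiling_iff[of "int m" r] by linarith
  show "nat (\<lceil>r\<rceil> - 1) = 0 \<or> real (nat (\<lceil>r\<rceil> - 1)) < r"
    by linarith
qed

lemma block_le: "n \<ge> 2 \<Longrightarrow> real (block n) \<le> 97 * real n ^ 4"
  using one_le_power[of "real n" 4] by (simp add: block_def)

lemma block_pos: "n \<ge> 2 \<Longrightarrow> 0 < block n"
  by (simp add: block_def)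

lemma log2_inverse_ge:
  assumes "0 < \<delta>" "\<delta>\<^sup>2 \<le> 1 / 2" "1 \<le> x"
  shows "1 + log 2 x \<le> log 2 (x / \<delta>\<^sup>2)"
proof -
  have "1 + log 2 x = log 2 (2 * x)" using assms by (simp add: log_mult)
  also have "\<dots> \<le> log 2 (x / \<delta>\<^sup>2)"
  proof (rule log_mono)
    have "2 * x * \<delta>\<^sup>2 \<le> x" using mult_left_mono[OF assms(2), of "2 * x"] assms(3) by simp
    then show "2 * x \<le> x / \<delta>\<^sup>2" using assms(1) by (simp add: pos_le_divide_eq)
  qed (use assms in auto)
  finally show ?thesis .
qed

text \<open>The last factor is at most one, and both logarithms in the denominator are at least 1/2
  because \<open>n \<ge> 2\<close> and \<open>\<delta>\<^sup>2 \<le> 1 / 2\<close>.\<close>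

lemma unitary_rate_le:
  assumes n: "n \<ge> 2" and d: "d \<ge> 1" and \<delta>: "0 < \<delta>" "\<delta>\<^sup>2 \<le> 1 / 2"
  shows "real d / (10 ^ 7 * real n ^ 9 * ln (real n) * log 2 (1 / \<delta>)) * (1 - 2 * log 2 (1 / (1 - \<delta>\<^sup>2)))
    \<le> 4 * real d / (10 ^ 7 * real n ^ 9)"
proof -
  have "ln 2 \<le> ln (real n)" using n by simp
  then have ln: "1 / 2 \<le> ln (real n)" using ln2_ge_two_thirds by simp
  have "1 \<le> log 2 (1 / \<delta>\<^sup>2)" using log2_inverse_ge[OF \<delta>, of 1] by simp
  also have "1 / \<delta>\<^sup>2 = (1 / \<delta>) ^ 2" by (simp add: power_divide)
  also have "log 2 \<dots> = 2 * log 2 (1 / \<delta>)" using \<delta> by (simp add: log_nat_power)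
  finally have lg: "1 / 2 \<le> log 2 (1 / \<delta>)" by simp
  have "0 \<le> log 2 (1 / (1 - \<delta>\<^sup>2))" using \<delta> by simp
  then have "real d / (10 ^ 7 * real n ^ 9 * ln (real n) * log 2 (1 / \<delta>)) * (1 - 2 * log 2 (1 / (1 - \<delta>\<^sup>2)))
      \<le> real d / (10 ^ 7 * real n ^ 9 * ln (real n) * log 2 (1 / \<delta>)) * 1"
    using ln lg by (intro mult_left_mono) auto
  also have "\<dots> \<le> real d / (10 ^ 7 * real n ^ 9 * (1 / 4))"
  proof -
    have "1 / 2 * (1 / 2) \<le> ln (real n) * log 2 (1 / \<delta>)" using ln lg by (intro mult_mono) auto
    then have "10 ^ 7 * real n ^ 9 * (1 / 4) \<le> 10 ^ 7 * real n ^ 9 * (ln (real n) * log 2 (1 / \<delta>))"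
      by (intro mult_left_mono) auto
    then show ?thesis using n ln lg by (simp only: mult_1_right mult.assoc) (intro divide_left_mono, auto intro!: mult_pos_pos)
  qed
  finally show ?thesis by simp
qed

lemma unitary_tail:
  assumes \<omega>: "\<omega> ^ 4 = -1" and n: "n \<ge> 2" and d: "d \<ge> 1" "real d \<le> 2 powr (real n / 2)"
    and \<delta>: "0 < \<delta>" "\<delta> < sqrt (1 - 2 powr (- 1 / 2))"
  shows "measure (zeta_circuit \<omega> n d) {U \<in> space (zeta_circuit \<omega> n d).
      ereal_of_enat (unitary_complexity n ((1 - sqrt (1 - \<delta>\<^sup>2)) * real d / (40000 * real n ^ 8 * 2 ^ n)) U)
      \<ge> ereal (real d / (10 ^ 7 * real n ^ 9 * ln (real n) * log 2 (1 / \<delta>)) * (1 - 2 * log 2 (1 / (1 - \<delta>\<^sup>2))))}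
    \<ge> 1 - exp (- (1 / 10 ^ 4) * real d / real n ^ 8)"
proof -
  define r where "r = real d / (10 ^ 7 * real n ^ 9 * ln (real n) * log 2 (1 / \<delta>)) * (1 - 2 * log 2 (1 / (1 - \<delta>\<^sup>2)))"
  define e where "e = (1 - sqrt (1 - \<delta>\<^sup>2)) * real d / (40000 * real n ^ 8 * 2 ^ n)"
  have "\<delta>\<^sup>2 < (sqrt (1 - 2 powr (- 1 / 2)))\<^sup>2" using \<delta> by (intro power_strict_mono) auto
  also have "\<dots> = 1 - 2 powr (- 1 / 2)"
    using powr_mono[of "- 1 / 2" 0 "2 :: real"] by (intro real_sqrt_pow2) simp
  also have "\<dots> \<le> 1 / 2" using powr_mono[of "-1" "- 1 / 2" "2 :: real"] by (simp add: powr_minus)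
  finally have \<delta>2: "\<delta>\<^sup>2 \<le> 1 / 2" by simp
  have d2: "real d \<le> 2 ^ n"
  proof -
    note d(2)
    also have "2 powr (real n / 2) \<le> (2 :: real) powr real n" by (intro powr_mono) auto
    finally show ?thesis by (simp add: powr_realpow)
  qed
  \<comment> \<open>As \<open>d\<close> is at most \<open>2 ^ n\<close>, it is cancelled by the
    power in the denominator.\<close>
  have e: "e \<le> 1 / 10"
  proof -
    have "e \<le> 1 * 2 ^ n / (40000 * 1 * 2 ^ n)"
      unfolding e_def using \<delta>2 d2 n one_le_power[of "real n" 8]
      by (intro frac_le mult_mono) auto
    also have "\<dots> \<le> 1 / 10" by simp
    finally show ?thesis .
  qed
  obtain L where L: "\<And>m. real m < r \<Longrightarrow> m \<le> L" "L = 0 \<or> real L < r"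
    using largest_nat_below[of r] by blast
  have n8: "0 < real n ^ 8" and n9: "1 \<le> real n ^ 9" using n by auto
  have L_le: "real L \<le> 4 * real d / (10 ^ 7 * real n ^ 9)"
    using L(2) unitary_rate_le[OF n d(1) \<delta>(1) \<delta>2] by (auto simp: r_def)
  have "real L * (203 + 2 * ln (real n) + 32 * ln (real L)) \<le> real L * (115 * real n)"
  proof (cases "L = 0")
    case False
    have "4 * real d / (10 ^ 7 * real n ^ 9) \<le> real d * 1"
    proof -
      have "4 * real d / (10 ^ 7 * real n ^ 9) \<le> 4 * real d / (10 ^ 7 * 1)"
        using n n9 by (intro divide_left_mono mult_left_mono) auto
      then show ?thesis by simp
    qed
    then have "ln (real L) \<le> ln (real d)" using False L_le d by (subst ln_le_cancel_iff) auto
    also have "\<dots> \<le> ln (2 powr (real n / 2))" using d by (subst ln_le_cancel_iff) auto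
    also have "\<dots> = real n / 2 * ln 2" by (simp add: ln_powr)
    also have "\<dots> \<le> real n / 2 * (25 / 36)" using ln2_le_25_over_36 by (intro mult_left_mono) auto
    finally have "ln (real L) \<le> real n * 25 / 72" by simp
    moreover have "ln (real n) \<le> real n" using ln_le_minus_one[of "real n"] n by simp
    \<comment> \<open>Here \<open>n \<ge> 2\<close> turns 203 into \<open>101.5 * n\<close>; the
      logarithms add \<open>2 * n\<close> and less than \<open>12 * n\<close>, the latter because
      \<open>L \<le> d\<close> and \<open>d\<close> is at most exponential in
      \<open>n\<close>.\<close>
    ultimately have "203 + 2 * ln (real n) + 32 * ln (real L) \<le> 115 * real n" using n by simp
    then show ?thesis by (intro mult_left_mono) auto
  qed simp
  also have "\<dots> \<le> 4 * real d / (10 ^ 7 * real n ^ 9) * (115 * real n)"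
    using L_le by (intro mult_right_mono) auto
  also have "\<dots> = 460 / 10 ^ 7 * (real d / real n ^ 8)" using n by (simp add: field_simps power_numeral_reduce)
  finally have 1: "real L * (203 + 2 * ln (real n) + 32 * ln (real L)) \<le> 460 / 10 ^ 7 * (real d / real n ^ 8)" .
  have "31 / (1296 * 97) * (real d / real n ^ 8) \<le> 31 / 1296 * (real d / real (block n))"
  proof -
    have "real n ^ 4 \<le> real n ^ 8" using n by (intro power_increasing) auto
    then have "real (block n) \<le> 97 * real n ^ 8" using block_le[OF n] by linarith
    then have "real d / (97 * real n ^ 8) \<le> real d / real (block n)"
      using block_pos[OF n] n by (intro divide_left_mono) auto
    then show ?thesis by simp
  qed
  moreover have "0 \<le> real d / real n ^ 8" by simp
  \<comment> \<open>The probability exponent has coefficient above \<open>2.4 / 10 ^ 4\<close>, of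
    which the net takes \<open>0.46 / 10 ^ 4\<close>.\<close>
  moreover have "Z - B \<le> - (1 / 10 ^ 4) * X"
    if "31 / (1296 * 97) * X \<le> B" "0 \<le> X" "Z \<le> 460 / 10 ^ 7 * X" for X B Z :: real using that by simp
  ultimately have "real L * (203 + 2 * ln (real n) + 32 * ln (real L)) - 31 / 1296 * (real d / real (block n))
      \<le> - (1 / 10 ^ 4) * (real d / real n ^ 8)"
    using 1 by blast
  then have "exp (real L * (203 + 2 * ln (real n) + 32 * ln (real L)) - 31 / 1296 * real d / real (block n))
      \<le> exp (- (1 / 10 ^ 4) * real d / real n ^ 8)" by simp
  moreover have "1 - exp (real L * (203 + 2 * ln (real n) + 32 * ln (real L)) - 31 / 1296 * real d / real (block n))
      \<le> measure (zeta_circuit \<omega> n d) {U \<in> space (zeta_circuit \<omega> n d). ereal_of_enat (unitary_complexity n e U) \<ge> ereal r}"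
    using L(1) by (rule unitary_complexity_bound[OF \<omega> n d e])
  ultimately show ?thesis unfolding r_def e_def by linarith
qed

text \<open>The bracket is at most \<open>n + 8 + 4 * log 2 n\<close>, hence at most
  \<open>9 * n\<close>, and \<open>\<delta>\<^sup>2 \<le> 1 / 2\<close> bounds the logarithm in the
  denominator from below by \<open>1 + log 2 d\<close>.\<close>

lemma state_rate_le:
  assumes n: "n \<ge> 2" and d: "d \<ge> 1" and \<delta>: "0 < \<delta>" "\<delta> < 1 / sqrt 2"
  shows "sqrt (real d) / (10 ^ 7 * real n ^ 4 * log 2 (real d / \<delta>\<^sup>2))
      * (real n - log 2 (sqrt (real d) / (200 * real n ^ 4)) - 2 * log 2 (1 / (1 - 2 * \<delta>\<^sup>2)))
    \<le> 9 * sqrt (real d) / (10 ^ 7 * real n ^ 3 * (1 + log 2 (real d)))"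
proof -
  have "\<delta>\<^sup>2 < (1 / sqrt 2)\<^sup>2" using \<delta> by (intro power_strict_mono) auto
  then have \<delta>2: "\<delta>\<^sup>2 < 1 / 2" by (simp add: power_divide)
  have D: "0 \<le> log 2 (real d)" using d by simp
  have lg: "1 + log 2 (real d) \<le> log 2 (real d / \<delta>\<^sup>2)" using \<delta> \<delta>2 d by (intro log2_inverse_ge) auto
  have "log 2 (real n) \<le> log 2 (2 ^ n)" using n of_nat_less_two_power[of n, where 'a = real] by (intro log_mono) auto
  then have lgn: "log 2 (real n) \<le> real n" by simp
  have "log 2 (200 :: real) \<le> log 2 (2 ^ 8)" by (intro log_mono) auto
  then have lg200: "log 2 (200 :: real) \<le> 8" by (simp only: log_pow_cancel)
  have "log 2 (sqrt (real d) / (200 * real n ^ 4)) = log 2 (sqrt (real d)) - (log 2 200 + 4 * log 2 (real n))"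
    using n d by (simp add: log_divide log_mult log_nat_power)
  moreover have "0 \<le> log 2 (sqrt (real d))" using d by simp
  moreover have "0 \<le> log 2 (1 / (1 - 2 * \<delta>\<^sup>2))" using \<delta> \<delta>2 by simp
  ultimately have br: "real n - log 2 (sqrt (real d) / (200 * real n ^ 4)) - 2 * log 2 (1 / (1 - 2 * \<delta>\<^sup>2)) \<le> 9 * real n"
    using lg200 lgn n by simp
  have "sqrt (real d) / (10 ^ 7 * real n ^ 4 * log 2 (real d / \<delta>\<^sup>2))
      * (real n - log 2 (sqrt (real d) / (200 * real n ^ 4)) - 2 * log 2 (1 / (1 - 2 * \<delta>\<^sup>2)))
    \<le> sqrt (real d) / (10 ^ 7 * real n ^ 4 * log 2 (real d / \<delta>\<^sup>2)) * (9 * real n)"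
    using D lg by (intro mult_left_mono[OF br]) auto
  also have "\<dots> \<le> sqrt (real d) / (10 ^ 7 * real n ^ 4 * (1 + log 2 (real d))) * (9 * real n)"
    using n D lg by (intro mult_right_mono divide_left_mono mult_left_mono) (auto intro!: mult_pos_pos)
  also have "\<dots> = 9 * sqrt (real d) / (10 ^ 7 * real n ^ 3 * (1 + log 2 (real d)))"
    using n D by (simp add: power_numeral_reduce)
  finally show ?thesis .
qed

text \<open>The size condition on \<open>t\<close> makes it small enough on two counts:
  \<open>t\<close> is at most \<open>2\<close> to the power \<open>n / 4\<close>, which tames
  \<open>fact t\<close>, and there are at least \<open>48 * n * t ^ 2\<close> blocks, which makes
  the survival probability negligible.\<close>

lemma moment_bound:
  assumes n: "n \<ge> 2" and d: "real d \<le> 2 powr (real n / 2)" and t: "t \<ge> 1" "10 ^ 4 * real n ^ 6 * (real t)\<^sup>2 \<le> real d"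
  shows "4 ^ t * (fact t * (1 / 2 ^ n) ^ t + (1 - 1 / (8 * real t)) ^ (d div block n)) \<le> exp (- (real n * real t / 3))"
proof -
  let ?s = "real n * real t"
  have t1: "1 \<le> real t" using t by simp
  have n1: "1 \<le> real n" using n by simp
  have nt: "0 \<le> ?s" by simp
  have n6: "10 ^ 4 * real n ^ 6 \<le> real d"
    using t(2) mult_left_mono[of 1 "(real t)\<^sup>2" "10 ^ 4 * real n ^ 6"] one_le_power[OF t1, of 2] by simp
  \<comment> \<open>A moment with \<open>t \<ge> 1\<close> is available only for \<open>d\<close> at
    least \<open>10 ^ 4\<close>, which exceeds \<open>2 ^ 6\<close>, and \<open>d\<close> is at most
    \<open>2\<close> to the power \<open>n / 2\<close>.\<close>
  have n12: "12 \<le> real n"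
  proof -
    have "2 powr 6 \<le> (10 ^ 4 :: real)" by (simp add: powr_numeral)
    also have "\<dots> \<le> 10 ^ 4 * real n ^ 6" using n1 by simp
    also note n6
    also note d
    finally have "6 \<le> real n / 2" by (simp only: powr_le_cancel_iff)
    then show ?thesis by simp
  qed
  have "fact t * (1 / 2 ^ n) ^ t \<le> exp (- (3 / 4 * ?s * ln 2))"
  proof -
    have "(real t)\<^sup>2 \<le> (10 ^ 4 * real n ^ 6) * (real t)\<^sup>2"
    proof -
      have "1 * (real t)\<^sup>2 \<le> (10 ^ 4 * real n ^ 6) * (real t)\<^sup>2"
        using one_le_power[OF n1, of 6] by (intro mult_right_mono) auto
      then show ?thesis by simp
    qed
    also note t(2)
    also note d
    also have "2 powr (real n / 2) = (exp (real n / 4 * ln 2))\<^sup>2"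
      by (simp add: powr_def power2_eq_square exp_add[symmetric])
    \<comment> \<open>Then \<open>fact t \<le> t ^ t\<close> costs only a quarter of the gain from
      \<open>(1 / 2 ^ n) ^ t\<close>.\<close>
    finally have te: "real t \<le> exp (real n / 4 * ln 2)" by (rule power2_le_imp_le) simp
    have "fact t \<le> real t ^ t" using fact_le_power[of t] by simp
    also have "\<dots> \<le> exp (real n / 4 * ln 2) ^ t" using te by (intro power_mono) auto
    also have "\<dots> = exp (1 / 4 * ?s * ln 2)" by (simp add: exp_of_nat_mult[symmetric] algebra_simps)
    finally have f: "fact t \<le> exp (1 / 4 * ?s * ln 2)" .
    have "(1 / 2 ^ n :: real) = exp (- (real n * ln 2))"
      by (simp add: exp_minus exp_of_nat_mult inverse_eq_divide)
    then have p: "(1 / 2 ^ n :: real) ^ t = exp (- (?s * ln 2))"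
      by (simp add: exp_of_nat_mult[symmetric] algebra_simps)
    have "fact t * (1 / 2 ^ n) ^ t \<le> exp (1 / 4 * ?s * ln 2) * exp (- (?s * ln 2))"
      unfolding p using f by (intro mult_right_mono) auto
    also have "exp (1 / 4 * ?s * ln 2) * exp (- (?s * ln 2)) = exp (- (3 / 4 * ?s * ln 2))"
      by (simp add: exp_add[symmetric])
    finally show ?thesis .
  qed
  moreover have "(1 - 1 / (8 * real t)) ^ (d div block n) \<le> exp (- (3 / 4 * ?s * ln 2))"
  proof -
    have bd: "real (block n) \<le> real d"
    proof -
      have "real n ^ 4 \<le> real n ^ 6" using n1 by (intro power_increasing) auto
      then show ?thesis using block_le[OF n] n6 by simp
    qed
    \<comment> \<open>The block length is at most \<open>97 * n ^ 4\<close>, and 194 allows for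
      rounding in \<open>d div block n\<close>. The product of the constants is 9312, below
      \<open>10 ^ 4\<close>.\<close>
    have "6 * ?s * (8 * real t) * (194 * real n ^ 4) \<le> real d"
    proof -
      have "6 * ?s * (8 * real t) * (194 * real n ^ 4) = 9312 * (real n ^ 5 * (real t)\<^sup>2)"
        by (simp add: power_numeral_reduce)
      also have "\<dots> \<le> 10 ^ 4 * (real n ^ 6 * (real t)\<^sup>2)"
      proof -
        have "real n ^ 5 * (real t)\<^sup>2 \<le> real n ^ 6 * (real t)\<^sup>2"
          using power_increasing[of 5 6, OF _ n1] by (intro mult_right_mono) auto
        moreover have "0 \<le> real n ^ 5 * (real t)\<^sup>2" by simp
        moreover have "9312 * x \<le> 10 ^ 4 * y" if "x \<le> y" "0 \<le> x" for x y :: real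
          using that by simp
        ultimately show ?thesis by blast
      qed
      also have "\<dots> \<le> real d" using t(2) by simp
      finally show ?thesis .
    qed
    also have "real d \<le> real (d div block n) * (2 * real (block n))"
    proof -
      have "block n \<le> d" using bd by simp
      then have "1 \<le> d div block n" using block_pos[OF n] by (simp add: Suc_le_eq div_greater_zero_iff)
      moreover have "d < block n * (d div block n + 1)"
        using dividend_less_times_div[OF block_pos[OF n], of d] by simp
      ultimately have "d \<le> block n * (2 * (d div block n))"
        using mult_le_mono2[of "d div block n + 1" "2 * (d div block n)" "block n"] by linarith
      then have "real d \<le> real (block n * (2 * (d div block n)))" by (rule of_nat_mono)
      then show ?thesis by (simp add: mult_ac)
    qed
    also have "\<dots> \<le> real (d div block n) * (194 * real n ^ 4)"
      using block_le[OF n] by (intro mult_left_mono) auto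
    finally have "6 * ?s * (8 * real t) \<le> real (d div block n)" using n1 by simp
    then have m: "6 * ?s \<le> real (d div block n) / (8 * real t)" using t1 by (simp add: pos_le_divide_eq)
    have "1 - 1 / (8 * real t) \<le> exp (- (1 / (8 * real t)))"
      using exp_ge_add_one_self[of "- (1 / (8 * real t))"] by simp
    then have "(1 - 1 / (8 * real t)) ^ (d div block n) \<le> exp (- (1 / (8 * real t))) ^ (d div block n)"
      using t1 by (intro power_mono) auto
    also have "\<dots> = exp (- (real (d div block n) / (8 * real t)))" by (simp add: exp_of_nat_mult[symmetric])
    also have "\<dots> \<le> exp (- (6 * ?s))" using m by simp
    also have "\<dots> \<le> exp (- (3 / 4 * ?s * ln 2))"
    proof -
      have "3 / 4 * ?s * ln 2 \<le> 3 / 4 * ?s * (25 / 36)"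
        using ln2_le_25_over_36 nt by (intro mult_left_mono) auto
      also have "\<dots> \<le> 6 * ?s" using nt by simp
      finally show ?thesis by simp
    qed
    finally show ?thesis .
  qed
  ultimately have "4 ^ t * (fact t * (1 / 2 ^ n) ^ t + (1 - 1 / (8 * real t)) ^ (d div block n))
      \<le> 4 ^ t * (exp (ln 2) * exp (- (3 / 4 * ?s * ln 2)))"
    by (intro mult_left_mono) auto
  also have "4 ^ t * (exp (ln 2) * exp (- (3 / 4 * ?s * ln 2))) = exp ((2 * real t + 1 - 3 / 4 * ?s) * ln 2)"
  proof -
    have "(4 :: real) = exp (2 * ln 2)" using exp_of_nat_mult[of 2 "ln (2::real)"] by simp
    then have "(4 :: real) ^ t = exp (2 * real t * ln 2)"
      by (simp only: exp_of_nat_mult[symmetric]) (simp add: mult_ac)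
    then show ?thesis by (simp only: exp_add[symmetric]) (simp add: algebra_simps)
  qed
  also have "\<dots> \<le> exp (- (real n * real t / 3))"
  proof -
    \<comment> \<open>For \<open>n \<ge> 12\<close> the factor \<open>4 ^ t\<close> and the doubling
      from the two summands cost at most \<open>2\<close> to the power \<open>3 * t\<close>, a
      quarter of the exponent \<open>n * t\<close>; then \<open>ln 2 \<ge> 2 / 3\<close> gives the
      rate 1/3.\<close>
    have "12 * real t \<le> ?s" using n12 t1 by (intro mult_right_mono) auto
    then have "2 * real t + 1 - 3 / 4 * ?s \<le> - (1 / 2 * ?s)" using t1 by linarith
    then have "(2 * real t + 1 - 3 / 4 * ?s) * ln 2 \<le> - (1 / 2 * ?s) * ln 2" by (intro mult_right_mono) auto
    also have "\<dots> \<le> - (1 / 2 * ?s) * (2 / 3)"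
      using ln2_ge_two_thirds nt by (intro mult_left_mono_neg) auto
    finally show ?thesis by simp
  qed
  finally show ?thesis .
qed

text \<open>The net has logarithm of order \<open>sqrt d / n ^ 2\<close> with a small constant, and
  the moment bound has exponent \<open>n * t / 3\<close>; the choice of \<open>t\<close> makes the
  second dominate.\<close>

lemma state_tail:
  assumes \<omega>: "\<omega> ^ 4 = -1" and n: "n \<ge> 2" and d: "d \<ge> 1" "real d \<le> 2 powr (real n / 2)"
    and \<delta>: "0 < \<delta>" "\<delta> < 1 / sqrt 2"
  shows "measure (zeta_circuit \<omega> n d) {U \<in> space (zeta_circuit \<omega> n d).
      ereal_of_enat (state_complexity n \<delta> (U *\<^sub>v kron_power ket_plus n))
      \<ge> ereal (sqrt (real d) / (10 ^ 7 * real n ^ 4 * log 2 (real d / \<delta>\<^sup>2))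
                * (real n - log 2 (sqrt (real d) / (200 * real n ^ 4)) - 2 * log 2 (1 / (1 - 2 * \<delta>\<^sup>2))))}
    \<ge> 1 - exp (- (1 / 10 ^ 4) * sqrt (real d) / real n ^ 4)"
proof -
  define r where "r = sqrt (real d) / (10 ^ 7 * real n ^ 4 * log 2 (real d / \<delta>\<^sup>2))
    * (real n - log 2 (sqrt (real d) / (200 * real n ^ 4)) - 2 * log 2 (1 / (1 - 2 * \<delta>\<^sup>2)))"
  define S where "S = sqrt (real d)"
  define D where "D = log 2 (real d)"
  \<comment> \<open>The largest order permitted by the condition
    \<open>10 ^ 4 * n ^ 6 * t ^ 2 \<le> d\<close> of \<open>moment_bound\<close>.\<close>
  define t where "t = nat \<lfloor>S / (100 * real n ^ 3)\<rfloor>"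
  have S1: "1 \<le> S" and SS: "S\<^sup>2 = real d" using d by (auto simp: S_def)
  have D0: "0 \<le> D" using d by (simp add: D_def)
  have n1: "1 \<le> real n" using n by simp
  have n3: "0 < real n ^ 3" "1 \<le> real n ^ 3" using n by auto
  obtain L where L: "\<And>m. real m < r \<Longrightarrow> m \<le> L" "L = 0 \<or> real L < r"
    using largest_nat_below[of r] by blast
  have r: "r \<le> 9 * S / (10 ^ 7 * real n ^ 3 * (1 + D))"
    unfolding r_def S_def D_def by (rule state_rate_le[OF n d(1) \<delta>])
  then have L_le: "real L \<le> 9 * S / (10 ^ 7 * real n ^ 3 * (1 + D))"
    using L(2) S1 D0 by auto
  also have "\<dots> \<le> 9 * S / (10 ^ 7 * real n ^ 3 * 1)"
    using n3 D0 S1 by (intro divide_left_mono mult_left_mono) auto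
  finally have L_le': "real L \<le> 9 * S / (10 ^ 7 * real n ^ 3)" by simp
  show ?thesis
  proof (cases "t = 0")
    \<comment> \<open>No moment is available, but then the claimed complexity is below one, and
      excluding the empty circuit suffices.\<close>
    case True
    then have "S / (100 * real n ^ 3) < 1" unfolding t_def by linarith
    then have "S < 100 * real n ^ 3" using n3 by (simp add: divide_less_eq)
    moreover have "9 * x < 10 ^ 7 * y" if "x < 100 * y" "0 < y" for x y :: real
      using that by simp
    ultimately have "9 * S < 10 ^ 7 * real n ^ 3" using n3 by blast
    then have "9 * S / (10 ^ 7 * real n ^ 3) < 1" using n3 by (simp add: divide_less_eq)
    then have "L = 0" using L_le' by simp
    then have "measure (zeta_circuit \<omega> n d) {U \<in> space (zeta_circuit \<omega> n d). ereal_of_enat (state_complexity n \<delta> (U *\<^sub>v kron_power ket_plus n)) \<ge> ereal r} = 1"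
      using L(1) by (intro state_complexity_bound(2)[OF \<omega> n \<delta>])
    then show ?thesis unfolding r_def by simp
  next
    case False
    then have t: "t \<ge> 1" by simp
    have "real t \<le> S / (100 * real n ^ 3)" using S1 n3 by (simp add: t_def)
    then have tS: "real t * (100 * real n ^ 3) \<le> S" using n3 by (simp add: pos_le_divide_eq)
    then have "(real t * (100 * real n ^ 3))\<^sup>2 \<le> S\<^sup>2" by (intro power_mono) auto
    then have td: "10 ^ 4 * real n ^ 6 * (real t)\<^sup>2 \<le> real d" by (simp add: SS power_mult_distrib mult_ac)
    have "S / (100 * real n ^ 3) < real t + 1" unfolding t_def by linarith
    also have "\<dots> \<le> 2 * real t" using t by simp
    finally have St: "S < 200 * real t * real n ^ 3" using n3 by (simp add: divide_less_eq mult_ac)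
    have "real L * (203 + 2 * ln (real n) + 32 * ln (real L)) \<le> real L * (203 * (1 + D))"
    proof (cases "L = 0")
      case False
      have "9 * S / (10 ^ 7 * real n ^ 3) \<le> 9 * S / (10 ^ 7 * 1)"
        using n3 S1 by (intro divide_left_mono mult_left_mono) auto
      then have "real L \<le> S" using L_le' S1 by simp
      then have "ln (real L) \<le> ln S" using False S1 by (subst ln_le_cancel_iff) auto
      moreover have "ln (real n) \<le> ln S"
      proof -
        have "real n * 1 \<le> real n ^ 3 * (100 * real t)"
          using n1 t power_increasing[of 1 3 "real n"] by (intro mult_mono) auto
        then show ?thesis using tS n by (subst ln_le_cancel_iff) (auto simp: mult_ac)
      qed
      \<comment> \<open>Both \<open>L\<close> and \<open>n\<close> are at most \<open>S\<close>, so
        every logarithm in the net size is controlled by \<open>D\<close>, the term that the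
        denominator of the rate contains.\<close>
      moreover have "2 * ln S = D * ln 2"
        using S1 d by (simp add: S_def D_def ln_sqrt log_def)
      moreover have "D * ln 2 \<le> D * 1" using D0 ln2_le_25_over_36 by (intro mult_left_mono) auto
      ultimately have "203 + 2 * ln (real n) + 32 * ln (real L) \<le> 203 * (1 + D)" using D0 by simp
      then show ?thesis by (intro mult_left_mono) auto
    qed simp
    also have "\<dots> \<le> 9 * S / (10 ^ 7 * real n ^ 3 * (1 + D)) * (203 * (1 + D))"
      using L_le D0 by (intro mult_right_mono) auto
    also have "\<dots> = 1827 / 10 ^ 7 * (S / real n ^ 3)" 
    proof -
      have "9 * S / (10 ^ 7 * z * y) * (203 * y) = 1827 / 10 ^ 7 * (S / z)" if "0 < y" "0 < z" for y z :: real
        using that by (simp add: field_simps)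
      moreover have "0 < 1 + D" using D0 by simp
      ultimately show ?thesis using n3(1) by blast
    qed
    also have "\<dots> \<le> 1827 / 10 ^ 7 * (S / real n ^ 2)"
      using n1 S1 by (intro mult_left_mono divide_left_mono power_increasing) auto
    finally have 1: "real L * (203 + 2 * ln (real n) + 32 * ln (real L)) \<le> 1827 / 10 ^ 7 * (S / real n ^ 2)" .
    have 2: "S / real n ^ 2 \<le> 200 * (real n * real t)"
      using St n1 by (simp add: divide_le_eq power_numeral_reduce mult_ac)
    have 3: "S / real n ^ 4 \<le> S / real n ^ 2"
      using n1 S1 by (intro divide_left_mono power_increasing) auto
    have "exp (real L * (203 + 2 * ln (real n) + 32 * ln (real L))) * (4 ^ t * (fact t * (1 / 2 ^ n) ^ t + (1 - 1 / (8 * real t)) ^ (d div block n)))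
      \<le> exp (real L * (203 + 2 * ln (real n) + 32 * ln (real L))) * exp (- (real n * real t / 3))"
      by (intro mult_left_mono moment_bound n d t td) simp
    also have "\<dots> = exp (real L * (203 + 2 * ln (real n) + 32 * ln (real L)) - real n * real t / 3)"
      by (simp only: exp_add[symmetric] diff_conv_add_uminus)
    finally have "exp (real L * (203 + 2 * ln (real n) + 32 * ln (real L))) * (4 ^ t * (fact t * (1 / 2 ^ n) ^ t + (1 - 1 / (8 * real t)) ^ (d div block n)))
      \<le> exp (real L * (203 + 2 * ln (real n) + 32 * ln (real L)) - real n * real t / 3)" .
    also have "\<dots> \<le> exp (- (1 / 10 ^ 4) * S / real n ^ 4)"
    proof -
      \<comment> \<open>In units of \<open>S / n ^ 2\<close> the moment exponent is at least 1/600,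
        since \<open>S / n ^ 2 \<le> 200 * n * t\<close>, while the net takes
        \<open>1827 / 10 ^ 7\<close>; the difference exceeds \<open>1 / 10 ^ 4\<close>.\<close>
      have "0 \<le> S / real n ^ 2" using S1 by simp
      then have "real L * (203 + 2 * ln (real n) + 32 * ln (real L)) - real n * real t / 3 \<le> - (1 / 10 ^ 4) * (S / real n ^ 4)"
        using 1 2 3 by simp
      then show ?thesis by simp
    qed
    finally have "exp (real L * (203 + 2 * ln (real n) + 32 * ln (real L))) * (4 ^ t * (fact t * (1 / 2 ^ n) ^ t + (1 - 1 / (8 * real t)) ^ (d div block n)))
      \<le> exp (- (1 / 10 ^ 4) * S / real n ^ 4)" .
    moreover have "1 - exp (real L * (203 + 2 * ln (real n) + 32 * ln (real L))) * (4 ^ t * (fact t * (1 / 2 ^ n) ^ t + (1 - 1 / (8 * real t)) ^ (d div block n)))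
      \<le> measure (zeta_circuit \<omega> n d) {U \<in> space (zeta_circuit \<omega> n d). ereal_of_enat (state_complexity n \<delta> (U *\<^sub>v kron_power ket_plus n)) \<ge> ereal r}"
      using L(1) by (rule state_complexity_bound(1)[OF \<omega> n \<delta>])
    ultimately show ?thesis unfolding r_def S_def by linarith
  qed
qed

theorem theorem1:
  shows "\<exists>K c :: real. K > 0 \<and> c > 0 \<and>
    (\<forall>\<omega> :: complex. \<forall>n d :: nat.
      \<omega> ^ 4 = -1 \<longrightarrow> 2 \<le> n \<longrightarrow> 1 \<le> d \<longrightarrow> real d \<le> 2 powr (real n / 2) \<longrightarrow>
      (\<forall>\<delta> :: real. 0 \<le> \<delta> \<longrightarrow> \<delta> < sqrt (1 - 2 powr (- 1 / 2)) \<longrightarrow>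
        measure (zeta_circuit \<omega> n d) {U \<in> space (zeta_circuit \<omega> n d).
          ereal_of_enat (unitary_complexity n
            ((1 - sqrt (1 - \<delta>\<^sup>2)) * real d / (40000 * real n ^ 8 * 2 ^ n)) U)
          \<ge> ereal (if \<delta> = 0 then 0 else
              real d / (K * real n ^ 9 * ln (real n) * log 2 (1 / \<delta>))
                * (1 - 2 * log 2 (1 / (1 - \<delta>\<^sup>2))))}
        \<ge> 1 - exp (- c * real d / real n ^ 8)) \<and>
      (\<forall>\<delta> :: real. 0 < \<delta> \<longrightarrow> \<delta> < 1 / sqrt 2 \<longrightarrow>
        measure (zeta_circuit \<omega> n d) {U \<in> space (zeta_circuit \<omega> n d).
          ereal_of_enat (state_complexity n \<delta> (U *\<^sub>v kron_power ket_plus n))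
          \<ge> ereal (sqrt (real d) / (K * real n ^ 4 * log 2 (real d / \<delta>\<^sup>2))
                * (real n - log 2 (sqrt (real d) / (200 * real n ^ 4))
                    - 2 * log 2 (1 / (1 - 2 * \<delta>\<^sup>2))))}
        \<ge> 1 - exp (- c * sqrt (real d) / real n ^ 4)))"
proof (rule exI[of _ "10 ^ 7"], rule exI[of _ "1 / 10 ^ 4"], intro conjI allI impI)
  fix \<omega> :: complex and n d :: nat and \<delta> :: real
  assume \<omega>: "\<omega> ^ 4 = -1" and n: "2 \<le> n" and d: "1 \<le> d" "real d \<le> 2 powr (real n / 2)"
  {
    assume \<delta>: "0 \<le> \<delta>" "\<delta> < sqrt (1 - 2 powr (- 1 / 2))"
    show "measure (zeta_circuit \<omega> n d) {U \<in> space (zeta_circuit \<omega> n d).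
        ereal_of_enat (unitary_complexity n ((1 - sqrt (1 - \<delta>\<^sup>2)) * real d / (40000 * real n ^ 8 * 2 ^ n)) U)
        \<ge> ereal (if \<delta> = 0 then 0 else real d / (10 ^ 7 * real n ^ 9 * ln (real n) * log 2 (1 / \<delta>))
              * (1 - 2 * log 2 (1 / (1 - \<delta>\<^sup>2))))}
      \<ge> 1 - exp (- (1 / 10 ^ 4) * real d / real n ^ 8)"
    proof (cases "\<delta> = 0")
      \<comment> \<open>For \<open>\<delta> = 0\<close> the threshold is zero, so the event is the
        whole space.\<close>
      case True
      interpret prob_space "zeta_circuit \<omega> n d" by (rule prob_space_circuit)
      have "0 \<le> ereal_of_enat m" for m by (cases m) auto
      then show ?thesis using True prob_space by (simp del: space_circuit add: zero_ereal_def[symmetric])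
    next
      case False
      then show ?thesis using unitary_tail[OF \<omega> n d] \<delta> by simp
    qed
  }
  assume "0 < \<delta>" "\<delta> < 1 / sqrt 2"
  then show "measure (zeta_circuit \<omega> n d) {U \<in> space (zeta_circuit \<omega> n d).
      ereal_of_enat (state_complexity n \<delta> (U *\<^sub>v kron_power ket_plus n))
      \<ge> ereal (sqrt (real d) / (10 ^ 7 * real n ^ 4 * log 2 (real d / \<delta>\<^sup>2))
            * (real n - log 2 (sqrt (real d) / (200 * real n ^ 4)) - 2 * log 2 (1 / (1 - 2 * \<delta>\<^sup>2))))}
    \<ge> 1 - exp (- (1 / 10 ^ 4) * sqrt (real d) / real n ^ 4)"
    by (rule state_tail[OF \<omega> n d])
qed simp_all

end
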